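(* Let $V\in L^1_{\rm loc}(\mathbb{R}^d)$ be a potential with $V\geqslant 0$ a.e., and let $p\in(1,2]$. Then for all $0\leqslant a\leqslant 1/p$ the Riesz transform $R_V^a$ is bounded on $L^p(\mathbb{R}^d)$.
   Context: $L^p=L^p(\mathbb{R}^d)$ with respect to Lebesgue measure, with norm $\|\cdot\|_p$. For an a.e. non-negative $V\in L^1_{\rm loc}$, the Schrödinger operator $L=-\frac12\Delta+V$ is the positive self-adjoint operator on $L^2$ associated with the closed sesquilinear form $Q(u,v)=\int_{\mathbb{R}^d}\frac12\langle\nabla u,\nabla v\rangle+Vu\overline v$ with domain $\mathrm{Dom}(Q)=\{f\in L^2:\nabla f\in L^2,\ V^{1/2}f\in L^2\}$ ($\nabla$ is the distributional gradient). The semigroup $e^{-tL}$ given by the spectral theorem is positivity-preserving, pointwise dominated by the heat semigroup $e^{t\Delta/2}$, and hence extends to a contraction semigroup on every $L^p$, $1\leqslant p<\infty$. For $a>0$, $1\leqslant p<\infty$ and a non-negative $f\in L^p$ define, for a.e. $x$, $R_V^af(x)=V^a(x)\cdot\frac1{\Gamma(a)}\int_0^\infty e^{-tL}f(x)\,t^{a-1}\,dt\in[0,\infty]$. Also $R_V^0$ is the identity operator. A finitely simple function is a simple function supported in a compact subset of $\mathbb{R}^d$. $R_V^a$ is said to be bounded on $L^p$ ($1\leqslant p<\infty$) if there is $C>0$ such that $\|R_V^af\|_p\leqslant C\|f\|_p$ for all non-negative finitely simple functions $f$. *)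

theory Defs
  imports "HOL-Analysis.Analysis"
begin

(* Elements of L^p spaces are represented by Lebesgue measurable functions, so
   membership and operators are insensitive to null sets and equality is equality a.e. *)

definition locally_integrable :: "(real^'n \<Rightarrow> 'b::{banach, second_countable_topology}) \<Rightarrow> bool" where
  "locally_integrable f \<longleftrightarrow> (\<forall>K. compact K \<longrightarrow> f absolutely_integrable_on K)"

definition L2 :: "(real^'n \<Rightarrow> complex) set" where
  "L2 = {f. f \<in> borel_measurable lebesgue \<and> integrable lebesgue (\<lambda>x. (cmod (f x))\<^sup>2)}"

definition l2_inner :: "(real^'n \<Rightarrow> complex) \<Rightarrow> (real^'n \<Rightarrow> complex) \<Rightarrow> complex" where
  "l2_inner f g = (\<integral>x. f x * cnj (g x) \<partial>lebesgue)"

definition ae_eq :: "(real^'n \<Rightarrow> complex) \<Rightarrow> (real^'n \<Rightarrow> complex) \<Rightarrow> bool" where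
  "ae_eq f g \<longleftrightarrow> (AE x in lebesgue. f x = g x)"

definition pderiv_at :: "'n \<Rightarrow> (real^'n \<Rightarrow> complex) \<Rightarrow> real^'n \<Rightarrow> complex" where
  "pderiv_at j \<phi> x = frechet_derivative \<phi> (at x) (axis j 1)"

primrec C_k :: "nat \<Rightarrow> (real^'n \<Rightarrow> complex) \<Rightarrow> bool" where
  "C_k 0 \<phi> \<longleftrightarrow> continuous_on UNIV \<phi>"
| "C_k (Suc k) \<phi> \<longleftrightarrow> (\<forall>x. \<phi> differentiable (at x)) \<and> (\<forall>j. C_k k (pderiv_at j \<phi>))"

definition test_functions :: "(real^'n \<Rightarrow> complex) set" where
  "test_functions = {\<phi>. (\<forall>k. C_k k \<phi>) \<and> compact (closure {x. \<phi> x \<noteq> 0})}"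

definition is_weak_gradient :: "(real^'n \<Rightarrow> complex) \<Rightarrow> (real^'n \<Rightarrow> complex^'n) \<Rightarrow> bool" where
  "is_weak_gradient u g \<longleftrightarrow>
     (\<forall>j. locally_integrable (\<lambda>x. g x $ j) \<and>
        (\<forall>\<phi>\<in>test_functions.
           (\<integral>x. u x * pderiv_at j \<phi> x \<partial>lebesgue) = - (\<integral>x. g x $ j * \<phi> x \<partial>lebesgue)))"

(* Unique up to null sets whenever it exists. *)
definition weak_gradient :: "(real^'n \<Rightarrow> complex) \<Rightarrow> real^'n \<Rightarrow> complex^'n" where
  "weak_gradient u = (SOME g. is_weak_gradient u g)"

definition form_dom :: "(real^'n \<Rightarrow> real) \<Rightarrow> (real^'n \<Rightarrow> complex) set" where
  "form_dom V = {f \<in> L2.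
      (\<exists>g. is_weak_gradient f g \<and> (\<forall>j. (\<lambda>x. g x $ j) \<in> L2)) \<and>
      (\<lambda>x. complex_of_real (sqrt (V x)) * f x) \<in> L2}"

definition schrodinger_form ::
  "(real^'n \<Rightarrow> real) \<Rightarrow> (real^'n \<Rightarrow> complex) \<Rightarrow> (real^'n \<Rightarrow> complex) \<Rightarrow> complex" where
  "schrodinger_form V u v =
     (\<integral>x. 1/2 * (\<Sum>j\<in>UNIV. weak_gradient u x $ j * cnj (weak_gradient v x $ j))
          + complex_of_real (V x) * u x * cnj (v x) \<partial>lebesgue)"

(* The graph of the operator associated with the form: "schrodinger_op V u g" says that
   u lies in the domain of L and L u = g. *)
definition schrodinger_op ::
  "(real^'n \<Rightarrow> real) \<Rightarrow> (real^'n \<Rightarrow> complex) \<Rightarrow> (real^'n \<Rightarrow> complex) \<Rightarrow> bool" where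
  "schrodinger_op V u g \<longleftrightarrow> u \<in> form_dom V \<and> g \<in> L2 \<and>
     (\<forall>v\<in>form_dom V. schrodinger_form V u v = l2_inner g v)"

(* Linearity of the projections, and their compatibility with a.e. equality, follow from
   the symmetry condition. *)
definition projection_valued_measure ::
  "(real set \<Rightarrow> (real^'n \<Rightarrow> complex) \<Rightarrow> (real^'n \<Rightarrow> complex)) \<Rightarrow> bool" where
  "projection_valued_measure E \<longleftrightarrow>
     (\<forall>B\<in>sets borel. \<forall>f\<in>L2. E B f \<in> L2) \<and>
     (\<forall>B\<in>sets borel. \<forall>f\<in>L2. \<forall>g\<in>L2. l2_inner (E B f) g = l2_inner f (E B g)) \<and>
     (\<forall>A\<in>sets borel. \<forall>B\<in>sets borel. \<forall>f\<in>L2. ae_eq (E (A \<inter> B) f) (E A (E B f))) \<and>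
     (\<forall>f\<in>L2. ae_eq (E UNIV f) f) \<and>
     (\<forall>B. range B \<subseteq> sets borel \<longrightarrow> disjoint_family B \<longrightarrow>
        (\<forall>f\<in>L2. \<forall>g\<in>L2. (\<lambda>i::nat. l2_inner (E (B i) f) g) sums l2_inner (E (\<Union>i. B i) f) g))"

definition spectral_measure ::
  "(real set \<Rightarrow> (real^'n \<Rightarrow> complex) \<Rightarrow> (real^'n \<Rightarrow> complex)) \<Rightarrow> (real^'n \<Rightarrow> complex) \<Rightarrow> real measure" where
  "spectral_measure E f = measure_of UNIV (sets borel) (\<lambda>B. ennreal (Re (l2_inner (E B f) f)))"

definition spectral_dom ::
  "(real set \<Rightarrow> (real^'n \<Rightarrow> complex) \<Rightarrow> (real^'n \<Rightarrow> complex)) \<Rightarrow> (real \<Rightarrow> real) \<Rightarrow> (real^'n \<Rightarrow> complex) set" where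
  "spectral_dom E \<phi> = {f \<in> L2. (\<integral>\<^sup>+s. ennreal ((\<phi> s)\<^sup>2) \<partial>spectral_measure E f) < \<infinity>}"

(* The integral of \<phi> against the complex measure B \<mapsto> <E B f, h>, written by polarization
   in terms of the positive measures B \<mapsto> <E B w, w>. *)
definition spectral_sesq ::
  "(real set \<Rightarrow> (real^'n \<Rightarrow> complex) \<Rightarrow> (real^'n \<Rightarrow> complex)) \<Rightarrow> (real \<Rightarrow> real) \<Rightarrow>
     (real^'n \<Rightarrow> complex) \<Rightarrow> (real^'n \<Rightarrow> complex) \<Rightarrow> complex" where
  "spectral_sesq E \<phi> f h =
     1/4 * (\<Sum>k<4. \<i> ^ k * complex_of_real (\<integral>s. \<phi> s \<partial>spectral_measure E (\<lambda>x. f x + \<i> ^ k * h x)))"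

(* The graph of the operator given by integrating \<phi> against E. *)
definition spectral_integral ::
  "(real set \<Rightarrow> (real^'n \<Rightarrow> complex) \<Rightarrow> (real^'n \<Rightarrow> complex)) \<Rightarrow> (real \<Rightarrow> real) \<Rightarrow>
     (real^'n \<Rightarrow> complex) \<Rightarrow> (real^'n \<Rightarrow> complex) \<Rightarrow> bool" where
  "spectral_integral E \<phi> f g \<longleftrightarrow> f \<in> spectral_dom E \<phi> \<and> g \<in> L2 \<and>
     (\<forall>h\<in>spectral_dom E \<phi>. l2_inner g h = spectral_sesq E \<phi> f h)"

definition is_spectral_resolution ::
  "(real set \<Rightarrow> (real^'n \<Rightarrow> complex) \<Rightarrow> (real^'n \<Rightarrow> complex)) \<Rightarrow>
     ((real^'n \<Rightarrow> complex) \<Rightarrow> (real^'n \<Rightarrow> complex) \<Rightarrow> bool) \<Rightarrow> bool" where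
  "is_spectral_resolution E A \<longleftrightarrow> projection_valued_measure E \<and>
     (\<forall>f g. A f g \<longleftrightarrow> spectral_integral E (\<lambda>s. s) f g)"

(* By the spectral theorem it exists and is unique up to a.e. equality of the values E B f. *)
definition schrodinger_resolution ::
  "(real^'n \<Rightarrow> real) \<Rightarrow> real set \<Rightarrow> (real^'n \<Rightarrow> complex) \<Rightarrow> (real^'n \<Rightarrow> complex)" where
  "schrodinger_resolution V = (SOME E. is_spectral_resolution E (schrodinger_op V))"

definition schrodinger_semigroup ::
  "(real^'n \<Rightarrow> real) \<Rightarrow> real \<Rightarrow> (real^'n \<Rightarrow> complex) \<Rightarrow> (real^'n \<Rightarrow> complex)" where
  "schrodinger_semigroup V t f =
     (SOME g. spectral_integral (schrodinger_resolution V) (\<lambda>s. exp (- t * s)) f g)"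

(* For each t the function e^{-tL} f is only determined up to a null set depending on t. To
   integrate in t at a fixed x one takes a jointly measurable version; by Fubini two such
   versions give the same integral for a.e. x. *)
definition is_semigroup_version ::
  "(real^'n \<Rightarrow> real) \<Rightarrow> (real^'n \<Rightarrow> complex) \<Rightarrow> (real \<Rightarrow> real^'n \<Rightarrow> complex) \<Rightarrow> bool" where
  "is_semigroup_version V f u \<longleftrightarrow>
     (\<lambda>(t, x). u t x) \<in> borel_measurable (lborel \<Otimes>\<^sub>M lborel) \<and>
     (\<forall>t>0. ae_eq (u t) (schrodinger_semigroup V t f))"

definition semigroup_version ::
  "(real^'n \<Rightarrow> real) \<Rightarrow> (real^'n \<Rightarrow> complex) \<Rightarrow> real \<Rightarrow> real^'n \<Rightarrow> complex" where
  "semigroup_version V f = (SOME u. is_semigroup_version V f u)"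

(* Meant for non-negative f in L^2 (in particular for finitely simple f), on which the
   L^p extension of the semigroup agrees with the L^2 semigroup; there the semigroup takes
   values in [0, \<infinity>) a.e., so that "Re" discards nothing. Where V vanishes and a > 0, the
   value is 0, by the convention 0 * \<infinity> = 0. *)
definition riesz_transform ::
  "(real^'n \<Rightarrow> real) \<Rightarrow> real \<Rightarrow> (real^'n \<Rightarrow> real) \<Rightarrow> real^'n \<Rightarrow> ennreal" where
  "riesz_transform V a f x =
     (if a = 0 then ennreal (f x)
      else ennreal (V x powr a) * (ennreal (1 / Gamma a) *
        (\<integral>\<^sup>+t\<in>{0<..}. ennreal (Re (semigroup_version V (\<lambda>y. complex_of_real (f y)) t x))
            * ennreal (t powr (a - 1)) \<partial>lborel)))"

definition ennreal_powr :: "ennreal \<Rightarrow> real \<Rightarrow> ennreal" where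
  "ennreal_powr y r = (if y = \<infinity> then \<infinity> else ennreal (enn2real y powr r))"

definition Lp_norm :: "real \<Rightarrow> (real^'n \<Rightarrow> ennreal) \<Rightarrow> ennreal" where
  "Lp_norm p f = ennreal_powr (\<integral>\<^sup>+x. ennreal_powr (f x) p \<partial>lebesgue) (1 / p)"

definition finitely_simple :: "(real^'n \<Rightarrow> real) \<Rightarrow> bool" where
  "finitely_simple f \<longleftrightarrow> simple_function lebesgue f \<and> (\<exists>K. compact K \<and> (\<forall>x. x \<notin> K \<longrightarrow> f x = 0))"

definition riesz_bounded_on_Lp :: "(real^'n \<Rightarrow> real) \<Rightarrow> real \<Rightarrow> real \<Rightarrow> bool" where
  "riesz_bounded_on_Lp V a p \<longleftrightarrow>
     (\<exists>C>0. \<forall>f. finitely_simple f \<longrightarrow> (\<forall>x. 0 \<le> f x) \<longrightarrow>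
        Lp_norm p (riesz_transform V a f) \<le> ennreal C * Lp_norm p (\<lambda>x. ennreal (f x)))"

end

theory Submission
 imports Defs "HOL-Probability.Probability" "HOL-Computational_Algebra.Polynomial"
begin

text \<open>
  Write \<open>u\<^sub>t[f]\<close> for the semigroup, \<open>N\<^sub>a f\<close> for the integral of \<open>t\<^bsup>a-1\<^esup> u\<^sub>t[f]\<close> and \<open>M f\<close> for the
  supremum of \<open>l (l + L)\<^sup>-\<^sup>1 f\<close> over \<open>l > 0\<close>. Testing the form with truncations of the resolvent gives
  \<open>\<integral> V N\<^sub>1 f \<le> \<integral> f\<close>; the spectral theorem gives \<open>\<integral> V (N\<^bsub>1/2\<^esub> f)\<^sup>2 \<le> \<pi> \<integral> f\<^sup>2\<close>; an obstacle problem gives the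
  weak type (1,1) bound for \<open>M\<close>, hence its boundedness on \<open>L\<^sup>p\<close>. With \<open>\<theta> = 2 - 2/p\<close>, Young's inequality for
  \<open>f = (f\<^sup>p)\<^bsup>1-\<theta>\<^esup> (f\<^bsup>p/2\<^esup>)\<^bsup>\<theta>\<^esup>\<close>, scaled by \<open>t\<^bsup>1/2\<^esup>\<close> at time \<open>t\<close>, bounds \<open>V (N\<^bsub>1/p\<^esub> f)\<^sup>p\<close> pointwise by a
  multiple of \<open>V N\<^sub>1(f\<^sup>p) + V (N\<^bsub>1/2\<^esub>(f\<^bsup>p/2\<^esup>))\<^sup>2\<close>, which settles \<open>a = 1/p\<close>. For \<open>0 < a < 1/p\<close> write \<open>N\<^sub>a\<close> as a
  multiple of the integral of \<open>l\<^bsup>-a\<^esup> (l + L)\<^sup>-\<^sup>1\<close> over \<open>l > 0\<close> and split it at \<open>l = V(x)\<close>: this bounds \<open>V\<^sup>a N\<^sub>a f\<close>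
 pointwise by a multiple of \<open>V\<^bsup>1/p\<^esup> N\<^bsub>1/p\<^esub> f + M f\<close>. The spectral resolution is obtained from the
 Hausdorff moment problem applied to the moments \<open>(A\<^sup>n f, f)\<close> of the resolvent \<open>A = (1 + L)\<^sup>-\<^sup>1\<close>.
\<close>

section \<open>Hilbert space preliminaries\<close>

text \<open>The two endpoints are p = 1 with a = 1 and p = 2 with a = 1/2, and 1/p = (1 - theta) * 1
  + theta * 1/2. Since the semigroup preserves positivity, a pointwise Young inequality applied
  under it does the work of complex interpolation. Zero may lie in the spectrum of L, so the time
  integrals need not be in L2: the estimates are made for l + L with l > 0, uniformly in l, and
  reach l = 0 by monotone convergence. Chain rules for Sobolev functions are avoided: having a weak
  derivative in L2 means a Lipschitz bound for translations, and normal contractions inherit such a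
  bound. The semigroup is given only through \<open>SOME\<close> choices of a resolution, of values
  and of a measurable version, so the spectral theorem enters both as existence and as uniqueness up
  to null sets. Null sets depend on the resolvent parameter and on the Young parameter; both
  therefore run through the positive rationals, at the price of factors 2. Splitting at l = V(x)
  leaves a range of large l where only l (l + L)^-1 f is controlled; its supremum is where p > 1 is
  essential.\<close>

lemma parallelogram:
 fixes x y :: "'a::real_inner"
 shows "(norm (x + y))\<^sup>2 + (norm (x - y))\<^sup>2 = 2 * (norm x)\<^sup>2 + 2 * (norm y)\<^sup>2"
 by (simp add: power2_norm_eq_inner inner_add inner_diff inner_commute algebra_simps)

text \<open>A minimising sequence is Cauchy by the parallelogram law, because midpoints stay in the
  convex set. The last conclusion is the variational inequality: it gives orthogonality for
  subspaces and later drives the obstacle problem.\<close>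

lemma closest_point_hilbert:
 fixes S :: "'a::{real_inner,complete_space} set"
 assumes cl: "closed S" and cv: "convex S" and ne: "S ~= {}"
 obtains p where "p \<in> S" "!!y. y \<in> S ==> norm (x - p) <= norm (x - y)"
  "!!y. y \<in> S ==> (x - p) \<bullet> (y - p) <= 0"
proof -
 define d where "d = (INF y\<in>S. norm (x - y))"
 have bdd: "bdd_below ((%y. norm (x - y)) ` S)" by (rule bdd_belowI[of _ 0]) auto
 have dle: "d <= norm (x - y)" if "y \<in> S" for y
  unfolding d_def using bdd that by (rule cINF_lower)
 have d0: "0 <= d" unfolding d_def using ne by (intro cINF_greatest) auto
 have "\<exists>y\<in>S. norm (x - y) < d + 1 / real (Suc n)" for n
 proof (rule ccontr)
  assume "\<not> ?thesis"
  then have "d + 1 / real (Suc n) <= d" unfolding d_def[symmetric]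
   by (subst (2) d_def) (intro cINF_greatest ne, auto simp: not_less)
  then show False by simp
 qed
 then obtain y where yS: "!!n. y n \<in> S" and y: "!!n. norm (x - y n) < d + 1 / real (Suc n)"
  by metis
 have est: "(norm (y m - y n))\<^sup>2 <= 4 * (2 * d * (1 / real (Suc N)) + (1 / real (Suc N))\<^sup>2)"
  if "m \<ge> N" "n \<ge> N" for m n N
 proof -
  let ?e = "1 / real (Suc N)"
  have b: "norm (x - y k) <= d + ?e" if "k \<ge> N" for k
   using y[of k] that frac_le[of 1 1 "real (Suc N)" "real (Suc k)"] by auto
  have b2: "(norm (x - y k))\<^sup>2 <= (d + ?e)\<^sup>2" if "k \<ge> N" for k
   using b[OF that] by (intro power_mono) auto
  have mid: "(1/2) *\<^sub>R y m + (1/2) *\<^sub>R y n \<in> S" using cv yS by (intro convexD) auto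
  have "norm ((x - y m) + (x - y n)) = 2 * norm (x - ((1/2) *\<^sub>R y m + (1/2) *\<^sub>R y n))"
  proof -
   have "(x - y m) + (x - y n) = 2 *\<^sub>R (x - ((1/2) *\<^sub>R y m + (1/2) *\<^sub>R y n))"
    by (simp add: algebra_simps scaleR_2)
   then show ?thesis by simp
  qed
  then have "2 * d <= norm ((x - y m) + (x - y n))" using dle[OF mid] by simp
  then have "(2 * d)\<^sup>2 <= (norm ((x - y m) + (x - y n)))\<^sup>2" using d0 by (intro power_mono) auto
  moreover have "(norm ((x - y m) - (x - y n)))\<^sup>2 = (norm (y m - y n))\<^sup>2"
   by (simp add: norm_minus_commute)
  ultimately have "(norm (y m - y n))\<^sup>2 <= 4 * (d + ?e)\<^sup>2 - (2*d)\<^sup>2"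
   using parallelogram[of "x - y m" "x - y n"] b2[OF that(1)] b2[OF that(2)] by linarith
  then show ?thesis by (simp add: power2_eq_square algebra_simps)
 qed
 have lim: "(%N. 4 * (2 * d * (1 / real (Suc N)) + (1 / real (Suc N))\<^sup>2)) \<longlonglongrightarrow> 4 * (2 * d * 0 + 0\<^sup>2)"
  by (intro tendsto_intros LIMSEQ_Suc[OF lim_1_over_n])
 have "Cauchy y"
 proof (rule metric_CauchyI)
  fix e :: real assume e: "e > 0"
  have "eventually (%N. 4 * (2 * d * (1 / real (Suc N)) + (1 / real (Suc N))\<^sup>2) < e\<^sup>2) sequentially"
   by (rule order_tendstoD(2)[OF lim]) (use e in simp)
  then obtain N where N: "4 * (2 * d * (1 / real (Suc N)) + (1 / real (Suc N))\<^sup>2) < e\<^sup>2"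
   unfolding eventually_sequentially by blast
  have "dist (y m) (y n) < e" if "m \<ge> N" "n \<ge> N" for m n
  proof -
   have "(norm (y m - y n))\<^sup>2 < e\<^sup>2" using est[OF that] N by linarith
   then have "norm (y m - y n) < e" using e by (rule power2_less_imp_less[OF _ less_imp_le])
   then show ?thesis by (simp add: dist_norm)
  qed
  then show "EX M. \<forall>m\<ge>M. \<forall>n\<ge>M. dist (y m) (y n) < e" by (intro exI[of _ N]) simp
 qed
 then obtain p where p: "y \<longlonglongrightarrow> p" using Cauchy_convergent_iff convergent_def by blast
 have pS: "p \<in> S" using closed_sequentially[OF cl _ p] yS by blast
 have "(%n. norm (x - y n)) \<longlonglongrightarrow> norm (x - p)" by (intro tendsto_intros p)
 moreover have "(%n. d + 1 / real (Suc n)) \<longlonglongrightarrow> d + 0"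
  by (intro tendsto_intros LIMSEQ_Suc[OF lim_1_over_n])
 ultimately have "norm (x - p) <= d + 0"
  by (rule LIMSEQ_le) (use y less_imp_le in blast)
 then have min: "norm (x - p) <= norm (x - z)" if "z \<in> S" for z using dle[OF that] by simp
 have "(x - p) \<bullet> (z - p) <= 0" if z: "z \<in> S" for z
 proof (rule ccontr)
  assume "\<not> ?thesis"
  then have pos: "(x - p) \<bullet> (z - p) > 0" by simp
  obtain u where u: "u > 0" "u <= 1" "dist (p + u *\<^sub>R (z - p)) x < dist p x"
   using closer_point_lemma[OF pos] by blast
  have "p + u *\<^sub>R (z - p) = (1 - u) *\<^sub>R p + u *\<^sub>R z" by (simp add: algebra_simps)
  then have "p + u *\<^sub>R (z - p) \<in> S" using cv pS z u by (simp add: convex_alt)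
  from min[OF this] u(3) show False by (simp add: dist_norm norm_minus_commute)
 qed
 with pS min that show thesis by blast
qed

text \<open>Both p + y and p - y are competitors, which turns the variational inequality into an
  equation.\<close>

lemma subspace_projection:
 fixes S :: "'a::{real_inner,complete_space} set"
 assumes cl: "closed S" and sub: "subspace S"
 obtains p where "p \<in> S" "!!y. y \<in> S ==> (x - p) \<bullet> y = 0"
proof -
 obtain p where p: "p \<in> S" "!!y. y \<in> S ==> (x - p) \<bullet> (y - p) <= 0"
  by (rule closest_point_hilbert[OF cl subspace_imp_convex[OF sub], of x])
   (use subspace_0[OF sub] in auto)
 have "(x - p) \<bullet> y = 0" if y: "y \<in> S" for y
 proof -
  have "(x - p) \<bullet> y <= 0" using p(2)[of "p + y"] subspace_add[OF sub p(1) y] by simp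
  moreover have "(x - p) \<bullet> - y <= 0"
   using p(2)[of "p - y"] subspace_diff[OF sub p(1) y] by simp
  ultimately show ?thesis by simp
 qed
 with p(1) that show thesis by blast
qed

text \<open>Some z outside the kernel has a component w orthogonal to the kernel, and every x
  differs from a multiple of w by a kernel element; so a multiple of w represents f.\<close>

lemma riesz_representation:
 fixes f :: "'a::{real_inner,complete_space} => real"
 assumes f: "bounded_linear f"
 obtains y where "!!x. f x = y \<bullet> x"
proof (cases "ALL x. f x = 0")
 case True then show ?thesis using that[of 0] by simp
next
 case False
 interpret bounded_linear f by fact
 obtain z where z: "f z ~= 0" using False by blast
 let ?S = "{x. f x = 0}"
 have "closed ?S"
  by (intro closed_Collect_eq linear_continuous_on f continuous_on_const)
 moreover have "subspace ?S" by (simp add: subspace_def zero add scaleR)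
 ultimately obtain p where p: "f p = 0" "!!y. f y = 0 ==> (z - p) \<bullet> y = 0"
  by (rule subspace_projection[of ?S z]) auto
 define w where "w = z - p"
 have fw: "f w ~= 0" using z p by (simp add: w_def diff)
 then have w: "w \<bullet> w ~= 0" using zero by auto
 have "f x = (f w / (w \<bullet> w)) *\<^sub>R w \<bullet> x" for x
 proof -
  have "f (x - (f x / f w) *\<^sub>R w) = 0" using fw by (simp add: diff scaleR)
  then have "w \<bullet> (x - (f x / f w) *\<^sub>R w) = 0" using p(2) w_def by blast
  then have "w \<bullet> x = f x / f w * (w \<bullet> w)" by (simp add: inner_diff_right)
  then show ?thesis using fw w by (simp add: field_simps)
 qed
 then show ?thesis using that by blast
qed

lemma dense_if_orthogonal_trivial:
 fixes S :: "'a::{real_inner,complete_space} set"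
 assumes sub: "subspace S" and orth: "!!y. (!!x. x \<in> S ==> y \<bullet> x = 0) ==> y = 0"
 shows "closure S = UNIV"
proof -
 have sc: "subspace (closure S)"
  unfolding subspace_def
 proof (intro conjI ballI allI)
  show "0 \<in> closure S" using closure_subset subspace_0[OF sub] by blast
 next
  fix x y assume "x \<in> closure S" "y \<in> closure S"
  then obtain f g where f: "ALL n. f n \<in> S" "f \<longlonglongrightarrow> x" and g: "ALL n. g n \<in> S" "g \<longlonglongrightarrow> y"
   unfolding closure_sequential by blast
  have "(%n. f n + g n) \<longlonglongrightarrow> x + y" using f g by (intro tendsto_intros)
  then show "x + y \<in> closure S" unfolding closure_sequential
   using f g subspace_add[OF sub] by (intro exI[of _ "%n. f n + g n"]) auto
 next
  fix c x assume "x \<in> closure S"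
  then obtain f where f: "ALL n. f n \<in> S" "f \<longlonglongrightarrow> x" unfolding closure_sequential by blast
  have "(%n. c *\<^sub>R f n) \<longlonglongrightarrow> c *\<^sub>R x" using f by (intro tendsto_intros)
  then show "c *\<^sub>R x \<in> closure S" unfolding closure_sequential
   using f subspace_scale[OF sub] by (intro exI[of _ "%n. c *\<^sub>R f n"]) auto
 qed
 have "x \<in> closure S" for x
 proof -
  obtain p where p: "p \<in> closure S" "!!y. y \<in> closure S ==> (x - p) \<bullet> y = 0"
   by (rule subspace_projection[OF closed_closure sc, of x]) blast
  have "x - p = 0" by (rule orth) (use p(2) closure_subset in blast)
  with p(1) show ?thesis by simp
 qed
 then show ?thesis by blast
qed

text \<open>One Riesz representative for each x. For the functional calculus only a bounded form is
  available at first; linearity of the operator is recovered there from symmetry.\<close>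

lemma bilinear_operator:
 fixes B :: "'a::{real_inner,complete_space} => 'a => real"
 assumes "!!x. linear (B x)" and "!!x y. \<bar>B x y\<bar> <= K * norm x * norm y"
 obtains T where "!!x y. B x y = T x \<bullet> y"
proof -
 have "EX z. ALL y. B x y = z \<bullet> y" for x
 proof -
  have "bounded_linear (B x)"
   by (rule bounded_linear_intro[where K="K * norm x"])
    (use assms(2)[of x] linear_add[OF assms(1)] linear_scale[OF assms(1)] in \<open>auto simp: algebra_simps\<close>)
  then show ?thesis using riesz_representation by metis
 qed
 then show thesis using that by metis
qed

section \<open>The Hausdorff moment problem\<close>

text \<open>The functional that a measure with moments \<open>m\<close> would define on polynomials
  by integration.\<close>

definition moment_functional :: "(nat => real) => real poly => real" where
 "moment_functional m p = (\<Sum>i\<le>degree p. coeff p i * m i)"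

lemma moment_functional_eq:
 assumes "degree p <= N"
 shows "moment_functional m p = (\<Sum>i\<le>N. coeff p i * m i)"
 unfolding moment_functional_def
 by (rule sum.mono_neutral_left) (use assms in \<open>auto intro: coeff_eq_0\<close>)

lemma moment_functional_add: "moment_functional m (p + q) = moment_functional m p + moment_functional m q"
proof -
 let ?N = "max (degree p) (degree q)"
 have "degree (p + q) <= ?N" by (rule degree_add_le) auto
 then show ?thesis
  by (simp add: moment_functional_eq[of _ ?N] sum.distrib distrib_right)
qed

lemma moment_functional_smult: "moment_functional m (smult c p) = c * moment_functional m p"
 by (simp add: moment_functional_eq[of _ "degree p"] degree_smult_le sum_distrib_left mult_ac)

lemma moment_functional_sum:
 "moment_functional m (\<Sum>k\<in>A. f k) = (\<Sum>k\<in>A. moment_functional m (f k))"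
proof (induction A rule: infinite_finite_induct)
 case (insert x F) then show ?case by (simp add: moment_functional_add)
qed (auto simp: moment_functional_def)

lemma moment_functional_monom: "moment_functional m (monom 1 n) = m n"
 by (simp add: moment_functional_eq[of _ n] degree_monom_le if_distrib[of "%x. x * _"]
   sum.delta cong: if_cong)

definition bpoly :: "nat => nat => real poly" where
 "bpoly k l = [:0, 1:] ^ k * [:1, -1:] ^ l"

text \<open>The n-th Bernstein polynomial of the function x ^ m, as a formal polynomial so that
  \<open>moment_functional\<close> applies to it.\<close>

definition Bern_mom :: "nat => nat => real poly" where
 "Bern_mom n m = (\<Sum>k\<le>n. smult ((real k / real n) ^ m * real (n choose k)) (bpoly k (n - k)))"

text \<open>The product rule multiplied by x (1 - x): this clears the denominators, so that k = 0
  and l = 0 are no exceptions.\<close>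

lemma bpoly_deriv:
 "[:0, 1:] * [:1, -1:] * pderiv (bpoly k l) =
  smult (real k) (bpoly k l) - smult (real (k + l)) ([:0, 1:] * bpoly k l)"
proof -
 have a: "[:0, 1:] * pderiv ([:0, 1:] ^ k) = smult (real k) ([:0, 1::real:] ^ k)" for k
  by (cases k) (simp_all add: pderiv_power_Suc pderiv_pCons del: power_Suc, simp)
 have b: "[:1, -1:] * pderiv ([:1, -1:] ^ l) = - smult (real l) ([:1, -1::real:] ^ l)" for l
  by (cases l) (simp_all add: pderiv_power_Suc pderiv_pCons smult_minus_left[symmetric] del: power_Suc smult_minus_left, simp)
 define X :: "real poly" where "X = [:0, 1:]"
 have Y: "[:1, -1:] = 1 - X" by (simp add: X_def one_pCons)
 have "X * (1 - X) * pderiv (bpoly k l) =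
   (X * pderiv (X ^ k)) * (1 - X) ^ l * (1 - X)
   + ((1 - X) * pderiv ((1 - X) ^ l)) * X ^ k * X"
  unfolding bpoly_def pderiv_mult Y X_def[symmetric] by (simp add: algebra_simps)
 also have "\<dots> = smult (real k) (bpoly k l) * (1 - X) - smult (real l) (bpoly k l) * X"
  using a[of k] b[of l] unfolding bpoly_def Y X_def[symmetric] by (simp add: mult_ac)
 also have "\<dots> = smult (real k) (bpoly k l) - smult (real (k + l)) (X * bpoly k l)"
  by (simp add: algebra_simps smult_add_left smult_diff_right)
 finally show ?thesis unfolding Y X_def[symmetric] .
qed

lemma Bern_mom_0: "Bern_mom n 0 = 1"
proof -
 have "([:0, 1:] + [:1, -1::real:]) ^ n = (\<Sum>k\<le>n. of_nat (n choose k) * [:0, 1:] ^ k * [:1, -1:] ^ (n - k))"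
  by (rule binomial_ring)
 moreover have "[:0, 1:] + [:1, -1::real:] = 1" by (simp add: one_pCons)
 ultimately have "(\<Sum>k\<le>n. of_nat (n choose k) * [:0, 1:] ^ k * [:1, -1:] ^ (n - k)) = (1 :: real poly)"
  by (metis power_one)
 then show ?thesis
  by (simp add: Bern_mom_def bpoly_def of_nat_poly mult_ac)
qed

text \<open>By \<open>bpoly_deriv\<close> with k + l = n, the operator p -> x p + x (1 - x) p' / n
  multiplies each Bernstein basis polynomial by k/n, which is the extra factor in the next
  moment.\<close>

lemma Bern_mom_Suc:
 assumes "n > 0"
 shows "Bern_mom n (Suc m) = [:0, 1:] * Bern_mom n m
   + smult (1 / real n) ([:0, 1:] * [:1, -1:] * pderiv (Bern_mom n m))"
proof -
 have "[:0, 1:] * [:1, -1:] * pderiv (Bern_mom n m) =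
  (\<Sum>k\<le>n. smult ((real k / real n) ^ m * real (n choose k)) ([:0, 1:] * [:1, -1:] * pderiv (bpoly k (n - k))))"
  unfolding Bern_mom_def
  by (simp only: higher_pderiv_sum[of 1, simplified] pderiv_smult sum_distrib_left mult_smult_right)
 also have "\<dots> = (\<Sum>k\<le>n. smult ((real k / real n) ^ m * real (n choose k) * real k) (bpoly k (n - k))
   - smult (real n) (smult ((real k / real n) ^ m * real (n choose k)) ([:0, 1:] * bpoly k (n - k))))"
  by (rule sum.cong[OF refl])
   (simp only: bpoly_deriv smult_diff_right atMost_iff le_add_diff_inverse smult_smult,
    simp add: mult_ac del: mult_pCons_left mult_pCons_right)
 finally have "smult (1 / real n) ([:0, 1:] * [:1, -1:] * pderiv (Bern_mom n m)) =
  (\<Sum>k\<le>n. smult ((real k / real n) ^ Suc m * real (n choose k)) (bpoly k (n - k))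
   - smult ((real k / real n) ^ m * real (n choose k)) ([:0, 1:] * bpoly k (n - k)))"
 proof -
  assume *: "[:0, 1:] * [:1, -1:] * pderiv (Bern_mom n m) =
   (\<Sum>k\<le>n. smult ((real k / real n) ^ m * real (n choose k) * real k) (bpoly k (n - k))
   - smult (real n) (smult ((real k / real n) ^ m * real (n choose k)) ([:0, 1:] * bpoly k (n - k))))"
  have sm: "smult c (\<Sum>k\<le>n. f k) = (\<Sum>k\<le>n. smult c (f k))" for c and f :: "nat => real poly"
   by (induction n) (simp_all add: smult_add_right)
  show ?thesis
   unfolding * sm
   by (rule sum.cong[OF refl]) (use assms in \<open>simp add: smult_diff_right mult_ac del: mult_pCons_left mult_pCons_right\<close>)
 qed
 then show ?thesis
  unfolding Bern_mom_def
  by (simp only: sum_subtractf sum_distrib_left mult_smult_right)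
qed

lemma coeff_Bern_mom_Suc:
 assumes "n > 0"
 shows "coeff (Bern_mom n (Suc m)) i = (if i = 0 then 0 else coeff (Bern_mom n m) (i - 1))
  + (1 / real n) * (real i * coeff (Bern_mom n m) i
    - (if i = 0 then 0 else real (i - 1) * coeff (Bern_mom n m) (i - 1)))"
proof -
 have [simp]: "coeff ([:0, 1:] * p) i = (if i = 0 then 0 else coeff p (i - 1))" for p :: "real poly" and i
  by (cases i) auto
 have "coeff ([:0, 1:] * [:1, -1:] * pderiv p) i = real i * coeff p i
   - (if i = 0 then 0 else real (i - 1) * coeff p (i - 1))" for p :: "real poly"
 proof -
  have "[:1,-1::real:] = 1 - [:0,1:]" by (simp add: one_pCons)
  then have "[:0, 1:] * [:1, -1:] * pderiv p = [:0,1:] * (1 - [:0,1:]) * pderiv p" by simp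
  also have "\<dots> = [:0,1:] * pderiv p - [:0,1:] * ([:0,1:] * pderiv p)"
   by (simp only: right_diff_distrib left_diff_distrib mult_1_right mult.assoc)
  finally have "[:0, 1:] * [:1, -1:] * pderiv p = [:0,1:] * pderiv p - [:0,1:] * ([:0,1:] * pderiv p)" .
  then show ?thesis
   by (simp only: coeff_diff) (cases i; cases "i - 1"; auto simp: coeff_pderiv)
 qed
 then show ?thesis unfolding Bern_mom_Suc[OF assms] coeff_add coeff_smult by (cases i) simp_all
qed

text \<open>The degree does not grow with n, so coefficientwise convergence concerns finitely many
  numbers and passes through \<open>moment_functional\<close>.\<close>

lemma degree_Bern_mom: "n > 0 ==> degree (Bern_mom n m) <= m"
proof (induction m)
 case 0 then show ?case by (simp add: Bern_mom_0)
next
 case (Suc m)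
 have "coeff (Bern_mom n m) i = 0" if "i > m" for i
  using that Suc by (intro coeff_eq_0) auto
 then show ?case using Suc.prems by (intro degree_le) (auto simp: coeff_Bern_mom_Suc)
qed

text \<open>The correction in the recursion carries the factor 1/n; in the limit only the
  multiplication by x remains.\<close>

lemma tendsto_coeff_Bern_mom: "(%n. coeff (Bern_mom n m) i) \<longlonglongrightarrow> coeff (monom 1 m) i"
proof (induction m arbitrary: i)
 case 0 then show ?case by (simp add: Bern_mom_0 monom_0 one_pCons)
next
 case (Suc m)
 let ?c = "%n. coeff (Bern_mom n m)" and ?d = "coeff (monom (1::real) m)"
 have "(%n. (if i = 0 then 0 else ?c n (i - 1))
  + (1 / real n) * (real i * ?c n i - (if i = 0 then 0 else real (i - 1) * ?c n (i - 1))))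
  \<longlonglongrightarrow> (if i = 0 then 0 else ?d (i - 1)) + 0 * (real i * ?d i - (if i = 0 then 0 else real (i - 1) * ?d (i - 1)))"
  using Suc[of i] Suc[of "i - 1"] by (cases "i = 0") (simp_all only: if_False if_True refl, (intro tendsto_intros lim_1_over_n; assumption)+)
 moreover have "eventually (%n. (if i = 0 then 0 else ?c n (i - 1))
  + (1 / real n) * (real i * ?c n i - (if i = 0 then 0 else real (i - 1) * ?c n (i - 1))) = coeff (Bern_mom n (Suc m)) i) sequentially"
  using eventually_gt_at_top[of 0] by eventually_elim (simp add: coeff_Bern_mom_Suc)
 ultimately have "(%n. coeff (Bern_mom n (Suc m)) i) \<longlonglongrightarrow>
   (if i = 0 then 0 else ?d (i - 1)) + 0 * (real i * ?d i - (if i = 0 then 0 else real (i - 1) * ?d (i - 1)))"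
  by (rule Lim_transform_eventually)
 then show ?case by (cases i) auto
qed

lemma moment_functional_Bern_mom:
 "(%n. moment_functional \<mu> (Bern_mom n m)) \<longlonglongrightarrow> \<mu> m"
proof -
 have "(%n. \<Sum>i\<le>m. coeff (Bern_mom n m) i * \<mu> i) \<longlonglongrightarrow> (\<Sum>i\<le>m. coeff (monom 1 m) i * \<mu> i)"
  by (intro tendsto_intros tendsto_coeff_Bern_mom)
 also have "(\<Sum>i\<le>m. coeff (monom 1 m) i * \<mu> i) = \<mu> m"
  using moment_functional_eq[of "monom 1 m" m \<mu>] by (simp add: degree_monom_le moment_functional_monom)
 finally have *: "(%n. \<Sum>i\<le>m. coeff (Bern_mom n m) i * \<mu> i) \<longlonglongrightarrow> \<mu> m" .
 show ?thesis
  by (rule Lim_transform_eventually[OF *])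
   (use eventually_gt_at_top[of 0] in eventually_elim, simp add: moment_functional_eq[OF degree_Bern_mom])
qed

text \<open>The discrete measures with mass \<open>w n k\<close> at k/n have as moments the
  functional at Bernstein polynomials, which tends to the prescribed moments. All of them live on
  [0,1], hence they are tight, and a weak limit of a subsequence solves the problem.\<close>

lemma hausdorff_moment_prob:
 fixes \<mu> :: "nat => real"
 assumes pos: "!!k l. moment_functional \<mu> (bpoly k l) \<ge> 0" and one: "\<mu> 0 = 1"
 obtains M where "real_distribution M" "AE x in M. x \<in> {0..1}" "!!i. (\<integral>x. x ^ i \<partial>M) = \<mu> i"
proof -
 define w where "w n k = (if k <= n then real (n choose k) * moment_functional \<mu> (bpoly k (n - k)) else 0)" for n k
 have w0: "w n k \<ge> 0" for n k by (simp add: w_def pos)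
 have wm: "(\<Sum>k\<le>n. (real k / real n) ^ m * w n k) = moment_functional \<mu> (Bern_mom n m)" for n m
  by (simp add: Bern_mom_def moment_functional_sum moment_functional_smult w_def mult_ac)
 have "moment_functional \<mu> 1 = 1" using moment_functional_monom[of \<mu> 0] one by (simp add: monom_0 one_pCons)
 then have w1: "(\<Sum>k\<le>n. w n k) = 1" for n using wm[of n 0] by (simp add: Bern_mom_0)
 define p where "p n = embed_pmf (w n)" for n
 have pp: "pmf (p n) k = w n k" for n k
  unfolding p_def
 proof (rule pmf_embed_pmf)
  have "(\<integral>\<^sup>+x. ennreal (w n x) \<partial>count_space UNIV) = (\<integral>\<^sup>+x. ennreal (w n x) \<partial>count_space {..n})"
   by (rule nn_integral_count_space_eq) (auto simp: w_def)
  also have "\<dots> = ennreal (\<Sum>k\<le>n. w n k)" by (simp add: nn_integral_count_space_finite w0)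
  finally show "(\<integral>\<^sup>+x. ennreal (w n x) \<partial>count_space UNIV) = 1" by (simp add: w1)
 qed (simp add: w0)
 define \<nu> where "\<nu> n = distr (measure_pmf (p n)) borel (%k. real k / real n)" for n
 have rd: "real_distribution (\<nu> n)" for n
  unfolding \<nu>_def by (intro real_distribution.intro prob_space.prob_space_distr real_distribution_axioms.intro)
   (auto intro: measure_pmf.prob_space_axioms)
 have int: "(\<integral>x. g x \<partial>\<nu> n) = (\<Sum>k\<le>n. g (real k / real n) * w n k)"
  if [measurable]: "g \<in> borel_measurable borel" for g :: "real => real" and n
 proof -
  have "(\<integral>x. g x \<partial>\<nu> n) = (\<integral>k. g (real k / real n) \<partial>measure_pmf (p n))"
   unfolding \<nu>_def by (rule integral_distr) auto
  also have "\<dots> = (\<Sum>k\<le>n. g (real k / real n) * pmf (p n) k)"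
   by (rule integral_measure_pmf_real) (auto simp: set_pmf_iff pp w_def split: if_splits)
  finally show ?thesis by (simp add: pp)
 qed
 have in01: "real k / real n \<in> {0..1}" if "k <= n" for k n
  using that by (cases "n = 0") (auto simp: field_simps)
 have "tight \<nu>"
  unfolding tight_def
 proof (intro conjI allI impI rd)
  fix e :: real assume e: "e > 0"
  \<comment> \<open>Tightness is formulated with half-open intervals; this one contains all of
    [0,1].\<close>
  have "measure (\<nu> n) {-1<..1} = 1" for n
  proof -
   have "measure (\<nu> n) {-1<..1} = (\<integral>x. indicator {-1<..1} x \<partial>\<nu> n)"
    by (simp add: \<nu>_def)
   also have "\<dots> = (\<Sum>k\<le>n. indicator {-1<..1} (real k / real n) * w n k)" by (rule int) auto
   also have "\<dots> = (\<Sum>k\<le>n. w n k)"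
    by (rule sum.cong) (use in01 in \<open>auto simp: indicator_def, (smt (verit) divide_nonneg_nonneg of_nat_0_le_iff)+\<close>)
   finally show ?thesis by (simp add: w1)
  qed
  then show "EX a b. a < b & (ALL n. 1 - e < measure (\<nu> n) {a<..b})"
   using e by (intro exI[of _ "-1"] exI[of _ 1]) auto
 qed
 from tight_imp_convergent_subsubsequence[OF this strict_mono_id]
 obtain r M where r: "strict_mono r" and M: "real_distribution M" and conv: "weak_conv_m (\<nu> \<circ> r) M"
  by (auto simp: comp_def id_def)
 interpret M: real_distribution M by fact
 have lim: "(%n. \<integral>x. g x \<partial>\<nu> (r n)) \<longlonglongrightarrow> (\<integral>x. g x \<partial>M)"
  if "!!x. isCont g x" "!!x. \<bar>g x\<bar> <= B" for g :: "real => real" and B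
  using weak_conv_imp_integral_bdd_continuous_conv[of "\<nu> \<circ> r" M g B] that conv rd M by auto
 have ae: "AE x in M. x \<in> {0..1}"
 proof -
  \<comment> \<open>Continuous, bounded, and zero exactly on [0,1]: a vanishing integral confines
    the limit measure to [0,1].\<close>
  define g where "g x = min 1 (max 0 (max (-x) (x - 1)))" for x :: real
  have gc: "isCont g x" for x unfolding g_def by (intro continuous_intros)
  have gb: "\<bar>g x\<bar> <= 1" for x by (auto simp: g_def)
  have gm [measurable]: "g \<in> borel_measurable borel" unfolding g_def by measurable
  have "(\<integral>x. g x \<partial>\<nu> n) = 0" for n
   unfolding int[OF gm] by (rule sum.neutral) (use in01 in \<open>auto simp: g_def\<close>)
  then have "(%n. 0) \<longlonglongrightarrow> (\<integral>x. g x \<partial>M)" using lim[of g, OF gc gb] by simp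
  then have "(\<integral>x. g x \<partial>M) = 0" by (simp add: LIMSEQ_const_iff)
  moreover have "integrable M g"
   by (rule M.integrable_const_bound[of _ 1]) (use gb in auto)
  ultimately have "AE x in M. g x = 0"
   by (subst (asm) integral_nonneg_eq_0_iff_AE) (auto simp: g_def)
  then show ?thesis by eventually_elim (auto simp: g_def min_def max_def split: if_splits)
 qed
 have "(\<integral>x. x ^ i \<partial>M) = \<mu> i" for i
 proof -
  \<comment> \<open>Weak convergence tests bounded continuous functions; clamping the argument to
    [0,1] changes the monomial only on a null set.\<close>
  define g where "g x = (min 1 (max 0 x)) ^ i" for x :: real
  have gc: "isCont g x" for x unfolding g_def by (intro continuous_intros)
  have gb: "\<bar>g x\<bar> <= 1" for x by (auto simp: g_def power_le_one)
  have gm [measurable]: "g \<in> borel_measurable borel" unfolding g_def by measurable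
  have "(\<integral>x. g x \<partial>\<nu> n) = moment_functional \<mu> (Bern_mom n i)" for n
   unfolding int[OF gm] wm[symmetric]
  proof (rule sum.cong[OF refl])
   fix k assume "k \<in> {..n}"
   then have "g (real k / real n) = (real k / real n) ^ i"
    using in01[of k n] by (simp add: g_def min_def max_def)
   then show "g (real k / real n) * w n k = (real k / real n) ^ i * w n k" by simp
  qed
  then have "(%n. moment_functional \<mu> (Bern_mom (r n) i)) \<longlonglongrightarrow> (\<integral>x. g x \<partial>M)"
   using lim[of g, OF gc gb] by simp
  moreover have "(%n. moment_functional \<mu> (Bern_mom (r n) i)) \<longlonglongrightarrow> \<mu> i"
   using LIMSEQ_subseq_LIMSEQ[OF moment_functional_Bern_mom r] by (simp add: comp_def)
  ultimately have "(\<integral>x. g x \<partial>M) = \<mu> i" using LIMSEQ_unique by blast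
  moreover have "(\<integral>x. g x \<partial>M) = (\<integral>x. x ^ i \<partial>M)"
  proof (rule integral_cong_AE)
   show "AE x in M. g x = x ^ i" using ae by eventually_elim (simp add: g_def)
  qed auto
  ultimately show ?thesis by simp
 qed
 with M ae that show thesis by blast
qed

text \<open>Rescaling to total mass one. Positivity at x^i and x^i (1 - x) makes the moments
  nonnegative and decreasing, so if the zeroth one vanishes they all do and the null measure
  serves.\<close>

lemma hausdorff_moment:
 fixes \<mu> :: "nat => real"
 assumes pos: "!!k l. moment_functional \<mu> (bpoly k l) \<ge> 0"
 obtains M where "finite_measure M" "sets M = sets borel" "AE x in M. x \<in> {0..1}" "!!i. (\<integral>x. x ^ i \<partial>M) = \<mu> i"
proof -
 have mono: "0 <= \<mu> i" "\<mu> (Suc i) <= \<mu> i" for i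
 proof -
  have b0: "bpoly i 0 = monom 1 i" for i by (simp add: bpoly_def monom_altdef)
  have "bpoly i 1 = monom 1 i + smult (-1) (monom 1 (Suc i))"
   by (simp add: bpoly_def monom_altdef)
  then have "moment_functional \<mu> (bpoly i 1) = \<mu> i - \<mu> (Suc i)"
   by (simp only: moment_functional_add moment_functional_smult moment_functional_monom)
  then show "\<mu> (Suc i) <= \<mu> i" using pos[of i 1] by simp
  show "0 <= \<mu> i" using pos[of i 0] by (simp add: b0 moment_functional_monom)
 qed
 have le0: "\<mu> i <= \<mu> 0" for i by (induction i) (use mono order_trans in blast)+
 show thesis
 proof (cases "\<mu> 0 = 0")
  case True
  then have "\<mu> i = 0" for i using le0[of i] mono(1)[of i] by simp
  then show thesis
   by (intro that[of "null_measure borel"]) (auto intro!: finite_measureI AE_I[of _ _ UNIV] simp: null_sets_def)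
 next
  case False
  then have c: "\<mu> 0 > 0" using mono(1)[of 0] by simp
  have "moment_functional (%i. \<mu> i / \<mu> 0) p = moment_functional \<mu> p / \<mu> 0" for p
   by (simp add: moment_functional_def sum_divide_distrib)
  then obtain M where M: "real_distribution M" "AE x in M. x \<in> {0..1}" "!!i. (\<integral>x. x ^ i \<partial>M) = \<mu> i / \<mu> 0"
   by (rule_tac hausdorff_moment_prob[of "%i. \<mu> i / \<mu> 0"]) (use pos c in auto)
  interpret M: real_distribution M by fact
  let ?N = "scale_measure (ennreal (\<mu> 0)) M"
  have eq: "?N = density M (%_. ennreal (\<mu> 0))"
   by (rule measure_eqI) (auto simp: emeasure_density nn_integral_cmult_indicator)
  show thesis
  proof (rule that)
   show "finite_measure ?N" by (rule finite_measureI) (simp add: M.emeasure_space_1 ennreal_mult_eq_top_iff)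
   show "sets ?N = sets borel" by simp
   show "AE x in ?N. x \<in> {0..1}" unfolding eq by (subst AE_density) (use M(2) in auto)
   show "(\<integral>x. x ^ i \<partial>?N) = \<mu> i" for i
    unfolding eq by (subst integral_density) (use c M(3) in auto)
  qed
 qed
qed

section \<open>Functionals determined by monomials\<close>

text \<open>Bounds are asked on [0,1] only, where the spectral measures live, so that polynomials
  belong to the class.\<close>

definition bb :: "(real => real) => bool" where
 "bb \<phi> \<longleftrightarrow> \<phi> \<in> borel_measurable borel & (EX B. \<forall>x\<in>{0..1}. \<bar>\<phi> x\<bar> <= B)"

lemma bb_const [simp]: "bb (%_. c)" by (auto simp: bb_def)

lemma bb_add: assumes "bb \<phi>" "bb \<psi>" shows "bb (%x. \<phi> x + \<psi> x)"
proof -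
 from assms obtain B C where "\<forall>x\<in>{0..1}. \<bar>\<phi> x\<bar> <= B" "\<forall>x\<in>{0..1}. \<bar>\<psi> x\<bar> <= C" by (auto simp: bb_def)
 then have "\<forall>x\<in>{0..1}. \<bar>\<phi> x + \<psi> x\<bar> <= B + C" by fastforce
 then show ?thesis using assms by (auto simp: bb_def)
qed

lemma bb_mult: assumes "bb \<phi>" "bb \<psi>" shows "bb (%x. \<phi> x * \<psi> x)"
proof -
 from assms obtain B C where BC: "\<forall>x\<in>{0..1}. \<bar>\<phi> x\<bar> <= B" "\<forall>x\<in>{0..1}. \<bar>\<psi> x\<bar> <= C" by (auto simp: bb_def)
 have "\<forall>x\<in>{0..1}. \<bar>\<phi> x * \<psi> x\<bar> <= \<bar>B\<bar> * \<bar>C\<bar>"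
  unfolding abs_mult by (intro ballI mult_mono) (use BC in force)+
 then show ?thesis using assms by (auto simp: bb_def)
qed

lemma bb_cmult: "bb \<phi> ==> bb (%x. c * \<phi> x)" by (rule bb_mult) auto

lemma bb_diff: assumes "bb \<phi>" "bb \<psi>" shows "bb (%x. \<phi> x - \<psi> x)"
 using bb_add[OF assms(1) bb_cmult[OF assms(2), of "-1"]] by simp

lemma bb_id: "bb (%x. x)" by (auto simp: bb_def intro!: exI[of _ 1])

lemma bb_power: "bb \<phi> ==> bb (%x. \<phi> x ^ n)"
 by (induction n) (auto intro: bb_mult)

lemma bb_sum: "(!!i. i \<in> I ==> bb (f i)) ==> bb (%x. \<Sum>i\<in>I. f i x)"
 by (induction I rule: infinite_finite_induct) (auto intro: bb_add)

lemma bb_indicator: "A \<in> sets borel ==> bb (indicator A)"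
 by (auto simp: bb_def indicator_def intro!: exI[of _ 1])

text \<open>Stands for integration against a finite signed measure on [0,1]: linear, and continuous
  under bounded pointwise convergence there. Polarised spectral measures are handled in this form
  instead of as signed measures.\<close>

definition sfun :: "((real => real) => real) => bool" where
 "sfun T \<longleftrightarrow> (\<forall>\<phi> \<psi>. bb \<phi> --> bb \<psi> --> T (%x. \<phi> x + \<psi> x) = T \<phi> + T \<psi>)
  & (\<forall>c \<phi>. bb \<phi> --> T (%x. c * \<phi> x) = c * T \<phi>)
  & (\<forall>\<phi> \<psi> B. (ALL n. bb (\<phi> n)) --> (ALL n. \<forall>x\<in>{0..1}. \<bar>\<phi> n x\<bar> <= B) -->
    (\<forall>x\<in>{0..1}. (%n. \<phi> n x) \<longlonglongrightarrow> \<psi> x) --> bb \<psi> --> (%n. T (\<phi> n)) \<longlonglongrightarrow> T \<psi>)"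

lemma sfun_add: "sfun T ==> bb \<phi> ==> bb \<psi> ==> T (%x. \<phi> x + \<psi> x) = T \<phi> + T \<psi>"
 by (simp add: sfun_def)

lemma sfun_cmult: "sfun T ==> bb \<phi> ==> T (%x. c * \<phi> x) = c * T \<phi>"
 by (simp add: sfun_def)

lemma sfun_lim: "sfun T ==> (!!n. bb (\<phi> n)) ==> (!!n x. x \<in> {0..1} ==> \<bar>\<phi> n x\<bar> <= B) ==>
  (!!x. x\<in>{0..1} ==> (%n. \<phi> n x) \<longlonglongrightarrow> \<psi> x) ==> bb \<psi> ==> (%n. T (\<phi> n)) \<longlonglongrightarrow> T \<psi>"
 unfolding sfun_def by blast

lemma sfun_zero: "sfun T ==> T (%_. 0) = 0"
 using sfun_cmult[of T "%_. 0" 0] by simp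

lemma sfun_diff: "sfun T ==> bb \<phi> ==> bb \<psi> ==> T (%x. \<phi> x - \<psi> x) = T \<phi> - T \<psi>"
 using sfun_add[of T \<phi> "%x. - 1 * \<psi> x"] sfun_cmult[of T \<psi> "-1"] bb_cmult[of \<psi> "-1"] by simp

lemma sfun_sum: "sfun T ==> (!!i. i \<in> I ==> bb (f i)) ==> T (%x. \<Sum>i\<in>I. f i x) = (\<Sum>i\<in>I. T (f i))"
proof (induction I rule: infinite_finite_induct)
 case (insert a F)
 have "T (%x. f a x + (\<Sum>i\<in>F. f i x)) = T (f a) + T (%x. \<Sum>i\<in>F. f i x)"
  by (rule sfun_add) (use insert in \<open>auto intro: bb_sum\<close>)
 then show ?case using insert by simp
qed (auto simp: sfun_zero)

lemma sfun_combine: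
 assumes "sfun T" "sfun T'" shows "sfun (%\<phi>. c * T \<phi> + d * T' \<phi>)"
 unfolding sfun_def
proof (intro conjI allI impI)
 fix \<phi> \<psi> assume "bb \<phi>" "bb \<psi>"
 then show "c * T (%x. \<phi> x + \<psi> x) + d * T' (%x. \<phi> x + \<psi> x) = c * T \<phi> + d * T' \<phi> + (c * T \<psi> + d * T' \<psi>)"
  using assms by (simp add: sfun_add algebra_simps)
next
 fix e \<phi> assume "bb \<phi>"
 then show "c * T (%x. e * \<phi> x) + d * T' (%x. e * \<phi> x) = e * (c * T \<phi> + d * T' \<phi>)"
  using assms by (simp add: sfun_cmult algebra_simps)
next
 fix \<phi> \<psi> B assume "ALL n. bb (\<phi> n)" "ALL n. \<forall>x\<in>{0..1::real}. \<bar>\<phi> n x\<bar> <= B"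
  "\<forall>x\<in>{0..1}. (%n. \<phi> n x) \<longlonglongrightarrow> \<psi> x" "bb \<psi>"
 then show "(%n. c * T (\<phi> n) + d * T' (\<phi> n)) \<longlonglongrightarrow> c * T \<psi> + d * T' \<psi>"
  by (intro tendsto_intros sfun_lim[OF assms(1), of \<phi> B] sfun_lim[OF assms(2), of \<phi> B]) auto
qed

lemma sfun_weight:
 assumes "sfun T" "bb \<rho>" shows "sfun (%\<phi>. T (%x. \<rho> x * \<phi> x))"
 unfolding sfun_def
proof (intro conjI allI impI)
 fix \<phi> \<psi> assume "bb \<phi>" "bb \<psi>"
 then show "T (%x. \<rho> x * (\<phi> x + \<psi> x)) = T (%x. \<rho> x * \<phi> x) + T (%x. \<rho> x * \<psi> x)"
  using sfun_add[OF assms(1) bb_mult[OF assms(2)] bb_mult[OF assms(2)], of \<phi> \<psi>]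
  by (simp add: distrib_left)
next
 fix e \<phi> assume "bb \<phi>"
 then have "T (%x. e * (\<rho> x * \<phi> x)) = e * T (%x. \<rho> x * \<phi> x)"
  using assms by (intro sfun_cmult bb_mult)
 then show "T (%x. \<rho> x * (e * \<phi> x)) = e * T (%x. \<rho> x * \<phi> x)" by (simp add: mult_ac)
next
 fix \<phi> \<psi> B assume *: "ALL n. bb (\<phi> n)" "ALL n. \<forall>x\<in>{0..1::real}. \<bar>\<phi> n x\<bar> <= B"
  "\<forall>x\<in>{0..1}. (%n. \<phi> n x) \<longlonglongrightarrow> \<psi> x" "bb \<psi>"
 obtain C where C: "!!x. x \<in> {0..1} ==> \<bar>\<rho> x\<bar> <= C" using assms(2) unfolding bb_def by blast
 have "0 <= C" using C[of 0] by (auto intro: order_trans[OF abs_ge_zero])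
 then show "(%n. T (%x. \<rho> x * \<phi> n x)) \<longlonglongrightarrow> T (%x. \<rho> x * \<psi> x)"
  using * assms by (intro sfun_lim[OF assms(1), of _ "C * B"] bb_mult tendsto_intros)
   (auto simp: abs_mult intro!: mult_mono C)
qed

lemma sfun_integral:
 assumes fin: "finite_measure M" and s: "sets M = sets borel" and ae: "AE x in M. x \<in> {0..1}"
 shows "sfun (%\<phi>. \<integral>x. \<phi> x \<partial>M)"
  and "bb \<phi> ==> integrable M \<phi>"
proof -
 interpret finite_measure M by fact
 have m: "bb \<phi> ==> \<phi> \<in> borel_measurable M" for \<phi>
  unfolding bb_def using measurable_cong_sets[OF s refl] by auto
 show int: "integrable M \<phi>" if "bb \<phi>" for \<phi>
 proof -
  from that obtain B where "\<forall>x\<in>{0..1}. \<bar>\<phi> x\<bar> <= B" by (auto simp: bb_def)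
  then have "AE x in M. norm (\<phi> x) <= B" using ae by (auto elim: eventually_mono)
  then show ?thesis by (rule integrable_const_bound[OF _ m[OF that]])
 qed
 show "sfun (%\<phi>. \<integral>x. \<phi> x \<partial>M)"
  unfolding sfun_def
 proof (intro conjI allI impI)
  fix \<phi> \<psi> B assume *: "ALL n. bb (\<phi> n)" "ALL n. \<forall>x\<in>{0..1::real}. \<bar>\<phi> n x\<bar> <= B"
   "\<forall>x\<in>{0..1}. (%n. \<phi> n x) \<longlonglongrightarrow> \<psi> x" "bb \<psi>"
  show "(%n. \<integral>x. \<phi> n x \<partial>M) \<longlonglongrightarrow> (\<integral>x. \<psi> x \<partial>M)"
  proof (rule integral_dominated_convergence[where w="%_. B"])
   show "AE x in M. (%n. \<phi> n x) \<longlonglongrightarrow> \<psi> x" using ae by eventually_elim (use * in blast)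
   show "AE x in M. norm (\<phi> n x) <= B" for n using ae by eventually_elim (use * in auto)
  qed (use * in \<open>auto intro: m\<close>)
 qed (auto simp: int)
qed

text \<open>Simple functions follow by linearity; a bounded function, cut off outside [0,1], is a
  pointwise limit of simple functions with a common bound.\<close>

lemma sfun_eq_zero_indicator:
 assumes T: "sfun T" and ind: "!!A. A \<in> sets borel ==> T (indicator A) = 0" and "bb \<phi>"
 shows "T \<phi> = 0"
proof -
 have simple: "T g = 0" if g: "simple_function borel g" for g
 proof -
  have fin: "finite (range g)" using g by (auto simp: simple_function_def)
  have ms: "g -` {y} \<in> sets borel" for y using g simple_functionD(2)[OF g, of "{y}"] by simp
  have "g x = (\<Sum>y\<in>range g. y * indicator (g -` {y}) x)" for x
  proof -
   have "(\<Sum>y\<in>range g. y * indicator (g -` {y}) x) = (\<Sum>y\<in>range g. if y = g x then y else 0)"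
    by (rule sum.cong) (auto simp: indicator_def)
   then show ?thesis using fin by simp
  qed
  then have "T g = T (%x. \<Sum>y\<in>range g. y * indicator (g -` {y}) x)" by (intro arg_cong[of _ _ T] ext)
  also have "\<dots> = 0"
   by (subst sfun_sum[OF T]) (auto intro!: bb_cmult bb_indicator ms simp: sfun_cmult[OF T bb_indicator[OF ms]] ind[OF ms])
  finally show ?thesis .
 qed
 define \<phi>' where "\<phi>' x = \<phi> x * indicator {0..1} x" for x
 obtain B where B: "!!x. x \<in> {0..1} ==> \<bar>\<phi> x\<bar> <= B" using assms(3) unfolding bb_def by blast
 have m: "\<phi>' \<in> borel_measurable borel" using assms(3) unfolding \<phi>'_def bb_def by auto
 have b0: "B \<ge> 0" using B[of 0] by auto
 have pb: "\<bar>\<phi>' x\<bar> <= B" for x using B[of x] b0 by (auto simp: \<phi>'_def indicator_def)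
 obtain F where F: "!!i. simple_function borel (F i)" "!!x. (%i. F i x) \<longlonglongrightarrow> \<phi>' x"
   "!!i x. \<bar>F i x\<bar> <= 2 * \<bar>\<phi>' x\<bar>"
  using borel_measurable_implies_sequence_metric[OF m, of 0] by (auto simp: dist_real_def)
 have Fb: "\<bar>F i x\<bar> <= 2 * B" for i x using F(3)[of i x] pb[of x] by linarith
 have "(%i. T (F i)) \<longlonglongrightarrow> T \<phi>"
 proof (rule sfun_lim[OF T, where B="2 * B"])
  show "bb (F n)" for n unfolding bb_def
   using Fb borel_measurable_simple_function[OF F(1)] by blast
  show "(%n. F n x) \<longlonglongrightarrow> \<phi> x" if "x \<in> {0..1}" for x
   using F(2)[of x] that by (simp add: \<phi>'_def)
 qed (use Fb assms(3) in auto)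
 then show ?thesis by (simp add: simple[OF F(1)] LIMSEQ_const_iff)
qed

text \<open>From monomials to Bernstein polynomials, to continuous functions by uniform
  approximation, to half-lines by ramps, and to Borel sets because the sets on which T vanishes form
  a Dynkin system. This is uniqueness in the moment problem, and below the main way to identify two
  functionals.\<close>

lemma sfun_eq_zero:
 assumes T: "sfun T" and mon: "!!n. T (%x. x ^ n) = 0" and "bb \<phi>"
 shows "T \<phi> = 0"
proof -
 have bern: "T (%x. x ^ k * (1 - x) ^ l) = 0" for k l
 proof (induction l arbitrary: k)
  case 0 then show ?case by (simp add: mon)
 next
  case (Suc l)
  have b: "bb (%x. x ^ k * (1 - x) ^ l)" for k
   by (intro bb_mult bb_power bb_diff bb_id bb_const)
  have "(%x::real. x ^ k * (1 - x) ^ Suc l) = (%x. x ^ k * (1 - x) ^ l - x ^ Suc k * (1 - x) ^ l)"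
   by (auto simp: algebra_simps)
  then show ?case using sfun_diff[OF T b b, of k "Suc k"] Suc[of k] Suc[of "Suc k"] by simp
 qed
 have cont: "T g = 0" if g: "continuous_on UNIV g" for g
 proof -
  have gb: "bb g"
  proof -
   have "compact (g ` {0..1})" by (intro compact_continuous_image continuous_on_subset[OF g]) auto
   then obtain B where "\<forall>x\<in>g ` {0..1}. norm x <= B" using compact_imp_bounded bounded_iff by metis
   then show ?thesis using g by (auto simp: bb_def intro: borel_measurable_continuous_onI)
  qed
  define P where "P n x = (\<Sum>k\<le>n. g (real k / real n) * Bernstein n k x)" for n x
  have Pm: "bb (%x. g (real k / real n) * Bernstein n k x)" for k n
   unfolding Bernstein_def by (intro bb_mult bb_power bb_diff bb_id bb_const)
  have Pb: "bb (P n)" for n unfolding P_def by (intro bb_sum Pm)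
  have TP: "T (P n) = 0" for n
  proof -
   have "T (%x. g (real k / real n) * Bernstein n k x) = 0" for k
   proof -
    have "T (%x. (g (real k / real n) * real (n choose k)) * (x ^ k * (1 - x) ^ (n - k))) = 0"
     by (subst sfun_cmult[OF T]) (auto simp: bern intro!: bb_mult bb_power bb_diff bb_id bb_const)
    then show ?thesis by (simp add: Bernstein_def mult_ac)
   qed
   then show ?thesis unfolding P_def by (subst sfun_sum[OF T Pm]) simp
  qed
  have "EX N. \<forall>n\<ge>N. \<forall>x\<in>{0..1}. \<bar>g x - P n x\<bar> < e" if "e > 0" for e
   using Bernstein_Weierstrass[of g e] continuous_on_subset[OF g] that unfolding P_def by fastforce
  then obtain N where N: "!!e n x. e > 0 ==> n \<ge> N e ==> x \<in> {0..1} ==> \<bar>g x - P n x\<bar> < e"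
   by metis
  obtain B where B: "!!x. x \<in> {0..1} ==> \<bar>g x\<bar> <= B" using gb unfolding bb_def by blast
  \<comment> \<open>Starting at \<open>N 1\<close> makes the common bound B + 1 valid from the first
    index on.\<close>
  have "(%n. T (P (n + N 1))) \<longlonglongrightarrow> T g"
  proof (rule sfun_lim[OF T Pb, where B="B + 1"])
   fix n x assume x: "x \<in> {0..1::real}"
   show "\<bar>P (n + N 1) x\<bar> <= B + 1" using N[of 1 "n + N 1" x] B[OF x] x by auto
  next
   fix x assume x: "x \<in> {0..1::real}"
   have "(%n. P n x) \<longlonglongrightarrow> g x"
   proof (rule LIMSEQ_I)
    fix r :: real assume "r > 0"
    then show "EX no. \<forall>n\<ge>no. norm (P n x - g x) < r"
     using N[of r _ x] x by (intro exI[of _ "N r"]) (auto simp: abs_minus_commute)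
   qed
   then show "(%n. P (n + N 1) x) \<longlonglongrightarrow> g x" by (rule LIMSEQ_ignore_initial_segment)
  qed (rule gb)
  then show ?thesis by (simp add: TP LIMSEQ_const_iff)
 qed
 have one: "T (%_. 1) = 0" using mon[of 0] by simp
 have ind: "T (indicator A) = 0" if A: "A \<in> sets borel" for A
 proof -
  have A': "A \<in> sigma_sets UNIV (range (%a::real. {..a}))"
   using A by (simp add: borel_eq_atMost)
  have sb: "X \<in> sigma_sets UNIV (range (%a::real. {..a})) ==> X \<in> sets borel" for X
   by (simp add: borel_eq_atMost)
  have st: "Int_stable (range (%a::real. {..a}))"
   by (auto simp: Int_stable_def intro!: exI[of _ "min _ _"])
  have "range (%a::real. {..a}) \<subseteq> Pow UNIV" by simp
  from st this A' show ?thesis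
  proof (induction rule: sigma_sets_induct_disjoint)
   case (basic A)
   then obtain a where a: "A = {..a}" by auto
   \<comment> \<open>A ramp: 1 on {..a}, and for n > 0 zero from a + 1/n on.\<close>
   define \<phi> where "\<phi> n x = max 0 (min 1 (1 - real n * (x - a)))" for n x
   have "(%n. T (\<phi> n)) \<longlonglongrightarrow> T (indicator A)"
   proof (rule sfun_lim[OF T, where B=1])
    show "bb (\<phi> n)" for n
     by (auto simp: bb_def \<phi>_def[abs_def] intro!: exI[of _ 1])
    show "bb (indicator A)" using a by (intro bb_indicator) auto
    show "\<bar>\<phi> n x\<bar> <= 1" for n x by (auto simp: \<phi>_def)
    show "(%n. \<phi> n x) \<longlonglongrightarrow> indicator A x" for x
    proof (cases "x <= a")
     case True
     then have "real n * (x - a) <= 0" for n by (intro mult_nonneg_nonpos) auto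
     then have "\<phi> n x = 1" for n unfolding \<phi>_def by (smt (verit))
     then show ?thesis using True a by simp
    next
     case False
     then have xa: "x - a > 0" by simp
     obtain N where N: "1 < real N * (x - a)" using ex_less_of_nat_mult[OF xa, of 1] by blast
     have "\<phi> n x = 0" if "n \<ge> N" for n
     proof -
      have "real N * (x - a) <= real n * (x - a)" using that xa by (intro mult_right_mono) auto
      then show ?thesis using N by (auto simp: \<phi>_def)
     qed
     then have "eventually (%n. \<phi> n x = indicator A x) sequentially"
      using False a by (auto simp: eventually_sequentially)
     then show ?thesis by (rule tendsto_eventually)
    qed
   qed
   moreover have "T (\<phi> n) = 0" for n
    by (rule cont) (auto simp: \<phi>_def intro!: continuous_intros)
   ultimately show ?case by (simp add: LIMSEQ_const_iff)
  next
   case empty then show ?case using sfun_zero[OF T] by (simp add: indicator_def)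
  next
   case (compl A)
   have "indicator (UNIV - A) = (%x. 1 - indicator A x :: real)"
    by (auto simp: indicator_def)
   then show ?case
    using sfun_diff[OF T bb_const bb_indicator[OF sb[OF compl(1)]], of 1] compl one by simp
  next
   case (union A)
   have Ab: "A i \<in> sets borel" for i using union(2) sb by blast
   have "(%n. T (%x. \<Sum>i<n. indicator (A i) x)) \<longlonglongrightarrow> T (indicator (\<Union>i. A i))"
   proof (rule sfun_lim[OF T, where B=1])
    show "bb (%x. \<Sum>i<n. indicator (A i) x)" for n by (intro bb_sum bb_indicator Ab)
    show "bb (indicator (\<Union>i. A i))" by (intro bb_indicator) (use Ab in auto)
    have eq: "(\<Sum>i<n. indicator (A i) x) = (indicator (\<Union>i<n. A i) x :: real)" for n x
     by (subst indicator_UN_disjoint[symmetric])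
      (use union(1) in \<open>auto intro: disjoint_family_on_mono\<close>)
    show "\<bar>\<Sum>i<n. indicator (A i) x\<bar> <= (1::real)" for n x unfolding eq by (auto simp: indicator_def)
    show "(%n. \<Sum>i<n. indicator (A i) x) \<longlonglongrightarrow> (indicator (\<Union>i. A i) x :: real)" for x
     unfolding eq by (rule LIMSEQ_indicator_UN)
   qed
   moreover have "T (%x. \<Sum>i<n. indicator (A i) x) = 0" for n
    by (subst sfun_sum[OF T]) (auto intro!: bb_indicator Ab simp: union)
   ultimately show ?case by (simp add: LIMSEQ_const_iff)
  qed
 qed
 show ?thesis by (rule sfun_eq_zero_indicator[OF T ind assms(3)])
qed

lemma sfun_eqI:
 assumes "sfun T" "sfun T'" "!!n. T (%x. x ^ n) = T' (%x. x ^ n)" "bb \<phi>"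
 shows "T \<phi> = T' \<phi>"
 using sfun_eq_zero[OF sfun_combine[OF assms(1,2), of 1 "-1"] _ assms(4)] assms(3) by simp

section \<open>Borel functional calculus of a positive symmetric contraction\<close>

lemma moment_functional_pCons:
 "moment_functional m (pCons 0 p) = moment_functional (%i. m (Suc i)) p"
proof (cases "p = 0")
 case False
 then show ?thesis
  by (simp add: moment_functional_def sum.atMost_Suc_shift del: sum.atMost_Suc)
qed (simp add: moment_functional_def)

text \<open>To be instantiated with the resolvent (1 + L)^-1. The Hilbert space is real; the complex
  structure comes in through \<open>fc_commute\<close>.\<close>

locale positive_contraction =
 fixes A :: "'a::{real_inner,complete_space} => 'a"
 assumes lin: "linear A" and sym: "A x \<bullet> y = x \<bullet> A y"
  and pos: "0 <= A x \<bullet> x" and le: "A x \<bullet> x <= x \<bullet> x"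
begin

lemma lin_pow: "linear (A ^^ n)"
proof (induction n)
 case 0 then show ?case by (simp add: linear_iff)
next
 case (Suc n) then show ?case using linear_compose[OF Suc lin] by (simp add: comp_def)
qed

lemma sym_pow: "(A ^^ n) x \<bullet> y = x \<bullet> (A ^^ n) y"
 by (induction n arbitrary: x y) (simp_all add: sym funpow_swap1)

definition A' :: "'a => 'a" where "A' x = x - A x"

lemma sym': "A' x \<bullet> y = x \<bullet> A' y" by (simp add: A'_def inner_diff sym)

lemma sym_pow': "(A' ^^ n) x \<bullet> y = x \<bullet> (A' ^^ n) y"
 by (induction n arbitrary: x y) (simp_all add: sym' funpow_swap1)

lemma commute: "A (A' x) = A' (A x)" by (simp add: A'_def linear_diff[OF lin])

lemma commute_pow: "A ((A' ^^ n) x) = (A' ^^ n) (A x)"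
 by (induction n arbitrary: x) (simp_all add: commute)

lemma commute_pow_pow: "(A ^^ m) ((A' ^^ n) x) = (A' ^^ n) ((A ^^ m) x)"
 by (induction m arbitrary: x) (simp_all add: commute_pow)

text \<open>Substituting the operator for the variable: x acts as A and 1 - x as \<open>A'\<close>.
  Positivity of the moment sequence thereby becomes positivity of operators.\<close>

lemma moment_bpoly:
 "moment_functional (%i. (A ^^ i) f \<bullet> h) (bpoly k l) = (A ^^ k) ((A' ^^ l) f) \<bullet> h"
proof -
 have X: "moment_functional (%i. (A ^^ i) f \<bullet> h) ([:0, 1:] * p) = moment_functional (%i. (A ^^ i) (A f) \<bullet> h) p" for p f
  by (simp add: moment_functional_pCons funpow_swap1)
 have Y: "moment_functional (%i. (A ^^ i) f \<bullet> h) ([:1, -1:] * p) = moment_functional (%i. (A ^^ i) (A' f) \<bullet> h) p" for p f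
 proof -
  have "[:1, -1:] * p = p + smult (-1) ([:0, 1:] * p)" by simp
  then have "moment_functional (%i. (A ^^ i) f \<bullet> h) ([:1, -1:] * p)
   = moment_functional (%i. (A ^^ i) f \<bullet> h) p - moment_functional (%i. (A ^^ i) (A f) \<bullet> h) p"
   by (simp only: moment_functional_add moment_functional_smult X)
  also have "\<dots> = moment_functional (%i. (A ^^ i) (A' f) \<bullet> h) p"
   by (simp add: A'_def moment_functional_def linear_diff[OF lin_pow] inner_diff_left right_diff_distrib sum_subtractf)
  finally show ?thesis .
 qed
 show ?thesis
 proof (induction k arbitrary: f)
  case 0
  show ?case
  proof (induction l arbitrary: f)
   case 0 show ?case by (simp add: bpoly_def moment_functional_def)
  next
   case (Suc l)
   have "bpoly 0 (Suc l) = [:1, -1:] * bpoly 0 l" by (simp add: bpoly_def)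
   then show ?case using Suc[of "A' f"] by (simp only: Y) (simp add: funpow_swap1)
  qed
 next
  case (Suc k)
  have "bpoly (Suc k) l = [:0, 1:] * bpoly k l" by (simp add: bpoly_def mult.assoc)
  then show ?case using Suc[of "A f"] by (simp only: X) (simp add: funpow_swap1 commute_pow)
 qed
qed

lemma pos': "0 <= A' x \<bullet> x" using le[of x] by (simp add: A'_def inner_diff_left)

text \<open>Even powers are shared between the two sides of the inner product by symmetry. Exponents
  0 and 1 remain, and the mixed case is A (1 - A) = (1 - A) A (1 - A) + A (1 - A) A.\<close>

lemma pos_pow: "0 <= (A ^^ k) ((A' ^^ l) f) \<bullet> f"
proof -
 have AA': "0 <= A (A' g) \<bullet> g" for g
 proof -
  have "A (A' g) \<bullet> g = A (A' g) \<bullet> (A' g + A g)" by (simp add: A'_def)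
  also have "\<dots> = A (A' g) \<bullet> A' g + A' (A g) \<bullet> A g" by (simp only: inner_add_right commute)
  finally show ?thesis using pos[of "A' g"] pos'[of "A g"] by simp
 qed
 define a b where "a = k div 2" and "b = l div 2"
 define r s where "r = k mod 2" and "s = l mod 2"
 have kl: "k = a + (r + a)" "l = b + (s + b)" unfolding a_def b_def r_def s_def by presburger+
 define g where "g = (A ^^ a) ((A' ^^ b) f)"
 have "(A ^^ k) ((A' ^^ l) f) \<bullet> f = (A ^^ a) ((A ^^ r) ((A ^^ a) ((A' ^^ b) ((A' ^^ s) ((A' ^^ b) f))))) \<bullet> f"
  unfolding kl funpow_add by simp
 also have "\<dots> = (A ^^ a) ((A' ^^ b) ((A ^^ r) ((A' ^^ s) g))) \<bullet> f"
  unfolding g_def by (simp only: commute_pow_pow)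
 also have "\<dots> = (A ^^ r) ((A' ^^ s) g) \<bullet> g"
  unfolding g_def by (simp only: sym_pow sym_pow' commute_pow_pow)
 also have "\<dots> \<ge> 0"
 proof -
  have "r = 0 \<or> r = 1" "s = 0 \<or> s = 1" by (auto simp: r_def s_def)
  then show ?thesis using pos[of g] pos'[of g] AA'[of g] by auto
 qed
 finally show ?thesis .
qed

text \<open>The scalar spectral measure of A at f.\<close>

definition \<mu> :: "'a => real measure" where
 "\<mu> f = (SOME M. finite_measure M & sets M = sets borel & (AE x in M. x \<in> {0..1})
   & (ALL i. (\<integral>x. x ^ i \<partial>M) = (A ^^ i) f \<bullet> f))"

lemma \<mu>: "finite_measure (\<mu> f)" "sets (\<mu> f) = sets borel" "AE x in \<mu> f. x \<in> {0..1}"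
 "(\<integral>x. x ^ i \<partial>\<mu> f) = (A ^^ i) f \<bullet> f"
proof -
 have p: "0 <= moment_functional (%i. (A ^^ i) f \<bullet> f) (bpoly k l)" for k l
  unfolding moment_bpoly by (rule pos_pow)
 have "EX M. finite_measure M & sets M = sets borel & (AE x in M. x \<in> {0..1})
   & (ALL i. (\<integral>x. x ^ i \<partial>M) = (A ^^ i) f \<bullet> f)"
  by (rule hausdorff_moment[of "%i. (A ^^ i) f \<bullet> f", OF p]) blast
 from someI_ex[OF this] show "finite_measure (\<mu> f)" "sets (\<mu> f) = sets borel" "AE x in \<mu> f. x \<in> {0..1}"
  "(\<integral>x. x ^ i \<partial>\<mu> f) = (A ^^ i) f \<bullet> f"
  unfolding \<mu>_def by blast+
qed

text \<open>Formally the inner product of phi(A) f with h, by real polarisation. The minus sign sits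
  in the coefficient so that \<open>sfun_combine\<close> applies.\<close>

definition bform :: "(real => real) => 'a => 'a => real" where
 "bform \<phi> f h = 1/4 * (\<integral>x. \<phi> x \<partial>\<mu> (f + h)) + (-1/4) * (\<integral>x. \<phi> x \<partial>\<mu> (f - h))"

lemma sfun_bform: "sfun (%\<phi>. bform \<phi> f h)"
 unfolding bform_def by (intro sfun_combine sfun_integral \<mu>)

lemma bform_power: "bform (%x. x ^ n) f h = (A ^^ n) f \<bullet> h"
proof -
 have "(A ^^ n) h \<bullet> f = (A ^^ n) f \<bullet> h" using sym_pow[of n f h] by (simp add: inner_commute)
 then show ?thesis
  by (simp add: bform_def \<mu> linear_add[OF lin_pow] linear_diff[OF lin_pow] inner_add inner_diff field_simps)
qed

text \<open>Bilinearity and symmetry are not visible in the polarised definition; here and below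
  they are read off from the values on monomials.\<close>

lemma bform_eqI:
 assumes "!!n. (A ^^ n) f \<bullet> h = (A ^^ n) f' \<bullet> h'" "bb \<phi>"
 shows "bform \<phi> f h = bform \<phi> f' h'"
 by (rule sfun_eqI[OF sfun_bform sfun_bform _ assms(2)]) (simp add: bform_power assms)

lemma bform_add: assumes "bb \<phi>" shows "bform \<phi> f (h + h') = bform \<phi> f h + bform \<phi> f h'"
 using sfun_eqI[OF sfun_bform sfun_combine[OF sfun_bform sfun_bform] _ assms, of f "h + h'" 1 f h 1 f h']
 by (simp add: bform_power inner_add)

lemma bform_scale: assumes "bb \<phi>" shows "bform \<phi> f (c *\<^sub>R h) = c * bform \<phi> f h"
 using sfun_eqI[OF sfun_bform sfun_combine[OF sfun_bform sfun_bform] _ assms, of f "c *\<^sub>R h" c f h 0 f h]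
 by (simp add: bform_power)

lemma bform_commute: "bb \<phi> ==> bform \<phi> f h = bform \<phi> h f"
 by (rule bform_eqI) (simp_all add: sym_pow inner_commute[of h])

lemma bform_A: "bb \<phi> ==> bform \<phi> (A f) h = bform (%x. x * \<phi> x) f h"
 by (rule sfun_eqI[OF sfun_bform sfun_weight[OF sfun_bform bb_id]])
  (simp_all add: bform_power funpow_swap1 flip: power_Suc)

lemma bform_diag: assumes "bb \<phi>" shows "bform \<phi> f f = (\<integral>x. \<phi> x \<partial>\<mu> f)"
 by (rule sfun_eqI[OF sfun_bform sfun_integral(1)[OF \<mu>(1,2,3)] _ assms]) (simp add: bform_power \<mu>)

lemma integral_\<mu>_le:
 assumes "bb \<phi>" "!!x. x \<in> {0..1} ==> \<bar>\<phi> x\<bar> <= B"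
 shows "\<bar>\<integral>x. \<phi> x \<partial>\<mu> f\<bar> <= B * (norm f)\<^sup>2"
proof -
 interpret finite_measure "\<mu> f" by (rule \<mu>)
 have 1: "(\<integral>x. 1 \<partial>\<mu> f) = (norm f)\<^sup>2" using \<mu>(4)[of f 0] by (simp add: power2_norm_eq_inner)
 have "\<bar>\<integral>x. \<phi> x \<partial>\<mu> f\<bar> <= (\<integral>x. \<bar>\<phi> x\<bar> \<partial>\<mu> f)" by (rule integral_abs_bound)
 also have "\<dots> <= (\<integral>x. B \<partial>\<mu> f)"
 proof (rule integral_mono_AE)
  show "integrable (\<mu> f) (%x. \<bar>\<phi> x\<bar>)"
   using sfun_integral(2)[OF \<mu>(1,2,3) assms(1)] by (rule integrable_abs)
  show "AE x in \<mu> f. \<bar>\<phi> x\<bar> <= B" using \<mu>(3) by eventually_elim (rule assms(2))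
 qed auto
 also have "\<dots> = B * (norm f)\<^sup>2" using 1 by simp
 finally show ?thesis .
qed

text \<open>Polarisation and the parallelogram law give a bound by the sum of the squared norms.
  Replacing f by f / c and h by c h keeps the form; the c that balances the two norms turns the sum
  into a product.\<close>

lemma bform_bound:
 assumes "bb \<phi>" "!!x. x \<in> {0..1} ==> \<bar>\<phi> x\<bar> <= B"
 shows "\<bar>bform \<phi> f h\<bar> <= B * norm f * norm h"
proof -
 have B0: "0 <= B" using assms(2)[of 0] by auto
 have *: "\<bar>bform \<phi> f h\<bar> <= B / 2 * ((norm f)\<^sup>2 + (norm h)\<^sup>2)" for f h
 proof -
  have "4 * \<bar>bform \<phi> f h\<bar> <= \<bar>\<integral>x. \<phi> x \<partial>\<mu> (f + h)\<bar> + \<bar>\<integral>x. \<phi> x \<partial>\<mu> (f - h)\<bar>"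
   unfolding bform_def by (simp add: abs_if)
  also have "\<dots> <= B * (norm (f + h))\<^sup>2 + B * (norm (f - h))\<^sup>2"
   by (intro add_mono integral_\<mu>_le assms)
  also have "\<dots> = B * (2 * (norm f)\<^sup>2 + 2 * (norm h)\<^sup>2)"
   by (simp only: distrib_left[symmetric] parallelogram)
  finally have "4 * \<bar>bform \<phi> f h\<bar> <= B * (2 * (norm f)\<^sup>2 + 2 * (norm h)\<^sup>2)" .
  then show ?thesis by (simp only: distrib_left)
 qed
 show ?thesis
 proof (cases "f = 0 \<or> h = 0")
  case True
  have z: "bform \<phi> x 0 = 0" for x
   using bform_scale[OF assms(1), of x 0 0] by simp
  have "bform \<phi> 0 x = 0" for x
   by (rule trans[OF bform_commute[OF assms(1)] z])
  with z show ?thesis using True by auto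
 next
  case False
  define c where "c = sqrt (norm f / norm h)"
  have c: "c > 0" "c\<^sup>2 = norm f / norm h" using False by (auto simp: c_def)
  have "bform \<phi> ((1 / c) *\<^sub>R f) (c *\<^sub>R h) = bform \<phi> f h"
   using c by (subst bform_scale[OF assms(1)], subst bform_commute[OF assms(1)], subst bform_scale[OF assms(1)])
    (simp add: bform_commute[OF assms(1), of h f])
  then have "\<bar>bform \<phi> f h\<bar> <= B / 2 * ((norm ((1 / c) *\<^sub>R f))\<^sup>2 + (norm (c *\<^sub>R h))\<^sup>2)"
   using *[of "(1/c) *\<^sub>R f" "c *\<^sub>R h"] by simp
  also have "(norm ((1 / c) *\<^sub>R f))\<^sup>2 + (norm (c *\<^sub>R h))\<^sup>2 = 2 * (norm f * norm h)"
   using c False by (simp add: power_mult_distrib power_divide) (simp add: power2_eq_square field_simps)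
  finally show ?thesis by (simp add: mult_ac)
 qed
qed

definition fc :: "(real => real) => 'a => 'a" where
 "fc \<phi> = (SOME T. ALL f h. bform \<phi> f h = T f \<bullet> h)"

lemma fc_inner: assumes "bb \<phi>" shows "fc \<phi> f \<bullet> h = bform \<phi> f h"
proof -
 obtain B where B: "!!x. x \<in> {0..1} ==> \<bar>\<phi> x\<bar> <= B" using assms unfolding bb_def by blast
 have "linear (bform \<phi> f)" for f
  by (rule linearI) (simp_all add: bform_add bform_scale assms)
 from bilinear_operator[OF this bform_bound[OF assms B]]
 have "EX T. ALL f h. bform \<phi> f h = T f \<bullet> h" by metis
 then have "ALL f h. bform \<phi> f h = fc \<phi> f \<bullet> h" unfolding fc_def by (rule someI_ex)
 then show ?thesis by simp
qed

lemma inner_eqI: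
 assumes "!!h. x \<bullet> h = y \<bullet> h" shows "x = (y::'a)"
proof -
 have "(x - y) \<bullet> (x - y) = 0" by (simp add: inner_diff_left assms)
 then show ?thesis by simp
qed

lemma fc_sym: "bb \<phi> ==> fc \<phi> f \<bullet> h = f \<bullet> fc \<phi> h"
 using fc_inner[of \<phi> h f] fc_inner[of \<phi> f h] bform_commute[of \<phi> f h] by (simp add: inner_commute)

lemma fc_add: "bb \<phi> ==> fc \<phi> (f + g) = fc \<phi> f + fc \<phi> g"
 by (rule inner_eqI) (simp add: fc_sym inner_add_left)

lemma fc_scale: "bb \<phi> ==> fc \<phi> (c *\<^sub>R f) = c *\<^sub>R fc \<phi> f"
 by (rule inner_eqI) (simp add: fc_sym)

lemma fc_bound:
 assumes "bb \<phi>" "!!x. x \<in> {0..1} ==> \<bar>\<phi> x\<bar> <= B"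
 shows "norm (fc \<phi> f) <= B * norm f"
proof -
 have "norm (fc \<phi> f) * norm (fc \<phi> f) <= B * norm f * norm (fc \<phi> f)"
  using bform_bound[OF assms, of f "fc \<phi> f"] by (simp add: fc_inner[OF assms(1), symmetric] norm_eq_sqrt_inner)
 moreover have "0 <= B * norm f" using assms(2)[of 0] by auto
 ultimately show ?thesis by (cases "norm (fc \<phi> f) = 0") auto
qed

lemma fc_power: "fc (%x. x ^ n) f = (A ^^ n) f"
 by (rule inner_eqI) (simp add: fc_inner bform_power bb_power bb_id)

lemma fc_id: "fc (%x. x) f = A f" using fc_power[of 1] by simp

lemma fc_one: "fc (%x. 1) f = f" using fc_power[of 0] by simp

lemma fc_fun_add: "bb \<phi> ==> bb \<psi> ==> fc (%x. \<phi> x + \<psi> x) f = fc \<phi> f + fc \<psi> f"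
 by (rule inner_eqI) (simp add: fc_inner bb_add inner_add_left sfun_add[OF sfun_bform])

lemma fc_fun_scale: "bb \<phi> ==> fc (%x. c * \<phi> x) f = c *\<^sub>R fc \<phi> f"
 by (rule inner_eqI) (simp add: fc_inner bb_cmult sfun_cmult[OF sfun_bform])

text \<open>Two passes through monomials, one for each factor: powers of A are moved across the
  inner product for arbitrary psi, and then x ^ n is replaced by arbitrary phi.\<close>

lemma fc_mult: assumes "bb \<phi>" "bb \<psi>" shows "fc (%x. \<phi> x * \<psi> x) f = fc \<phi> (fc \<psi> f)"
proof (rule inner_eqI)
 fix h
 have 1: "bform \<psi> f ((A ^^ n) h) = bform (%x. \<psi> x * x ^ n) f h" for n
 proof -
  have "bform \<psi> f ((A ^^ n) h) = bform (%x. x ^ n * \<psi> x) f h"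
  proof (rule sfun_eqI[OF sfun_bform sfun_weight[OF sfun_bform bb_power[OF bb_id]] _ assms(2)])
   show "bform (%x. x ^ m) f ((A ^^ n) h) = bform (%x. x ^ n * x ^ m) f h" for m
    by (simp add: bform_power sym_pow funpow_add flip: power_add)
  qed
  then show ?thesis by (simp add: mult.commute)
 qed
 have "bform \<phi> (fc \<psi> f) h = bform (%x. \<psi> x * \<phi> x) f h"
 proof (rule sfun_eqI[OF sfun_bform sfun_weight[OF sfun_bform assms(2)] _ assms(1)])
  show "bform (%x. x ^ n) (fc \<psi> f) h = bform (%x. \<psi> x * x ^ n) f h" for n
   by (simp add: bform_power sym_pow fc_inner[OF assms(2)] 1)
 qed
 then show "fc (%x. \<phi> x * \<psi> x) f \<bullet> h = fc \<phi> (fc \<psi> f) \<bullet> h"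
  by (simp add: fc_inner assms bb_mult mult.commute)
qed

lemma fc_norm: assumes "bb \<phi>" shows "(norm (fc \<phi> f))\<^sup>2 = (\<integral>x. (\<phi> x)\<^sup>2 \<partial>\<mu> f)"
proof -
 have "(norm (fc \<phi> f))\<^sup>2 = fc (%x. \<phi> x * \<phi> x) f \<bullet> f"
  using assms by (simp add: power2_norm_eq_inner fc_mult fc_sym)
 then show ?thesis using assms by (simp add: fc_inner bb_mult bform_diag power2_eq_square)
qed

lemma fc_tendsto:
 assumes "!!n. bb (\<phi> n)" "!!n x. x \<in> {0..1} ==> \<bar>\<phi> n x\<bar> <= B"
  "!!x. x\<in>{0..1} ==> (%n. \<phi> n x) \<longlonglongrightarrow> \<psi> x" "bb \<psi>"
 shows "(%n. fc (\<phi> n) f \<bullet> h) \<longlonglongrightarrow> fc \<psi> f \<bullet> h"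
 using sfun_lim[OF sfun_bform, of \<phi> B \<psi> f h] assms by (simp add: fc_inner)

lemma fc_cong01:
 assumes "bb \<phi>" "bb \<psi>" "!!x. x \<in> {0..1} ==> \<phi> x = \<psi> x"
 shows "fc \<phi> f = fc \<psi> f"
proof (rule inner_eqI)
 fix h
 obtain B where B: "!!x. x \<in> {0..1} ==> \<bar>\<phi> x\<bar> <= B" using assms(1) unfolding bb_def by blast
 have "(%n::nat. fc \<phi> f \<bullet> h) \<longlonglongrightarrow> fc \<psi> f \<bullet> h"
  by (rule fc_tendsto[OF assms(1) B]) (use assms in auto)
 then show "fc \<phi> f \<bullet> h = fc \<psi> f \<bullet> h" by (simp add: LIMSEQ_const_iff)
qed

text \<open>Multiplication by x hides the value at 0, and injectivity of A cancels that factor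
  again: functions of an injective A ignore the point 0.\<close>

lemma fc_cong:
 assumes inj: "!!x. A x = 0 ==> x = 0"
  and "bb \<phi>" "bb \<psi>" "!!x. 0 < x ==> x <= 1 ==> \<phi> x = \<psi> x"
 shows "fc \<phi> f = fc \<psi> f"
proof -
 have "A (fc \<phi> f) = A (fc \<psi> f)"
 proof -
  have "fc (%x. x * \<phi> x) f = fc (%x. x * \<psi> x) f"
   by (rule fc_cong01) (use assms bb_id in \<open>auto intro: bb_mult simp: less_eq_real_def\<close>)
  then show ?thesis using assms by (simp add: fc_mult bb_id fc_id)
 qed
 then have "A (fc \<phi> f - fc \<psi> f) = 0" by (simp add: linear_diff[OF lin])
 then show ?thesis using inj[of "fc \<phi> f - fc \<psi> f"] by simp
qed

text \<open>Applied to multiplication by the imaginary unit, this makes the real functional calculus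
  complex linear.\<close>

lemma fc_commute:
 assumes J: "linear J" "surj J" "!!x y. J x \<bullet> J y = x \<bullet> y" "!!x. A (J x) = J (A x)" and "bb \<phi>"
 shows "fc \<phi> (J f) = J (fc \<phi> f)"
proof (rule inner_eqI)
 fix h
 obtain k where k: "h = J k" using J(2) by blast
 have "(A ^^ n) (J f) = J ((A ^^ n) f)" for n by (induction n) (simp_all add: J(4))
 then have "bform \<phi> (J f) h = bform \<phi> f k" unfolding k by (intro bform_eqI assms) (simp add: J(3))
 then show "fc \<phi> (J f) \<bullet> h = J (fc \<phi> f) \<bullet> h"
  by (simp add: fc_inner assms(5) k J(3))
qed

end

section \<open>The Hilbert space of square integrable functions\<close>

lemma ae_eq_refl [simp]: "ae_eq f f" by (simp add: ae_eq_def)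
lemma ae_eq_sym: "ae_eq f g ==> ae_eq g f" by (auto simp: ae_eq_def elim: eventually_mono)
lemma ae_eq_trans: "ae_eq f g ==> ae_eq g h ==> ae_eq f h"
 unfolding ae_eq_def by (erule (1) eventually_elim2) simp

lemma L2D: "f \<in> L2 ==> f \<in> borel_measurable lebesgue" "f \<in> L2 ==> integrable lebesgue (%x. (cmod (f x))\<^sup>2)"
 by (auto simp: L2_def)

lemma L2_dominated:
 assumes "f \<in> borel_measurable lebesgue" "g \<in> L2" "AE x in lebesgue. cmod (f x) <= C * cmod (g x)"
 shows "f \<in> L2"
proof -
 note [measurable] = assms(1) L2D(1)[OF assms(2)]
 have "integrable lebesgue (%x. (cmod (f x))\<^sup>2)"
 proof (rule Bochner_Integration.integrable_bound)
  show "integrable lebesgue (%x. C\<^sup>2 * (cmod (g x))\<^sup>2)" using L2D(2)[OF assms(2)] by simp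
  show "AE x in lebesgue. norm ((cmod (f x))\<^sup>2) <= norm (C\<^sup>2 * (cmod (g x))\<^sup>2)"
   using assms(3)
  proof eventually_elim
   case (elim x)
   then have "(cmod (f x))\<^sup>2 <= (C * cmod (g x))\<^sup>2" by (intro power_mono) auto
   then show ?case by (simp add: power_mult_distrib)
  qed
 qed measurable
 then show ?thesis using assms(1) by (simp add: L2_def)
qed

lemma L2_zero [simp]: "(%_. 0) \<in> L2" by (simp add: L2_def)

lemma L2_cmult: "f \<in> L2 ==> (%x. c * f x) \<in> L2"
 by (rule L2_dominated[of _ f "cmod c"]) (auto dest: L2D simp: norm_mult)

lemma L2_add: assumes "f \<in> L2" "g \<in> L2" shows "(%x. f x + g x) \<in> L2"
proof -
 note [measurable] = L2D(1)[OF assms(1)] L2D(1)[OF assms(2)]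
 have "integrable lebesgue (%x. (cmod (f x + g x))\<^sup>2)"
 proof (rule Bochner_Integration.integrable_bound)
  show "integrable lebesgue (%x. 2 * (cmod (f x))\<^sup>2 + 2 * (cmod (g x))\<^sup>2)"
   using L2D(2)[OF assms(1)] L2D(2)[OF assms(2)] by simp
  show "AE x in lebesgue. norm ((cmod (f x + g x))\<^sup>2) <= norm (2 * (cmod (f x))\<^sup>2 + 2 * (cmod (g x))\<^sup>2)"
  proof (rule AE_I2)
   fix x
   show "norm ((cmod (f x + g x))\<^sup>2) <= norm (2 * (cmod (f x))\<^sup>2 + 2 * (cmod (g x))\<^sup>2)"
   proof -
    have "(cmod (f x + g x))\<^sup>2 <= 2 * (cmod (f x))\<^sup>2 + 2 * (cmod (g x))\<^sup>2"
     using parallelogram[of "f x" "g x"] zero_le_power2[of "norm (f x - g x)"] by linarith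
    then show ?thesis by (simp del: norm_power power_add)
   qed
  qed
 qed measurable
 then show ?thesis by (simp add: L2_def)
qed

lemma L2_uminus: "f \<in> L2 ==> (%x. - f x) \<in> L2" using L2_cmult[of f "-1"] by simp

lemma L2_diff: "f \<in> L2 ==> g \<in> L2 ==> (%x. f x - g x) \<in> L2"
 using L2_add[of f "%x. - g x"] L2_uminus[of g] by simp

lemma L2_norm: "f \<in> L2 ==> (%x. complex_of_real (cmod (f x))) \<in> L2"
 by (rule L2_dominated[of _ f 1]) (auto dest: L2D)

lemma L2_integrable_mult:
 assumes "f \<in> L2" "g \<in> L2" shows "integrable lebesgue (%x. f x * g x)"
proof -
 note [measurable] = L2D(1)[OF assms(1)] L2D(1)[OF assms(2)]
 show ?thesis
 proof (rule Bochner_Integration.integrable_bound)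
  show "integrable lebesgue (%x. (cmod (f x))\<^sup>2 + (cmod (g x))\<^sup>2)"
   using L2D(2)[OF assms(1)] L2D(2)[OF assms(2)] by simp
  show "AE x in lebesgue. norm (f x * g x) <= norm ((cmod (f x))\<^sup>2 + (cmod (g x))\<^sup>2)"
  proof (rule AE_I2)
   fix x
   show "norm (f x * g x) <= norm ((cmod (f x))\<^sup>2 + (cmod (g x))\<^sup>2)"
   proof -
    have "cmod (f x) * cmod (g x) <= (cmod (f x))\<^sup>2 + (cmod (g x))\<^sup>2"
    proof -
     have "0 <= cmod (f x) * cmod (g x)" by simp
     with sum_squares_bound[of "cmod (f x)" "cmod (g x)"] show ?thesis
      unfolding mult.assoc by linarith
    qed
    then show ?thesis by (simp add: norm_mult del: norm_power)
   qed
  qed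
 qed measurable
qed

lemma L2_cnj: "f \<in> L2 ==> (%x. cnj (f x)) \<in> L2"
 by (rule L2_dominated[of _ f 1]) (auto dest: L2D intro: borel_measurable_continuous_on[of cnj, OF continuous_on_cnj[OF continuous_on_id]])

lemma L2_integrable: "f \<in> L2 ==> g \<in> L2 ==> integrable lebesgue (%x. f x * cnj (g x))"
 by (intro L2_integrable_mult L2_cnj)

lemma l2_inner_add: "f \<in> L2 ==> g \<in> L2 ==> h \<in> L2 ==>
  l2_inner (%x. f x + g x) h = l2_inner f h + l2_inner g h"
 by (simp add: l2_inner_def distrib_right L2_integrable)

lemma l2_inner_cmult: "l2_inner (%x. c * f x) g = c * l2_inner f g"
 by (simp add: l2_inner_def mult.assoc)

lemma l2_inner_commute: "l2_inner g f = cnj (l2_inner f g)"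
proof -
 have "cnj (l2_inner f g) = (\<integral>x. cnj (f x * cnj (g x)) \<partial>lebesgue)" unfolding l2_inner_def by (rule Bochner_Integration.integral_cnj[symmetric])
 then show ?thesis by (simp add: l2_inner_def mult.commute)
qed

lemma l2_inner_cmult_right: "l2_inner f (%x. c * g x) = cnj c * l2_inner f g"
 by (simp add: l2_inner_def mult_ac)

lemma l2_inner_self: "l2_inner f f = complex_of_real (\<integral>x. (cmod (f x))\<^sup>2 \<partial>lebesgue)"
 unfolding l2_inner_def by (subst integral_complex_of_real[symmetric]) (simp only: complex_norm_square)

lemma l2_inner_cong:
 assumes "ae_eq f f'" "ae_eq g g'" "f \<in> L2" "f' \<in> L2" "g \<in> L2" "g' \<in> L2"
 shows "l2_inner f g = l2_inner f' g'"
 unfolding l2_inner_def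
proof (rule integral_cong_AE)
 show "AE x in lebesgue. f x * cnj (g x) = f' x * cnj (g' x)"
  using assms(1,2) unfolding ae_eq_def by eventually_elim simp
qed (use assms in \<open>auto intro!: borel_measurable_integrable L2_integrable\<close>)

\<comment> \<open>A partial quotient, since only functions in \<open>L2\<close> are to have classes.
  The type becomes a real Hilbert space under the real part of the complex inner product; imaginary
  parts are recovered from the operator \<open>J\<close>.\<close>
quotient_type 'n ell2 = "real^'n => complex" / partial: "%f g. f \<in> L2 & g \<in> L2 & ae_eq f g"
 morphisms rep cls
proof (rule part_equivpI)
 show "EX x. x \<in> L2 & x \<in> L2 & ae_eq x x" by (rule exI[of _ "%_. 0"]) simp
 show "symp (%f g. f \<in> L2 & g \<in> L2 & ae_eq f g)" by (auto intro!: sympI ae_eq_sym)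
 show "transp (%f g. f \<in> L2 & g \<in> L2 & ae_eq f g)" by (auto intro!: transpI intro: ae_eq_trans)
qed

lemma rep_L2 [simp]: "rep x \<in> L2"
 using Quotient_rep_reflp[OF Quotient_ell2] by blast

lemma cls_rep [simp]: "cls (rep x) = x"
 by (rule Quotient_abs_rep[OF Quotient_ell2])

lemma rep_cls: "f \<in> L2 ==> ae_eq (rep (cls f)) f"
 using Quotient_rep_abs[OF Quotient_ell2, of f] by simp

lemma cls_eq_iff: "f \<in> L2 ==> g \<in> L2 ==> cls f = cls g \<longleftrightarrow> ae_eq f g"
 using Quotient_rel[OF Quotient_ell2, of f g] by simp

lemma cls_eqI: "f \<in> L2 ==> g \<in> L2 ==> AE x in lebesgue. f x = g x ==> cls f = cls g"
 by (simp add: cls_eq_iff ae_eq_def)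

lemma rep_eq_iff: "x = y \<longleftrightarrow> ae_eq (rep x) (rep y)"
 by (metis ae_eq_refl cls_eq_iff cls_rep rep_L2)

instantiation ell2 :: (finite) real_vector
begin

lift_definition zero_ell2 :: "'a ell2" is "%_. 0" by simp
lift_definition plus_ell2 :: "'a ell2 => 'a ell2 => 'a ell2" is "%f g x. f x + g x"
 by (auto intro: L2_add simp: ae_eq_def elim: eventually_elim2)
lift_definition minus_ell2 :: "'a ell2 => 'a ell2 => 'a ell2" is "%f g x. f x - g x"
 by (auto intro: L2_diff simp: ae_eq_def elim: eventually_elim2)
lift_definition uminus_ell2 :: "'a ell2 => 'a ell2" is "%f x. - f x"
 by (auto intro: L2_uminus simp: ae_eq_def elim: eventually_mono)
lift_definition scaleR_ell2 :: "real => 'a ell2 => 'a ell2" is "%r f x. complex_of_real r * f x"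
 by (auto intro: L2_cmult simp: ae_eq_def elim: eventually_mono)

instance
proof
 fix a b c :: "'a ell2" and r s :: real
 show "a + b + c = a + (b + c)" by transfer (simp add: L2_add add.assoc)
 show "a + b = b + a" by transfer (simp add: L2_add add.commute)
 show "0 + a = a" by transfer simp
 show "- a + a = 0" by transfer simp
 show "a - b = a + - b" by transfer (simp add: L2_diff)
 show "r *\<^sub>R (a + b) = r *\<^sub>R a + r *\<^sub>R b" by transfer (simp add: L2_add L2_cmult distrib_left)
 show "(r + s) *\<^sub>R a = r *\<^sub>R a + s *\<^sub>R a"
 proof transfer
  fix r s :: real and f :: "real^'a => complex"
  assume f: "f \<in> L2 & f \<in> L2 & ae_eq f f"
  have "(%x. complex_of_real (r + s) * f x) = (%x. complex_of_real r * f x + complex_of_real s * f x)"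
   by (simp add: distrib_right)
  then show "(%x. complex_of_real (r + s) * f x) \<in> L2 & (%x. complex_of_real r * f x + complex_of_real s * f x) \<in> L2 &
   ae_eq (%x. complex_of_real (r + s) * f x) (%x. complex_of_real r * f x + complex_of_real s * f x)"
   using f by (auto intro: L2_add L2_cmult)
 qed
 show "r *\<^sub>R s *\<^sub>R a = (r * s) *\<^sub>R a" by transfer (simp add: L2_cmult mult.assoc)
 show "1 *\<^sub>R a = a" by transfer simp
qed

end

instantiation ell2 :: (finite) real_inner
begin

lift_definition inner_ell2 :: "'a ell2 => 'a ell2 => real" is "%f g. Re (l2_inner f g)"
 by (auto intro: arg_cong[of _ _ Re] l2_inner_cong)

definition norm_ell2 :: "'a ell2 => real" where "norm_ell2 x = sqrt (x \<bullet> x)"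
definition dist_ell2 :: "'a ell2 => 'a ell2 => real" where "dist_ell2 x y = norm (x - y)"
definition sgn_ell2 :: "'a ell2 => 'a ell2" where "sgn_ell2 x = inverse (norm x) *\<^sub>R x"
definition uniformity_ell2 :: "('a ell2 \<times> 'a ell2) filter" where
 "uniformity_ell2 = (INF e\<in>{0<..}. principal {(x, y). dist x y < e})"
definition open_ell2 :: "'a ell2 set => bool" where
 "open_ell2 U \<longleftrightarrow> (\<forall>x\<in>U. eventually (%(x', y). x' = x --> y \<in> U) uniformity)"

instance
proof
 fix x y z :: "'a ell2" and r :: real and U :: "'a ell2 set"
 show "dist x y = norm (x - y)" by (rule dist_ell2_def)
 show "sgn x = inverse (norm x) *\<^sub>R x" by (rule sgn_ell2_def)
 show "uniformity = (INF e\<in>{0<..}. principal {(x, y :: 'a ell2). dist x y < e})" by (rule uniformity_ell2_def)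
 show "open U \<longleftrightarrow> (\<forall>x\<in>U. eventually (%(x', y). x' = x --> y \<in> U) uniformity)" by (rule open_ell2_def)
 show "norm x = sqrt (x \<bullet> x)" by (rule norm_ell2_def)
 show "x \<bullet> y = y \<bullet> x" by transfer (subst l2_inner_commute, simp)
 show "(x + y) \<bullet> z = x \<bullet> z + y \<bullet> z" by transfer (simp add: l2_inner_add)
 show "r *\<^sub>R x \<bullet> y = r * (x \<bullet> y)" by transfer (simp add: l2_inner_cmult)
 show "0 <= x \<bullet> x" by transfer (simp add: l2_inner_self)
 show "x \<bullet> x = 0 \<longleftrightarrow> x = 0"
 proof transfer
  fix f :: "real^'a => complex" assume f: "f \<in> L2 & f \<in> L2 & ae_eq f f"
  then have "integrable lebesgue (%x. (cmod (f x))\<^sup>2)" by (auto dest: L2D)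
  then have "(\<integral>x. (cmod (f x))\<^sup>2 \<partial>lebesgue) = 0 \<longleftrightarrow> (AE x in lebesgue. (cmod (f x))\<^sup>2 = 0)"
   by (rule integral_nonneg_eq_0_iff_AE) auto
  then show "Re (l2_inner f f) = 0 \<longleftrightarrow> f \<in> L2 & (%_. 0) \<in> L2 & ae_eq f (%_. 0)"
   using f by (simp add: l2_inner_self ae_eq_def)
 qed
qed

end

lemma cls_add: "f \<in> L2 ==> g \<in> L2 ==> cls f + cls g = cls (%x. f x + g x)"
 by (rule plus_ell2.abs_eq) (simp_all add: eq_onp_def)

lemma cls_diff: "f \<in> L2 ==> g \<in> L2 ==> cls f - cls g = cls (%x. f x - g x)"
 by (rule minus_ell2.abs_eq) (simp_all add: eq_onp_def)

lemma cls_scale: "f \<in> L2 ==> r *\<^sub>R cls f = cls (%x. complex_of_real r * f x)"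
 by (rule scaleR_ell2.abs_eq) (simp_all add: eq_onp_def)

lemma cls_zero: "0 = cls (%_. 0)" by (rule zero_ell2.abs_eq)

lemma cls_inner: "f \<in> L2 ==> g \<in> L2 ==> cls f \<bullet> cls g = Re (l2_inner f g)"
 by (rule inner_ell2.abs_eq) (simp_all add: eq_onp_def)

lemma cls_norm: "f \<in> L2 ==> (norm (cls f))\<^sup>2 = (\<integral>x. (cmod (f x))\<^sup>2 \<partial>lebesgue)"
 by (simp add: power2_norm_eq_inner cls_inner l2_inner_self)

lemma rep_inner: "x \<bullet> y = Re (l2_inner (rep x) (rep y))"
 by (metis cls_inner cls_rep rep_L2)

lemma rep_norm: "(norm x)\<^sup>2 = (\<integral>t. (cmod (rep x t))\<^sup>2 \<partial>lebesgue)"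
 by (metis cls_norm cls_rep rep_L2)

lemma rep_add: "AE t in lebesgue. rep (x + y) t = rep x t + rep y t"
 using rep_cls[of "%t. rep x t + rep y t"] cls_add[of "rep x" "rep y"] by (simp add: ae_eq_def L2_add)

lemma rep_diff: "AE t in lebesgue. rep (x - y) t = rep x t - rep y t"
 using rep_cls[of "%t. rep x t - rep y t"] cls_diff[of "rep x" "rep y"] by (simp add: ae_eq_def L2_diff)

lemma rep_scale: "AE t in lebesgue. rep (r *\<^sub>R x) t = complex_of_real r * rep x t"
 using rep_cls[of "%t. complex_of_real r * rep x t"] cls_scale[of "rep x" r] by (simp add: ae_eq_def L2_cmult)

lemma rep_zero: "AE t in lebesgue. rep 0 t = 0"
 using rep_cls[of "%t. 0"] by (simp add: ae_eq_def flip: cls_zero)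

lemma nn_norm: "f \<in> L2 ==> (\<integral>\<^sup>+x. ennreal ((cmod (f x))\<^sup>2) \<partial>lebesgue) = ennreal ((norm (cls f))\<^sup>2)"
 by (simp add: cls_norm nn_integral_eq_integral L2D)

lemma L2_nn_iff: "f \<in> L2 \<longleftrightarrow> f \<in> borel_measurable lebesgue & (\<integral>\<^sup>+x. ennreal ((cmod (f x))\<^sup>2) \<partial>lebesgue) < \<infinity>"
 by (auto simp: L2_def integrable_iff_bounded)

text \<open>As in the Riesz-Fischer theorem, the partial sums of the moduli of the increments have
  norm at most 2 by the geometric series, so by monotone convergence the increments are absolutely
  summable at almost every point. Used for completeness and again for the measurable version of the
  semigroup.\<close>

lemma ell2_Cauchy_subseq:
 fixes f :: "nat => real^'n => complex"
 assumes f: "!!n. f n \<in> L2" and d: "!!n. norm (cls (f (Suc n)) - cls (f n)) <= (1/2)^n"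
 shows "AE x in lebesgue. convergent (%n. f n x)"
proof -
 note [measurable] = L2D(1)[OF f]
 define a where "a n x = cmod (f (Suc n) x - f n x)" for n x
 have am [measurable]: "a n \<in> borel_measurable lebesgue" for n unfolding a_def by measurable
 have aL: "(%x. complex_of_real (a n x)) \<in> L2" for n
  unfolding a_def by (intro L2_norm L2_diff f)
 have an: "norm (cls (%x. complex_of_real (a n x))) <= (1/2)^n" for n
 proof -
  have "(norm (cls (%x. complex_of_real (a n x))))\<^sup>2 = (norm (cls (f (Suc n)) - cls (f n)))\<^sup>2"
   by (simp add: cls_norm[OF aL] cls_diff[OF f f] cls_norm L2_diff f) (simp add: a_def)
  then show ?thesis using d[of n] by (simp add: power2_eq_iff_nonneg)
 qed
 define S where "S N x = (\<Sum>n<N. a n x)" for N x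
 have SL: "(%x. complex_of_real (S N x)) \<in> L2 & norm (cls (%x. complex_of_real (S N x))) <= (\<Sum>n<N. (1/2)^n)" for N
 proof (induction N)
  case 0 then show ?case by (simp add: S_def flip: cls_zero)
 next
  case (Suc N)
  have eq: "(%x. complex_of_real (S (Suc N) x)) = (%x. complex_of_real (S N x) + complex_of_real (a N x))"
   by (simp add: S_def)
  have "cls (%x. complex_of_real (S (Suc N) x)) = cls (%x. complex_of_real (S N x)) + cls (%x. complex_of_real (a N x))"
   unfolding eq using Suc aL by (simp add: cls_add)
  then show ?case using Suc aL an[of N] norm_triangle_ineq[of "cls (%x. complex_of_real (S N x))" "cls (%x. complex_of_real (a N x))"]
   unfolding eq by (auto intro: L2_add)
 qed
 have "(\<Sum>n<N. (1/2::real)^n) <= 2" for N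
  by (simp add: geometric_sum)
 then have SN: "norm (cls (%x. complex_of_real (S N x))) <= 2" for N using SL[of N] order_trans by blast
 have Sm [measurable]: "S N \<in> borel_measurable lebesgue" for N unfolding S_def by measurable
 have Spos: "0 <= S N x" for N x by (auto simp: S_def a_def intro: sum_nonneg)
 have "(\<integral>\<^sup>+x. (SUP N. ennreal ((S N x)\<^sup>2)) \<partial>lebesgue) = (SUP N. \<integral>\<^sup>+x. ennreal ((S N x)\<^sup>2) \<partial>lebesgue)"
 proof (rule nn_integral_monotone_convergence_SUP)
  show "incseq (%i x. ennreal ((S i x)\<^sup>2))"
   by (intro incseq_SucI le_funI ennreal_leI power_mono Spos) (simp add: S_def a_def)
 qed measurable
 also have "\<dots> <= 4"
 proof (rule SUP_least)
  fix N
  have "(\<integral>\<^sup>+x. ennreal ((S N x)\<^sup>2) \<partial>lebesgue) = ennreal ((norm (cls (%x. complex_of_real (S N x))))\<^sup>2)"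
   using nn_norm[OF SL[of N, THEN conjunct1]] by simp
  also have "\<dots> <= ennreal (2\<^sup>2)" by (intro ennreal_leI power_mono SN) auto
  finally show "(\<integral>\<^sup>+x. ennreal ((S N x)\<^sup>2) \<partial>lebesgue) <= 4" by simp
 qed
 finally have "(\<integral>\<^sup>+x. (SUP N. ennreal ((S N x)\<^sup>2)) \<partial>lebesgue) ~= \<infinity>" by (auto simp: top_unique)
 then have "AE x in lebesgue. (SUP N. ennreal ((S N x)\<^sup>2)) ~= \<infinity>"
  by (rule nn_integral_PInf_AE[rotated]) measurable
 then show ?thesis
 proof eventually_elim
  case (elim x)
  then obtain B where B: "0 <= B" "(SUP N. ennreal ((S N x)\<^sup>2)) = ennreal B"
   by (metis ennreal_cases infinity_ennreal_def)
  have "(S N x)\<^sup>2 <= B" for N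
  proof -
   have "ennreal ((S N x)\<^sup>2) <= ennreal B" unfolding B(2)[symmetric] by (rule SUP_upper) simp
   then show ?thesis using B(1) by simp
  qed
  then have "S N x <= sqrt B" for N by (simp add: real_le_rsqrt)
  then have "summable (%n. a n x)"
   unfolding S_def by (intro summableI_nonneg_bounded[of _ "sqrt B"]) (auto simp: a_def)
  then have "summable (%n. f (Suc n) x - f n x)" unfolding a_def by (rule summable_norm_cancel)
  then have "convergent (%n. \<Sum>i<n. f (Suc i) x - f i x)" by (simp add: summable_iff_convergent)
  moreover have "(%n. \<Sum>i<n. f (Suc i) x - f i x) = (%n. f n x - f 0 x)"
   by (rule ext) (rule sum_lessThan_telescope)
  ultimately have "convergent (%n. f n x - f 0 x)" by simp
  then have "convergent (%n. (f n x - f 0 x) + f 0 x)" by (intro convergent_add convergent_const)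
  then show ?case by simp
 qed
qed

lemma ell2_fatou:
 fixes f :: "nat => real^'n => complex"
 assumes f: "!!n. f n \<in> L2" and lim: "AE x in lebesgue. (%n. f n x) \<longlonglongrightarrow> g x" and g: "g \<in> borel_measurable lebesgue"
  and C: "eventually (%n. norm (cls (f n)) <= C) sequentially" and "0 <= C"
 shows "g \<in> L2" "norm (cls g) <= C"
proof -
 note [measurable] = L2D(1)[OF f] g
 have "(\<integral>\<^sup>+x. ennreal ((cmod (g x))\<^sup>2) \<partial>lebesgue) = (\<integral>\<^sup>+x. liminf (%n. ennreal ((cmod (f n x))\<^sup>2)) \<partial>lebesgue)"
 proof (rule nn_integral_cong_AE)
  show "AE x in lebesgue. ennreal ((cmod (g x))\<^sup>2) = liminf (%n. ennreal ((cmod (f n x))\<^sup>2))"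
   using lim
  proof eventually_elim
   case (elim x)
   have "(%n. ennreal ((cmod (f n x))\<^sup>2)) \<longlonglongrightarrow> ennreal ((cmod (g x))\<^sup>2)"
    by (intro tendsto_ennrealI tendsto_intros elim)
   then show ?case by (intro lim_imp_Liminf[symmetric]) auto
  qed
 qed
 also have "\<dots> <= liminf (%n. \<integral>\<^sup>+x. ennreal ((cmod (f n x))\<^sup>2) \<partial>lebesgue)"
  by (rule nn_integral_liminf) measurable
 also have "\<dots> = liminf (%n. ennreal ((norm (cls (f n)))\<^sup>2))" by (simp add: nn_norm f)
 also have "\<dots> <= liminf (%n. ennreal (C\<^sup>2))"
  by (rule Liminf_mono) (use C in eventually_elim, auto intro!: ennreal_leI power_mono)
 also have "\<dots> = ennreal (C\<^sup>2)" by (simp add: Liminf_const)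
 finally have *: "(\<integral>\<^sup>+x. ennreal ((cmod (g x))\<^sup>2) \<partial>lebesgue) <= ennreal (C\<^sup>2)" .
 then show gL: "g \<in> L2" using g by (auto simp: L2_nn_iff top_unique less_top[symmetric])
 show "norm (cls g) <= C"
  using * \<open>0 <= C\<close> by (simp add: nn_norm[OF gL]) 
qed

instance ell2 :: (finite) complete_space
proof
 fix X :: "nat => 'a ell2" assume X: "Cauchy X"
 have "EX M. \<forall>m\<ge>M. \<forall>n\<ge>M. dist (X m) (X n) < (1/2)^k" for k
  using metric_CauchyD[OF X, of "(1/2)^k"] by simp
 then obtain M where M: "!!k m n. m \<ge> M k ==> n \<ge> M k ==> dist (X m) (X n) < (1/2)^k" by metis
 \<comment> \<open>Sums of the M i dominate each single M i, so r is monotone and lies beyond every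
   threshold reached so far.\<close>
 define r where "r k = (\<Sum>i\<le>k. M i)" for k
 have rM1: "r k \<ge> M k" for k unfolding r_def by (rule member_le_sum) auto
 have rM2: "r (Suc k) \<ge> M k" for k using rM1[of k] by (simp add: r_def)
 define f where "f k = rep (X (r k))" for k
 have fL: "f k \<in> L2" and fc: "cls (f k) = X (r k)" for k by (simp_all add: f_def)
 note [measurable] = L2D(1)[OF fL]
 have "AE x in lebesgue. convergent (%n. f n x)"
  by (rule ell2_Cauchy_subseq[OF fL]) (use M[OF rM2 rM1] in \<open>auto simp: fc dist_norm less_imp_le\<close>)
 then have ae: "AE x in lebesgue. (%n. f n x) \<longlonglongrightarrow> lim (%n. f n x)"
  by eventually_elim (simp add: convergent_LIMSEQ_iff)
 have gm [measurable]: "(%x. lim (%n. f n x)) \<in> borel_measurable lebesgue"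
  by (rule borel_measurable_lim_metric) measurable
 define g where "g x = lim (%n. f n x)" for x
 have gm' [measurable]: "g \<in> borel_measurable lebesgue" unfolding g_def by measurable
 have est: "(%x. g x - rep (X m) x) \<in> L2 & norm (cls (%x. g x - rep (X m) x)) <= (1/2)^k" if m: "m \<ge> M k" for k m
 proof -
  have "eventually (%n. norm (cls (%x. f n x - rep (X m) x)) <= (1/2)^k) sequentially"
   using eventually_ge_at_top[of k]
  proof eventually_elim
   case (elim n)
   have "M k <= r n" unfolding r_def using elim by (intro member_le_sum) auto
   then have "dist (X (r n)) (X m) < (1/2)^k" using M m by blast
   moreover have "cls (%x. f n x - rep (X m) x) = X (r n) - X m"
    using cls_diff[OF fL rep_L2, of n "X m"] by (simp add: fc)
   ultimately show ?case by (simp add: dist_norm)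
  qed
  moreover have "AE x in lebesgue. (%n. f n x - rep (X m) x) \<longlonglongrightarrow> g x - rep (X m) x"
   using ae unfolding g_def by eventually_elim (intro tendsto_intros)
  moreover have "(%x. g x - rep (X m) x) \<in> borel_measurable lebesgue"
   by (intro borel_measurable_diff gm' L2D(1) rep_L2)
  moreover have "(%x. f n x - rep (X m) x) \<in> L2" for n by (intro L2_diff fL rep_L2)
  ultimately show ?thesis
   using ell2_fatou[of "%n x. f n x - rep (X m) x" "%x. g x - rep (X m) x" "(1/2)^k"] by auto
 qed
 have gL: "g \<in> L2"
  using L2_add[OF est[OF order_refl, THEN conjunct1, of 0] rep_L2[of "X (M 0)"]] by simp
 have "X \<longlonglongrightarrow> cls g"
 proof (rule metric_LIMSEQ_I)
  fix e :: real assume "e > 0"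
  then obtain k where k: "(1/2)^k < e" using real_arch_pow_inv[of e "1/2"] by auto
  have "dist (X m) (cls g) < e" if "m \<ge> M k" for m
  proof -
   have "cls (%x. g x - rep (X m) x) = cls g - X m" using cls_diff[OF gL rep_L2, of "X m"] by simp
   then show ?thesis using est[OF that] k by (simp add: dist_norm norm_minus_commute)
  qed
  then show "EX no. \<forall>n\<ge>no. dist (X n) (cls g) < e" by (intro exI[of _ "M k"]) simp
 qed
 then show "convergent X" by (auto simp: convergent_def)
qed

section \<open>Smooth bump functions\<close>

text \<open>Continuity of the k-th derivative is supplied by level k + 1; the notion is meant for
  all k together, as in \<open>smooth\<close>.\<close>

primrec Cdiff :: "nat => (real => real) => bool" where
 "Cdiff 0 f \<longleftrightarrow> True"
| "Cdiff (Suc k) f \<longleftrightarrow> (\<exists>f'. (ALL x. (f has_real_derivative f' x) (at x)) & Cdiff k f')"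

lemma Cdiff_mono: "Cdiff (Suc k) f ==> Cdiff k f"
proof (induction k arbitrary: f)
 case (Suc k)
 then obtain f' where "ALL x. (f has_real_derivative f' x) (at x)" "Cdiff (Suc k) f'"
  unfolding Cdiff.simps(2)[of "Suc k"] by blast
 then show ?case using Suc.IH[of f'] by auto
qed simp

lemma Cdiff_add: "Cdiff k f ==> Cdiff k g ==> Cdiff k (%x. f x + g x)"
proof (induction k arbitrary: f g)
 case (Suc k)
 then obtain f' g' where "ALL x. (f has_real_derivative f' x) (at x)" "Cdiff k f'"
  "ALL x. (g has_real_derivative g' x) (at x)" "Cdiff k g'" by auto
 then show ?case using Suc.IH[of f' g'] by (auto intro!: exI[of _ "%x. f' x + g' x"] derivative_intros)
qed simp

lemma Cdiff_mult: "Cdiff k f ==> Cdiff k g ==> Cdiff k (%x. f x * g x)"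
proof (induction k arbitrary: f g)
 case (Suc k)
 then obtain f' g' where fg: "ALL x. (f has_real_derivative f' x) (at x)" "Cdiff k f'"
  "ALL x. (g has_real_derivative g' x) (at x)" "Cdiff k g'" by auto
 have "Cdiff k (%x. f' x * g x + g' x * f x)"
  using fg Suc.IH Cdiff_mono[OF Suc.prems(1)] Cdiff_mono[OF Suc.prems(2)] by (intro Cdiff_add) auto
 then show ?case using fg by (auto intro!: exI[of _ "%x. f' x * g x + g' x * f x"] DERIV_mult)
qed simp

lemma Cdiff_affine: "Cdiff k f ==> Cdiff k (%x. f (c * x + d))"
proof (induction k arbitrary: f)
 case (Suc k)
 then obtain f' where f': "ALL x. (f has_real_derivative f' x) (at x)" "Cdiff k f'" by auto
 have "Cdiff k (%x. c)" for c by (induction k arbitrary: c) (auto intro!: exI[of _ "%_. 0"])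
 then have "Cdiff k (%x. f' (c * x + d) * c)" using Suc.IH[OF f'(2)] by (intro Cdiff_mult)
 moreover have "((%x. f (c * x + d)) has_real_derivative f' (c * x + d) * c) (at x)" for x
  by (rule DERIV_chain2[of f]) (use f' in \<open>auto intro!: derivative_eq_intros\<close>)
 ultimately show ?case by (auto intro!: exI[of _ "%x. f' (c * x + d) * c"])
qed simp

definition smooth :: "(real => real) => bool" where "smooth f \<longleftrightarrow> (ALL k. Cdiff k f)"

lemma smooth_mult: "smooth f ==> smooth g ==> smooth (%x. f x * g x)"
 by (simp add: smooth_def Cdiff_mult)

lemma smooth_affine: "smooth f ==> smooth (%x. f (c * x + d))"
 by (simp add: smooth_def Cdiff_affine)

lemma smooth_DERIV: assumes "smooth f" shows "(f has_real_derivative deriv f x) (at x)"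
proof -
 have "Cdiff (Suc 0) f" using assms by (simp only: smooth_def)
 then obtain f' where f': "(f has_real_derivative f' x) (at x)" by auto
 then show ?thesis using DERIV_imp_deriv[OF f'] by simp
qed

lemma smooth_deriv: assumes "smooth f" shows "smooth (deriv f)"
 unfolding smooth_def
proof
 fix k
 have "Cdiff (Suc k) f" using assms by (simp only: smooth_def)
 then obtain f' where f': "!!x. (f has_real_derivative f' x) (at x)" "Cdiff k f'" by auto
 have "deriv f = f'" using f'(1) by (intro ext DERIV_imp_deriv)
 then show "Cdiff k (deriv f)" using f'(2) by simp
qed

text \<open>The classical exp(-1/x), extended by 0. The polynomial factor in 1/x makes the family
  closed under differentiation.\<close>

definition ebump :: "real poly => real => real" where
 "ebump p x = (if x > 0 then poly p (1 / x) * exp (- (1 / x)) else 0)"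

lemma poly_exp_0: "((%x. poly p x * exp (- x)) \<longlongrightarrow> (0::real)) at_top"
proof -
 have "((%x. \<Sum>i\<le>degree p. coeff p i * (x ^ i / exp x)) \<longlongrightarrow> (\<Sum>i\<le>degree p. coeff p i * 0)) at_top"
  by (intro tendsto_intros tendsto_power_div_exp_0)
 then show ?thesis by (simp add: poly_altdef exp_minus field_simps sum_distrib_left sum_distrib_right sum_divide_distrib)
qed

text \<open>With y = 1/x, differentiating p(y) exp(-y) in x produces the factor y^2 and p - p'. At 0
  the exponential beats every polynomial in 1/h, including the extra factor 1/h of the difference
  quotient.\<close>

lemma ebump_DERIV: "(ebump p has_real_derivative ebump ([:0, 0, 1:] * (p - pderiv p)) x) (at x)"
proof (cases "x = 0")
 case False
 show ?thesis
 proof (cases "x > 0")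
  case True
  have "((%x. poly p (1 / x) * exp (- (1 / x))) has_real_derivative
    poly ([:0, 0, 1:] * (p - pderiv p)) (1 / x) * exp (- (1 / x))) (at x)"
   using True by (auto intro!: derivative_eq_intros DERIV_chain2[OF poly_DERIV] simp: field_simps power2_eq_square)
  then have "(ebump p has_real_derivative poly ([:0, 0, 1:] * (p - pderiv p)) (1 / x) * exp (- (1 / x))) (at x)"
   by (rule has_field_derivative_transform_within_open[of _ _ _ "{0<..}"]) (use True in \<open>auto simp: ebump_def\<close>)
  then show ?thesis using True by (simp add: ebump_def)
 next
  case f: False
  have "((%x. 0) has_real_derivative 0) (at x)" by simp
  then have "(ebump p has_real_derivative 0) (at x)"
   by (rule has_field_derivative_transform_within_open[of _ _ _ "{..<0}"]) (use f False in \<open>auto simp: ebump_def\<close>)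
  then show ?thesis using f by (simp add: ebump_def)
 qed
next
 case True
 have "((%h. ebump p h / h) \<longlongrightarrow> 0) (at 0)"
 proof (rule filterlim_split_at)
  have "eventually (%h. 0 = ebump p h / h) (at_left (0::real))"
   unfolding eventually_at_filter by (intro always_eventually) (auto simp: ebump_def)
  then show "((%h. ebump p h / h) \<longlongrightarrow> 0) (at_left 0)"
   by (rule Lim_transform_eventually[OF tendsto_const])
 next
  have lim: "((%h. poly (pCons 0 p) (inverse h) * exp (- inverse h)) \<longlongrightarrow> 0) (at_right (0::real))"
   by (rule filterlim_compose[OF poly_exp_0 filterlim_inverse_at_top_right])
  have "eventually (%h. poly (pCons 0 p) (inverse h) * exp (- inverse h) = ebump p h / h) (at_right (0::real))"
   unfolding eventually_at_filter
   by (intro always_eventually) (auto simp: ebump_def field_simps)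
  then show "((%h. ebump p h / h) \<longlongrightarrow> 0) (at_right 0)"
   by (rule Lim_transform_eventually[OF lim])
 qed
 then show ?thesis unfolding True by (simp add: DERIV_def ebump_def)
qed

lemma smooth_ebump: "smooth (ebump p)"
proof -
 have "Cdiff k (ebump p)" for k
 proof (induction k arbitrary: p)
  case (Suc k)
  then show ?case using ebump_DERIV[of p] by auto
 qed simp
 then show ?thesis by (simp add: smooth_def)
qed

text \<open>Where positive this is exp(-1/(n (t - a))) exp(-1/(n (b - t))); the exponents tend to 0
  as n grows, so the indicator of the open interval is reached pointwise and boundedly.\<close>

definition bump :: "nat => real => real => real => real" where
 "bump n a b t = ebump 1 (real n * t + (- real n * a)) * ebump 1 ((- real n) * t + real n * b)"

lemma smooth_bump: "smooth (bump n a b)"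
 unfolding bump_def by (intro smooth_mult smooth_affine smooth_ebump)

lemma bump_bounds: "0 <= bump n a b t" "bump n a b t <= 1"
 by (auto simp: bump_def ebump_def intro!: mult_le_one)

lemma bump_eq_0: assumes "\<not> (a < t & t < b)" shows "bump n a b t = 0"
proof -
 have "real n * t + (- real n * a) <= 0 \<or> (- real n) * t + real n * b <= 0"
  using assms by (auto simp: not_less intro: mult_left_mono)
 then show ?thesis by (auto simp: bump_def ebump_def)
qed

lemma bump_tendsto: "(%n. bump n a b t) \<longlonglongrightarrow> indicator {a<..<b} t"
proof (cases "a < t & t < b")
 case True
 have e: "(%n. exp (- (1 / (real n * c)))) \<longlonglongrightarrow> 1" if "c > 0" for c :: real
 proof -
  have "(%n. exp (- (1 / c * (1 / real n)))) \<longlonglongrightarrow> exp (- (1 / c * 0))"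
   by (intro tendsto_intros lim_1_over_n)
  then show ?thesis by (simp add: mult.commute)
 qed
 have "(%n. exp (- (1 / (real n * (t - a)))) * exp (- (1 / (real n * (b - t))))) \<longlonglongrightarrow> 1 * 1"
  by (intro tendsto_mult e) (use True in auto)
 moreover have "eventually (%n. exp (- (1 / (real n * (t - a)))) * exp (- (1 / (real n * (b - t)))) = bump n a b t) sequentially"
  using eventually_gt_at_top[of 0]
 proof eventually_elim
  case (elim n)
  have "real n * t + (- real n * a) = real n * (t - a)" "(- real n) * t + real n * b = real n * (b - t)"
   by (simp_all add: algebra_simps)
  then show ?case using True elim by (simp only: bump_def) (simp add: ebump_def)
 qed
 ultimately have "(%n. bump n a b t) \<longlonglongrightarrow> 1 * 1" by (rule Lim_transform_eventually)
 then show ?thesis using True by simp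
next
 case False
 then have "bump n a b t = 0" for n by (rule bump_eq_0)
 moreover have "indicator {a<..<b} t = (0::real)" using False by (auto simp: indicator_def)
 ultimately show ?thesis by simp
qed

text \<open>Tensor products are a sufficient supply of test functions: their partial derivatives
  have the same shape, and products of bumps approximate indicators of boxes. The constant
  \<open>c\<close> puts complex multiples into the real span.\<close>

definition tprod :: "complex => ('n::finite => real => real) => real^'n => complex" where
 "tprod c F x = c * complex_of_real (\<Prod>j\<in>UNIV. F j (x $ j))"

definition tfam :: "('n::finite => real => real) => bool" where
 "tfam F \<longleftrightarrow> (ALL j. smooth (F j)) & (EX R. ALL j t. R < \<bar>t\<bar> --> F j t = 0)"

lemma tfam_bump: "tfam (%j. bump n (a $ j) (b $ j))"
 unfolding tfam_def
proof (intro conjI allI smooth_bump exI impI)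
 fix j t assume "norm a + norm b < \<bar>t\<bar>"
 then have "\<bar>a $ j\<bar> + \<bar>b $ j\<bar> < \<bar>t\<bar>" using component_le_norm_cart[of a j] component_le_norm_cart[of b j] by linarith
 then show "bump n (a $ j) (b $ j) t = 0" by (intro bump_eq_0) auto
qed

lemma tfam_deriv: assumes "tfam F" shows "tfam (F(j := deriv (F j)))"
proof -
 obtain R where R: "!!j t. R < \<bar>t\<bar> ==> F j t = 0" using assms by (auto simp: tfam_def)
 have "deriv (F j) t = 0" if t: "R < \<bar>t\<bar>" for t
 proof -
  have "open {t. R < \<bar>t::real\<bar>}" by (intro open_Collect_less continuous_intros)
  have "((%_. 0) has_real_derivative 0) (at t)" by simp
  then have "(F j has_real_derivative 0) (at t)"
   by (rule has_field_derivative_transform_within_open[of _ _ _ "{t. R < \<bar>t\<bar>}"]) (use t R \<open>open _\<close> in auto)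
  then show ?thesis by (rule DERIV_imp_deriv)
 qed
 then show ?thesis using assms R smooth_deriv[of "F j"] by (auto simp: tfam_def)
qed

lemma tprod_has_derivative:
 assumes "tfam F"
 shows "(tprod c F has_derivative (%v. c * complex_of_real (\<Sum>j\<in>UNIV. deriv (F j) (x $ j) * v $ j * (\<Prod>i\<in>UNIV - {j}. F i (x $ i))))) (at x)"
proof -
 have "((%x. F j (x $ j)) has_derivative (%v. deriv (F j) (x $ j) * v $ j)) (at x)" for j
 proof -
  have "(F j has_derivative (%t. deriv (F j) (x $ j) * t)) (at (x $ j))"
   using smooth_DERIV[of "F j" "x $ j"] assms by (simp add: tfam_def has_field_derivative_def)
  moreover have "((%x. x $ j) has_derivative (%v. v $ j)) (at x)"
   by (rule bounded_linear_imp_has_derivative[OF bounded_linear_vec_nth])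
  ultimately show ?thesis using has_derivative_compose by fastforce
 qed
 then have "((%x. \<Prod>j\<in>UNIV. F j (x $ j)) has_derivative (%v. \<Sum>j\<in>UNIV. deriv (F j) (x $ j) * v $ j * (\<Prod>i\<in>UNIV - {j}. F i (x $ i)))) (at x)"
  by (rule has_derivative_prod)
 then show ?thesis
  unfolding tprod_def[abs_def] by (intro has_derivative_mult_right has_derivative_of_real)
qed

lemma pderiv_tprod:
 fixes F :: "'n::finite => real => real"
 assumes "tfam F" shows "pderiv_at j (tprod c F) = tprod c (F(j := deriv (F j)))"
proof
 fix x :: "real^'n"
 have "pderiv_at j (tprod c F) x = c * complex_of_real (\<Sum>k\<in>UNIV. deriv (F k) (x $ k) * axis j 1 $ k * (\<Prod>i\<in>UNIV - {k}. F i (x $ i)))"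
  unfolding pderiv_at_def frechet_derivative_at[OF tprod_has_derivative[OF assms], symmetric] ..
 also have "(\<Sum>k\<in>UNIV. deriv (F k) (x $ k) * axis j 1 $ k * (\<Prod>i\<in>UNIV - {k}. F i (x $ i)))
   = (\<Sum>k\<in>UNIV. if k = j then deriv (F j) (x $ j) * (\<Prod>i\<in>UNIV - {j}. F i (x $ i)) else 0)"
  by (rule sum.cong) (auto simp: axis_def)
 also have "\<dots> = deriv (F j) (x $ j) * (\<Prod>i\<in>UNIV - {j}. F i (x $ i))" by simp
 also have "\<dots> = (\<Prod>i\<in>UNIV. (F(j := deriv (F j))) i (x $ i))"
  by (subst (2) prod.remove[of _ j]) (auto intro!: prod.cong)
 finally show "pderiv_at j (tprod c F) x = tprod c (F(j := deriv (F j))) x"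
  unfolding tprod_def[of c "F(j := deriv (F j))"] .
qed

lemma tprod_test:
 fixes F :: "'n::finite => real => real"
 assumes "tfam F" shows "tprod c F \<in> test_functions"
proof -
 have "C_k k (tprod c F)" if "tfam F" for k and F :: "'n => real => real"
  using that
 proof (induction k arbitrary: F)
  case 0
  then have "tprod c F differentiable_on UNIV"
   using tprod_has_derivative unfolding differentiable_on_def differentiable_def by blast
  then show ?case by (simp add: differentiable_imp_continuous_on)
 next
  case (Suc k)
  show ?case unfolding C_k.simps
  proof (intro conjI allI)
   show "tprod c F differentiable at x" for x
    unfolding differentiable_def using tprod_has_derivative[OF Suc.prems] by blast
   show "C_k k (pderiv_at j (tprod c F))" for j
    unfolding pderiv_tprod[OF Suc.prems] by (rule Suc.IH[OF tfam_deriv[OF Suc.prems]])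
  qed
 qed
 moreover have "compact (closure {x. tprod c F x ~= 0})"
 proof -
  obtain R where R: "!!j t. R < \<bar>t\<bar> ==> F j t = 0" using assms by (auto simp: tfam_def)
  have "{x. tprod c F x ~= 0} \<subseteq> cbox (\<chi> j. - R) (\<chi> j. R)"
  proof
   fix x assume "x \<in> {x. tprod c F x ~= 0}"
   then have "F j (x $ j) ~= 0" for j by (auto simp: tprod_def)
   then have "\<bar>x $ j\<bar> <= R" for j using R[of "x $ j" j] by force
   then show "x \<in> cbox (\<chi> j. - R) (\<chi> j. R)" by (auto simp: mem_box_cart abs_le_iff) (smt (verit))
  qed
  then have "bounded {x. tprod c F x ~= 0}" using bounded_cbox bounded_subset by blast
  then show ?thesis by (simp add: bounded_closure compact_eq_bounded_closed)
 qed
 ultimately show ?thesis using assms by (simp add: test_functions_def)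
qed

section \<open>The fundamental lemma of the calculus of variations\<close>

text \<open>Boxes are an intersection-stable generator, so the integrals over all Borel sets vanish;
  the total integral, required for complements, is a limit over growing boxes.\<close>

lemma AE_zero_if_box_integrals_zero:
 fixes h :: "'a::euclidean_space => real"
 assumes h: "integrable lebesgue h" and box: "!!a b. (\<integral>x. indicator (box a b) x * h x \<partial>lebesgue) = 0"
 shows "AE x in lebesgue. h x = 0"
proof -
 obtain h' where h'm [measurable]: "h' \<in> borel_measurable lborel" and ae: "AE x in lborel. h x = h' x"
  using completion_ex_borel_measurable_real[OF borel_measurable_integrable[OF h]] by auto
 have ae': "AE x in lebesgue. h x = h' x" using ae by (rule AE_completion)
 have h'i: "integrable lborel h'"
 proof -
  have "integrable lebesgue h'"
   by (subst integrable_cong_AE[of _ _ h]) (use h ae' measurable_completion[OF h'm] borel_measurable_integrable[OF h] in \<open>auto elim: eventually_mono\<close>)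
  then show ?thesis by (simp add: integrable_completion)
 qed
 have I: "(\<integral>x. indicator A x * h' x \<partial>lborel) = (\<integral>x. indicator A x * h x \<partial>lebesgue)" if A [measurable]: "A \<in> sets borel" for A
 proof -
  have "(\<integral>x. indicator A x * h' x \<partial>lborel) = (\<integral>x. indicator A x * h' x \<partial>lebesgue)"
   by (rule integral_completion[symmetric]) measurable
  also have "\<dots> = (\<integral>x. indicator A x * h x \<partial>lebesgue)"
  proof (rule integral_cong_AE)
   show "AE x in lebesgue. indicator A x * h' x = indicator A x * h x" using ae' by eventually_elim simp
   show "(%x. indicator A x * h' x) \<in> borel_measurable lebesgue" by (rule measurable_completion) measurable
   show "(%x. indicator A x * h x) \<in> borel_measurable lebesgue"
    using borel_measurable_integrable[OF h] A by (intro borel_measurable_times borel_measurable_indicator) auto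
  qed
  finally show ?thesis .
 qed
 have int: "integrable lborel (%x. indicator A x * h' x)" if A: "A \<in> sets borel" for A
  using integrable_mult_indicator[OF _ h'i, of A] A by simp
 have "(%n. \<integral>x. indicator (box (- real n *\<^sub>R One) (real n *\<^sub>R One)) x * h' x \<partial>lborel) \<longlonglongrightarrow> (\<integral>x. h' x \<partial>lborel)"
 proof (rule integral_dominated_convergence[where w="%x. \<bar>h' x\<bar>"])
  show "AE x in lborel. (%n. indicator (box (- real n *\<^sub>R One) (real n *\<^sub>R One)) x * h' x) \<longlonglongrightarrow> h' x"
  proof (rule AE_I2)
   fix x :: 'a
   obtain N :: nat where N: "norm x < real N" using reals_Archimedean2 by blast
   have "x \<in> box (- real n *\<^sub>R One) (real n *\<^sub>R One)" if "n \<ge> N" for n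
   proof -
    have "\<bar>x \<bullet> i\<bar> < real n" if "i \<in> Basis" for i
     using Basis_le_norm[OF that, of x] N \<open>n \<ge> N\<close> by linarith
    then show ?thesis by (auto simp: mem_box abs_less_iff) (smt (verit))+
   qed
   then have "eventually (%n. indicator (box (- real n *\<^sub>R One) (real n *\<^sub>R One)) x * h' x = h' x) sequentially"
    by (auto simp: eventually_sequentially intro!: exI[of _ N])
   then show "(%n. indicator (box (- real n *\<^sub>R One) (real n *\<^sub>R One)) x * h' x) \<longlonglongrightarrow> h' x"
    by (rule tendsto_eventually)
  qed
 qed (use h'i in \<open>auto simp: indicator_def\<close>)
 then have tot: "(\<integral>x. h' x \<partial>lborel) = 0" using I box by (simp add: LIMSEQ_const_iff)
 have zero: "(\<integral>x. indicator A x * h' x \<partial>lborel) = 0" if A: "A \<in> sets borel" for A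
 proof -
  let ?G = "range (%(a, b). box a b :: 'a set)"
  have st: "Int_stable ?G"
   unfolding Int_stable_def
  proof (intro ballI)
   fix X Y assume "X \<in> ?G" "Y \<in> ?G"
   then obtain a b c d where XY: "X = box a b" "Y = box c d" by auto
   show "X \<inter> Y \<in> ?G" unfolding XY box_Int_box by blast
  qed
  have sub: "?G \<subseteq> Pow UNIV" by simp
  have "A \<in> sigma_sets UNIV ?G" using A by (simp add: borel_eq_box)
  with st sub show ?thesis
  proof (induction rule: sigma_sets_induct_disjoint)
   case (basic A)
   then obtain a b where "A = box a b" by auto
   then show ?case using I[of A] box by simp
  next
   case empty then show ?case by simp
  next
   case (compl A)
   have Ab: "A \<in> sets borel" using compl(1) by (simp add: borel_eq_box)
   have "(%x. indicator (UNIV - A) x * h' x) = (%x. h' x - indicator A x * h' x)"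
    by (auto simp: indicator_def)
   then show ?case using h'i int[OF Ab] compl(2) tot by simp
  next
   case (union A)
   have Ab: "A i \<in> sets borel" for i using union(2) by (auto simp: borel_eq_box)
   have "(%n. \<integral>x. indicator (\<Union>i<n. A i) x * h' x \<partial>lborel) \<longlonglongrightarrow> (\<integral>x. indicator (\<Union>i. A i) x * h' x \<partial>lborel)"
   proof (rule integral_dominated_convergence[where w="%x. \<bar>h' x\<bar>"])
    show "AE x in lborel. (%n. indicator (\<Union>i<n. A i) x * h' x) \<longlonglongrightarrow> indicator (\<Union>i. A i) x * h' x"
     by (intro AE_I2 tendsto_mult LIMSEQ_indicator_UN tendsto_const)
    show "(%x. indicator (\<Union>i. A i) x * h' x) \<in> borel_measurable lborel"
     using Ab by (intro borel_measurable_times borel_measurable_indicator h'm) auto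
    show "(%x. indicator (\<Union>i<n. A i) x * h' x) \<in> borel_measurable lborel" for n
     using Ab by (intro borel_measurable_times borel_measurable_indicator h'm) auto
   qed (use h'i in \<open>auto simp: indicator_def\<close>)
   moreover have "(\<integral>x. indicator (\<Union>i<n. A i) x * h' x \<partial>lborel) = 0" for n
   proof -
    have "indicator (\<Union>i<n. A i) x * h' x = (\<Sum>i<n. indicator (A i) x * h' x)" for x
     by (subst indicator_UN_disjoint) (use union(1) in \<open>auto intro: disjoint_family_on_mono simp: sum_distrib_right\<close>)
    then have "(\<integral>x. indicator (\<Union>i<n. A i) x * h' x \<partial>lborel) = (\<integral>x. (\<Sum>i<n. indicator (A i) x * h' x) \<partial>lborel)"
     by (simp only:)
    also have "\<dots> = (\<Sum>i<n. \<integral>x. indicator (A i) x * h' x \<partial>lborel)"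
     by (rule Bochner_Integration.integral_sum) (rule int[OF Ab])
    finally show ?thesis by (simp add: union)
   qed
   ultimately show ?case by (simp add: LIMSEQ_const_iff)
  qed
 qed
 have "AE x in lborel. h' x = 0"
  by (rule sigma_finite_measure.density_zero[OF sigma_finite_lborel h'i]) (use zero in \<open>auto simp: set_lebesgue_integral_def\<close>)
 then have "AE x in lebesgue. h' x = 0" by (rule AE_completion)
 with ae' show ?thesis by eventually_elim simp
qed

text \<open>Products of bumps converge boundedly to indicators of boxes, so all box integrals of g
  vanish. As g is only locally integrable, the conclusion is drawn on one box at a time.\<close>

lemma test_functions_separate:
 fixes g :: "real^'n => complex"
 assumes g: "locally_integrable g" and z: "!!F. tfam F ==> (\<integral>x. g x * tprod 1 F x \<partial>lebesgue) = 0"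
 shows "AE x in lebesgue. g x = 0"
proof -
 have gi: "integrable lebesgue (%x. indicator (cbox a b) x *\<^sub>R g x)" for a b
  using g unfolding locally_integrable_def set_integrable_def by auto
 have bz: "(\<integral>x. indicator (box a b) x *\<^sub>R g x \<partial>lebesgue) = 0" for a b :: "real^'n"
 proof -
  let ?F = "%n j. bump n (a $ j) (b $ j)"
  have lim: "(%n. tprod 1 (?F n) x) \<longlonglongrightarrow> indicator (box a b) x" for x
  proof -
   have "(%n. \<Prod>j\<in>UNIV. bump n (a $ j) (b $ j) (x $ j)) \<longlonglongrightarrow> (\<Prod>j\<in>UNIV. indicator {a $ j<..<b $ j} (x $ j))"
    by (intro tendsto_prod bump_tendsto)
   also have "(\<Prod>j\<in>UNIV. indicator {a $ j<..<b $ j} (x $ j)) = (indicator (box a b) x :: real)"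
    by (auto simp: indicator_def mem_box_cart prod_zero_iff intro!: prod.neutral)
   finally have "(%n. complex_of_real (\<Prod>j\<in>UNIV. bump n (a $ j) (b $ j) (x $ j))) \<longlonglongrightarrow> complex_of_real (indicator (box a b) x)"
    by (rule tendsto_of_real)
   moreover have "complex_of_real (indicator (box a b) x) = indicator (box a b) x" by (simp add: indicator_def)
   ultimately show ?thesis unfolding tprod_def mult_1 by (simp only:)
  qed
  have b1: "cmod (tprod 1 (?F n) x) <= indicator (cbox a b) x" for n x
  proof (cases "x \<in> cbox a b")
   case True
   have "(\<Prod>j\<in>UNIV. bump n (a $ j) (b $ j) (x $ j)) <= 1" by (intro prod_le_1 conjI bump_bounds)
   moreover have "0 <= (\<Prod>j\<in>UNIV. bump n (a $ j) (b $ j) (x $ j))" by (intro prod_nonneg ballI bump_bounds)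
   ultimately show ?thesis using True by (simp add: tprod_def del: of_real_prod)
  next
   case False
   then obtain j where "\<not> (a $ j <= x $ j & x $ j <= b $ j)" by (auto simp: mem_box_cart)
   then have "\<not> (a $ j < x $ j & x $ j < b $ j)" by auto
   then have "bump n (a $ j) (b $ j) (x $ j) = 0" by (rule bump_eq_0)
   then have p0: "(\<Prod>j\<in>UNIV. bump n (a $ j) (b $ j) (x $ j)) = 0" by (intro prod_zero) auto
   show ?thesis unfolding tprod_def p0 by simp
  qed
  have gc: "(%x. g x * tprod 1 (?F n) x) = (%x. indicator (cbox a b) x *\<^sub>R g x * tprod 1 (?F n) x)" for n
  proof -
   have "tprod 1 (?F n) x = 0" if "x \<notin> cbox a b" for x using b1[of n x] that by (simp add: indicator_def)
   then show ?thesis by (auto simp: fun_eq_iff indicator_def)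
  qed
  have tm: "tprod 1 (?F n) \<in> borel_measurable lebesgue" for n
  proof -
   have "tprod 1 (?F n) differentiable_on UNIV"
    using tprod_has_derivative[OF tfam_bump] unfolding differentiable_on_def differentiable_def by blast
   then have "continuous_on UNIV (tprod 1 (?F n))" by (rule differentiable_imp_continuous_on)
   then show ?thesis by (intro measurable_completion) (simp add: borel_measurable_continuous_onI)
  qed
  have "(%n. \<integral>x. indicator (cbox a b) x *\<^sub>R g x * tprod 1 (?F n) x \<partial>lebesgue) \<longlonglongrightarrow>
    (\<integral>x. indicator (cbox a b) x *\<^sub>R g x * indicator (box a b) x \<partial>lebesgue)"
  proof (rule integral_dominated_convergence[where w="%x. norm (indicator (cbox a b) x *\<^sub>R g x)"])
   show "AE x in lebesgue. (%n. indicator (cbox a b) x *\<^sub>R g x * tprod 1 (?F n) x) \<longlonglongrightarrow> indicator (cbox a b) x *\<^sub>R g x * indicator (box a b) x"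
    by (intro AE_I2 tendsto_mult lim tendsto_const)
   show "AE x in lebesgue. norm (indicator (cbox a b) x *\<^sub>R g x * tprod 1 (?F n) x) <= norm (indicator (cbox a b) x *\<^sub>R g x)" for n
   proof (rule AE_I2)
    fix x
    have "cmod (tprod 1 (?F n) x) <= 1" using b1[of n x] by (rule order_trans) (simp add: indicator_def)
    then show "norm (indicator (cbox a b) x *\<^sub>R g x * tprod 1 (?F n) x) <= norm (indicator (cbox a b) x *\<^sub>R g x)"
     unfolding norm_mult by (rule mult_left_le) simp
   qed
   show "integrable lebesgue (%x. norm (indicator (cbox a b) x *\<^sub>R g x))" by (rule integrable_norm[OF gi])
   show "(%x. indicator (cbox a b) x *\<^sub>R g x * tprod 1 (?F n) x) \<in> borel_measurable lebesgue" for n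
    by (intro borel_measurable_times borel_measurable_integrable[OF gi] tm)
   show "(%x. indicator (cbox a b) x *\<^sub>R g x * indicator (box a b) x) \<in> borel_measurable lebesgue"
    by (intro borel_measurable_times borel_measurable_integrable[OF gi] borel_measurable_indicator) auto
  qed
  moreover have "(\<integral>x. indicator (cbox a b) x *\<^sub>R g x * tprod 1 (?F n) x \<partial>lebesgue) = 0" for n
   using z[OF tfam_bump, of n a b] by (simp only: gc)
  ultimately have "(\<integral>x. indicator (cbox a b) x *\<^sub>R g x * indicator (box a b) x \<partial>lebesgue) = 0"
   by (simp only: LIMSEQ_const_iff)
  moreover have "indicator (cbox a b) x *\<^sub>R g x * indicator (box a b) x = indicator (box a b) x *\<^sub>R g x" for x
   using box_subset_cbox[of a b] by (auto simp: indicator_def)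
  ultimately show ?thesis by (simp only:)
 qed
 have local: "AE x in lebesgue. x \<in> box c d --> g x = 0" for c d
 proof -
  define h where "h x = indicator (box c d) x *\<^sub>R g x" for x
  have hi: "integrable lebesgue h"
  proof -
   have "h = (%x. indicator (box c d) x *\<^sub>R (indicator (cbox c d) x *\<^sub>R g x))"
    using box_subset_cbox[of c d] by (auto simp: h_def indicator_def fun_eq_iff)
   then show ?thesis using integrable_mult_indicator[OF _ gi, of "box c d" c d] by simp
  qed
  have hz: "(\<integral>x. indicator (box a b) x *\<^sub>R h x \<partial>lebesgue) = 0" for a b
  proof -
   obtain u v where "box a b \<inter> box c d = box u v" using box_Int_box by blast
   then have "indicator (box a b) x *\<^sub>R h x = indicator (box u v) x *\<^sub>R g x" for x
    by (auto simp: h_def indicator_def)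
   then show ?thesis using bz[of u v] by simp
  qed
  have hzi: "integrable lebesgue (%x. indicator (box a b) x *\<^sub>R h x)" for a b
   by (rule integrable_mult_indicator[OF _ hi]) auto
  have "AE x in lebesgue. Re (h x) = 0"
  proof (rule AE_zero_if_box_integrals_zero)
   show "(\<integral>x. indicator (box a b) x * Re (h x) \<partial>lebesgue) = 0" for a b
    using integral_Re[OF hzi[of a b]] hz[of a b] by simp
  qed (use hi in auto)
  moreover have "AE x in lebesgue. Im (h x) = 0"
  proof (rule AE_zero_if_box_integrals_zero)
   show "(\<integral>x. indicator (box a b) x * Im (h x) \<partial>lebesgue) = 0" for a b
    using integral_Im[OF hzi[of a b]] hz[of a b] by simp
  qed (use hi in auto)
  ultimately show ?thesis
   by eventually_elim (auto simp: h_def complex_eq_iff)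
 qed
 have "AE x in lebesgue. \<forall>n::nat. x \<in> box (\<chi> j. - real n) (\<chi> j. real n) --> g x = 0"
  unfolding AE_all_countable using local by (intro allI)
 then show ?thesis
 proof eventually_elim
  case (elim x)
  obtain N :: nat where N: "norm x < real N" using reals_Archimedean2 by blast
  have "\<bar>x $ j\<bar> < real N" for j using component_le_norm_cart[of x j] N by linarith
  then have "x \<in> box (\<chi> j. - real N) (\<chi> j. real N)" by (auto simp: mem_box_cart abs_less_iff) (smt (verit))
  then show ?case using elim by blast
 qed
qed

section \<open>Translations on the Hilbert space\<close>

lemma lebesgue_translate:
 fixes c :: "'a::euclidean_space"
 shows "distr lebesgue lebesgue (%x. x + c) = lebesgue" and "(%x. x + c) \<in> lebesgue \<rightarrow>\<^sub>M lebesgue"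
proof -
 have T: "(%x. c + (\<Sum>j\<in>Basis. (1 * (x \<bullet> j)) *\<^sub>R j)) = (%x. x + c)"
  by (auto simp: euclidean_representation)
 show "(%x. x + c) \<in> lebesgue \<rightarrow>\<^sub>M lebesgue"
  using lebesgue_affine_measurable[of "%_. 1" c] unfolding T by simp
 show "distr lebesgue lebesgue (%x. x + c) = lebesgue"
  using lebesgue_affine_euclidean[of "%_. 1" c] unfolding T by (simp add: density_1)
qed

lemma AE_translate: "AE x in lebesgue. P x ==> AE x in lebesgue. P (x + c)" for c :: "'a::euclidean_space"
 using AE_distrD[OF lebesgue_translate(2)[of c], of P] by (simp only: lebesgue_translate(1))

lemma integral_translate:
 fixes f :: "'a::euclidean_space => 'b::{banach, second_countable_topology}"
 assumes "f \<in> borel_measurable lebesgue"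
 shows "(\<integral>x. f (x + c) \<partial>lebesgue) = (\<integral>x. f x \<partial>lebesgue)"
 using integral_distr[OF lebesgue_translate(2)[of c] assms] by (simp only: lebesgue_translate(1))

lemma measurable_translate:
 fixes f :: "'a::euclidean_space => 'b::topological_space"
 assumes "f \<in> borel_measurable lebesgue"
 shows "(%x. f (x + c)) \<in> borel_measurable lebesgue"
 using measurable_compose[OF lebesgue_translate(2) assms] .

lemma L2_translate: assumes "f \<in> L2" shows "(%x. f (x + c)) \<in> L2"
proof -
 have "integrable (distr lebesgue lebesgue (%x. x + c)) (%x. (cmod (f x))\<^sup>2)"
  using L2D(2)[OF assms] by (simp only: lebesgue_translate)
 then have "integrable lebesgue (%x. (cmod (f (x + c)))\<^sup>2)"
  by (rule integrable_distr[OF lebesgue_translate(2)])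
 then show ?thesis using measurable_translate[OF L2D(1)[OF assms]] by (simp add: L2_def)
qed

definition shift :: "real^'n => 'n ell2 => 'n ell2" where
 "shift c x = cls (%t. rep x (t + c))"

lemma shift_cls: "f \<in> L2 ==> shift c (cls f) = cls (%t. f (t + c))"
 unfolding shift_def
 by (rule cls_eqI) (auto intro!: L2_translate AE_translate rep_cls[unfolded ae_eq_def])

lemma shift_inner: "shift c x \<bullet> shift c y = x \<bullet> y"
 unfolding shift_def rep_inner[of x y] l2_inner_def
 by (simp add: cls_inner L2_translate l2_inner_def integral_translate[OF borel_measurable_integrable[OF L2_integrable]])

lemma shift_shift: "shift c (shift d x) = shift (c + d) x"
 unfolding shift_def[of d] shift_def[of "c + d"]
 by (subst shift_cls) (simp_all add: L2_translate add_ac)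

lemma shift_0 [simp]: "shift 0 x = x" by (simp add: shift_def)

lemma shift_adj: "shift c x \<bullet> y = x \<bullet> shift (- c) y"
 using shift_inner[of "-c" "shift c x" y] by (simp add: shift_shift)

lemma shift_add: "shift c (x + y) = shift c x + shift c y"
proof -
 have "x + y = cls (%t. rep x t + rep y t)" using cls_add[of "rep x" "rep y"] by simp
 then have "shift c (x + y) = cls (%t. rep x (t + c) + rep y (t + c))" by (simp only:) (rule shift_cls, simp add: L2_add)
 also have "\<dots> = shift c x + shift c y" unfolding shift_def by (rule cls_add[symmetric]) (simp_all add: L2_translate)
 finally show ?thesis .
qed

lemma shift_scale: "shift c (r *\<^sub>R x) = r *\<^sub>R shift c x"
proof -
 have "r *\<^sub>R x = cls (%t. complex_of_real r * rep x t)" using cls_scale[of "rep x" r] by simp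
 then have "shift c (r *\<^sub>R x) = cls (%t. complex_of_real r * rep x (t + c))" by (simp only:) (rule shift_cls, simp add: L2_cmult)
 also have "\<dots> = r *\<^sub>R shift c x" unfolding shift_def by (rule cls_scale[symmetric]) (simp add: L2_translate)
 finally show ?thesis .
qed

lemma shift_norm: "norm (shift c x) = norm x" by (simp add: norm_eq_sqrt_inner shift_inner)

section \<open>Test functions in the Hilbert space\<close>

lemma test_continuous: "\<phi> \<in> test_functions ==> continuous_on UNIV \<phi>"
 unfolding test_functions_def using C_k.simps(1) by blast

lemma test_differentiable: "\<phi> \<in> test_functions ==> \<phi> differentiable (at x)"
 unfolding test_functions_def using C_k.simps(2)[of 0] by blast

lemma test_support:
 assumes "\<phi> \<in> test_functions" obtains R where "0 < R" "!!x. R < norm x ==> \<phi> x = 0"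
proof -
 have "bounded (closure {x. \<phi> x ~= 0})" using assms compact_imp_bounded by (auto simp: test_functions_def)
 then obtain R where R: "0 < R" "!!x. x \<in> closure {x. \<phi> x ~= 0} ==> norm x <= R"
  unfolding bounded_pos by blast
 have "\<phi> x = 0" if "R < norm x" for x
 proof (rule ccontr)
  assume "\<phi> x ~= 0"
  then have "x \<in> closure {x. \<phi> x ~= 0}" using closure_subset[of "{x. \<phi> x ~= 0}"] by blast
  then show False using R(2)[of x] that by simp
 qed
 then show thesis using R that by blast
qed

lemma pderiv_test: assumes \<phi>: "\<phi> \<in> test_functions" shows "pderiv_at j \<phi> \<in> test_functions"
proof -
 have C: "C_k k (pderiv_at j \<phi>)" for k
  using \<phi> C_k.simps(2)[of k \<phi>] by (auto simp: test_functions_def)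
 have "pderiv_at j \<phi> x = 0" if x: "x \<notin> closure {x. \<phi> x ~= 0}" for x
 proof -
  have "((%_. 0) has_derivative (%_. 0)) (at x)" by simp
  then have "(\<phi> has_derivative (%_. 0)) (at x)"
   by (rule has_derivative_transform_within_open[of _ _ _ _ "- closure {x. \<phi> x ~= 0}"])
    (use x closure_subset[of "{x. \<phi> x ~= 0}"] in auto)
  then show ?thesis unfolding pderiv_at_def by (simp flip: frechet_derivative_at)
 qed
 then have "closure {x. pderiv_at j \<phi> x ~= 0} \<subseteq> closure {x. \<phi> x ~= 0}"
  by (intro closure_minimal) auto
 then have "compact (closure {x. pderiv_at j \<phi> x ~= 0})"
  using \<phi> bounded_subset by (auto simp: test_functions_def compact_eq_bounded_closed)
 then show ?thesis using C by (simp add: test_functions_def)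
qed

lemma indicator_L2: assumes "A \<in> lmeasurable" shows "(%x. complex_of_real (indicator A x)) \<in> L2"
proof -
 have "A \<in> sets lebesgue" "emeasure lebesgue A < \<infinity>" using assms by (auto simp: fmeasurable_def)
 then have "integrable lebesgue (indicator A :: _ => real)" by (rule integrable_real_indicator)
 moreover have "(cmod (complex_of_real (indicator A x)))\<^sup>2 = indicator A x" for x
  by (simp add: indicator_def)
 ultimately show ?thesis using \<open>A \<in> sets lebesgue\<close> by (simp add: L2_def)
qed

lemma test_bounded:
 assumes \<phi>: "\<phi> \<in> test_functions" obtains M where "0 <= M" "!!x. cmod (\<phi> x) <= M"
proof -
 obtain R where R: "0 < R" "!!x. R < norm x ==> \<phi> x = 0" using test_support[OF \<phi>] by metis
 have "compact (\<phi> ` cball 0 R)"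
  by (intro compact_continuous_image continuous_on_subset[OF test_continuous[OF \<phi>]]) auto
 then obtain M where M: "!!y. y \<in> \<phi> ` cball 0 R ==> norm y <= M" "M > 0"
  using compact_imp_bounded bounded_pos by metis
 have "cmod (\<phi> x) <= M" for x
  using M R(2)[of x] by (cases "norm x <= R") auto
 then show thesis using that[of M] M(2) by simp
qed

lemma test_L2: assumes \<phi>: "\<phi> \<in> test_functions" shows "\<phi> \<in> L2"
proof -
 obtain R where R: "0 < R" "!!x. R < norm x ==> \<phi> x = 0" using test_support[OF \<phi>] by metis
 obtain M where M: "0 <= M" "!!x. cmod (\<phi> x) <= M" using test_bounded[OF \<phi>] by metis
 show ?thesis
 proof (rule L2_dominated)
  show "\<phi> \<in> borel_measurable lebesgue"
   by (rule measurable_completion) (simp add: borel_measurable_continuous_onI test_continuous[OF \<phi>])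
  show "(%x. complex_of_real (indicator (cball 0 R) x)) \<in> L2" by (rule indicator_L2) simp
  show "AE x in lebesgue. cmod (\<phi> x) <= M * cmod (complex_of_real (indicator (cball 0 R) x))"
  proof (rule AE_I2)
   fix x show "cmod (\<phi> x) <= M * cmod (complex_of_real (indicator (cball 0 R) x))"
    using M(2)[of x] R(2)[of x] by (cases "norm x <= R") auto
  qed
 qed
qed

lemma test_line_derivative:
 assumes \<phi>: "\<phi> \<in> test_functions"
 shows "((%t. \<phi> (x + t *\<^sub>R axis j 1)) has_vector_derivative pderiv_at j \<phi> (x + s *\<^sub>R axis j 1)) (at s)"
proof -
 let ?y = "x + s *\<^sub>R axis j 1"
 have "(\<phi> has_derivative frechet_derivative \<phi> (at ?y)) (at ?y)"
  using test_differentiable[OF \<phi>] frechet_derivative_works by blast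
 moreover have "((%t. x + t *\<^sub>R axis j 1) has_vector_derivative axis j 1) (at s)"
  by (auto intro!: derivative_eq_intros)
 ultimately show ?thesis
  unfolding pderiv_at_def using vector_derivative_diff_chain_within[of "%t. x + t *\<^sub>R axis j 1" _ s UNIV \<phi>]
  by (auto simp: comp_def intro: has_derivative_at_withinI)
qed

lemma test_lipschitz:
 assumes \<phi>: "\<phi> \<in> test_functions"
 obtains M where "0 <= M" "!!x h. cmod (\<phi> (x + h *\<^sub>R axis j 1) - \<phi> x) <= M * \<bar>h\<bar>"
proof -
 obtain M where M: "0 <= M" "!!x. cmod (pderiv_at j \<phi> x) <= M" using test_bounded[OF pderiv_test[OF \<phi>]] by metis
 have "cmod (\<phi> (x + h *\<^sub>R axis j 1) - \<phi> (x + 0 *\<^sub>R axis j 1)) <= M * norm (h - 0)" for x h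
 proof (rule differentiable_bound[where S=UNIV and f="%t. \<phi> (x + t *\<^sub>R axis j 1)"])
  show "((%t. \<phi> (x + t *\<^sub>R axis j 1)) has_derivative (%t. t *\<^sub>R pderiv_at j \<phi> (x + s *\<^sub>R axis j 1))) (at s)" for s
   using test_line_derivative[OF \<phi>] by (simp add: has_vector_derivative_def)
  show "onorm (%t. t *\<^sub>R pderiv_at j \<phi> (x + s *\<^sub>R axis j 1)) <= M" for s
   by (rule onorm_le) (simp add: mult.commute[of M] mult_left_mono M)
 qed auto
 then show thesis using that[of M] M(1) by simp
qed

lemma has_vector_derivative_quotient:
 assumes "(f has_vector_derivative D) (at 0)"
 shows "((%t. (f t - f 0) /\<^sub>R t) \<longlongrightarrow> D) (at 0)"
proof -
 have "((%t. norm (f (0 + t) - f 0 - t *\<^sub>R D) / norm t) \<longlongrightarrow> 0) (at 0)"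
  using assms unfolding has_vector_derivative_def has_derivative_at by blast
 then have "((%t. norm ((f t - f 0) /\<^sub>R t - D)) \<longlongrightarrow> 0) (at 0)"
 proof (rule Lim_transform_eventually)
  show "eventually (%t. norm (f (0 + t) - f 0 - t *\<^sub>R D) / norm t = norm ((f t - f 0) /\<^sub>R t - D)) (at 0)"
   unfolding eventually_at_filter
  proof (intro always_eventually allI impI)
   fix t :: real assume "t ~= 0"
   then have "(f t - f 0) /\<^sub>R t - D = (f (0 + t) - f 0 - t *\<^sub>R D) /\<^sub>R t" by (simp add: scaleR_diff_right)
   then show "norm (f (0 + t) - f 0 - t *\<^sub>R D) / norm t = norm ((f t - f 0) /\<^sub>R t - D)"
    by (simp only: norm_scaleR) (simp add: divide_inverse mult.commute)
  qed
 qed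
 then show ?thesis using LIM_zero_iff tendsto_norm_zero_iff by blast
qed

text \<open>Dominated convergence: by the Lipschitz constant the quotients are bounded, and once |h|
  <= 1 they are supported in a ball enlarged by 1, on which w is integrable.\<close>

lemma test_difference_quotient:
 fixes \<phi> :: "real^'n => complex"
 assumes \<phi>: "\<phi> \<in> test_functions" and w: "w \<in> L2"
 shows "((%h. \<integral>x. w x * ((\<phi> (x + h *\<^sub>R axis j 1) - \<phi> x) / complex_of_real h) \<partial>lebesgue)
  \<longlongrightarrow> (\<integral>x. w x * pderiv_at j \<phi> x \<partial>lebesgue)) (at 0)"
 unfolding tendsto_at_iff_sequentially
proof (intro allI impI)
 fix h :: "nat => real" assume "ALL i. h i \<in> UNIV - {0}" and h0: "h \<longlonglongrightarrow> 0"
 then have hn: "h i ~= 0" for i by simp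
 obtain N where N: "!!n. n \<ge> N ==> \<bar>h n\<bar> <= 1" using LIMSEQ_D[OF h0, of 1] by (auto intro: less_imp_le)
 obtain R where R: "0 < R" "!!x. R < norm x ==> \<phi> x = 0" using test_support[OF \<phi>] by metis
 obtain M where M: "0 <= M" "!!x h. cmod (\<phi> (x + h *\<^sub>R axis j 1) - \<phi> x) <= M * \<bar>h\<bar>" using test_lipschitz[OF \<phi>, of j] by metis
 let ?I = "%n. \<integral>x. w x * ((\<phi> (x + h n *\<^sub>R axis j 1) - \<phi> x) / complex_of_real (h n)) \<partial>lebesgue"
 have wm [measurable]: "w \<in> borel_measurable lebesgue" by (rule L2D[OF w])
 have pm [measurable]: "\<phi> \<in> borel_measurable lebesgue" by (rule L2D[OF test_L2[OF \<phi>]])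
 have pm' [measurable]: "(%x. \<phi> (x + c)) \<in> borel_measurable lebesgue" for c by (rule measurable_translate[OF pm])
 have "(%n. ?I (n + N)) \<longlonglongrightarrow> (\<integral>x. w x * pderiv_at j \<phi> x \<partial>lebesgue)"
 proof (rule integral_dominated_convergence[where w="%x. M * (cmod (w x) * indicator (cball 0 (R + 1)) x)"])
  show "(%x. w x * pderiv_at j \<phi> x) \<in> borel_measurable lebesgue"
   using L2D[OF test_L2[OF pderiv_test[OF \<phi>]]] by measurable
  show "integrable lebesgue (%x. M * (cmod (w x) * indicator (cball 0 (R + 1)) x))"
  proof -
   have "(%x. complex_of_real (indicator (cball (0::real^'n) (R + 1)) x)) \<in> L2" by (rule indicator_L2) simp
   from integrable_norm[OF L2_integrable_mult[OF w this]] show ?thesis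
    by (intro integrable_mult_right) (simp add: norm_mult)
  qed
  show "AE x in lebesgue. norm (w x * ((\<phi> (x + h (n + N) *\<^sub>R axis j 1) - \<phi> x) / complex_of_real (h (n + N)))) <= M * (cmod (w x) * indicator (cball 0 (R + 1)) x)" for n
  proof (rule AE_I2)
   fix x :: "real^'n"
   let ?h = "h (n + N)"
   have bd: "cmod ((\<phi> (x + ?h *\<^sub>R axis j 1) - \<phi> x) / complex_of_real ?h) <= M * indicator (cball 0 (R + 1)) x"
   proof (cases "norm x <= R + 1")
    case True
    then show ?thesis using M(2)[of x ?h] hn[of "n + N"] by (simp add: norm_divide field_simps)
   next
    case False
    have "norm (?h *\<^sub>R (axis j 1 :: real^'n)) <= 1" using N[of "n + N"] by simp
    then have "R < norm (x + ?h *\<^sub>R axis j 1)"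
     using False norm_diff_ineq[of x "?h *\<^sub>R axis j 1"] by linarith
    then show ?thesis using R(2)[of x] R(2)[of "x + ?h *\<^sub>R axis j 1"] False by simp
   qed
   have "cmod (w x) * cmod ((\<phi> (x + ?h *\<^sub>R axis j 1) - \<phi> x) / complex_of_real ?h) <= cmod (w x) * (M * indicator (cball 0 (R + 1)) x)"
    by (rule mult_left_mono[OF bd norm_ge_zero])
   then show "norm (w x * ((\<phi> (x + ?h *\<^sub>R axis j 1) - \<phi> x) / complex_of_real ?h)) <= M * (cmod (w x) * indicator (cball 0 (R + 1)) x)"
    unfolding norm_mult by (simp only: mult_ac)
  qed
  show "AE x in lebesgue. (%n. w x * ((\<phi> (x + h (n + N) *\<^sub>R axis j 1) - \<phi> x) / complex_of_real (h (n + N)))) \<longlonglongrightarrow> w x * pderiv_at j \<phi> x"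
  proof (intro AE_I2 tendsto_mult tendsto_const)
   fix x
   have "((%t. \<phi> (x + t *\<^sub>R axis j 1)) has_vector_derivative pderiv_at j \<phi> (x + 0 *\<^sub>R axis j 1)) (at 0)"
    by (rule test_line_derivative[OF \<phi>])
   then have "((%t. (\<phi> (x + t *\<^sub>R axis j 1) - \<phi> x) /\<^sub>R t) \<longlongrightarrow> pderiv_at j \<phi> x) (at 0)"
    using has_vector_derivative_quotient by fastforce
   then have "(%n. (\<phi> (x + h (n + N) *\<^sub>R axis j 1) - \<phi> x) /\<^sub>R h (n + N)) \<longlonglongrightarrow> pderiv_at j \<phi> x"
    using hn LIMSEQ_ignore_initial_segment[OF h0, of N]
    unfolding tendsto_at_iff_sequentially comp_def by (auto dest!: spec[of _ "%n. h (n + N)"])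
   then show "(%n. (\<phi> (x + h (n + N) *\<^sub>R axis j 1) - \<phi> x) / complex_of_real (h (n + N))) \<longlonglongrightarrow> pderiv_at j \<phi> x"
    by (simp add: scaleR_conv_of_real divide_inverse mult.commute)
  qed
 qed measurable
 from LIMSEQ_offset[OF this] show "((%h. \<integral>x. w x * ((\<phi> (x + h *\<^sub>R axis j 1) - \<phi> x) / complex_of_real h) \<partial>lebesgue) \<circ> h) \<longlonglongrightarrow> (\<integral>x. w x * pderiv_at j \<phi> x \<partial>lebesgue)"
  by (simp add: comp_def)
qed

lemma cls_difference_quotient:
 fixes \<phi> :: "real^'n => complex"
 assumes \<phi>: "\<phi> \<in> test_functions"
 shows "((%h. w \<bullet> ((shift (h *\<^sub>R axis j 1) (cls \<phi>) - cls \<phi>) /\<^sub>R h)) \<longlongrightarrow> w \<bullet> cls (pderiv_at j \<phi>)) (at 0)"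
proof -
 have *: "((%h. Re (\<integral>x. cnj (rep w x) * ((\<phi> (x + h *\<^sub>R axis j 1) - \<phi> x) / complex_of_real h) \<partial>lebesgue))
  \<longlongrightarrow> Re (\<integral>x. cnj (rep w x) * pderiv_at j \<phi> x \<partial>lebesgue)) (at 0)"
  by (intro tendsto_Re test_difference_quotient[OF \<phi>] L2_cnj rep_L2)
 have \<phi>L: "\<phi> \<in> L2" by (rule test_L2[OF \<phi>])
 have 1: "cls f \<bullet> w = Re (\<integral>x. cnj (rep w x) * f x \<partial>lebesgue)" if "f \<in> L2" for f
  using cls_inner[OF that rep_L2, of w] by (simp add: l2_inner_def mult.commute)
 have 2: "w \<bullet> ((shift (h *\<^sub>R axis j 1) (cls \<phi>) - cls \<phi>) /\<^sub>R h) = Re (\<integral>x. cnj (rep w x) * ((\<phi> (x + h *\<^sub>R axis j 1) - \<phi> x) / complex_of_real h) \<partial>lebesgue)" for h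
 proof -
  have "(shift (h *\<^sub>R axis j 1) (cls \<phi>) - cls \<phi>) /\<^sub>R h = cls (%x. (\<phi> (x + h *\<^sub>R axis j 1) - \<phi> x) / complex_of_real h)"
   by (simp add: shift_cls \<phi>L cls_diff L2_translate cls_scale L2_diff divide_inverse mult.commute)
  moreover have "(%x. (\<phi> (x + h *\<^sub>R axis j 1) - \<phi> x) / complex_of_real h) \<in> L2"
   using L2_cmult[OF L2_diff[OF L2_translate[OF \<phi>L] \<phi>L], of "1 / complex_of_real h"] by simp
  ultimately show ?thesis using 1 by (simp add: inner_commute)
 qed
 show ?thesis using * 1[OF test_L2[OF pderiv_test[OF \<phi>]]] unfolding 2 by (simp add: inner_commute)
qed

definition tspace :: "'n::finite ell2 set" where
 "tspace = span {cls (tprod c F) | c F. tfam F}"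

lemma L2_locally_integrable: assumes "f \<in> L2" shows "locally_integrable f"
 unfolding locally_integrable_def set_integrable_def
proof (intro allI impI)
 fix K :: "(real^'a) set" assume "compact K"
 then have "(%x. complex_of_real (indicator K x)) \<in> L2" by (intro indicator_L2 lmeasurable_compact)
 from L2_integrable_mult[OF this assms] show "integrable lebesgue (%x. indicat_real K x *\<^sub>R f x)"
  by (simp add: scaleR_conv_of_real)
qed

lemma cnj_tprod: "cnj (tprod c F x) = tprod (cnj c) F x" by (simp add: tprod_def)

text \<open>The inner product sees only real parts; the constants 1 and i recover the whole complex
  integral.\<close>

lemma ell2_eq_0I:
 fixes y :: "'n::finite ell2"
 assumes "!!c F. tfam F ==> y \<bullet> cls (tprod c F) = 0" shows "y = 0"
proof -
 have "AE x in lebesgue. rep y x = 0"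
 proof (rule test_functions_separate[OF L2_locally_integrable[OF rep_L2]])
  fix F :: "'n => real => real" assume F: "tfam F"
  have *: "y \<bullet> cls (tprod c F) = Re (cnj c * (\<integral>x. rep y x * tprod 1 F x \<partial>lebesgue))" for c
  proof -
   have "y \<bullet> cls (tprod c F) = Re (l2_inner (rep y) (tprod c F))"
    using cls_inner[OF rep_L2[of y] test_L2[OF tprod_test[OF F, of c]]] by simp
   also have "l2_inner (rep y) (tprod c F) = (\<integral>x. cnj c * (rep y x * tprod 1 F x) \<partial>lebesgue)"
    unfolding l2_inner_def by (rule Bochner_Integration.integral_cong) (simp_all add: tprod_def)
   finally show ?thesis by simp
  qed
  show "(\<integral>x. rep y x * tprod 1 F x \<partial>lebesgue) = 0"
   using *[of 1] *[of \<i>] assms[OF F] by (simp add: complex_eq_iff)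
 qed
 then show ?thesis using rep_eq_iff[of y 0] rep_zero by (auto simp: ae_eq_def elim: eventually_elim2)
qed

lemma tspace_dense: "closure tspace = (UNIV :: 'n::finite ell2 set)"
proof (rule dense_if_orthogonal_trivial)
 show "subspace (tspace :: 'n ell2 set)" unfolding tspace_def by (rule subspace_span)
 fix y :: "'n ell2" assume *: "!!x. x \<in> tspace ==> y \<bullet> x = 0"
 show "y = 0" by (rule ell2_eq_0I) (rule *, unfold tspace_def, rule span_base, blast)
qed

section \<open>Weak derivatives\<close>

lemma dense_norm_le:
 fixes y :: "'a::real_inner"
 assumes d: "closure S = UNIV" and K: "0 <= K" and b: "!!v. v \<in> S ==> \<bar>y \<bullet> v\<bar> <= K * norm v"
 shows "norm y <= K"
proof -
 obtain v where v: "!!n. v n \<in> S" "v \<longlonglongrightarrow> y" using d closure_sequential[of y S] by auto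
 have "(%n. \<bar>y \<bullet> v n\<bar>) \<longlonglongrightarrow> \<bar>y \<bullet> y\<bar>" "(%n. K * norm (v n)) \<longlonglongrightarrow> K * norm y"
  by (intro tendsto_intros v)+
 then have "\<bar>y \<bullet> y\<bar> <= K * norm y" by (rule LIMSEQ_le) (use b v in blast)
 then have *: "norm y * norm y <= K * norm y" by (simp add: power2_norm_eq_inner[symmetric] power2_eq_square)
 show ?thesis
 proof (cases "norm y = 0")
  case True
  then show ?thesis using K by simp
 next
  case False
  then show ?thesis using * by simp
 qed
qed

text \<open>The uniform bound carries the Cauchy property from a dense set to all vectors by a
  three-term estimate.\<close>

lemma weak_limit_extend:
 fixes D :: "nat => 'a::real_inner"
 assumes d: "closure S = UNIV" and D: "!!n. norm (D n) <= C"
  and c: "!!v. v \<in> S ==> convergent (%n. D n \<bullet> v)"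
 shows "convergent (%n. D n \<bullet> y)"
proof -
 have C0: "0 <= C" using D[of 0] norm_ge_zero order_trans by blast
 have "Cauchy (%n. D n \<bullet> y)"
 proof (rule metric_CauchyI)
  fix e :: real assume e: "e > 0"
  have "y \<in> closure S" using d by simp
  then obtain v where v: "v \<in> S" "dist v y < e / (4 * (C + 1))"
   unfolding closure_approachable using e C0 by (auto dest!: spec[of _ "e / (4 * (C + 1))"])
  have "Cauchy (%n. D n \<bullet> v)" using c[OF v(1)] by (rule convergent_Cauchy)
  then obtain M where M: "!!m n. m \<ge> M ==> n \<ge> M ==> dist (D m \<bullet> v) (D n \<bullet> v) < e / 2"
   using metric_CauchyD[of "%n. D n \<bullet> v" "e / 2"] e by auto
  have b: "\<bar>D n \<bullet> y - D n \<bullet> v\<bar> < e / 4" for n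
  proof -
   have "\<bar>D n \<bullet> y - D n \<bullet> v\<bar> = \<bar>D n \<bullet> (y - v)\<bar>" by (simp add: inner_diff_right)
   also have "\<dots> <= norm (D n) * norm (y - v)" by (rule Cauchy_Schwarz_ineq2)
   also have "\<dots> <= (C + 1) * norm (y - v)" using D[of n] by (intro mult_right_mono) auto
   also have "\<dots> < (C + 1) * (e / (4 * (C + 1)))"
    using v(2) C0 by (intro mult_strict_left_mono) (auto simp: dist_norm norm_minus_commute)
   also have "\<dots> = e / 4" using C0 by (simp add: field_simps)
   finally show ?thesis .
  qed
  have "dist (D m \<bullet> y) (D n \<bullet> y) < e" if "m \<ge> M" "n \<ge> M" for m n
   using b[of m] b[of n] M[OF that] unfolding dist_real_def by linarith
  then show "EX M. \<forall>m\<ge>M. \<forall>n\<ge>M. dist (D m \<bullet> y) (D n \<bullet> y) < e" by (intro exI[of _ M]) simp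
 qed
 then show ?thesis by (rule Cauchy_convergent)
qed

lemma weak_limit_exists:
 fixes D :: "nat => 'a::{real_inner,complete_space}"
 assumes d: "closure S = UNIV" and D: "!!n. norm (D n) <= C"
  and c: "!!v. v \<in> S ==> convergent (%n. D n \<bullet> v)"
 obtains g where "!!y. (%n. D n \<bullet> y) \<longlonglongrightarrow> g \<bullet> y" "norm g <= C"
proof -
 define L where "L y = lim (%n. D n \<bullet> y)" for y
 have L: "(%n. D n \<bullet> y) \<longlonglongrightarrow> L y" for y
  unfolding L_def using weak_limit_extend[OF assms] convergent_LIMSEQ_iff by blast
 have Lb: "\<bar>L y\<bar> <= C * norm y" for y
 proof (rule LIMSEQ_le_const2[OF tendsto_rabs[OF L]])
  show "EX N. \<forall>n\<ge>N. \<bar>D n \<bullet> y\<bar> <= C * norm y"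
   using Cauchy_Schwarz_ineq2[of "D _" y] D mult_right_mono[OF D norm_ge_zero] order_trans by blast
 qed
 have "bounded_linear L"
 proof (rule bounded_linear_intro[where K=C])
  show "L (x + y) = L x + L y" for x y
   by (rule LIMSEQ_unique[OF L]) (unfold inner_add_right, intro tendsto_add L)
  show "L (r *\<^sub>R x) = r *\<^sub>R L x" for r x
   by (rule LIMSEQ_unique[OF L]) (unfold inner_scaleR_right real_scaleR_def, intro tendsto_mult L tendsto_const)
  show "norm (L x) <= norm x * C" for x using Lb[of x] by (simp add: mult.commute)
 qed
 then obtain g where g: "!!y. L y = g \<bullet> y" using riesz_representation by metis
 have "norm g <= C"
  by (rule dense_norm_le[of UNIV]) (use Lb order_trans[OF norm_ge_zero D] in \<open>auto simp: g\<close>)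
 then show thesis using that[of g] L g by simp
qed

lemma C_k_linear:
 assumes L: "bounded_linear L" shows "C_k k \<phi> ==> C_k k (%x. L (\<phi> x))"
  "(!!x. \<phi> differentiable (at x)) ==> pderiv_at j (%x. L (\<phi> x)) = (%x. L (pderiv_at j \<phi> x))"
proof -
 have hd: "((%x. L (\<phi> x)) has_derivative (%h. L (frechet_derivative \<phi> (at x) h))) (at x)"
  if "\<phi> differentiable (at x)" for \<phi> :: "real^'a => complex" and x
  using bounded_linear.has_derivative[OF L] that frechet_derivative_works by blast
 have pd: "pderiv_at j (%x. L (\<phi> x)) = (%x. L (pderiv_at j \<phi> x))"
  if "!!x. \<phi> differentiable (at x)" for \<phi> :: "real^'a => complex" and j
  using frechet_derivative_at[OF hd[OF that]] by (auto simp: pderiv_at_def fun_eq_iff)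
 show "(!!x. \<phi> differentiable (at x)) ==> pderiv_at j (%x. L (\<phi> x)) = (%x. L (pderiv_at j \<phi> x))" by (rule pd)
 show "C_k k \<phi> ==> C_k k (%x. L (\<phi> x))"
 proof (induction k arbitrary: \<phi>)
  case 0
  then show ?case by (auto intro: bounded_linear.continuous_on[OF L])
 next
  case (Suc k)
  from Suc.prems have d: "!!x. \<phi> differentiable (at x)" and c: "!!j. C_k k (pderiv_at j \<phi>)" by auto
  show ?case unfolding C_k.simps
  proof (intro conjI allI)
   show "(%x. L (\<phi> x)) differentiable at x" for x using hd[OF d] unfolding differentiable_def by blast
   show "C_k k (pderiv_at j (%x. L (\<phi> x)))" for j unfolding pd[OF d] by (rule Suc.IH[OF c])
  qed
 qed
qed

text \<open>Used with the map z -> cnj (alpha * z), to pass from the real inner product back to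
  complex integrals.\<close>

lemma test_linear:
 assumes L: "bounded_linear L" and \<phi>: "\<phi> \<in> test_functions"
 shows "(%x. L (\<phi> x)) \<in> test_functions" and "pderiv_at j (%x. L (\<phi> x)) = (%x. L (pderiv_at j \<phi> x))"
proof -
 show "pderiv_at j (%x. L (\<phi> x)) = (%x. L (pderiv_at j \<phi> x))"
  by (rule C_k_linear(2)[OF L test_differentiable[OF \<phi>]])
 have "{x. L (\<phi> x) ~= 0} \<subseteq> {x. \<phi> x ~= 0}" using linear_simps(3)[OF L] by auto
 then have "closure {x. L (\<phi> x) ~= 0} \<subseteq> closure {x. \<phi> x ~= 0}" by (rule closure_mono)
 then have "compact (closure {x. L (\<phi> x) ~= 0})"
  using \<phi> bounded_subset by (auto simp: test_functions_def compact_eq_bounded_closed)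
 then show "(%x. L (\<phi> x)) \<in> test_functions" using \<phi> C_k_linear(1)[OF L] by (auto simp: test_functions_def)
qed

text \<open>The weak derivative tested against tensor products only. Their span is dense, which
  gives uniqueness; \<open>wd_test\<close> extends the relation to all test functions.\<close>

definition wd :: "'n::finite => 'n ell2 => 'n ell2 => bool" where
 "wd j u g \<longleftrightarrow> (ALL c F. tfam F --> u \<bullet> cls (pderiv_at j (tprod c F)) = - (g \<bullet> cls (tprod c F)))"

lemma wd_unique: assumes "wd j u g" "wd j u g'" shows "g = g'"
proof -
 have "g - g' = 0" by (rule ell2_eq_0I) (use assms in \<open>auto simp: wd_def inner_diff_left\<close>)
 then show ?thesis by simp
qed

lemma wd_add: "wd j u g ==> wd j v h ==> wd j (u + v) (g + h)" by (simp add: wd_def inner_add_left)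
lemma wd_scale: "wd j u g ==> wd j (r *\<^sub>R u) (r *\<^sub>R g)" by (simp add: wd_def)
lemma wd_zero: "wd j 0 0" by (simp add: wd_def)

lemma closed_wd: "closed {(u, g). wd j u g}"
proof -
 have "{(u, g). wd j u g} = (\<Inter>(c, F) \<in> {(c, F). tfam F}. {x. fst x \<bullet> cls (pderiv_at j (tprod c F)) = - (snd x \<bullet> cls (tprod c F))})"
  by (auto simp: wd_def)
 also have "closed \<dots>"
  by (intro closed_INT ballI) (auto intro!: closed_Collect_eq continuous_intros)
 finally show ?thesis .
qed

lemma tprod_shift:
 fixes F :: "'n::finite => real => real"
 assumes "tfam F" obtains G where "tfam G" "!!x. tprod c F (x + s *\<^sub>R axis j 1) = tprod c G x"
proof -
 define G where "G = F(j := (%t. F j (1 * t + s)))"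
 obtain R where R: "!!j t. R < \<bar>t\<bar> ==> F j t = 0" using assms by (auto simp: tfam_def)
 have "G k t = 0" if "R + \<bar>s\<bar> < \<bar>t\<bar>" for k t using that R[of t k] R[of "t + s" j] by (auto simp: G_def)
 moreover have "smooth (G k)" for k using assms smooth_affine[of "F j" 1 s] by (auto simp: G_def tfam_def)
 ultimately have "tfam G" unfolding tfam_def by blast
 moreover have "tprod c F (x + s *\<^sub>R axis j 1) = tprod c G x" for x
  unfolding tprod_def by (intro arg_cong2[of _ _ _ _ "(*)"] arg_cong[of _ _ complex_of_real] prod.cong) (auto simp: G_def axis_def)
 ultimately show thesis using that by blast
qed

lemma test_deriv_shift:
 assumes "\<phi> \<in> test_functions"
 shows "((%h. (u \<bullet> shift (h *\<^sub>R axis j 1) (cls \<phi>) - u \<bullet> cls \<phi>) / h) \<longlongrightarrow> u \<bullet> cls (pderiv_at j \<phi>)) (at 0)"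
 using cls_difference_quotient[OF assms, of u j] by (simp add: inner_diff_right divide_inverse mult.commute)

text \<open>The curve s -> shift of u by s, paired with v, is classically differentiable with the
  weak derivative as its velocity. The translation is written on v, hence with a minus sign.\<close>

lemma wd_derivative:
 fixes v :: "'a::finite ell2"
 assumes wd: "wd j u g" and v: "v \<in> tspace"
 shows "((%s. u \<bullet> shift (- s *\<^sub>R axis j 1) v) has_real_derivative g \<bullet> shift (- s *\<^sub>R axis j 1) v) (at s)"
proof -
 let ?P = "%v. ALL s. ((%s. u \<bullet> shift (- s *\<^sub>R axis j 1) v) has_real_derivative g \<bullet> shift (- s *\<^sub>R axis j 1) v) (at s)"
 have z: "shift c 0 = 0" for c :: "real^'a" using shift_scale[of c 0 0] by simp
 have "?P v"
  using v unfolding tspace_def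
 proof (rule span_induct)
  show "subspace (Collect ?P)"
   by (auto simp: subspace_def shift_add shift_scale inner_add_right z intro!: DERIV_add DERIV_cmult)
  fix w :: "'a ell2" assume "w \<in> {cls (tprod c F) | c F. tfam F}"
  then obtain c F where w: "w = cls (tprod c F)" and F: "tfam F" by blast
  show "?P w"
  proof
   fix s
   obtain G where G: "tfam G" "!!x. tprod c F (x + (- s) *\<^sub>R axis j 1) = tprod c G x" using tprod_shift[OF F] by blast
   have sw: "shift (- s *\<^sub>R axis j 1) w = cls (tprod c G)"
    unfolding w by (subst shift_cls[OF test_L2[OF tprod_test[OF F]]]) (simp only: G(2))
   have "((%h. (u \<bullet> shift (h *\<^sub>R axis j 1) (cls (tprod c G)) - u \<bullet> cls (tprod c G)) / h) \<longlongrightarrow> u \<bullet> cls (pderiv_at j (tprod c G))) (at 0)"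
    by (rule test_deriv_shift[OF tprod_test[OF G(1)]])
   moreover have "filterlim uminus (at 0) (at (0::real))"
    unfolding filterlim_at using tendsto_minus[OF tendsto_ident_at, of "0::real" UNIV] by (simp add: eventually_at_filter)
   ultimately have "((%h. (u \<bullet> shift (- h *\<^sub>R axis j 1) (cls (tprod c G)) - u \<bullet> cls (tprod c G)) / - h) \<longlongrightarrow> u \<bullet> cls (pderiv_at j (tprod c G))) (at 0)"
    by (rule filterlim_compose)
   then have lim: "((%h. - ((u \<bullet> shift (- h *\<^sub>R axis j 1) (cls (tprod c G)) - u \<bullet> cls (tprod c G)) / - h)) \<longlongrightarrow> - (u \<bullet> cls (pderiv_at j (tprod c G)))) (at 0)"
    by (rule tendsto_minus)
   have d: "- (u \<bullet> cls (pderiv_at j (tprod c G))) = g \<bullet> cls (tprod c G)"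
    using wd G(1) by (simp add: wd_def)
   have t: "shift (- (s + h) *\<^sub>R axis j 1) w = shift (- h *\<^sub>R axis j 1) (cls (tprod c G))" for h
    unfolding sw[symmetric] shift_shift by (rule arg_cong[of _ _ "%c. shift c w"]) (simp add: algebra_simps)
   show "((%s. u \<bullet> shift (- s *\<^sub>R axis j 1) w) has_real_derivative g \<bullet> shift (- s *\<^sub>R axis j 1) w) (at s)"
    using lim unfolding DERIV_def t sw d by simp
  qed
 qed
 then show ?thesis by blast
qed

text \<open>Mean value inequality for the scalar function of \<open>wd_derivative\<close>, then
  duality with the dense test vectors. Together with \<open>wd_exists\<close> it characterises weak
  derivatives in L2 by Lipschitz translations.\<close>

lemma wd_bound:
 assumes wd: "wd j u g" shows "norm (shift (h *\<^sub>R axis j 1) u - u) <= norm g * \<bar>h\<bar>"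
proof (rule dense_norm_le[OF tspace_dense])
 show "0 <= norm g * \<bar>h\<bar>" by simp
 fix v :: "'a ell2" assume v: "v \<in> tspace"
 let ?f = "%s. u \<bullet> shift (- s *\<^sub>R axis j 1) v"
 have "norm (?f h - ?f 0) <= (norm g * norm v) * norm (h - 0)"
 proof (rule field_differentiable_bound[of UNIV])
  show "(?f has_real_derivative g \<bullet> shift (- s *\<^sub>R axis j 1) v) (at s within UNIV)" for s
   using wd_derivative[OF wd v] by simp
  show "norm (g \<bullet> shift (- s *\<^sub>R axis j 1) v) <= norm g * norm v" for s
   using Cauchy_Schwarz_ineq2[of g "shift (- s *\<^sub>R axis j 1) v"] by (simp add: shift_norm)
 qed auto
 then show "\<bar>(shift (h *\<^sub>R axis j 1) u - u) \<bullet> v\<bar> <= norm g * \<bar>h\<bar> * norm v"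
  by (simp add: inner_diff_left shift_adj mult_ac)
qed

definition dquot :: "'n::finite => 'n ell2 => nat => 'n ell2" where
 "dquot j u n = real (Suc n) *\<^sub>R (shift ((1 / real (Suc n)) *\<^sub>R axis j 1) u - u)"

lemma dquot_inner: "dquot j u n \<bullet> v = - ((u \<bullet> shift (- (1 / real (Suc n)) *\<^sub>R axis j 1) v - u \<bullet> v) / - (1 / real (Suc n)))"
 by (simp add: dquot_def inner_diff_left shift_adj)

lemma dquot_bound:
 assumes "!!h. norm (shift (h *\<^sub>R axis j 1) u - u) <= C * \<bar>h\<bar>" shows "norm (dquot j u n) <= C"
 using assms[of "1 / real (Suc n)"] unfolding dquot_def norm_scaleR
 by (simp add: pos_le_divide_eq mult.commute del: of_nat_Suc)

lemma dquot_test: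
 assumes "\<phi> \<in> test_functions"
 shows "(%n. dquot j u n \<bullet> cls \<phi>) \<longlonglongrightarrow> - (u \<bullet> cls (pderiv_at j \<phi>))"
proof -
 have "filterlim (%n. - (1 / real (Suc n))) (at 0) sequentially"
  unfolding filterlim_at using tendsto_minus[OF LIMSEQ_Suc[OF lim_1_over_n]] by auto
 from filterlim_compose[OF test_deriv_shift[OF assms] this]
 have "(%n. (u \<bullet> shift (- (1 / real (Suc n)) *\<^sub>R axis j 1) (cls \<phi>) - u \<bullet> cls \<phi>) / - (1 / real (Suc n))) \<longlonglongrightarrow> u \<bullet> cls (pderiv_at j \<phi>)" .
 from tendsto_minus[OF this] show ?thesis unfolding dquot_inner .
qed

text \<open>The difference quotients are bounded and converge on test vectors, so the whole sequence
  converges weakly; its limit is the derivative.\<close>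

lemma wd_exists:
 assumes b: "!!h. norm (shift (h *\<^sub>R axis j 1) u - u) <= C * \<bar>h\<bar>"
 obtains g where "wd j u g" "norm g <= C" "!!y. (%n. dquot j u n \<bullet> y) \<longlonglongrightarrow> g \<bullet> y"
proof -
 have "convergent (%n. dquot j u n \<bullet> v)" if "v \<in> tspace" for v
  using that unfolding tspace_def
 proof (rule span_induct)
  show "subspace {v. convergent (%n. dquot j u n \<bullet> v)}"
   by (auto simp: subspace_def inner_add_right convergent_const intro: convergent_add convergent_mult)
  fix w :: "'a ell2" assume "w \<in> {cls (tprod c F) | c F. tfam F}"
  then obtain c F where w: "w = cls (tprod c F)" and F: "tfam F" by blast
  show "convergent (%n. dquot j u n \<bullet> w)"
   unfolding w convergent_def using dquot_test[OF tprod_test[OF F]] by blast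
 qed
 from weak_limit_exists[OF tspace_dense dquot_bound[OF b] this]
 obtain g where g: "!!y. (%n. dquot j u n \<bullet> y) \<longlonglongrightarrow> g \<bullet> y" "norm g <= C" by metis
 have "wd j u g"
  unfolding wd_def
 proof (intro allI impI)
  fix c and F :: "'a => real => real" assume F: "tfam F"
  from LIMSEQ_unique[OF g(1) dquot_test[OF tprod_test[OF F], of j u c]]
  show "u \<bullet> cls (pderiv_at j (tprod c F)) = - (g \<bullet> cls (tprod c F))" by simp
 qed
 with g that show thesis by blast
qed

text \<open>The difference quotients of u converge weakly to its derivative, and against any test
  function they can be evaluated by moving the quotient to the test function.\<close>

lemma wd_test:
 assumes wd: "wd j u g" and \<phi>: "\<phi> \<in> test_functions"
 shows "u \<bullet> cls (pderiv_at j \<phi>) = - (g \<bullet> cls \<phi>)"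
proof -
 obtain g' where g': "wd j u g'" "!!y. (%n. dquot j u n \<bullet> y) \<longlonglongrightarrow> g' \<bullet> y"
  using wd_exists[OF wd_bound[OF wd]] by metis
 have "g' = g" by (rule wd_unique[OF g'(1) wd])
 with LIMSEQ_unique[OF g'(2) dquot_test[OF \<phi>]] show ?thesis by simp
qed

lemma wd_integral:
 assumes wd: "wd j u g" and \<phi>: "\<phi> \<in> test_functions"
 shows "(\<integral>x. rep u x * pderiv_at j \<phi> x \<partial>lebesgue) = - (\<integral>x. rep g x * \<phi> x \<partial>lebesgue)"
proof -
 have *: "Re (\<alpha> * (\<integral>x. rep u x * pderiv_at j \<phi> x \<partial>lebesgue)) = - Re (\<alpha> * (\<integral>x. rep g x * \<phi> x \<partial>lebesgue))" for \<alpha>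
 proof -
  have L: "bounded_linear (%z. cnj (\<alpha> * z))"
   using bounded_linear_compose[OF bounded_linear_cnj bounded_linear_mult_right] .
  have i: "v \<bullet> cls (%x. cnj (\<alpha> * \<psi> x)) = Re (\<alpha> * (\<integral>x. rep v x * \<psi> x \<partial>lebesgue))" if "\<psi> \<in> L2" for v \<psi>
  proof -
   have "v \<bullet> cls (%x. cnj (\<alpha> * \<psi> x)) = Re (\<integral>x. \<alpha> * (rep v x * \<psi> x) \<partial>lebesgue)"
    using cls_inner[OF rep_L2[of v] L2_cnj[OF L2_cmult[OF that, of \<alpha>]]] by (simp add: l2_inner_def mult_ac)
   then show ?thesis by simp
  qed
  show ?thesis
   using wd_test[OF wd test_linear(1)[OF L \<phi>]]
   by (simp only: test_linear(2)[OF L \<phi>] i[OF test_L2[OF \<phi>]] i[OF test_L2[OF pderiv_test[OF \<phi>]]])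
 qed
 show ?thesis using *[of 1] *[of \<i>] by (simp add: complex_eq_iff)
qed

text \<open>Integration by parts without integrals: the adjoint of a translation is the opposite
  translation, so a difference quotient moves to the other factor with a sign.\<close>

lemma wd_tprod:
 assumes F: "tfam F" shows "wd j (cls (tprod c F)) (cls (pderiv_at j (tprod c F)))"
 unfolding wd_def
proof (intro allI impI)
 fix c' and G :: "'a => real => real" assume G: "tfam G"
 let ?f = "cls (tprod c F)" and ?g = "cls (tprod c' G)"
 have 1: "((%h. (?f \<bullet> shift (h *\<^sub>R axis j 1) ?g - ?f \<bullet> ?g) / h) \<longlongrightarrow> ?f \<bullet> cls (pderiv_at j (tprod c' G))) (at 0)"
  by (rule test_deriv_shift[OF tprod_test[OF G]])
 have m: "filterlim uminus (at 0) (at (0::real))"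
  unfolding filterlim_at using tendsto_minus[OF tendsto_ident_at, of "0::real" UNIV] by (simp add: eventually_at_filter)
 have "((%h. (?g \<bullet> shift (h *\<^sub>R axis j 1) ?f - ?g \<bullet> ?f) / h) \<longlongrightarrow> ?g \<bullet> cls (pderiv_at j (tprod c F))) (at 0)"
  by (rule test_deriv_shift[OF tprod_test[OF F]])
 have e: "?f \<bullet> shift s ?g = ?g \<bullet> shift (- s) ?f" for s
  using shift_adj[of s ?g ?f] by (simp add: inner_commute)
 from tendsto_minus[OF filterlim_compose[OF \<open>(_ \<longlongrightarrow> ?g \<bullet> cls (pderiv_at j (tprod c F))) (at 0)\<close> m]]
 have "((%h. (?f \<bullet> shift (h *\<^sub>R axis j 1) ?g - ?f \<bullet> ?g) / h) \<longlongrightarrow> - (?g \<bullet> cls (pderiv_at j (tprod c F)))) (at 0)"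
  by (simp add: e inner_commute[of ?f ?g])
 from tendsto_unique[OF trivial_limit_at 1 this]
 show "?f \<bullet> cls (pderiv_at j (tprod c' G)) = - (cls (pderiv_at j (tprod c F)) \<bullet> ?g)" by (simp add: inner_commute)
qed

section \<open>Normal contractions\<close>

text \<open>Normal contractions in the sense of Dirichlet forms, here of the complex plane.\<close>

definition nc :: "(complex => complex) => bool" where
 "nc F \<longleftrightarrow> F 0 = 0 & (ALL z w. cmod (F z - F w) <= cmod (z - w))"

definition comp :: "(complex => complex) => 'n::finite ell2 => 'n ell2" where
 "comp F x = cls (%t. F (rep x t))"

lemma nc_norm: assumes "nc F" shows "cmod (F z) <= cmod z"
proof -
 have "cmod (F z - F 0) <= cmod (z - 0)" and "F 0 = 0" using assms unfolding nc_def by blast+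
 then show ?thesis by simp
qed

lemma nc_measurable: assumes "nc F" shows "F \<in> borel_measurable borel"
proof (rule borel_measurable_continuous_onI)
 show "continuous_on UNIV F"
  unfolding continuous_on_iff
 proof (intro ballI allI impI)
  fix x e :: "_" assume "0 < (e::real)"
  then show "\<exists>d>0. \<forall>x'\<in>UNIV. dist x' x < d --> dist (F x') (F x) < e"
   using assms by (intro exI[of _ e]) (auto simp: nc_def dist_norm intro: le_less_trans)
 qed
qed

lemma nc_L2: assumes "nc F" "f \<in> L2" shows "(%t. F (f t)) \<in> L2"
proof (rule L2_dominated[OF _ assms(2), of _ 1])
 show "(%t. F (f t)) \<in> borel_measurable lebesgue"
  by (rule measurable_compose[OF L2D(1)[OF assms(2)] nc_measurable[OF assms(1)]])
qed (simp add: nc_norm[OF assms(1)])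

lemma comp_cls: assumes "nc F" "f \<in> L2" shows "comp F (cls f) = cls (%t. F (f t))"
 unfolding comp_def
proof (rule cls_eqI)
 show "AE x in lebesgue. F (rep (cls f) x) = F (f x)"
  using rep_cls[OF assms(2)] unfolding ae_eq_def by eventually_elim simp
qed (rule nc_L2[OF assms(1) rep_L2] nc_L2[OF assms])+

lemma norm_mono_ae:
 assumes "AE t in lebesgue. cmod (rep x t) <= cmod (rep y t)" shows "norm x <= norm y"
proof (rule power2_le_imp_le)
 show "(norm x)\<^sup>2 <= (norm y)\<^sup>2" unfolding rep_norm
 proof (rule integral_mono_AE)
  show "AE t in lebesgue. (cmod (rep x t))\<^sup>2 <= (cmod (rep y t))\<^sup>2"
   using assms by eventually_elim (rule power_mono, assumption, rule norm_ge_zero)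
 qed (rule L2D(2)[OF rep_L2])+
qed simp

lemma rep_comp: assumes "nc F" shows "AE t in lebesgue. rep (comp F x) t = F (rep x t)"
 using rep_cls[OF nc_L2[OF assms rep_L2[of x]]] unfolding comp_def ae_eq_def .

lemma comp_diff_norm: assumes "nc F" shows "norm (comp F x - comp F y) <= norm (x - y)"
proof (rule norm_mono_ae)
 have le: "cmod (F a - F b) <= cmod (a - b)" for a b using assms unfolding nc_def by blast
 show "AE t in lebesgue. cmod (rep (comp F x - comp F y) t) <= cmod (rep (x - y) t)"
  using rep_diff[of "comp F x" "comp F y"] rep_diff[of x y] rep_comp[OF assms, of x] rep_comp[OF assms, of y]
  by eventually_elim (simp only: le)
qed

lemma shift_comp: assumes "nc F" shows "shift c (comp F x) = comp F (shift c x)"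
 unfolding comp_def[of F x] shift_def[of c x]
 by (simp add: shift_cls comp_cls nc_L2 L2_translate assms)

text \<open>The composition inherits the Lipschitz bound for translations, so its derivative exists
  and is controlled without a chain rule.\<close>

lemma wd_comp:
 assumes wd: "wd j u g" and F: "nc F"
 obtains g' where "wd j (comp F u) g'" "norm g' <= norm g"
proof -
 have "norm (shift (h *\<^sub>R axis j 1) (comp F u) - comp F u) <= norm g * \<bar>h\<bar>" for h
  using wd_bound[OF wd, of h] comp_diff_norm[OF F, of "shift (h *\<^sub>R axis j 1) u" u] by (simp add: shift_comp[OF F])
 from wd_exists[OF this] that show thesis by metis
qed

section \<open>Multiplication by the imaginary unit\<close>

text \<open>Complex linearity of an operator on the real space \<open>ell2\<close> is expressed as
  commuting with \<open>J\<close>.\<close>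

definition J :: "'n::finite ell2 => 'n ell2" where "J x = cls (%t. \<i> * rep x t)"

lemma J_cls: assumes "f \<in> L2" shows "J (cls f) = cls (%t. \<i> * f t)"
 unfolding J_def
proof (rule cls_eqI)
 show "AE x in lebesgue. \<i> * rep (cls f) x = \<i> * f x"
  using rep_cls[OF assms] unfolding ae_eq_def by eventually_elim simp
qed (intro L2_cmult assms rep_L2)+

lemma rep_J: "AE t in lebesgue. rep (J x) t = \<i> * rep x t"
 using rep_cls[OF L2_cmult[OF rep_L2[of x]]] unfolding J_def ae_eq_def .

lemma J_J: "J (J x) = - x"
proof -
 have "J (J x) = cls (%t. complex_of_real (-1) * rep x t)"
  unfolding J_def[of x] by (subst J_cls) (simp_all add: L2_cmult flip: mult.assoc)
 also have "\<dots> = (-1) *\<^sub>R cls (rep x)" by (rule cls_scale[symmetric]) simp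
 finally show ?thesis by simp
qed

lemma J_inner: "J x \<bullet> J y = x \<bullet> y"
 unfolding J_def rep_inner[of x y] by (simp add: cls_inner L2_cmult l2_inner_cmult l2_inner_cmult_right)

lemma J_linear: "linear J"
proof (rule linearI)
 show "J (x + y) = J x + J y" for x y :: "'n::finite ell2"
 proof -
  have "x + y = cls (%t. rep x t + rep y t)" using cls_add[of "rep x" "rep y"] by simp
  then have "J (x + y) = cls (%t. \<i> * (rep x t + rep y t))" by (simp only:) (rule J_cls, simp add: L2_add)
  also have "\<dots> = J x + J y" unfolding J_def by (subst cls_add) (simp_all add: L2_cmult distrib_left)
  finally show ?thesis .
 qed
 show "J (r *\<^sub>R x) = r *\<^sub>R J x" for r and x :: "'n::finite ell2"
 proof -
  have "r *\<^sub>R x = cls (%t. complex_of_real r * rep x t)" using cls_scale[of "rep x" r] by simp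
  then have "J (r *\<^sub>R x) = cls (%t. \<i> * (complex_of_real r * rep x t))" by (simp only:) (rule J_cls, simp add: L2_cmult)
  also have "\<dots> = r *\<^sub>R J x" unfolding J_def by (subst cls_scale) (simp_all add: L2_cmult mult_ac)
  finally show ?thesis .
 qed
qed

lemma J_surj: "surj J"
proof (rule surjI[of _ "%x. - J x"])
 show "J (- J x) = x" for x :: "'n::finite ell2" using linear_neg[OF J_linear, of "J x"] by (simp add: J_J)
qed

lemma J_adj: "J x \<bullet> y = - (x \<bullet> J y)"
 using J_inner[of "J x" y] by (simp add: J_J)

lemma wd_J: assumes "wd j u g" shows "wd j (J u) (J g)"
 unfolding wd_def
proof (intro allI impI)
 fix c and F :: "'a => real => real" assume F: "tfam F"
 have Jt: "J (cls (tprod c F)) = cls (tprod (\<i> * c) F)" if "tfam F" for F :: "'a => real => real"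
  unfolding J_cls[OF test_L2[OF tprod_test[OF that]]] by (rule arg_cong[of _ _ cls]) (simp add: tprod_def fun_eq_iff)
 have "J (cls (pderiv_at j (tprod c F))) = cls (pderiv_at j (tprod (\<i> * c) F))"
  unfolding pderiv_tprod[OF F] by (rule Jt[OF tfam_deriv[OF F]])
 then show "J u \<bullet> cls (pderiv_at j (tprod c F)) = - (J g \<bullet> cls (tprod c F))"
  using assms F by (simp add: J_adj Jt wd_def)
qed

section \<open>Comparison with weak gradients of functions\<close>

lemma is_weak_gradient_unique:
 assumes "is_weak_gradient f G" "is_weak_gradient f G'"
 shows "AE x in lebesgue. G x = G' x"
proof -
 have "AE x in lebesgue. G x $ j - G' x $ j = 0" for j
 proof (rule test_functions_separate)
  have l: "locally_integrable (%x. G x $ j)" "locally_integrable (%x. G' x $ j)"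
   using assms by (auto simp: is_weak_gradient_def)
  then show "locally_integrable (%x. G x $ j - G' x $ j)"
   unfolding locally_integrable_def by (auto intro: set_integral_diff)
  fix F :: "'a => real => real" assume F: "tfam F"
  have \<phi>: "tprod 1 F \<in> test_functions" by (rule tprod_test[OF F])
  have int: "integrable lebesgue (%x. g x * tprod 1 F x)" if g: "locally_integrable g" for g
  proof -
   obtain R where R: "0 < R" "!!x. R < norm x ==> tprod 1 F x = 0" using test_support[OF \<phi>] by metis
   obtain M where M: "0 <= M" "!!x. cmod (tprod 1 F x) <= M" using test_bounded[OF \<phi>] by metis
   have gi: "integrable lebesgue (%x. indicator (cball 0 R) x *\<^sub>R g x)"
    using g unfolding locally_integrable_def set_integrable_def by auto
   have e: "(%x. g x * tprod 1 F x) = (%x. indicator (cball 0 R) x *\<^sub>R g x * tprod 1 F x)"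
    using R(2) by (auto simp: fun_eq_iff indicator_def not_le)
   show ?thesis unfolding e
   proof (rule Bochner_Integration.integrable_bound[OF integrable_mult_right[OF integrable_norm[OF gi], of M]])
    show "(%x. indicator (cball 0 R) x *\<^sub>R g x * tprod 1 F x) \<in> borel_measurable lebesgue"
     by (intro borel_measurable_times borel_measurable_integrable[OF gi] L2D(1) test_L2 \<phi>)
    show "AE x in lebesgue. norm (indicator (cball 0 R) x *\<^sub>R g x * tprod 1 F x) <= norm (M * norm (indicator (cball 0 R) x *\<^sub>R g x))"
    proof (rule AE_I2)
     fix x
     have "norm (indicator (cball 0 R) x *\<^sub>R g x) * cmod (tprod 1 F x) <= norm (indicator (cball 0 R) x *\<^sub>R g x) * M"
      by (intro mult_left_mono M) simp
     then show "norm (indicator (cball 0 R) x *\<^sub>R g x * tprod 1 F x) <= norm (M * norm (indicator (cball 0 R) x *\<^sub>R g x))"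
      using M(1) by (simp add: norm_mult mult_ac)
    qed
   qed
  qed
  have "(\<integral>x. f x * pderiv_at j (tprod 1 F) x \<partial>lebesgue) = - (\<integral>x. G x $ j * tprod 1 F x \<partial>lebesgue)"
   "(\<integral>x. f x * pderiv_at j (tprod 1 F) x \<partial>lebesgue) = - (\<integral>x. G' x $ j * tprod 1 F x \<partial>lebesgue)"
   using assms \<phi> by (auto simp: is_weak_gradient_def)
  then show "(\<integral>x. (G x $ j - G' x $ j) * tprod 1 F x \<partial>lebesgue) = 0"
   using int[OF l(1)] int[OF l(2)] by (simp add: left_diff_distrib)
 qed
 then have "AE x in lebesgue. ALL j. G x $ j - G' x $ j = 0" by (simp add: AE_all_countable AE_finite_all)
 then show ?thesis by eventually_elim (simp add: vec_eq_iff)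
qed

lemma wd_if_weak_gradient:
 assumes f: "f \<in> L2" and G: "is_weak_gradient f G" and Gj: "(%x. G x $ j) \<in> L2"
 shows "wd j (cls f) (cls (%x. G x $ j))"
 unfolding wd_def
proof (intro allI impI)
 fix c and F :: "'a => real => real" assume F: "tfam F"
 have t: "tprod c' F \<in> test_functions" for c' by (rule tprod_test[OF F])
 have "cls f \<bullet> cls (pderiv_at j (tprod c F)) = Re (\<integral>x. f x * pderiv_at j (tprod (cnj c) F) x \<partial>lebesgue)"
  using cls_inner[OF f test_L2[OF pderiv_test[OF t, of j c]]] by (simp add: l2_inner_def pderiv_tprod[OF F] cnj_tprod)
 also have "\<dots> = - Re (\<integral>x. G x $ j * tprod (cnj c) F x \<partial>lebesgue)"
  using G t by (simp add: is_weak_gradient_def)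
 also have "\<dots> = - (cls (%x. G x $ j) \<bullet> cls (tprod c F))"
  using cls_inner[OF Gj test_L2[OF t, of c]] by (simp add: l2_inner_def cnj_tprod)
 finally show "cls f \<bullet> cls (pderiv_at j (tprod c F)) = - (cls (%x. G x $ j) \<bullet> cls (tprod c F))" .
qed

lemma weak_gradient_if_wd:
 assumes f: "f \<in> L2" and wd: "!!j. wd j (cls f) (g j)"
 shows "is_weak_gradient f (%x. \<chi> j. rep (g j) x)"
 unfolding is_weak_gradient_def
proof (intro allI conjI ballI)
 fix j
 show "locally_integrable (%x. (\<chi> j. rep (g j) x) $ j)" using L2_locally_integrable[OF rep_L2[of "g j"]] by simp
 fix \<phi> :: "real^'a => complex" assume \<phi>: "\<phi> \<in> test_functions"
 have "(\<integral>x. f x * pderiv_at j \<phi> x \<partial>lebesgue) = (\<integral>x. rep (cls f) x * pderiv_at j \<phi> x \<partial>lebesgue)"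
 proof (rule integral_cong_AE)
  show "AE x in lebesgue. f x * pderiv_at j \<phi> x = rep (cls f) x * pderiv_at j \<phi> x"
   using rep_cls[OF f] unfolding ae_eq_def by eventually_elim simp
 qed (intro borel_measurable_times L2D(1) f rep_L2 test_L2 pderiv_test \<phi>)+
 then show "(\<integral>x. f x * pderiv_at j \<phi> x \<partial>lebesgue) = - (\<integral>x. (\<chi> j. rep (g j) x) $ j * \<phi> x \<partial>lebesgue)"
  using wd_integral[OF wd \<phi>] by simp
qed

section \<open>The closed form and its resolvent\<close>

lemma ell2_AE_subseq:
 fixes X :: "nat => 'n::finite ell2"
 assumes X: "X \<longlonglongrightarrow> x"
 obtains r where "strict_mono r" "AE t in lebesgue. (%n. rep (X (r n)) t) \<longlonglongrightarrow> rep x t"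
proof -
 have L: "(%t. rep (X n) t - rep x t) \<in> L2" for n by (intro L2_diff rep_L2)
 have "(%n. norm (X n - x)) \<longlonglongrightarrow> 0" using X by (rule LIM_zero[THEN tendsto_norm_zero])
 then have "(%n. (norm (X n - x))\<^sup>2) \<longlonglongrightarrow> 0\<^sup>2" by (rule tendsto_power)
 moreover have "(norm (X n - x))\<^sup>2 = (\<integral>t. norm ((cmod (rep (X n) t - rep x t))\<^sup>2) \<partial>lebesgue)" for n
  using cls_norm[OF L[of n]] cls_diff[OF rep_L2 rep_L2, of "X n" x] by simp
 ultimately have "(%n. \<integral>t. norm ((cmod (rep (X n) t - rep x t))\<^sup>2) \<partial>lebesgue) \<longlonglongrightarrow> 0" by simp
 from tendsto_L1_AE_subseq[OF L2D(2)[OF L] this]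
 obtain r where r: "strict_mono r" "AE t in lebesgue. (%n. (cmod (rep (X (r n)) t - rep x t))\<^sup>2) \<longlonglongrightarrow> 0" by blast
 from r(2) have "AE t in lebesgue. (%n. rep (X (r n)) t) \<longlonglongrightarrow> rep x t"
 proof eventually_elim
  case (elim t)
  then have "(%n. sqrt ((cmod (rep (X (r n)) t - rep x t))\<^sup>2)) \<longlonglongrightarrow> sqrt 0" by (rule tendsto_real_sqrt)
  then show ?case by (simp add: LIM_zero_iff tendsto_norm_zero_iff)
 qed
 with r(1) that show thesis by blast
qed

definition nonneg :: "'n::finite ell2 => bool" where
 "nonneg x \<longleftrightarrow> (AE t in lebesgue. Im (rep x t) = 0 & 0 <= Re (rep x t))"

text \<open>Asking this of both F and z - F z gives norm (g - g') <= norm g for the derivatives g of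
  u and g' of F(u), hence g \<bullet> g' >= 0 by \<open>half_inner\<close>. This is the energy
  inequality that is usually drawn from the chain rule.\<close>

definition mc :: "(complex => complex) => bool" where
 "mc F \<longleftrightarrow> nc F & nc (%z. z - F z)"

text \<open>This map and \<open>cut\<close> also discard the imaginary part, so being a fixed point
  includes being real valued.\<close>

definition cpos :: "complex => complex" where "cpos z = complex_of_real (max 0 (Re z))"
definition cut :: "real => complex => complex" where "cut e z = complex_of_real (min e (max 0 (Re z)))"

lemma cmod_mono: assumes "\<bar>Re z\<bar> <= \<bar>Re w\<bar>" "\<bar>Im z\<bar> <= \<bar>Im w\<bar>" shows "cmod z <= cmod w"
 unfolding cmod_def using assms by (intro real_sqrt_le_mono add_mono) (simp_all add: abs_le_square_iff)

lemma mc_cpos: "mc cpos"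
 unfolding mc_def nc_def cpos_def by (auto intro!: cmod_mono)

lemma mc_cut: "0 < e ==> mc (cut e)"
 unfolding mc_def nc_def cut_def by (auto intro!: cmod_mono)

lemma mc_nc: "mc F ==> nc F" by (simp add: mc_def)

lemma nonneg_cpos_iff: "nonneg x \<longleftrightarrow> comp cpos x = x"
proof
 assume n: "nonneg x"
 have "AE t in lebesgue. rep (comp cpos x) t = rep x t"
  using n[unfolded nonneg_def] rep_comp[OF mc_nc[OF mc_cpos], of x]
  by eventually_elim (simp add: cpos_def complex_eq_iff)
 then show "comp cpos x = x" by (simp add: rep_eq_iff ae_eq_def)
next
 assume *: "comp cpos x = x"
 have "AE t in lebesgue. rep x t = cpos (rep x t)" using rep_comp[OF mc_nc[OF mc_cpos], of x] by (simp only: *)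
 then show "nonneg x" unfolding nonneg_def
  by eventually_elim (metis Im_complex_of_real Re_complex_of_real cpos_def max.cobounded1)
qed

lemma nonneg_comp_cpos: "nonneg (comp cpos x)"
 unfolding nonneg_def using rep_comp[OF mc_nc[OF mc_cpos], of x]
 by eventually_elim (simp add: cpos_def)

lemma nonneg_comp_cut: assumes "0 < e" shows "nonneg (comp (cut e) x)"
 unfolding nonneg_def using rep_comp[OF mc_nc[OF mc_cut[OF assms]], of x]
 by eventually_elim (use assms in \<open>simp add: cut_def\<close>)

lemma closed_nonneg: "closed {x. nonneg x}"
proof -
 have "continuous_on UNIV (comp cpos :: 'a::finite ell2 => _)"
  unfolding continuous_on_iff dist_norm
  using le_less_trans[OF comp_diff_norm[OF mc_nc[OF mc_cpos]]] by blast
 then show ?thesis unfolding nonneg_cpos_iff by (intro closed_Collect_eq continuous_on_id)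
qed

lemma nonneg_add: "nonneg x ==> nonneg y ==> nonneg (x + y)"
 unfolding nonneg_def using rep_add[of x y] by (auto elim!: eventually_elim2[THEN eventually_rev_mp, rotated] simp: eventually_conj_iff)

lemma nonneg_inner: assumes "nonneg x" "nonneg y" shows "0 <= x \<bullet> y"
proof -
 have "x \<bullet> y = (\<integral>t. Re (rep x t * cnj (rep y t)) \<partial>lebesgue)"
  unfolding rep_inner l2_inner_def by (rule integral_Re[symmetric]) (rule L2_integrable[OF rep_L2 rep_L2])
 also have "\<dots> \<ge> 0"
 proof (rule integral_nonneg_AE)
  show "AE t in lebesgue. 0 <= Re (rep x t * cnj (rep y t))"
   using assms unfolding nonneg_def by eventually_elim simp
 qed
 finally show ?thesis .
qed

lemma nonneg_inner_integral:
 assumes "nonneg x" "nonneg y"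
 shows "(\<integral>\<^sup>+t. ennreal (Re (rep x t)) * ennreal (Re (rep y t)) \<partial>lebesgue) = ennreal (x \<bullet> y)"
proof -
 have ae: "AE t in lebesgue. 0 <= Re (rep x t * cnj (rep y t)) & ennreal (Re (rep x t)) * ennreal (Re (rep y t)) = ennreal (Re (rep x t * cnj (rep y t)))"
  using assms unfolding nonneg_def by eventually_elim (simp add: ennreal_mult)
 have "(\<integral>\<^sup>+t. ennreal (Re (rep x t)) * ennreal (Re (rep y t)) \<partial>lebesgue) = (\<integral>\<^sup>+t. ennreal (Re (rep x t * cnj (rep y t))) \<partial>lebesgue)"
  by (rule nn_integral_cong_AE) (use ae in eventually_elim, blast)
 also have "\<dots> = ennreal (\<integral>t. Re (rep x t * cnj (rep y t)) \<partial>lebesgue)"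
 proof (rule nn_integral_eq_integral)
  show "integrable lebesgue (%t. Re (rep x t * cnj (rep y t)))" by (rule integrable_Re) (rule L2_integrable[OF rep_L2 rep_L2])
  show "AE t in lebesgue. 0 <= Re (rep x t * cnj (rep y t))" using ae by eventually_elim blast
 qed
 also have "(\<integral>t. Re (rep x t * cnj (rep y t)) \<partial>lebesgue) = x \<bullet> y"
  unfolding rep_inner l2_inner_def by (rule integral_Re) (rule L2_integrable[OF rep_L2 rep_L2])
 finally show ?thesis .
qed

lemma half_inner:
 fixes x y :: "'a::real_inner"
 assumes "norm (x - y) <= norm x" shows "0 <= x \<bullet> y"
proof -
 have "(norm (x - y))\<^sup>2 <= (norm x)\<^sup>2" using assms by (intro power_mono) auto
 then have "y \<bullet> y <= 2 * (x \<bullet> y)" by (simp add: power2_norm_eq_inner inner_diff inner_commute)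
 then show ?thesis using inner_ge_zero[of y] by linarith
qed

lemma comp_minus: assumes "mc F" shows "comp (%z. z - F z) x = x - comp F x"
 using cls_diff[OF rep_L2 nc_L2[OF mc_nc[OF assms] rep_L2], of x x] by (simp add: comp_def)

lemma wd_mc:
 assumes F: "mc F" and u: "wd j u g" "wd j (comp F u) g'"
 shows "0 <= g \<bullet> g'" "norm g' <= norm g"
proof -
 obtain h where h: "wd j (comp (%z. z - F z) u) h" "norm h <= norm g"
  using wd_comp[OF u(1), of "%z. z - F z"] F unfolding mc_def by metis
 have "wd j (u + (-1) *\<^sub>R comp F u) (g + (-1) *\<^sub>R g')" by (intro wd_add wd_scale u)
 then have "wd j (comp (%z. z - F z) u) (g - g')" unfolding comp_minus[OF F] by simp
 then have "h = g - g'" using wd_unique h(1) by blast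
 then show "0 <= g \<bullet> g'" using h(2) half_inner by blast
 obtain k where "wd j (comp F u) k" "norm k <= norm g" using wd_comp[OF u(1) mc_nc[OF F]] by metis
 then show "norm g' <= norm g" using wd_unique[OF u(2)] by blast
qed

lemma locally_integrable_measurable:
 fixes f :: "real^'n => 'b::{banach, second_countable_topology}"
 assumes "locally_integrable f" shows "f \<in> borel_measurable lebesgue"
proof (rule borel_measurable_LIMSEQ_metric)
 fix n
 have "integrable lebesgue (%x. indicator (cball 0 (real n)) x *\<^sub>R f x)"
  using assms unfolding locally_integrable_def set_integrable_def by auto
 then show "(%x. indicator (cball 0 (real n)) x *\<^sub>R f x) \<in> borel_measurable lebesgue" by (rule borel_measurable_integrable)
next
 fix x :: "real^'n"
 obtain N :: nat where N: "norm x < real N" using reals_Archimedean2 by blast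
 have "indicator (cball 0 (real n)) x *\<^sub>R f x = f x" if "n \<ge> N" for n
  using N that by (simp add: indicator_def)
 then have "eventually (%n. indicator (cball 0 (real n)) x *\<^sub>R f x = f x) sequentially"
  unfolding eventually_sequentially by blast
 then show "(%n. indicator (cball 0 (real n)) x *\<^sub>R f x) \<longlonglongrightarrow> f x" by (rule tendsto_eventually)
qed

locale schroedinger =
 fixes V :: "real^'n::finite => real"
 assumes V_int: "locally_integrable V" and V_pos: "AE x in lebesgue. 0 <= V x"
begin

lemma V_measurable [measurable]: "V \<in> borel_measurable lebesgue"
 by (rule locally_integrable_measurable[OF V_int])

definition sV :: "real^'n => complex" where "sV x = complex_of_real (sqrt (V x))"

lemma sV_measurable [measurable]: "sV \<in> borel_measurable lebesgue"
proof -
 have "(%x. complex_of_real (sqrt (V x))) \<in> borel_measurable lebesgue" by measurable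
 then show ?thesis unfolding sV_def[abs_def] .
qed

text \<open>The graph of the map from u to its gradient divided by sqrt 2 and to sqrt V u. The real
  part of the form is the inner product of these components, and closedness of the form is
  closedness of this set.\<close>

definition D :: "('n ell2 \<times> (('n ell2)^'n) \<times> 'n ell2) set" where
 "D = {(u, p, q). (ALL j. wd j u (sqrt 2 *\<^sub>R p $ j)) & ae_eq (rep q) (%x. sV x * rep u x)}"

lemma D_iff: "(u, p, q) \<in> D \<longleftrightarrow> (ALL j. wd j u (sqrt 2 *\<^sub>R p $ j)) & (AE x in lebesgue. rep q x = sV x * rep u x)"
 by (simp add: D_def ae_eq_def)

lemma D_add:
 assumes "(u, w) \<in> D" "(u', w') \<in> D" shows "(u + u', w + w') \<in> D"
proof -
 obtain p q p' q' where w: "w = (p, q)" "w' = (p', q')" by (metis surj_pair)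
 have "wd j (u + u') (sqrt 2 *\<^sub>R (p + p') $ j)" for j
  using wd_add[of j u "sqrt 2 *\<^sub>R p $ j" u' "sqrt 2 *\<^sub>R p' $ j"] assms by (simp add: w D_iff scaleR_add_right)
 moreover have "AE x in lebesgue. rep (q + q') x = sV x * rep (u + u') x"
  using rep_add[of q q'] rep_add[of u u'] assms(1)[unfolded w D_iff, THEN conjunct2] assms(2)[unfolded w D_iff, THEN conjunct2]
  by eventually_elim (simp add: distrib_left)
 ultimately show ?thesis by (simp add: w D_iff)
qed

lemma D_scale:
 assumes "(u, w) \<in> D" shows "(r *\<^sub>R u, r *\<^sub>R w) \<in> D"
proof -
 obtain p q where w: "w = (p, q)" by (metis surj_pair)
 have "wd j (r *\<^sub>R u) (sqrt 2 *\<^sub>R (r *\<^sub>R p) $ j)" for j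
  using wd_scale[of j u "sqrt 2 *\<^sub>R p $ j" r] assms by (simp add: w D_iff mult.commute)
 moreover have "AE x in lebesgue. rep (r *\<^sub>R q) x = sV x * rep (r *\<^sub>R u) x"
  using rep_scale[of r q] rep_scale[of r u] assms[unfolded w D_iff, THEN conjunct2]
  by eventually_elim (simp add: mult_ac)
 ultimately show ?thesis by (simp add: w D_iff)
qed

lemma D_zero: "(0, 0) \<in> D"
proof -
 have "AE x in lebesgue. rep 0 x = sV x * rep 0 x" using rep_zero by eventually_elim simp
 then show ?thesis by (simp add: D_iff wd_zero zero_prod_def)
qed

lemma D_diff: "(u, w) \<in> D ==> (u', w') \<in> D ==> (u - u', w - w') \<in> D"
 using D_add[of u w "(-1) *\<^sub>R u'" "(-1) *\<^sub>R w'"] D_scale[of u' w' "-1"] by simp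

lemma D_J:
 assumes "(u, p, q) \<in> D" shows "(J u, (\<chi> j. J (p $ j)), J q) \<in> D"
proof -
 have "wd j (J u) (sqrt 2 *\<^sub>R (\<chi> j. J (p $ j)) $ j)" for j
  using wd_J[of j u "sqrt 2 *\<^sub>R p $ j"] assms by (simp add: D_iff linear_scale[OF J_linear])
 moreover have "AE x in lebesgue. rep (J q) x = sV x * rep (J u) x"
  using rep_J[of q] rep_J[of u] assms[unfolded D_iff, THEN conjunct2] by eventually_elim simp
 ultimately show ?thesis by (simp add: D_iff)
qed

lemma closed_D: "closed D"
 unfolding closed_sequential_limits
proof (intro allI impI, elim conjE)
 fix X and l :: "'n ell2 \<times> (('n ell2)^'n) \<times> 'n ell2"
 assume X: "ALL n. X n \<in> D" and lim: "X \<longlonglongrightarrow> l"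
 obtain u p q where l: "l = (u, p, q)" by (metis surj_pair)
 define U P Q where "U n = fst (X n)" and "P n = fst (snd (X n))" and "Q n = snd (snd (X n))" for n
 have XD: "(U n, P n, Q n) \<in> D" for n using X by (simp add: U_def P_def Q_def)
 have U: "U \<longlonglongrightarrow> u" and P: "P \<longlonglongrightarrow> p" and Q: "Q \<longlonglongrightarrow> q"
  using tendsto_fst[OF lim] tendsto_fst[OF tendsto_snd[OF lim]] tendsto_snd[OF tendsto_snd[OF lim]]
  unfolding l U_def[abs_def] P_def[abs_def] Q_def[abs_def] fst_conv snd_conv .
 have "wd j u (sqrt 2 *\<^sub>R p $ j)" for j
 proof -
  have "(%n. (U n, sqrt 2 *\<^sub>R P n $ j)) \<longlonglongrightarrow> (u, sqrt 2 *\<^sub>R p $ j)"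
   by (rule tendsto_Pair[OF U tendsto_scaleR[OF tendsto_const tendsto_vec_nth[OF P]]])
  from closed_sequentially[OF closed_wd _ this, of j] XD show ?thesis by (simp add: D_iff)
 qed
 moreover have "AE x in lebesgue. rep q x = sV x * rep u x"
 proof -
  obtain r where r: "strict_mono r" "AE t in lebesgue. (%n. rep (U (r n)) t) \<longlonglongrightarrow> rep u t"
   by (rule ell2_AE_subseq[OF U], rule that)
  have Qr: "(%n. Q (r n)) \<longlonglongrightarrow> q" using LIMSEQ_subseq_LIMSEQ[OF Q r(1)] by (simp add: o_def)
  obtain s where s: "strict_mono s" "AE t in lebesgue. (%n. rep (Q (r (s n))) t) \<longlonglongrightarrow> rep q t"
   by (rule ell2_AE_subseq[OF Qr], rule that)
  have "AE t in lebesgue. ALL n. rep (Q n) t = sV t * rep (U n) t"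
   unfolding AE_all_countable using XD by (simp add: D_iff)
  then show ?thesis using r(2) s(2)
  proof eventually_elim
   case (elim t)
   have "(%n. rep (U (r (s n))) t) \<longlonglongrightarrow> rep u t"
    using LIMSEQ_subseq_LIMSEQ[OF elim(2) s(1)] by (simp add: o_def)
   then have "(%n. sV t * rep (U (r (s n))) t) \<longlonglongrightarrow> sV t * rep u t" by (intro tendsto_mult tendsto_const)
   then have "(%n. rep (Q (r (s n))) t) \<longlonglongrightarrow> sV t * rep u t" using elim(1) by simp
   then show ?case using LIMSEQ_unique elim(3) by blast
  qed
 qed
 ultimately show "l \<in> D" by (simp add: l D_iff)
qed

text \<open>Contractions act componentwise: by \<open>wd_mc\<close> on the gradient and by pointwise
  domination on sqrt V u. The last conclusion concerns the gradient alone, whose term is discarded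
  in \<open>V_bound\<close>.\<close>

lemma D_mc:
 assumes uw: "(u, w) \<in> D" and F: "mc F"
 obtains z where "(comp F u, z) \<in> D" "0 <= w \<bullet> z" "norm z <= norm w"
  "0 <= fst w \<bullet> fst z"
proof -
 obtain p q where w: "w = (p, q)" by (metis surj_pair)
 have wd: "wd j u (sqrt 2 *\<^sub>R p $ j)" for j using uw by (simp add: w D_iff)
 have q: "AE x in lebesgue. rep q x = sV x * rep u x" using uw by (simp add: w D_iff)
 have "EX h. wd j (comp F u) h" for j by (rule wd_comp[OF wd mc_nc[OF F], of j]) blast
 then obtain g where g: "!!j. wd j (comp F u) (g j)" by metis
 define p' where "p' = (\<chi> j. (1 / sqrt 2) *\<^sub>R g j)"
 have p': "sqrt 2 *\<^sub>R p' $ j = g j" for j by (simp add: p'_def)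
 have sL: "(%x. sV x * F (rep u x)) \<in> L2"
 proof (rule L2_dominated[of _ "rep q" 1])
  show "(%x. sV x * F (rep u x)) \<in> borel_measurable lebesgue"
   using L2D(1)[OF nc_L2[OF mc_nc[OF F] rep_L2[of u]]] by measurable
  show "AE x in lebesgue. cmod (sV x * F (rep u x)) <= 1 * cmod (rep q x)"
   using q by eventually_elim (simp add: norm_mult mult_left_mono nc_norm[OF mc_nc[OF F]])
 qed simp
 define q' where "q' = cls (%x. sV x * F (rep u x))"
 have rq': "AE x in lebesgue. rep q' x = sV x * F (rep u x)"
  using rep_cls[OF sL] unfolding q'_def ae_eq_def .
 have D: "(comp F u, p', q') \<in> D"
 proof -
  have "AE x in lebesgue. rep q' x = sV x * rep (comp F u) x"
   using rq' rep_comp[OF mc_nc[OF F], of u] by eventually_elim simp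
  then show ?thesis by (simp add: D_iff p' g)
 qed
 have pj: "0 <= p $ j \<bullet> p' $ j" "norm (p' $ j) <= norm (p $ j)" for j
  using wd_mc[OF F wd g, of j] unfolding p'[symmetric] by (simp_all add: zero_le_mult_iff)
 have F': "nc (%z. z - F z)" using F by (simp add: mc_def)
 have qq: "0 <= q \<bullet> q'"
 proof (rule half_inner, rule norm_mono_ae)
  show "AE t in lebesgue. cmod (rep (q - q') t) <= cmod (rep q t)"
   using rep_diff[of q q'] q rq'
  proof eventually_elim
   case (elim t)
   have "rep (q - q') t = sV t * (rep u t - F (rep u t))" using elim by (simp add: right_diff_distrib)
   then show ?case using nc_norm[OF F', of "rep u t"] elim by (simp add: norm_mult mult_left_mono)
  qed
 qed
 have nq: "norm q' <= norm q"
 proof (rule norm_mono_ae)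
  show "AE t in lebesgue. cmod (rep q' t) <= cmod (rep q t)"
   using q rq' by eventually_elim (simp add: norm_mult mult_left_mono nc_norm[OF mc_nc[OF F]])
 qed
 have pp: "0 <= p \<bullet> p'" unfolding inner_vec_def by (intro sum_nonneg pj)
 have np: "norm p' <= norm p" unfolding norm_vec_def by (rule L2_set_mono) (use pj in auto)
 show thesis
 proof (rule that[OF D])
  show "0 <= w \<bullet> (p', q')" using pp qq by (simp add: w inner_prod_def)
  show "norm (p', q') <= norm w" unfolding w norm_prod_def fst_conv snd_conv
   by (intro real_sqrt_le_mono add_mono power_mono np nq norm_ge_zero)
  show "0 <= fst w \<bullet> fst (p', q')" using pp by (simp add: w)
 qed
qed

text \<open>Local integrability of V puts the test functions into the form domain; that is why the
  domain is dense and the resolvent injective, see \<open>R_inj\<close>.\<close>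

lemma D_tprod:
 assumes F: "tfam F" obtains w where "(cls (tprod c F), w) \<in> D"
proof -
 let ?\<phi> = "tprod c F"
 have \<phi>: "?\<phi> \<in> test_functions" by (rule tprod_test[OF F])
 have \<phi>m [measurable]: "?\<phi> \<in> borel_measurable lebesgue" by (rule L2D(1)[OF test_L2[OF \<phi>]])
 obtain R where R: "0 < R" "!!x. R < norm x ==> ?\<phi> x = 0" using test_support[OF \<phi>] by metis
 obtain M where M: "0 <= M" "!!x. cmod (?\<phi> x) <= M" using test_bounded[OF \<phi>] by metis
 have "(%x. sV x * ?\<phi> x) \<in> L2"
 proof -
  have Vi: "integrable lebesgue (%x. indicator (cball 0 R) x *\<^sub>R V x)"
   using V_int unfolding locally_integrable_def set_integrable_def by auto
  have "integrable lebesgue (%x. (cmod (sV x * ?\<phi> x))\<^sup>2)"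
  proof (rule Bochner_Integration.integrable_bound[OF integrable_mult_right[OF Vi, of "M\<^sup>2"]])
   show "AE x in lebesgue. norm ((cmod (sV x * ?\<phi> x))\<^sup>2) <= norm (M\<^sup>2 * (indicator (cball 0 R) x *\<^sub>R V x))"
    using V_pos
   proof eventually_elim
    case (elim x)
    have "(cmod (?\<phi> x))\<^sup>2 <= M\<^sup>2 * indicator (cball 0 R) x"
     using M(2)[of x] R(2)[of x] power_mono[OF M(2)[of x], of 2] by (cases "norm x <= R") auto
    then have "V x * (cmod (?\<phi> x))\<^sup>2 <= V x * (M\<^sup>2 * indicator (cball 0 R) x)" by (rule mult_left_mono[OF _ elim])
    then show ?case using elim by (simp add: sV_def norm_mult power_mult_distrib mult_ac)
   qed
  qed measurable
  then show ?thesis by (simp add: L2_def)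
 qed
 then have q: "ae_eq (rep (cls (%x. sV x * ?\<phi> x))) (%x. sV x * ?\<phi> x)" by (rule rep_cls)
 define p where "p = (\<chi> j. (1 / sqrt 2) *\<^sub>R cls (pderiv_at j ?\<phi>))"
 have "wd j (cls ?\<phi>) (sqrt 2 *\<^sub>R p $ j)" for j using wd_tprod[OF F, of j c] by (simp add: p_def)
 moreover have "AE x in lebesgue. rep (cls (%x. sV x * ?\<phi> x)) x = sV x * rep (cls ?\<phi>) x"
  using q rep_cls[OF test_L2[OF \<phi>]] unfolding ae_eq_def by eventually_elim simp
 ultimately have "(cls ?\<phi>, p, cls (%x. sV x * ?\<phi> x)) \<in> D" by (simp add: D_iff)
 with that show thesis by blast
qed

text \<open>Rescaling the first component turns the form \<open>l * (u \<bullet> v) + w \<bullet> z\<close> on the graph \<open>D\<close> into the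
  inner product of the ambient Hilbert space.\<close>

definition Dsc :: "real => ('n ell2 \<times> (('n ell2)^'n) \<times> 'n ell2) set" where
 "Dsc l = {(u, w). ((1 / sqrt l) *\<^sub>R u, w) \<in> D}"

lemma Dsc_iff: "0 < l ==> (sqrt l *\<^sub>R u, w) \<in> Dsc l \<longleftrightarrow> (u, w) \<in> D"
 by (simp add: Dsc_def)

lemma closed_Dsc: "closed (Dsc l)"
proof -
 have "Dsc l = (%x. ((1 / sqrt l) *\<^sub>R fst x, snd x)) -` D" by (auto simp: Dsc_def)
 then show ?thesis
  using continuous_closed_vimage[OF closed_D, of "%x. ((1 / sqrt l) *\<^sub>R fst x, snd x)"]
  by (simp add: continuous_intros)
qed

lemma subspace_Dsc: "subspace (Dsc l)"
proof (rule subspaceI)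
 show "0 \<in> Dsc l" using D_zero by (simp add: Dsc_def zero_prod_def)
next
 fix x y assume "x \<in> Dsc l" "y \<in> Dsc l"
 then show "x + y \<in> Dsc l"
  using D_add[of "(1 / sqrt l) *\<^sub>R fst x" "snd x" "(1 / sqrt l) *\<^sub>R fst y" "snd y"]
  by (cases x; cases y) (simp add: Dsc_def scaleR_add_right)
next
 fix c x assume "x \<in> Dsc l"
 then show "c *\<^sub>R x \<in> Dsc l"
  using D_scale[of "(1 / sqrt l) *\<^sub>R fst x" "snd x" c] by (cases x) (simp add: Dsc_def mult.commute)
qed

text \<open>Project (f / sqrt l, 0) onto the rescaled graph: orthogonality of the residual is the
  weak form of (l + L) u = f.\<close>

lemma resolvent_exists:
 assumes l: "0 < l"
 obtains u w where "(u, w) \<in> D" "!!v z. (v, z) \<in> D ==> l * (u \<bullet> v) + w \<bullet> z = f \<bullet> v"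
proof -
 let ?x = "((1 / sqrt l) *\<^sub>R f, 0) :: 'n ell2 \<times> (('n ell2)^'n) \<times> 'n ell2"
 obtain p where p: "p \<in> Dsc l" "!!y. y \<in> Dsc l ==> (?x - p) \<bullet> y = 0"
  by (rule subspace_projection[OF closed_Dsc subspace_Dsc, of l ?x]) blast
 define u w where "u = (1 / sqrt l) *\<^sub>R fst p" and "w = snd p"
 have pe: "p = (sqrt l *\<^sub>R u, w)" using l by (simp add: u_def w_def)
 have sl: "sqrt l * sqrt l = l" using l by simp
 have "l * (u \<bullet> v) + w \<bullet> z = f \<bullet> v" if "(v, z) \<in> D" for v z
 proof -
  have "(?x - p) \<bullet> (sqrt l *\<^sub>R v, z) = 0" using p(2) that l by (simp add: Dsc_iff)
  moreover have "((1 / sqrt l) *\<^sub>R f - sqrt l *\<^sub>R u) \<bullet> (sqrt l *\<^sub>R v) = f \<bullet> v - (sqrt l * sqrt l) * (u \<bullet> v)"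
   using l by (simp add: inner_diff_left right_diff_distrib)
  ultimately have "f \<bullet> v - (sqrt l * sqrt l) * (u \<bullet> v) - w \<bullet> z = 0"
   by (simp only: pe diff_Pair inner_Pair diff_0 inner_minus_left)
  then show ?thesis unfolding sl by simp
 qed
 moreover have "(u, w) \<in> D" using p(1) l by (simp add: pe Dsc_iff)
 ultimately show thesis using that by blast
qed

lemma form_unique:
 assumes l: "0 < l" and u: "(u, w) \<in> D" "(u', w') \<in> D"
  and eq: "!!v z. (v, z) \<in> D ==> l * (u \<bullet> v) + w \<bullet> z = l * (u' \<bullet> v) + w' \<bullet> z"
 shows "u = u'" "w = w'"
proof -
 have "l * ((u - u') \<bullet> (u - u')) + (w - w') \<bullet> (w - w') = 0"
  using eq[OF D_diff[OF u]] by (simp add: inner_diff_left right_diff_distrib)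
 moreover have "0 <= l * ((u - u') \<bullet> (u - u'))" "0 <= (w - w') \<bullet> (w - w')" using l by simp_all
 ultimately have "l * ((u - u') \<bullet> (u - u')) = 0" "(w - w') \<bullet> (w - w') = 0" by linarith+
 then show "u = u'" "w = w'" using l by simp_all
qed

definition R :: "real => 'n ell2 => 'n ell2" where
 "R l f = (SOME u. EX w. (u, w) \<in> D & (ALL v z. (v, z) \<in> D --> l * (u \<bullet> v) + w \<bullet> z = f \<bullet> v))"

lemma R_spec:
 assumes "0 < l"
 obtains w where "(R l f, w) \<in> D" "!!v z. (v, z) \<in> D ==> l * (R l f \<bullet> v) + w \<bullet> z = f \<bullet> v"
proof -
 have "EX u w. (u, w) \<in> D & (ALL v z. (v, z) \<in> D --> l * (u \<bullet> v) + w \<bullet> z = f \<bullet> v)"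
  by (rule resolvent_exists[OF assms, of f]) blast
 then have "EX w. (R l f, w) \<in> D & (ALL v z. (v, z) \<in> D --> l * (R l f \<bullet> v) + w \<bullet> z = f \<bullet> v)"
  unfolding R_def by (rule someI_ex)
 with that show thesis by blast
qed

lemma R_eqI:
 assumes l: "0 < l" and u: "(u, w) \<in> D" and eq: "!!v z. (v, z) \<in> D ==> l * (u \<bullet> v) + w \<bullet> z = f \<bullet> v"
 shows "R l f = u"
proof -
 obtain w' where w': "(R l f, w') \<in> D" "!!v z. (v, z) \<in> D ==> l * (R l f \<bullet> v) + w' \<bullet> z = f \<bullet> v"
  by (rule R_spec[OF l, of f]) blast
 show ?thesis by (rule form_unique(1)[OF l w'(1) u]) (simp add: w'(2) eq)
qed

lemma R_add: assumes l: "0 < l" shows "R l (f + g) = R l f + R l g"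
proof -
 obtain w where w: "(R l f, w) \<in> D" "!!v z. (v, z) \<in> D ==> l * (R l f \<bullet> v) + w \<bullet> z = f \<bullet> v"
  by (rule R_spec[OF l, of f]) blast
 obtain w' where w': "(R l g, w') \<in> D" "!!v z. (v, z) \<in> D ==> l * (R l g \<bullet> v) + w' \<bullet> z = g \<bullet> v"
  by (rule R_spec[OF l, of g]) blast
 show ?thesis
 proof (rule R_eqI[OF l D_add[OF w(1) w'(1)]])
  show "l * ((R l f + R l g) \<bullet> v) + (w + w') \<bullet> z = (f + g) \<bullet> v" if "(v, z) \<in> D" for v z
   using w(2)[OF that] w'(2)[OF that] by (simp add: inner_add_left distrib_left)
 qed
qed

lemma R_scale: assumes l: "0 < l" shows "R l (c *\<^sub>R f) = c *\<^sub>R R l f"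
proof -
 obtain w where w: "(R l f, w) \<in> D" "!!v z. (v, z) \<in> D ==> l * (R l f \<bullet> v) + w \<bullet> z = f \<bullet> v"
  by (rule R_spec[OF l, of f]) blast
 show ?thesis
 proof (rule R_eqI[OF l D_scale[OF w(1)]])
  show "l * (c *\<^sub>R R l f \<bullet> v) + c *\<^sub>R w \<bullet> z = c *\<^sub>R f \<bullet> v" if "(v, z) \<in> D" for v z
   using arg_cong[OF w(2)[OF that], of "%x. c * x"] by (simp add: distrib_left mult_ac)
 qed
qed

lemma R_linear: "0 < l ==> linear (R l)"
 by (rule linearI) (simp_all add: R_add R_scale)

lemma R_diff: "0 < l ==> R l (f - g) = R l f - R l g"
 by (rule linear_diff[OF R_linear])

lemma R_sym: assumes l: "0 < l" shows "R l f \<bullet> g = f \<bullet> R l g"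
proof -
 obtain w where w: "(R l f, w) \<in> D" "!!v z. (v, z) \<in> D ==> l * (R l f \<bullet> v) + w \<bullet> z = f \<bullet> v"
  by (rule R_spec[OF l, of f]) blast
 obtain w' where w': "(R l g, w') \<in> D" "!!v z. (v, z) \<in> D ==> l * (R l g \<bullet> v) + w' \<bullet> z = g \<bullet> v"
  by (rule R_spec[OF l, of g]) blast
 show ?thesis using w(2)[OF w'(1)] w'(2)[OF w(1)] by (simp add: inner_commute)
qed

lemma R_pos: assumes l: "0 < l" shows "l * (R l f \<bullet> R l f) <= R l f \<bullet> f"
proof -
 obtain w where w: "(R l f, w) \<in> D" "!!v z. (v, z) \<in> D ==> l * (R l f \<bullet> v) + w \<bullet> z = f \<bullet> v"
  by (rule R_spec[OF l, of f]) blast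
 show ?thesis using w(2)[OF w(1)] inner_ge_zero[of w] inner_commute[of f "R l f"] by linarith
qed

lemma R_norm: assumes l: "0 < l" shows "l * norm (R l f) <= norm f"
proof (cases "R l f = 0")
 case False
 have "l * (norm (R l f))\<^sup>2 <= norm (R l f) * norm f"
  using R_pos[OF l, of f] norm_cauchy_schwarz[of "R l f" f] by (simp add: power2_norm_eq_inner)
 then have "norm (R l f) * (l * norm (R l f)) <= norm (R l f) * norm f" by (simp add: power2_eq_square mult_ac)
 then show ?thesis using False by simp
qed simp

lemma R_resolvent: assumes l: "0 < l" "0 < m" shows "R l f = R m (f + (m - l) *\<^sub>R R l f)"
proof -
 obtain w where w: "(R l f, w) \<in> D" "!!v z. (v, z) \<in> D ==> l * (R l f \<bullet> v) + w \<bullet> z = f \<bullet> v"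
  by (rule R_spec[OF l(1), of f]) blast
 show ?thesis
 proof (rule R_eqI[OF l(2) w(1), symmetric])
  show "m * (R l f \<bullet> v) + w \<bullet> z = (f + (m - l) *\<^sub>R R l f) \<bullet> v" if "(v, z) \<in> D" for v z
   using w(2)[OF that] by (simp add: inner_add_left algebra_simps)
 qed
qed

lemma R_inj: assumes l: "0 < l" and z: "R l f = 0" shows "f = 0"
proof (rule ell2_eq_0I)
 fix c and F :: "'n => real => real" assume F: "tfam F"
 obtain w where w: "(R l f, w) \<in> D" "!!v z. (v, z) \<in> D ==> l * (R l f \<bullet> v) + w \<bullet> z = f \<bullet> v"
  by (rule R_spec[OF l, of f]) blast
 have "w = 0" using form_unique(2)[OF zero_less_one w(1) D_zero] w D_zero z
 proof -
  have "w \<bullet> w = 0" using w(2)[OF w(1)] by (simp add: z)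
  then show ?thesis by simp
 qed
 moreover obtain y where "(cls (tprod c F), y) \<in> D" by (rule D_tprod[OF F])
 ultimately show "f \<bullet> cls (tprod c F) = 0" using w(2) z by fastforce
qed

lemma R_J: assumes l: "0 < l" shows "R l (J f) = J (R l f)"
proof -
 obtain w where w: "(R l f, w) \<in> D" "!!v z. (v, z) \<in> D ==> l * (R l f \<bullet> v) + w \<bullet> z = f \<bullet> v"
  by (rule R_spec[OF l, of f]) blast
 obtain p q where pq: "w = (p, q)" by (metis surj_pair)
 show ?thesis
 proof (rule R_eqI[OF l D_J[OF w(1)[unfolded pq]]])
  fix v z assume vz: "(v, z) \<in> D"
  obtain p' q' where z: "z = (p', q')" by (metis surj_pair)
  have "l * (R l f \<bullet> J v) + w \<bullet> ((\<chi> j. J (p' $ j)), J q') = f \<bullet> J v"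
   by (rule w(2)[OF D_J[OF vz[unfolded z]]])
  then show "l * (J (R l f) \<bullet> v) + ((\<chi> j. J (p $ j)), J q) \<bullet> z = J f \<bullet> v"
   by (simp add: z pq J_adj inner_prod_def inner_vec_def sum_negf)
 qed
qed

text \<open>\<open>R l f\<close> is the unique minimiser of l |u - f/l|^2 + |w|^2 over the graph,
  and a contraction that fixes f/l does not increase this functional.\<close>

lemma R_invariant:
 assumes l: "0 < l" and F: "mc F" and fx: "comp F ((1 / l) *\<^sub>R f) = (1 / l) *\<^sub>R f"
 shows "comp F (R l f) = R l f"
proof -
 obtain w where w: "(R l f, w) \<in> D" "!!v z. (v, z) \<in> D ==> l * (R l f \<bullet> v) + w \<bullet> z = f \<bullet> v"
  by (rule R_spec[OF l, of f]) blast
 obtain z where z: "(comp F (R l f), z) \<in> D" "norm z <= norm w" by (rule D_mc[OF w(1) F]) blast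
 let ?u = "R l f" and ?v = "comp F (R l f)" and ?g = "(1 / l) *\<^sub>R f"
 have n: "norm (?v - ?g) <= norm (?u - ?g)" using comp_diff_norm[OF mc_nc[OF F], of ?u ?g] by (simp only: fx)
 then have n2: "(norm (?v - ?g))\<^sup>2 <= (norm (?u - ?g))\<^sup>2" by (intro power_mono) auto
 have nz: "(norm z)\<^sup>2 <= (norm w)\<^sup>2" using z(2) by (intro power_mono) auto
 \<comment> \<open>The weak equation tested with v - u; it cancels the cross terms of the two
   expansions below.\<close>
 have orth: "l * ((?u - ?g) \<bullet> (?v - ?u)) + w \<bullet> (z - w) = 0"
  using w(2)[OF D_diff[OF z(1) w(1)]] l by (simp add: inner_diff_left right_diff_distrib)
 have e1: "(norm (?v - ?g))\<^sup>2 = (norm (?u - ?g))\<^sup>2 + 2 * ((?u - ?g) \<bullet> (?v - ?u)) + (norm (?v - ?u))\<^sup>2"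
  by (simp add: power2_norm_eq_inner inner_diff inner_commute algebra_simps)
 have e2: "(norm z)\<^sup>2 = (norm w)\<^sup>2 + 2 * (w \<bullet> (z - w)) + (norm (z - w))\<^sup>2"
  by (simp add: power2_norm_eq_inner inner_diff inner_commute algebra_simps)
 have a: "l * (2 * ((?u - ?g) \<bullet> (?v - ?u)) + (norm (?v - ?u))\<^sup>2) <= 0"
  using n2 e1 l by (intro mult_nonneg_nonpos) auto
 have b: "2 * (w \<bullet> (z - w)) + (norm (z - w))\<^sup>2 <= 0" using nz e2 by linarith
 have "l * (norm (?v - ?u))\<^sup>2 <= 0"
  using a b orth zero_le_power2[of "norm (z - w)"] by (simp only: distrib_left mult.left_commute[of l 2])
 then show ?thesis using l by (simp add: mult_le_0_iff)
qed

lemma R_nonneg: assumes l: "0 < l" and f: "nonneg f" shows "nonneg (R l f)"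
 unfolding nonneg_cpos_iff
proof (rule R_invariant[OF l mc_cpos])
 have "nonneg ((1 / l) *\<^sub>R f)"
  unfolding nonneg_def using rep_scale[of "1 / l" f] f[unfolded nonneg_def]
  by eventually_elim (use l in simp)
 then show "comp cpos ((1 / l) *\<^sub>R f) = (1 / l) *\<^sub>R f" by (simp only: nonneg_cpos_iff)
qed

text \<open>Truncation at height 1/l fixes f/l when f has values in [0,1].\<close>

lemma R_markov:
 assumes l: "0 < l" and f: "AE t in lebesgue. Im (rep f t) = 0 & 0 <= Re (rep f t) & Re (rep f t) <= 1"
 shows "AE t in lebesgue. l * Re (rep (R l f) t) <= 1"
proof -
 have l': "0 < 1 / l" using l by simp
 have "comp (cut (1 / l)) ((1 / l) *\<^sub>R f) = (1 / l) *\<^sub>R f"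
  unfolding rep_eq_iff ae_eq_def using rep_comp[OF mc_nc[OF mc_cut[OF l']], of "(1 / l) *\<^sub>R f"] rep_scale[of "1 / l" f] f
  by eventually_elim (use l in \<open>simp add: cut_def complex_eq_iff divide_right_mono\<close>)
 then have "comp (cut (1 / l)) (R l f) = R l f" by (rule R_invariant[OF l mc_cut[OF l']])
 then have "AE t in lebesgue. rep (R l f) t = cut (1 / l) (rep (R l f) t)"
  using rep_comp[OF mc_nc[OF mc_cut[OF l']], of "R l f"] by simp
 then show ?thesis
 proof eventually_elim
  case (elim t)
  have "Re (rep (R l f) t) <= 1 / l" by (subst elim) (simp add: cut_def)
  then show ?case using l by (simp add: field_simps)
 qed
qed

end

section \<open>Truncations as test functions: the potential estimate and the maximal
  inequality\<close>

lemma SUP_min_1: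
 assumes "0 <= x"
 shows "(SUP n. ennreal (min 1 (x * real (Suc n)))) = indicator {0<..} x"
proof (cases "x = 0")
 case False
 with assms have x: "0 < x" by simp
 obtain n where "1 < real n * x" using ex_less_of_nat_mult[OF x, of 1] by blast
 then have n: "1 <= x * real (Suc n)" using x by (simp add: algebra_simps)
 have "(SUP n. ennreal (min 1 (x * real (Suc n)))) = 1"
 proof (rule antisym)
  show "(SUP n. ennreal (min 1 (x * real (Suc n)))) <= 1"
   by (rule SUP_least) (use ennreal_leI[of "min 1 _" 1] in auto)
  have "1 = ennreal (min 1 (x * real (Suc n)))" using n by (simp del: of_nat_Suc)
  also have "\<dots> <= (SUP n. ennreal (min 1 (x * real (Suc n))))" by (rule SUP_upper) simp
  finally show "1 <= (SUP n. ennreal (min 1 (x * real (Suc n))))" .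
 qed
 then show ?thesis using x by simp
qed simp

lemma incseq_min_1: "0 <= x ==> incseq (%n. ennreal (min 1 (x * real (Suc n))))"
 by (intro incseq_SucI ennreal_leI min.mono order_refl mult_left_mono) auto

text \<open>With e = 1/(n + 1), min(u, e) / e increases to the indicator of {u > 0}; bounds obtained
  from truncated test functions pass to that set.\<close>

lemma nn_integral_SUP_min_1:
 assumes [measurable]: "c \<in> borel_measurable M" "u \<in> borel_measurable M" and u: "AE t in M. 0 <= u t"
  and le: "!!n. (\<integral>\<^sup>+t. c t * ennreal (min 1 (u t * real (Suc n))) \<partial>M) <= K"
 shows "(\<integral>\<^sup>+t. c t * indicator {0<..} (u t) \<partial>M) <= K"
proof -
 have "(\<integral>\<^sup>+t. c t * indicator {0<..} (u t) \<partial>M) = (\<integral>\<^sup>+t. (SUP n. c t * ennreal (min 1 (max 0 (u t) * real (Suc n)))) \<partial>M)"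
 proof (rule nn_integral_cong_AE)
  show "AE t in M. c t * indicator {0<..} (u t) = (SUP n. c t * ennreal (min 1 (max 0 (u t) * real (Suc n))))"
   using u by eventually_elim (simp only: max_absorb2 SUP_min_1 SUP_mult_left_ennreal[symmetric])
 qed
 also have "\<dots> = (SUP n. \<integral>\<^sup>+t. c t * ennreal (min 1 (max 0 (u t) * real (Suc n))) \<partial>M)"
 proof (rule nn_integral_monotone_convergence_SUP)
  show "incseq (%n t. c t * ennreal (min 1 (max 0 (u t) * real (Suc n))))"
   using incseq_min_1[of "max 0 _"] by (auto simp: incseq_def le_fun_def intro!: mult_left_mono)
 qed measurable
 also have "\<dots> <= K"
 proof (rule SUP_least)
  fix n
  have "(\<integral>\<^sup>+t. c t * ennreal (min 1 (max 0 (u t) * real (Suc n))) \<partial>M) = (\<integral>\<^sup>+t. c t * ennreal (min 1 (u t * real (Suc n))) \<partial>M)"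
   by (rule nn_integral_cong_AE) (use u in eventually_elim, simp only: max_absorb2)
  then show "(\<integral>\<^sup>+t. c t * ennreal (min 1 (max 0 (u t) * real (Suc n))) \<partial>M) <= K" using le by simp
 qed
 finally show ?thesis .
qed

lemma rep_cut:
 assumes "nonneg u"
 shows "AE t in lebesgue. ennreal (Re (rep (comp (cut (1 / real (Suc n))) u) t)) =
  ennreal (1 / real (Suc n)) * ennreal (min 1 (Re (rep u t) * real (Suc n)))"
proof -
 have e: "0 < 1 / real (Suc n)" by simp
 show ?thesis
  using rep_comp[OF mc_nc[OF mc_cut[OF e]], of u] assms[unfolded nonneg_def]
 proof eventually_elim
  case (elim t)
  have "min (1 / real (Suc n)) (Re (rep u t)) = 1 / real (Suc n) * min 1 (Re (rep u t) * real (Suc n))"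
   by (simp add: min_def field_simps del: of_nat_Suc)
  then have "Re (rep (comp (cut (1 / real (Suc n))) u) t) = 1 / real (Suc n) * min 1 (Re (rep u t) * real (Suc n))"
   using elim by (simp add: cut_def max_absorb2 del: of_nat_Suc)
  then show ?case using elim by (simp only:) (rule ennreal_mult; simp)
 qed
qed

lemma rep_measurable [measurable]: "rep x \<in> borel_measurable lebesgue"
 by (rule L2D(1)[OF rep_L2])

context schroedinger
begin

text \<open>Test the equation for u = \<open>R l f\<close> with min(u, e) and drop the nonnegative
  gradient and l terms. Division by e leaves the integral of V u min(1, u/e) bounded by the integral
  of f, and e tends to 0.\<close>

lemma V_bound:
 assumes l: "0 < l" and f: "nonneg f"
 shows "(\<integral>\<^sup>+t. ennreal (V t) * ennreal (Re (rep (R l f) t)) \<partial>lebesgue) <= (\<integral>\<^sup>+t. ennreal (Re (rep f t)) \<partial>lebesgue)"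
  (is "_ <= ?F")
proof -
 let ?u = "R l f"
 have u: "nonneg ?u" by (rule R_nonneg[OF l f])
 obtain w where w: "(?u, w) \<in> D" "!!v z. (v, z) \<in> D ==> l * (?u \<bullet> v) + w \<bullet> z = f \<bullet> v"
  by (rule R_spec[OF l, of f]) blast
 obtain p q where pq: "w = (p, q)" by (metis surj_pair)
 have q: "AE x in lebesgue. rep q x = sV x * rep ?u x" using w(1) by (simp add: pq D_iff)
 have un: "AE t in lebesgue. 0 <= Re (rep ?u t)" using u unfolding nonneg_def by eventually_elim simp
 have "(\<integral>\<^sup>+t. ennreal (V t) * ennreal (Re (rep ?u t)) * ennreal (min 1 (Re (rep ?u t) * real (Suc n))) \<partial>lebesgue) <= ?F" for n
 proof -
  let ?e = "1 / real (Suc n)"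
  let ?v = "comp (cut ?e) ?u"
  have e: "0 < ?e" by simp
  have v: "nonneg ?v" by (rule nonneg_comp_cut[OF e])
  obtain z where z: "(?v, z) \<in> D" "0 <= fst w \<bullet> fst z" by (rule D_mc[OF w(1) mc_cut[OF e]]) blast
  obtain p' q' where pq': "z = (p', q')" by (metis surj_pair)
  have q': "AE x in lebesgue. rep q' x = sV x * rep ?v x" using z(1) by (simp add: pq' D_iff)
  have "0 <= l * (?u \<bullet> ?v)" using l nonneg_inner[OF u v] by simp
  then have le: "q \<bullet> q' <= f \<bullet> ?v" using w(2)[OF z(1)] z(2) by (simp add: pq pq' inner_prod_def)
  have nq: "nonneg q" unfolding nonneg_def using q u[unfolded nonneg_def] V_pos by eventually_elim (simp add: sV_def)
  have nq': "nonneg q'" unfolding nonneg_def using q' v[unfolded nonneg_def] V_pos by eventually_elim (simp add: sV_def)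
  have "ennreal ?e * (\<integral>\<^sup>+t. ennreal (V t) * ennreal (Re (rep ?u t)) * ennreal (min 1 (Re (rep ?u t) * real (Suc n))) \<partial>lebesgue)
   = (\<integral>\<^sup>+t. ennreal ?e * (ennreal (V t) * ennreal (Re (rep ?u t)) * ennreal (min 1 (Re (rep ?u t) * real (Suc n)))) \<partial>lebesgue)"
   by (rule nn_integral_cmult[symmetric]) measurable
  also have "\<dots> = (\<integral>\<^sup>+t. ennreal (Re (rep q t)) * ennreal (Re (rep q' t)) \<partial>lebesgue)"
  proof (rule nn_integral_cong_AE)
   show "AE t in lebesgue. ennreal ?e * (ennreal (V t) * ennreal (Re (rep ?u t)) * ennreal (min 1 (Re (rep ?u t) * real (Suc n)))) = ennreal (Re (rep q t)) * ennreal (Re (rep q' t))"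
    using q q' rep_cut[OF u, of n] V_pos u[unfolded nonneg_def] v[unfolded nonneg_def]
   proof eventually_elim
    case (elim t)
    have "ennreal (Re (rep q t)) * ennreal (Re (rep q' t)) = (ennreal (sqrt (V t)) * ennreal (Re (rep ?u t))) * (ennreal (sqrt (V t)) * ennreal (Re (rep ?v t)))"
     using elim by (simp add: sV_def ennreal_mult)
    also have "\<dots> = (ennreal (sqrt (V t)) * ennreal (sqrt (V t))) * ennreal (Re (rep ?u t)) * ennreal (Re (rep ?v t))"
     by (simp add: mult_ac)
    also have "ennreal (sqrt (V t)) * ennreal (sqrt (V t)) = ennreal (V t)" using elim by (simp flip: ennreal_mult)
    finally show ?case unfolding elim(3) by (simp only: mult_ac)
   qed
  qed
  also have "\<dots> = ennreal (q \<bullet> q')" by (rule nonneg_inner_integral[OF nq nq'])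
  also have "\<dots> <= ennreal (f \<bullet> ?v)" by (rule ennreal_leI[OF le])
  also have "\<dots> = (\<integral>\<^sup>+t. ennreal (Re (rep f t)) * ennreal (Re (rep ?v t)) \<partial>lebesgue)" by (rule nonneg_inner_integral[OF f v, symmetric])
  also have "\<dots> <= (\<integral>\<^sup>+t. ennreal ?e * ennreal (Re (rep f t)) \<partial>lebesgue)"
  proof (rule nn_integral_mono_AE)
   show "AE t in lebesgue. ennreal (Re (rep f t)) * ennreal (Re (rep ?v t)) <= ennreal ?e * ennreal (Re (rep f t))"
    using rep_cut[OF u, of n]
   proof eventually_elim
    case (elim t)
    have "ennreal (min 1 (Re (rep ?u t) * real (Suc n))) <= 1" using ennreal_leI[of "min 1 (Re (rep ?u t) * real (Suc n))" 1] by simp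
    then have "ennreal (Re (rep f t)) * (ennreal ?e * ennreal (min 1 (Re (rep ?u t) * real (Suc n)))) <= ennreal (Re (rep f t)) * (ennreal ?e * 1)"
     by (intro mult_left_mono) auto
    then show ?case unfolding elim mult_1_right by (simp only: mult.commute[of "ennreal ?e"])
   qed
  qed
  also have "\<dots> = ennreal ?e * ?F" by (rule nn_integral_cmult) measurable
  finally show ?thesis by (subst (asm) ennreal_mult_le_mult_iff) (use e in auto)
 qed
 from nn_integral_SUP_min_1[OF _ _ un this]
 have "(\<integral>\<^sup>+t. ennreal (V t) * ennreal (Re (rep ?u t)) * indicator {0<..} (Re (rep ?u t)) \<partial>lebesgue) <= ?F" by measurable
 also have "(\<integral>\<^sup>+t. ennreal (V t) * ennreal (Re (rep ?u t)) * indicator {0<..} (Re (rep ?u t)) \<partial>lebesgue)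
  = (\<integral>\<^sup>+t. ennreal (V t) * ennreal (Re (rep ?u t)) \<partial>lebesgue)"
  by (rule nn_integral_cong) (auto simp: indicator_def ennreal_neg)
 finally show ?thesis .
qed

text \<open>The solution \<open>w\<close> of the obstacle problem for \<open>l\<^sub>0 + L\<close> dominates all resolvents
  \<open>R l h\<close>, \<open>l \<ge> l\<^sub>0\<close>, at once; it takes the role of the maximal function of ergodic averages in
  Hopf's maximal lemma.\<close>

lemma obstacle:
 assumes l0: "0 < l0"
 obtains w where "nonneg w"
  "!!l. l0 <= l ==> AE t in lebesgue. Re (rep (R l h) t) <= Re (rep w t)"
  "!!e. 0 < e ==> 0 <= h \<bullet> comp (cut e) w"
proof -
 let ?C = "Dsc l0 \<inter> {x. nonneg (fst x)}"
 let ?x = "((1 / sqrt l0) *\<^sub>R h, 0) :: 'n ell2 \<times> (('n ell2)^'n) \<times> 'n ell2"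
 have sl: "sqrt l0 * sqrt l0 = l0" using l0 by simp
 have cl: "closed ?C"
 proof (intro closed_Int closed_Dsc)
  have "closed (fst -` {x. nonneg x} :: ('n ell2 \<times> (('n ell2)^'n) \<times> 'n ell2) set)"
   by (rule closed_vimage_fst[OF closed_nonneg])
  then show "closed {x :: 'n ell2 \<times> (('n ell2)^'n) \<times> 'n ell2. nonneg (fst x)}"
   by (simp add: vimage_def)
 qed
 have nsc: "nonneg (c *\<^sub>R x)" if "0 <= c" "nonneg x" for c and x :: "'n ell2"
  unfolding nonneg_def using rep_scale[of c x] that(2)[unfolded nonneg_def] by eventually_elim (use that(1) in simp)
 have cv: "convex ?C"
 proof (intro convex_Int subspace_imp_convex[OF subspace_Dsc])
  show "convex {x :: 'n ell2 \<times> (('n ell2)^'n) \<times> 'n ell2. nonneg (fst x)}"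
   by (rule convexI) (auto intro!: nonneg_add nsc)
 qed
 have n0: "nonneg (0 :: 'n ell2)" unfolding nonneg_def using rep_zero by eventually_elim simp
 have "0 \<in> ?C" using subspace_0[OF subspace_Dsc] n0 by simp
 then have ne: "?C ~= {}" by blast
 obtain p where p: "p \<in> ?C" "!!y. y \<in> ?C ==> (?x - p) \<bullet> (y - p) <= 0"
  by (rule closest_point_hilbert[OF cl cv ne, of ?x]) blast
 define w \<omega> where "w = (1 / sqrt l0) *\<^sub>R fst p" and "\<omega> = snd p"
 have pe: "p = (sqrt l0 *\<^sub>R w, \<omega>)" using l0 by (simp add: w_def \<omega>_def)
 have wD: "(w, \<omega>) \<in> D" using p(1) l0 by (simp add: pe Dsc_iff)
 have wn: "nonneg w" unfolding w_def by (rule nsc) (use p(1) l0 in auto)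
 \<comment> \<open>Optimality in every direction v that keeps w + v nonnegative; for v >= 0 it says
   that w is a supersolution of (l0 + L) w = h.\<close>
 have VI: "h \<bullet> v - l0 * (w \<bullet> v) - \<omega> \<bullet> z <= 0" if vz: "(v, z) \<in> D" and n: "nonneg (w + v)" for v z
 proof -
  have "(sqrt l0 *\<^sub>R (w + v), \<omega> + z) \<in> ?C"
   using D_add[OF wD vz] n l0 by (simp add: Dsc_iff nsc del: scaleR_add_right)
  from p(2)[OF this] have "(?x - p) \<bullet> (sqrt l0 *\<^sub>R v, z) <= 0" by (simp add: pe scaleR_add_right)
  moreover have "((1 / sqrt l0) *\<^sub>R h - sqrt l0 *\<^sub>R w) \<bullet> (sqrt l0 *\<^sub>R v) = h \<bullet> v - (sqrt l0 * sqrt l0) * (w \<bullet> v)"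
   using l0 by (simp add: inner_diff_left right_diff_distrib)
  ultimately have "h \<bullet> v - (sqrt l0 * sqrt l0) * (w \<bullet> v) - \<omega> \<bullet> z <= 0"
   by (simp only: pe diff_Pair inner_Pair diff_0 inner_minus_left)
  then show ?thesis unfolding sl .
 qed
 show thesis
 proof (rule that[OF wn])
  fix l assume ll: "l0 <= l"
  then have l: "0 < l" using l0 by simp
  obtain \<gamma> where g: "(R l h, \<gamma>) \<in> D" "!!v z. (v, z) \<in> D ==> l * (R l h \<bullet> v) + \<gamma> \<bullet> z = h \<bullet> v"
   by (rule R_spec[OF l, of h]) blast
  let ?d = "R l h - w"
  \<comment> \<open>The positive part of the difference is an admissible direction. Comparing the
    inequality with the equation for \<open>R l h\<close>, and using l0 <= l, gives l |v|^2 <=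
    0.\<close>
  let ?v = "comp cpos ?d"
  have dD: "(?d, \<gamma> - \<omega>) \<in> D" by (rule D_diff[OF g(1) wD])
  obtain z where z: "(?v, z) \<in> D" "0 <= (\<gamma> - \<omega>) \<bullet> z" by (rule D_mc[OF dD mc_cpos]) blast
  have vn: "nonneg ?v" by (rule nonneg_comp_cpos)
  have "h \<bullet> ?v - l0 * (w \<bullet> ?v) - \<omega> \<bullet> z <= 0" by (rule VI[OF z(1) nonneg_add[OF wn vn]])
  then have "l * (R l h \<bullet> ?v) + \<gamma> \<bullet> z - l0 * (w \<bullet> ?v) - \<omega> \<bullet> z <= 0" using g(2)[OF z(1)] by simp
  moreover have "l0 * (w \<bullet> ?v) <= l * (w \<bullet> ?v)" using nonneg_inner[OF wn vn] ll by (intro mult_right_mono)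
  ultimately have "l * (?d \<bullet> ?v) <= 0" using z(2) by (simp add: inner_diff_left right_diff_distrib)
  then have "?d \<bullet> ?v <= 0" using l by (simp add: mult_le_0_iff)
  moreover have "?d \<bullet> ?v = ?v \<bullet> ?v"
  proof -
   have "l2_inner (rep ?d) (rep ?v) = (\<integral>t. rep ?d t * cnj (rep ?v t) \<partial>lebesgue)" by (simp add: l2_inner_def)
   have "Re (l2_inner (rep ?d) (rep ?v)) = (\<integral>t. Re (rep ?d t * cnj (rep ?v t)) \<partial>lebesgue)"
    unfolding l2_inner_def by (rule integral_Re[symmetric]) (rule L2_integrable[OF rep_L2 rep_L2])
   also have "\<dots> = (\<integral>t. Re (rep ?v t * cnj (rep ?v t)) \<partial>lebesgue)"
   proof (rule integral_cong_AE)
    show "AE t in lebesgue. Re (rep ?d t * cnj (rep ?v t)) = Re (rep ?v t * cnj (rep ?v t))"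
     using rep_comp[OF mc_nc[OF mc_cpos], of ?d] by eventually_elim (auto simp: cpos_def max_def)
   qed (intro borel_measurable_integrable integrable_Re L2_integrable rep_L2)+
   also have "\<dots> = Re (l2_inner (rep ?v) (rep ?v))"
    unfolding l2_inner_def by (rule integral_Re) (rule L2_integrable[OF rep_L2 rep_L2])
   finally show ?thesis by (simp only: rep_inner)
  qed
  ultimately have v0: "?v = 0" using inner_ge_zero[of ?v] by simp
  show "AE t in lebesgue. Re (rep (R l h) t) <= Re (rep w t)"
   using rep_comp[OF mc_nc[OF mc_cpos], of ?d] rep_diff[of "R l h" w] rep_zero unfolding v0
   by eventually_elim (auto simp: cpos_def max_def split: if_splits)
 next
  fix e :: real assume e: "0 < e"
  \<comment> \<open>The direction - min(w, e) is admissible, because w - min(w, e) is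
    nonnegative.\<close>
  let ?v = "comp (cut e) w"
  obtain z where z: "(?v, z) \<in> D" "0 <= \<omega> \<bullet> z" by (rule D_mc[OF wD mc_cut[OF e]]) blast
  have "nonneg (w + (-1) *\<^sub>R ?v)"
   unfolding nonneg_def
   using rep_add[of w "(-1) *\<^sub>R ?v"] rep_scale[of "-1" ?v] rep_comp[OF mc_nc[OF mc_cut[OF e]], of w] wn[unfolded nonneg_def]
   by eventually_elim (simp add: cut_def)
  from VI[OF D_scale[OF z(1), of "-1"] this]
  have "l0 * (w \<bullet> ?v) + \<omega> \<bullet> z <= h \<bullet> ?v" by simp
  moreover have "0 <= l0 * (w \<bullet> ?v)" using nonneg_inner[OF wn nonneg_comp_cut[OF e, of w]] l0 by simp
  ultimately show "0 <= h \<bullet> ?v" using z(2) by linarith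
 qed
qed

text \<open>Take h = f - a 1_B. Where l R_l f > a, the bound l R_l 1_B <= 1 gives R_l h > 0, hence w
  > 0 for the obstacle solution w. Testing h with min(w, e) / e bounds a times the measure of B
  within {w > 0} by the integral of f. B has finite measure so that its indicator is in L2.\<close>

lemma weak_max_local:
 assumes l0: "0 < l0" and \<Lambda>: "countable \<Lambda>" "!!l. l \<in> \<Lambda> ==> l0 <= l" and f: "nonneg f" and a: "0 < a" and B: "B \<in> lmeasurable"
 shows "ennreal a * emeasure lebesgue (B \<inter> {x. \<exists>l\<in>\<Lambda>. a < l * Re (rep (R l f) x)}) <= (\<integral>\<^sup>+t. ennreal (Re (rep f t)) \<partial>lebesgue)"
  (is "_ <= ?F")
proof -
 have Bm [measurable]: "B \<in> sets lebesgue" using B by (simp add: fmeasurable_def)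
 define b where "b = cls (%x. complex_of_real (indicator B x))"
 have rb: "AE x in lebesgue. rep b x = complex_of_real (indicator B x)"
  using rep_cls[OF indicator_L2[OF B]] unfolding b_def ae_eq_def .
 have bn: "nonneg b" unfolding nonneg_def using rb by eventually_elim simp
 obtain w where w: "nonneg w" "!!l. l0 <= l ==> AE t in lebesgue. Re (rep (R l (f - a *\<^sub>R b)) t) <= Re (rep w t)"
  "!!e. 0 < e ==> 0 <= (f - a *\<^sub>R b) \<bullet> comp (cut e) w"
  by (rule obstacle[OF l0, of "f - a *\<^sub>R b"]) blast
 have wp: "AE t in lebesgue. 0 <= Re (rep w t)" using w(1) unfolding nonneg_def by eventually_elim simp
 have "AE t in lebesgue. \<forall>l\<in>\<Lambda>. a < l * Re (rep (R l f) t) --> 0 < Re (rep w t)"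
 proof (subst AE_ball_countable[OF \<Lambda>(1)], intro ballI)
  fix l assume "l \<in> \<Lambda>"
  then have ll: "l0 <= l" and l: "0 < l" using \<Lambda>(2) l0 by force+
  have "AE t in lebesgue. l * Re (rep (R l b) t) <= 1"
   by (rule R_markov[OF l]) (use rb in eventually_elim, simp add: indicator_def)
  then show "AE t in lebesgue. a < l * Re (rep (R l f) t) --> 0 < Re (rep w t)"
   using w(2)[OF ll] rep_diff[of "R l f" "a *\<^sub>R R l b"] rep_scale[of a "R l b"]
  proof eventually_elim
   case (elim t)
   show ?case
   proof
    assume *: "a < l * Re (rep (R l f) t)"
    have "Re (rep (R l f) t) - a * Re (rep (R l b) t) <= Re (rep w t)"
     using elim by (simp add: R_diff[OF l] R_scale[OF l])
    then have "l * (Re (rep (R l f) t) - a * Re (rep (R l b) t)) <= l * Re (rep w t)" using l by (intro mult_left_mono) auto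
    moreover have "a * (l * Re (rep (R l b) t)) <= a * 1" using elim(1) a by (intro mult_left_mono) auto
    ultimately have "0 < l * Re (rep w t)" using * by (simp add: right_diff_distrib mult.left_commute)
    then show "0 < Re (rep w t)" using l by (simp add: zero_less_mult_iff)
   qed
  qed
 qed
 then have "emeasure lebesgue (B \<inter> {x. \<exists>l\<in>\<Lambda>. a < l * Re (rep (R l f) x)}) <= emeasure lebesgue (B \<inter> {x. 0 < Re (rep w x)})"
 proof (intro emeasure_mono_AE)
  show "B \<inter> {x. 0 < Re (rep w x)} \<in> sets lebesgue"
   using borel_measurable_less[of "%_. 0" lebesgue "%x. Re (rep w x)"] by (intro sets.Int) (auto simp: pred_def)
 qed (auto elim!: eventually_mono)
 also have "\<dots> = (\<integral>\<^sup>+t. indicator B t * indicator {0<..} (Re (rep w t)) \<partial>lebesgue)"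
 proof -
  have "B \<inter> {x. 0 < Re (rep w x)} \<in> sets lebesgue"
   using borel_measurable_less[of "%_. 0" lebesgue "%x. Re (rep w x)"] by (intro sets.Int) (auto simp: pred_def)
  then have "emeasure lebesgue (B \<inter> {x. 0 < Re (rep w x)}) = (\<integral>\<^sup>+t. indicator (B \<inter> {x. 0 < Re (rep w x)}) t \<partial>lebesgue)"
   by (rule nn_integral_indicator[symmetric])
  also have "\<dots> = (\<integral>\<^sup>+t. indicator B t * indicator {0<..} (Re (rep w t)) \<partial>lebesgue)"
   by (rule nn_integral_cong) (auto simp: indicator_def)
  finally show ?thesis .
 qed
 finally have le: "ennreal a * emeasure lebesgue (B \<inter> {x. \<exists>l\<in>\<Lambda>. a < l * Re (rep (R l f) x)})
   <= ennreal a * (\<integral>\<^sup>+t. indicator B t * indicator {0<..} (Re (rep w t)) \<partial>lebesgue)"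
  by (rule mult_left_mono) simp
 have "(\<integral>\<^sup>+t. (ennreal a * indicator B t) * ennreal (min 1 (Re (rep w t) * real (Suc n))) \<partial>lebesgue) <= ?F" for n
 proof -
  let ?e = "1 / real (Suc n)"
  let ?v = "comp (cut ?e) w"
  have e: "0 < ?e" by simp
  have v: "nonneg ?v" by (rule nonneg_comp_cut[OF e])
  have le: "a * (b \<bullet> ?v) <= f \<bullet> ?v" using w(3)[OF e] by (simp add: inner_diff_left)
  have "ennreal ?e * (\<integral>\<^sup>+t. (ennreal a * indicator B t) * ennreal (min 1 (Re (rep w t) * real (Suc n))) \<partial>lebesgue)
   = (\<integral>\<^sup>+t. ennreal ?e * ((ennreal a * indicator B t) * ennreal (min 1 (Re (rep w t) * real (Suc n)))) \<partial>lebesgue)"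
   by (rule nn_integral_cmult[symmetric]) measurable
  also have "\<dots> = (\<integral>\<^sup>+t. ennreal a * (ennreal (Re (rep b t)) * ennreal (Re (rep ?v t))) \<partial>lebesgue)"
  proof (rule nn_integral_cong_AE)
   show "AE t in lebesgue. ennreal ?e * ((ennreal a * indicator B t) * ennreal (min 1 (Re (rep w t) * real (Suc n)))) = ennreal a * (ennreal (Re (rep b t)) * ennreal (Re (rep ?v t)))"
    using rb rep_cut[OF w(1), of n]
   proof eventually_elim
    case (elim t)
    have "ennreal (Re (rep b t)) = indicator B t" unfolding elim(1) by (simp add: indicator_def)
    then show ?case unfolding elim(2) by (simp only: mult_ac)
   qed
  qed
  also have "\<dots> = ennreal a * ennreal (b \<bullet> ?v)"
   unfolding nonneg_inner_integral[OF bn v, symmetric] by (rule nn_integral_cmult) measurable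
  also have "\<dots> = ennreal (a * (b \<bullet> ?v))" using a nonneg_inner[OF bn v] by (simp add: ennreal_mult)
  also have "\<dots> <= ennreal (f \<bullet> ?v)" by (rule ennreal_leI[OF le])
  also have "\<dots> = (\<integral>\<^sup>+t. ennreal (Re (rep f t)) * ennreal (Re (rep ?v t)) \<partial>lebesgue)" by (rule nonneg_inner_integral[OF f v, symmetric])
  also have "\<dots> <= (\<integral>\<^sup>+t. ennreal ?e * ennreal (Re (rep f t)) \<partial>lebesgue)"
  proof (rule nn_integral_mono_AE)
   show "AE t in lebesgue. ennreal (Re (rep f t)) * ennreal (Re (rep ?v t)) <= ennreal ?e * ennreal (Re (rep f t))"
    using rep_cut[OF w(1), of n]
   proof eventually_elim
    case (elim t)
    have "ennreal (min 1 (Re (rep w t) * real (Suc n))) <= 1" using ennreal_leI[of "min 1 (Re (rep w t) * real (Suc n))" 1] by simp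
    then have "ennreal (Re (rep f t)) * (ennreal ?e * ennreal (min 1 (Re (rep w t) * real (Suc n)))) <= ennreal (Re (rep f t)) * (ennreal ?e * 1)"
     by (intro mult_left_mono) auto
    then show ?case unfolding elim mult_1_right by (simp only: mult.commute[of "ennreal ?e"])
   qed
  qed
  also have "\<dots> = ennreal ?e * ?F" by (rule nn_integral_cmult) measurable
  finally show ?thesis by (subst (asm) ennreal_mult_le_mult_iff) (use e in auto)
 qed
 from nn_integral_SUP_min_1[OF _ _ wp this]
 have "(\<integral>\<^sup>+t. (ennreal a * indicator B t) * indicator {0<..} (Re (rep w t)) \<partial>lebesgue) <= ?F" by measurable
 also have "(\<integral>\<^sup>+t. (ennreal a * indicator B t) * indicator {0<..} (Re (rep w t)) \<partial>lebesgue)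
   = ennreal a * (\<integral>\<^sup>+t. indicator B t * indicator {0<..} (Re (rep w t)) \<partial>lebesgue)"
 proof -
  have "(\<integral>\<^sup>+t. ennreal a * (indicator B t * indicator {0<..} (Re (rep w t))) \<partial>lebesgue) = ennreal a * (\<integral>\<^sup>+t. indicator B t * indicator {0<..} (Re (rep w t)) \<partial>lebesgue)"
   by (rule nn_integral_cmult) measurable
  then show ?thesis by (simp only: mult.assoc)
 qed
 finally show ?thesis using le by (rule order_trans[rotated])
qed

text \<open>Exhaustion by balls and by the lower bounds 1/(n + 1) for l; the local estimate depends
  on neither.\<close>

lemma weak_max:
 assumes \<Lambda>: "countable \<Lambda>" "!!l. l \<in> \<Lambda> ==> 0 < l" and f: "nonneg f" and a: "0 < a"
 shows "ennreal a * emeasure lebesgue {x. \<exists>l\<in>\<Lambda>. a < l * Re (rep (R l f) x)} <= (\<integral>\<^sup>+t. ennreal (Re (rep f t)) \<partial>lebesgue)"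
  (is "_ * emeasure _ ?S <= ?F")
proof -
 define S where "S n = cball 0 (real n) \<inter> {x. \<exists>l\<in>\<Lambda> \<inter> {1 / real (Suc n)..}. a < l * Re (rep (R l f) x)}" for n
 have Sm: "S n \<in> sets lebesgue" for n
 proof -
  have "{x. a < l * Re (rep (R l f) x)} \<in> sets lebesgue" for l
   using borel_measurable_less[of "%_. a" lebesgue "%x. l * Re (rep (R l f) x)"] by (auto simp: pred_def)
  moreover have "{x. \<exists>l\<in>\<Lambda> \<inter> {1 / real (Suc n)..}. a < l * Re (rep (R l f) x)} = (\<Union>l\<in>\<Lambda> \<inter> {1 / real (Suc n)..}. {x. a < l * Re (rep (R l f) x)})" by auto
  ultimately have "{x. \<exists>l\<in>\<Lambda> \<inter> {1 / real (Suc n)..}. a < l * Re (rep (R l f) x)} \<in> sets lebesgue"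
   using \<Lambda>(1) by (simp only:) (intro sets.countable_UN', auto)
  then show ?thesis unfolding S_def by (intro sets.Int) auto
 qed
 have inc: "incseq S"
 proof (rule incseq_SucI)
  fix n
  have "1 / real (Suc (Suc n)) <= 1 / real (Suc n)" by (simp add: frac_le)
  then show "S n \<subseteq> S (Suc n)" unfolding S_def by fastforce
 qed
 have un: "?S = (\<Union>n. S n)"
 proof
  show "(\<Union>n. S n) \<subseteq> ?S" unfolding S_def by auto
  show "?S \<subseteq> (\<Union>n. S n)"
  proof
   fix x assume "x \<in> ?S"
   then obtain l where l: "l \<in> \<Lambda>" "a < l * Re (rep (R l f) x)" by blast
   obtain N :: nat where N: "norm x < real N" using reals_Archimedean2 by blast
   obtain M :: nat where M: "1 / real (Suc M) < l" using nat_approx_posE[OF \<Lambda>(2)[OF l(1)]] by blast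
   have "1 / real (Suc (max N M)) <= 1 / real (Suc M)" by (simp add: frac_le)
   then have "x \<in> S (max N M)" unfolding S_def using l M N by (auto intro!: bexI[of _ l])
   then show "x \<in> (\<Union>n. S n)" by blast
  qed
 qed
 have "ennreal a * emeasure lebesgue ?S = (SUP n. ennreal a * emeasure lebesgue (S n))"
  unfolding un SUP_mult_left_ennreal[symmetric] by (subst SUP_emeasure_incseq[symmetric]) (use Sm inc in auto)
 also have "\<dots> <= ?F"
 proof (rule SUP_least)
  fix n
  show "ennreal a * emeasure lebesgue (S n) <= ?F"
   unfolding S_def by (rule weak_max_local[of "1 / real (Suc n)"]) (use \<Lambda> f a in auto)
 qed
 finally show ?thesis .
qed

end

section \<open>The operator of the form\<close>

lemma l2_inner_rep: "l2_inner (rep x) (rep y) = Complex (x \<bullet> y) (x \<bullet> J y)"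
proof -
 have "x \<bullet> J y = Re (l2_inner (rep x) (%t. \<i> * rep y t))"
  using cls_inner[OF rep_L2[of x] L2_cmult[OF rep_L2[of y]], of \<i>] by (simp add: J_def)
 also have "\<dots> = Im (l2_inner (rep x) (rep y))" by (simp add: l2_inner_cmult_right)
 finally show ?thesis by (simp add: complex_eq_iff rep_inner)
qed

lemma l2_inner_cls: assumes "f \<in> L2" "g \<in> L2" shows "l2_inner f g = Complex (cls f \<bullet> cls g) (cls f \<bullet> J (cls g))"
proof -
 have "l2_inner f g = l2_inner (rep (cls f)) (rep (cls g))"
  by (rule l2_inner_cong) (use assms rep_cls ae_eq_sym in auto)
 then show ?thesis by (simp only: l2_inner_rep)
qed

context schroedinger
begin

lemma form_dom_iff: "u \<in> form_dom V \<longleftrightarrow> u \<in> L2 & (EX w. (cls u, w) \<in> D)"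
proof
 assume u: "u \<in> form_dom V"
 then have uL: "u \<in> L2" and sL: "(%x. sV x * u x) \<in> L2" by (auto simp: form_dom_def sV_def)
 from u obtain G where G: "is_weak_gradient u G" "!!j. (%x. G x $ j) \<in> L2" by (auto simp: form_dom_def)
 define p where "p = (\<chi> j. (1 / sqrt 2) *\<^sub>R cls (%x. G x $ j))"
 have "wd j (cls u) (sqrt 2 *\<^sub>R p $ j)" for j
  using wd_if_weak_gradient[OF uL G(1) G(2), of j] by (simp add: p_def)
 moreover have "AE x in lebesgue. rep (cls (%x. sV x * u x)) x = sV x * rep (cls u) x"
  using rep_cls[OF sL] rep_cls[OF uL] unfolding ae_eq_def by eventually_elim simp
 ultimately have "(cls u, p, cls (%x. sV x * u x)) \<in> D" by (simp add: D_iff)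
 with uL show "u \<in> L2 & (EX w. (cls u, w) \<in> D)" by blast
next
 assume "u \<in> L2 & (EX w. (cls u, w) \<in> D)"
 then obtain p q where uL: "u \<in> L2" and pq: "(cls u, p, q) \<in> D" by auto
 have g: "is_weak_gradient u (%x. \<chi> j. rep (sqrt 2 *\<^sub>R p $ j) x)"
  by (rule weak_gradient_if_wd[OF uL]) (use pq in \<open>simp add: D_iff\<close>)
 have "(%x. sV x * u x) \<in> L2"
 proof (rule L2_dominated[OF _ rep_L2[of q], of _ 1])
  show "(%x. sV x * u x) \<in> borel_measurable lebesgue" using L2D(1)[OF uL] by measurable
  show "AE x in lebesgue. cmod (sV x * u x) <= 1 * cmod (rep q x)"
   using pq[unfolded D_iff, THEN conjunct2] rep_cls[OF uL] unfolding ae_eq_def by eventually_elim simp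
 qed
 then show "u \<in> form_dom V"
  unfolding form_dom_def using uL g by (auto simp: sV_def intro!: exI[of _ "%x. \<chi> j. rep (sqrt 2 *\<^sub>R p $ j) x"])
qed

lemma weak_gradient_D:
 assumes u: "u \<in> L2" "(cls u, p, q) \<in> D"
 shows "AE x in lebesgue. weak_gradient u x = (\<chi> j. complex_of_real (sqrt 2) * rep (p $ j) x)"
  and "!!j. (%x. weak_gradient u x $ j) \<in> borel_measurable lebesgue"
proof -
 have g: "is_weak_gradient u (%x. \<chi> j. rep (sqrt 2 *\<^sub>R p $ j) x)"
  by (rule weak_gradient_if_wd[OF u(1)]) (use u(2) in \<open>simp add: D_iff\<close>)
 have w: "is_weak_gradient u (weak_gradient u)" unfolding weak_gradient_def by (rule someI[where P="is_weak_gradient u"]) (rule g)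
 have s: "AE x in lebesgue. ALL j. rep (sqrt 2 *\<^sub>R p $ j) x = complex_of_real (sqrt 2) * rep (p $ j) x"
  unfolding AE_all_countable by (intro allI rep_scale)
 show ae: "AE x in lebesgue. weak_gradient u x = (\<chi> j. complex_of_real (sqrt 2) * rep (p $ j) x)"
  using is_weak_gradient_unique[OF w g] s by eventually_elim simp
 show "(%x. weak_gradient u x $ j) \<in> borel_measurable lebesgue" for j
  using w locally_integrable_measurable unfolding is_weak_gradient_def by blast
qed

text \<open>The sqrt 2 in \<open>D\<close> absorbs the factor 1/2 of the gradient term. As for the
  inner product in \<open>l2_inner_rep\<close>, the imaginary part is the real form with the second
  argument multiplied by i.\<close>

lemma schrodinger_form_D:
 assumes u: "u \<in> L2" "(cls u, w) \<in> D" and v: "v \<in> L2" "(cls v, z) \<in> D"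
 shows "schrodinger_form V u v = Complex (w \<bullet> z) (w \<bullet> ((\<chi> j. J (fst z $ j)), J (snd z)))"
proof -
 obtain p q p' q' where w: "w = (p, q)" and z: "z = (p', q')" by (metis surj_pair)
 note gu = weak_gradient_D[OF u(1) u(2)[unfolded w]]
 note gv = weak_gradient_D[OF v(1) v(2)[unfolded z]]
 have q: "AE x in lebesgue. rep q x = sV x * u x"
  using u(2)[unfolded w D_iff, THEN conjunct2] rep_cls[OF u(1)] unfolding ae_eq_def by eventually_elim simp
 have q': "AE x in lebesgue. rep q' x = sV x * v x"
  using v(2)[unfolded z D_iff, THEN conjunct2] rep_cls[OF v(1)] unfolding ae_eq_def by eventually_elim simp
 have "schrodinger_form V u v = (\<integral>x. (\<Sum>j\<in>UNIV. rep (p $ j) x * cnj (rep (p' $ j) x)) + rep q x * cnj (rep q' x) \<partial>lebesgue)"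
  unfolding schrodinger_form_def
 proof (rule integral_cong_AE)
  note [measurable] = gu(2) gv(2) L2D(1)[OF u(1)] L2D(1)[OF v(1)]
  have cm: "(%x. cnj (f x)) \<in> borel_measurable lebesgue" if "f \<in> borel_measurable lebesgue" for f :: "real^'n => complex"
   using borel_measurable_continuous_on[OF continuous_on_cnj[OF continuous_on_id] that] .
  show "(%x. 1 / 2 * (\<Sum>j\<in>UNIV. weak_gradient u x $ j * cnj (weak_gradient v x $ j)) + complex_of_real (V x) * u x * cnj (v x)) \<in> borel_measurable lebesgue"
   using cm[OF gv(2)] cm[OF L2D(1)[OF v(1)]] by measurable
  show "(%x. (\<Sum>j\<in>UNIV. rep (p $ j) x * cnj (rep (p' $ j) x)) + rep q x * cnj (rep q' x)) \<in> borel_measurable lebesgue"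
   using cm[OF rep_measurable] by measurable
  show "AE x in lebesgue. 1 / 2 * (\<Sum>j\<in>UNIV. weak_gradient u x $ j * cnj (weak_gradient v x $ j)) + complex_of_real (V x) * u x * cnj (v x)
   = (\<Sum>j\<in>UNIV. rep (p $ j) x * cnj (rep (p' $ j) x)) + rep q x * cnj (rep q' x)"
   using gu(1) gv(1) q q' V_pos
  proof eventually_elim
   case (elim x)
   have s2: "complex_of_real (sqrt 2) * complex_of_real (sqrt 2) = 2" by (simp flip: of_real_mult)
   have "weak_gradient u x $ j * cnj (weak_gradient v x $ j) = 2 * (rep (p $ j) x * cnj (rep (p' $ j) x))" for j
   proof -
    have "weak_gradient u x $ j * cnj (weak_gradient v x $ j) = (complex_of_real (sqrt 2) * complex_of_real (sqrt 2)) * (rep (p $ j) x * cnj (rep (p' $ j) x))"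
     unfolding elim(1,2) by (simp add: mult_ac)
    then show ?thesis by (simp only: s2)
   qed
   moreover have "sV x * sV x = complex_of_real (V x)" using elim by (simp add: sV_def flip: of_real_mult)
   moreover have "rep q x * cnj (rep q' x) = (sV x * sV x) * u x * cnj (v x)"
    unfolding elim(3,4) by (simp add: sV_def)
   ultimately show ?case by (simp add: sum_distrib_left)
  qed
 qed
 also have "\<dots> = (\<Sum>j\<in>UNIV. l2_inner (rep (p $ j)) (rep (p' $ j))) + l2_inner (rep q) (rep q')"
  unfolding l2_inner_def by (subst Bochner_Integration.integral_add) (auto intro!: Bochner_Integration.integrable_sum L2_integrable rep_L2 simp: Bochner_Integration.integral_sum L2_integrable)
 also have "\<dots> = Complex (w \<bullet> z) (w \<bullet> ((\<chi> j. J (fst z $ j)), J (snd z)))"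
  by (simp add: l2_inner_rep complex_eq_iff w z inner_vec_def inner_Pair)
 finally show ?thesis .
qed

text \<open>L u = g is rewritten as u = (1 + L)^-1 (u + g), so that from here on the bounded
  resolvent stands for the unbounded operator.\<close>

lemma schrodinger_op_iff:
 "schrodinger_op V u g \<longleftrightarrow> u \<in> L2 & g \<in> L2 & cls u = R 1 (cls u + cls g)"
proof (intro iffI conjI)
 assume op: "schrodinger_op V u g"
 then show uL: "u \<in> L2" and gL: "g \<in> L2" by (auto simp: schrodinger_op_def form_dom_iff)
 from op obtain w where w: "(cls u, w) \<in> D" by (auto simp: schrodinger_op_def form_dom_iff)
 have "R 1 (cls u + cls g) = cls u"
 proof (rule R_eqI[OF zero_less_one w])
  fix v z assume vz: "(v, z) \<in> D"
  have "schrodinger_form V u (rep v) = l2_inner g (rep v)"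
  proof -
   have "rep v \<in> form_dom V" using vz by (cases z) (auto simp: form_dom_iff)
   then show ?thesis using op unfolding schrodinger_op_def by blast
  qed
  then have "w \<bullet> z = cls g \<bullet> v"
   using schrodinger_form_D[OF uL w rep_L2, of v z] vz l2_inner_cls[OF gL rep_L2, of v] by simp
  then show "1 * (cls u \<bullet> v) + w \<bullet> z = (cls u + cls g) \<bullet> v" by (simp add: inner_add_left)
 qed
 then show "cls u = R 1 (cls u + cls g)" by simp
next
 assume *: "u \<in> L2 & g \<in> L2 & cls u = R 1 (cls u + cls g)"
 obtain w where w: "(R 1 (cls u + cls g), w) \<in> D"
  "!!v z. (v, z) \<in> D ==> 1 * (R 1 (cls u + cls g) \<bullet> v) + w \<bullet> z = (cls u + cls g) \<bullet> v"
  by (rule R_spec[OF zero_less_one, of "cls u + cls g"]) blast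
 have wD: "(cls u, w) \<in> D" using w(1) * by simp
 have eq: "w \<bullet> z = cls g \<bullet> v" if "(v, z) \<in> D" for v z
  using w(2)[OF that] * by (simp add: inner_add_left)
 have "schrodinger_form V u v = l2_inner g v" if v: "v \<in> form_dom V" for v
 proof -
  obtain p q where vL: "v \<in> L2" and z: "(cls v, p, q) \<in> D" using v by (auto simp: form_dom_iff)
  show ?thesis
   using schrodinger_form_D[OF _ wD vL z] l2_inner_cls[of g v] eq[OF z] eq[OF D_J[OF z]] * vL by simp
 qed
 moreover have "u \<in> form_dom V" using * wD by (cases w) (auto simp: form_dom_iff)
 ultimately show "schrodinger_op V u g" using * by (simp add: schrodinger_op_def)
qed

end

section \<open>Projection-valued measures on a Hilbert space\<close>

text \<open>Serves to show that domains of spectral integrals are closed under sums, where the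
  measure of x + y is at most twice the sum of those of x and y.\<close>

lemma nn_integral_le_sum_measures:
 fixes f :: "'a => ennreal"
 assumes s: "sets M = sets N" "sets M' = sets N" and le: "!!A. A \<in> sets N ==> emeasure N A <= c * emeasure M A + c * emeasure M' A"
  and f: "f \<in> borel_measurable N"
 shows "(\<integral>\<^sup>+x. f x \<partial>N) <= c * (\<integral>\<^sup>+x. f x \<partial>M) + c * (\<integral>\<^sup>+x. f x \<partial>M')"
 using f
proof (induction rule: borel_measurable_induct)
 case (cong f g)
 have "space M = space N" "space M' = space N" using s by (auto intro!: sets_eq_imp_space_eq)
 then show ?case using cong nn_integral_cong[of N f g] nn_integral_cong[of M f g] nn_integral_cong[of M' f g] by simp
next
 case (set A)
 then show ?case using le[OF set] s by simp
next
 case (mult u d)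
 have m: "u \<in> borel_measurable M" "u \<in> borel_measurable M'" using mult(2) s by (simp_all add: measurable_def sets_eq_imp_space_eq[OF s(1)] sets_eq_imp_space_eq[OF s(2)])
 have "d * (\<integral>\<^sup>+x. u x \<partial>N) <= d * (c * (\<integral>\<^sup>+x. u x \<partial>M) + c * (\<integral>\<^sup>+x. u x \<partial>M'))" by (rule mult_left_mono[OF mult(4)]) simp
 then show ?case using mult(2) m by (simp add: nn_integral_cmult distrib_left mult.left_commute)
next
 case (add u v)
 have m: "u \<in> borel_measurable M" "u \<in> borel_measurable M'" "v \<in> borel_measurable M" "v \<in> borel_measurable M'"
  using add s by (simp_all add: measurable_def sets_eq_imp_space_eq[OF s(1)] sets_eq_imp_space_eq[OF s(2)])
 have "(\<integral>\<^sup>+x. u x \<partial>N) <= c * (\<integral>\<^sup>+x. u x \<partial>M) + c * (\<integral>\<^sup>+x. u x \<partial>M')"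
  "(\<integral>\<^sup>+x. v x \<partial>N) <= c * (\<integral>\<^sup>+x. v x \<partial>M) + c * (\<integral>\<^sup>+x. v x \<partial>M')" by fact+
 from add_mono[OF this] show ?case using add m by (simp add: nn_integral_add distrib_left add_ac)
next
 case (seq U)
 have "(\<integral>\<^sup>+x. (SUP i. U i) x \<partial>N) = (SUP i. \<integral>\<^sup>+x. U i x \<partial>N)"
  unfolding SUP_apply by (rule nn_integral_monotone_convergence_SUP[OF seq(3) seq(1)])
 also have "\<dots> <= c * (\<integral>\<^sup>+x. (SUP i. U i) x \<partial>M) + c * (\<integral>\<^sup>+x. (SUP i. U i) x \<partial>M')"
 proof (rule SUP_least)
  fix i
  have "(\<integral>\<^sup>+x. U i x \<partial>K) <= (\<integral>\<^sup>+x. (SUP i. U i) x \<partial>K)" for K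
   by (intro nn_integral_mono) (auto intro: SUP_upper)
  then have "c * (\<integral>\<^sup>+x. U i x \<partial>M) + c * (\<integral>\<^sup>+x. U i x \<partial>M') <= c * (\<integral>\<^sup>+x. (SUP i. U i) x \<partial>M) + c * (\<integral>\<^sup>+x. (SUP i. U i) x \<partial>M')"
   by (intro add_mono mult_left_mono) auto
  moreover have "(\<integral>\<^sup>+x. U i x \<partial>N) <= c * (\<integral>\<^sup>+x. U i x \<partial>M) + c * (\<integral>\<^sup>+x. U i x \<partial>M')" by (rule seq)
  ultimately show "(\<integral>\<^sup>+x. U i x \<partial>N) <= c * (\<integral>\<^sup>+x. (SUP i. U i) x \<partial>M) + c * (\<integral>\<^sup>+x. (SUP i. U i) x \<partial>M')"
   by (rule order_trans[rotated])
 qed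
 finally show ?case by (simp add: image_comp)
qed

lemma density_indicator_eq:
 fixes \<phi> :: "real => real"
 assumes s: "sets M = sets borel" "sets N = sets borel"
  and eq: "!!B. B \<in> sets borel ==> emeasure M (C \<inter> B) = emeasure N (C \<inter> B)" and C: "C \<in> sets borel"
  and \<phi>: "\<phi> \<in> borel_measurable borel"
 shows "(\<integral>x. indicator C x * \<phi> x \<partial>M) = (\<integral>x. indicator C x * \<phi> x \<partial>N)"
  and "integrable M (%x. indicator C x * \<phi> x) \<longleftrightarrow> integrable N (%x. indicator C x * \<phi> x)"
proof -
 have d: "density M (%x. ennreal (indicator C x)) = density N (%x. ennreal (indicator C x))"
 proof (rule measure_eqI)
  show "sets (density M (%x. ennreal (indicator C x))) = sets (density N (%x. ennreal (indicator C x)))" using s by simp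
  fix B assume "B \<in> sets (density M (%x. ennreal (indicator C x)))"
  then have B: "B \<in> sets borel" using s by simp
  have "emeasure (density K (%x. ennreal (indicator C x))) B = emeasure K (C \<inter> B)" if sK: "sets K = sets borel" for K :: "real measure"
  proof -
   have [measurable]: "C \<in> sets K" "B \<in> sets K" using C B sK by auto
   have "emeasure (density K (%x. ennreal (indicator C x))) B = (\<integral>\<^sup>+x. ennreal (indicator C x) * indicator B x \<partial>K)"
    by (rule emeasure_density) auto
   also have "\<dots> = (\<integral>\<^sup>+x. indicator (C \<inter> B) x \<partial>K)" by (rule nn_integral_cong) (simp add: indicator_def)
   also have "\<dots> = emeasure K (C \<inter> B)" by (rule nn_integral_indicator) auto
   finally show ?thesis .
  qed
  then show "emeasure (density M (%x. ennreal (indicator C x))) B = emeasure (density N (%x. ennreal (indicator C x))) B"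
   using eq[OF B] s by simp
 qed
 have m: "indicator C \<in> borel_measurable K" "\<phi> \<in> borel_measurable K" if "sets K = sets borel" for K :: "real measure"
  using C \<phi> that measurable_cong_sets[OF that refl] by auto
 have 1: "(\<integral>x. indicator C x * \<phi> x \<partial>K) = (\<integral>x. \<phi> x \<partial>density K (%x. ennreal (indicator C x)))" if "sets K = sets borel" for K :: "real measure"
  by (subst integral_density) (use m[OF that] in auto)
 have 2: "integrable K (%x. indicator C x * \<phi> x) \<longleftrightarrow> integrable (density K (%x. ennreal (indicator C x))) \<phi>" if "sets K = sets borel" for K :: "real measure"
  by (subst integrable_density) (use m[OF that] in auto)
 show "(\<integral>x. indicator C x * \<phi> x \<partial>M) = (\<integral>x. indicator C x * \<phi> x \<partial>N)" using 1[OF s(1)] 1[OF s(2)] d by simp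
 show "integrable M (%x. indicator C x * \<phi> x) \<longleftrightarrow> integrable N (%x. indicator C x * \<phi> x)" using 2[OF s(1)] 2[OF s(2)] d by simp
qed

text \<open>The counterpart of \<open>projection_valued_measure\<close> on classes. Linearity,
  idempotence and positivity follow from symmetry and multiplicativity.\<close>

locale pvm =
 fixes P :: "real set => 'a::{real_inner,complete_space} => 'a"
 assumes P_sym: "B \<in> sets borel ==> P B x \<bullet> y = x \<bullet> P B y"
  and P_Int: "A \<in> sets borel ==> B \<in> sets borel ==> P (A \<inter> B) x = P A (P B x)"
  and P_UNIV: "P UNIV x = x"
  and P_sums: "range F \<subseteq> sets borel ==> disjoint_family F ==> (%i::nat. P (F i) x \<bullet> y) sums (P (\<Union>i. F i) x \<bullet> y)"
begin

lemma P_add: "B \<in> sets borel ==> P B (x + y) = P B x + P B y"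
 by (simp add: P_sym inner_add_left flip: vector_eq_rdot)

lemma P_scale: "B \<in> sets borel ==> P B (c *\<^sub>R x) = c *\<^sub>R P B x"
 by (simp add: P_sym flip: vector_eq_rdot)

lemma P_diff: "B \<in> sets borel ==> P B (x - y) = P B x - P B y"
 by (simp add: P_sym inner_diff_left flip: vector_eq_rdot)

lemma P_idem: "B \<in> sets borel ==> P B (P B x) = P B x"
 using P_Int[of B B x] by simp

lemma P_self: "B \<in> sets borel ==> P B x \<bullet> x = P B x \<bullet> P B x"
 using P_sym[of B "P B x" x] by (simp add: P_idem)

lemma P_nonneg: "B \<in> sets borel ==> 0 <= P B x \<bullet> x"
 by (simp add: P_self)

text \<open>The constant sequence of empty sets is disjoint, and a convergent series with constant
  terms has zero terms.\<close>

lemma P_empty: "P {} x = 0"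
proof -
 have "P {} x \<bullet> y = 0" for y
 proof -
  have "(%i::nat. P {} x \<bullet> y) sums (P {} x \<bullet> y)"
   using P_sums[of "%_. {}" x y] by (simp add: disjoint_family_on_def)
  then have "(%i::nat. P {} x \<bullet> y) \<longlonglongrightarrow> 0" by (rule summable_LIMSEQ_zero[OF sums_summable])
  then show ?thesis by (simp add: LIMSEQ_const_iff)
 qed
 from this[of "P {} x"] show ?thesis by simp
qed

definition m :: "'a => real measure" where
 "m x = measure_of UNIV (sets borel) (%B. ennreal (P B x \<bullet> x))"

lemma sets_m [simp]: "sets (m x) = sets borel" and space_m [simp]: "space (m x) = UNIV"
 unfolding m_def by (simp_all add: sets_measure_of_conv space_measure_of_conv sets.sigma_sets_eq[of borel, simplified])

lemma measurable_m [simp]: "f \<in> borel_measurable (m x) \<longleftrightarrow> f \<in> borel_measurable borel"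
 using measurable_cong_sets[OF sets_m refl] by blast

lemma emeasure_m: assumes B: "B \<in> sets borel" shows "emeasure (m x) B = ennreal (P B x \<bullet> x)"
proof (rule emeasure_measure_of[OF m_def])
 show "sets borel \<subseteq> Pow (UNIV :: real set)" by simp
 show "B \<in> sets (m x)" using B by simp
 show "positive (sets (m x)) (%B. ennreal (P B x \<bullet> x))" by (simp add: positive_def P_empty)
 show "countably_additive (sets (m x)) (%B. ennreal (P B x \<bullet> x))"
 proof (rule countably_additiveI)
  fix B :: "nat => real set" assume *: "range B \<subseteq> sets (m x)" "disjoint_family B" "(\<Union>i. B i) \<in> sets (m x)"
  show "(\<Sum>i. ennreal (P (B i) x \<bullet> x)) = ennreal (P (\<Union>i. B i) x \<bullet> x)"
   by (rule suminf_ennreal_eq) (use * P_sums[of B x x] in \<open>auto intro!: P_nonneg\<close>)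
 qed
qed

lemma finite_measure_m: "finite_measure (m x)"
 by (rule finite_measureI) (simp add: emeasure_m)

lemma measure_m: "B \<in> sets borel ==> measure (m x) B = P B x \<bullet> x"
 by (simp add: measure_def emeasure_m P_nonneg)

text \<open>Real polarisation of the integral against B -> P B x \<bullet> y; with it
  \<open>SI\<close> is the real counterpart of \<open>spectral_integral\<close>.\<close>

definition bS :: "(real => real) => 'a => 'a => real" where
 "bS \<phi> x y = 1/4 * ((\<integral>s. \<phi> s \<partial>m (x + y)) - (\<integral>s. \<phi> s \<partial>m (x - y)))"

definition dm :: "(real => real) => 'a set" where
 "dm \<phi> = {x. (\<integral>\<^sup>+s. ennreal ((\<phi> s)\<^sup>2) \<partial>m x) < \<infinity>}"

definition SI :: "(real => real) => 'a => 'a => bool" where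
 "SI \<phi> x g \<longleftrightarrow> x \<in> dm \<phi> & (\<forall>h\<in>dm \<phi>. g \<bullet> h = bS \<phi> x h)"

lemma bS_indicator: assumes B: "B \<in> sets borel" shows "bS (indicator B) x y = P B x \<bullet> y"
proof -
 have "P B y \<bullet> x = P B x \<bullet> y" using P_sym[OF B, of y x] by (simp add: inner_commute)
 then show ?thesis
  using B by (simp add: bS_def measure_m P_add P_diff inner_add inner_diff field_simps)
qed

lemma dm_integrable:
 assumes "x \<in> dm \<phi>" "\<phi> \<in> borel_measurable borel" shows "integrable (m x) \<phi>"
proof -
 interpret finite_measure "m x" by (rule finite_measure_m)
 have "integrable (m x) (%s. (\<phi> s)\<^sup>2)"
  using assms by (intro integrableI_bounded) (auto simp: dm_def)
 then show ?thesis using square_integrable_imp_integrable[of \<phi>] assms(2) by simp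
qed

lemma dm_add: assumes "x \<in> dm \<phi>" "y \<in> dm \<phi>" and \<phi>: "\<phi> \<in> borel_measurable borel" shows "x + y \<in> dm \<phi>" "x - y \<in> dm \<phi>"
proof -
 have par: "P B (x + y) \<bullet> (x + y) + P B (x - y) \<bullet> (x - y) = 2 * (P B x \<bullet> x) + 2 * (P B y \<bullet> y)" if "B \<in> sets borel" for B
  using that by (simp add: P_add P_diff inner_add inner_diff)
 have le: "emeasure (m z) B <= 2 * emeasure (m x) B + 2 * emeasure (m y) B" if "z = x + y \<or> z = x - y" "B \<in> sets (m z)" for z B
 proof -
  have B: "B \<in> sets borel" using that by simp
  have "P B z \<bullet> z <= 2 * (P B x \<bullet> x) + 2 * (P B y \<bullet> y)"
   using par[OF B] that(1) P_nonneg[OF B, of "x + y"] P_nonneg[OF B, of "x - y"] by auto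
  then have "ennreal (P B z \<bullet> z) <= ennreal (2 * (P B x \<bullet> x) + 2 * (P B y \<bullet> y))" by (rule ennreal_leI)
  also have "\<dots> = 2 * ennreal (P B x \<bullet> x) + 2 * ennreal (P B y \<bullet> y)"
   using P_nonneg[OF B] by (simp add: ennreal_plus ennreal_mult)
  finally show ?thesis using B by (simp add: emeasure_m)
 qed
 have "z \<in> dm \<phi>" if z: "z = x + y \<or> z = x - y" for z
 proof -
  have "(\<integral>\<^sup>+s. ennreal ((\<phi> s)\<^sup>2) \<partial>m z) <= 2 * (\<integral>\<^sup>+s. ennreal ((\<phi> s)\<^sup>2) \<partial>m x) + 2 * (\<integral>\<^sup>+s. ennreal ((\<phi> s)\<^sup>2) \<partial>m y)"
   by (rule nn_integral_le_sum_measures) (use le[OF z] \<phi> in auto)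
  also have "\<dots> < \<infinity>" using assms by (simp add: dm_def ennreal_mult_less_top)
  finally show ?thesis by (simp add: dm_def)
 qed
 then show "x + y \<in> dm \<phi>" "x - y \<in> dm \<phi>" by auto
qed

lemma P_dm_id: assumes C: "C \<in> sets borel" "C \<subseteq> {-N..N}" shows "P C h \<in> dm (%s. s)"
proof -
 interpret finite_measure "m (P C h)" by (rule finite_measure_m)
 have C': "- C \<in> sets borel" using C by auto
 have "emeasure (m (P C h)) (- C) = 0"
  using emeasure_m[OF C', of "P C h"] P_Int[OF C' C(1), of h] by (simp add: P_empty)
 then have ae: "AE s in m (P C h). s \<in> C"
  by (intro AE_I[of _ _ "- C"]) (use C' in auto)
 have "(\<integral>\<^sup>+s. ennreal (s\<^sup>2) \<partial>m (P C h)) <= (\<integral>\<^sup>+s. ennreal (N\<^sup>2) \<partial>m (P C h))"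
 proof (rule nn_integral_mono_AE)
  show "AE s in m (P C h). ennreal (s\<^sup>2) <= ennreal (N\<^sup>2)"
   using ae
  proof eventually_elim
   case (elim s)
   then have "\<bar>s\<bar> <= \<bar>N\<bar>" using C(2) by (auto simp: abs_le_iff)
   then show ?case by (intro ennreal_leI) (simp add: abs_le_square_iff)
  qed
 qed
 also have "\<dots> < \<infinity>" by (simp add: ennreal_mult_less_top emeasure_eq_measure)
 finally show ?thesis by (simp add: dm_def)
qed

text \<open>Off C the measure of u + P C h sees only u, on C it sees u + h, because P C is a
  projection that commutes with all P B.\<close>

lemma integral_m_P:
 assumes C: "C \<in> sets borel" "C \<subseteq> {-N..N}" and u: "u \<in> dm (%s. s)"
 shows "(\<integral>s. s \<partial>m (u + P C h)) = (\<integral>s. indicator (- C) s * s \<partial>m u) + (\<integral>s. indicator C s * s \<partial>m (u + h))"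
proof -
 have C': "- C \<in> sets borel" using C by auto
 have PC: "P (C \<inter> B) x \<bullet> y = P B x \<bullet> P C y" if "B \<in> sets borel" for B x y
  using P_Int[OF C(1) that, of x] P_sym[OF C(1)] by simp
 have e1: "emeasure (m (u + P C h)) (- C \<inter> B) = emeasure (m u) (- C \<inter> B)" if B: "B \<in> sets borel" for B
 proof -
  have B': "- C \<inter> B \<in> sets borel" using C' B by auto
  have "P (- C \<inter> B) (P C h) = 0"
   using P_Int[OF B' C(1), of h] by (simp add: P_empty Int_commute Int_left_commute)
  moreover have "P (- C \<inter> B) u \<bullet> P C h = 0"
   using P_sym[OF B', of u "P C h"] calculation by simp
  ultimately show ?thesis by (simp add: emeasure_m[OF B'] P_add[OF B'] inner_add)
 qed
 have e2: "emeasure (m (u + P C h)) (C \<inter> B) = emeasure (m (u + h)) (C \<inter> B)" if B: "B \<in> sets borel" for B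
 proof -
  have B': "C \<inter> B \<in> sets borel" using C B by auto
  have 1: "P (C \<inter> B) (P C h) = P (C \<inter> B) h"
   using P_Int[OF B' C(1), of h] by (simp add: Int_commute Int_left_commute)
  have 2: "P (C \<inter> B) x \<bullet> P C h = P (C \<inter> B) x \<bullet> h" for x
   using P_sym[OF C(1), of "P (C \<inter> B) x" h] P_Int[OF C(1) B', of x] by simp
  show ?thesis by (simp add: emeasure_m[OF B'] P_add[OF B'] inner_add 1 2)
 qed
 note i1 = density_indicator_eq[OF sets_m sets_m e1 C', of "%s. s"]
 note i2 = density_indicator_eq[OF sets_m sets_m e2 C(1), of "%s. s"]
 have "integrable (m u) (%s. indicator (- C) s * s)"
  by (subst mult.commute, rule integrable_real_mult_indicator) (use dm_integrable[OF u] C' in auto)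
 then have I1: "integrable (m (u + P C h)) (%s. indicator (- C) s * s)" using i1(2) by simp
 have I2: "integrable (m (u + P C h)) (%s. indicator C s * s)"
 proof -
  interpret finite_measure "m (u + P C h)" by (rule finite_measure_m)
  have "norm (indicator C s * s) <= \<bar>N\<bar>" for s using subsetD[OF C(2), of s] by (cases "s \<in> C") auto
  then show ?thesis using C(1) by (intro integrable_const_bound[of _ "\<bar>N\<bar>"]) auto
 qed
 have "(\<integral>s. s \<partial>m (u + P C h)) = (\<integral>s. indicator (- C) s * s + indicator C s * s \<partial>m (u + P C h))"
  by (rule Bochner_Integration.integral_cong) (auto simp: indicator_def)
 also have "\<dots> = (\<integral>s. indicator (- C) s * s \<partial>m (u + P C h)) + (\<integral>s. indicator C s * s \<partial>m (u + P C h))"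
  by (rule Bochner_Integration.integral_add[OF I1 I2])
 finally show ?thesis using i1(1) i2(1) by simp
qed

text \<open>With u as (1 + L)^-1 f, the vector P C h lies in the domain of the spectral integral of
  s and may be used as a test vector; the parts off C cancel between h and -h. The outcome is d(P f,
  h) = (1 + s) d(P u, h) on bounded sets.\<close>

lemma resolvent_relation:
 assumes C: "C \<in> sets borel" "C \<subseteq> {-N..N}" and SI: "SI (%s. s) u (f - u)"
 shows "P C f \<bullet> h = bS (%s. indicator C s * (1 + s)) u h"
proof -
 have u: "u \<in> dm (%s. s)" using SI by (simp add: SI_def)
 have "(f - u) \<bullet> P C h = bS (%s. s) u (P C h)" using SI P_dm_id[OF C] by (simp add: SI_def)
 also have "\<dots> = 1/4 * ((\<integral>s. indicator C s * s \<partial>m (u + h)) - (\<integral>s. indicator C s * s \<partial>m (u - h)))"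
  using integral_m_P[OF C u, of h] integral_m_P[OF C u, of "- h"] P_scale[OF C(1), of "-1" h] by (simp add: bS_def)
 finally have 1: "P C f \<bullet> h - P C u \<bullet> h = 1/4 * ((\<integral>s. indicator C s * s \<partial>m (u + h)) - (\<integral>s. indicator C s * s \<partial>m (u - h)))"
  by (simp add: inner_diff_left P_sym[OF C(1)])
 have I: "integrable (m x) (%s. indicator C s * s)" "integrable (m x) (indicator C :: real => real)" for x
 proof -
  interpret finite_measure "m x" by (rule finite_measure_m)
  have "norm (indicator C s * s) <= \<bar>N\<bar>" for s using subsetD[OF C(2), of s] by (cases "s \<in> C") auto
  then show "integrable (m x) (%s. indicator C s * s)"
   using C(1) by (intro integrable_const_bound[of _ "\<bar>N\<bar>"]) auto
  show "integrable (m x) (indicator C :: real => real)"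
   by (rule integrable_real_indicator) (use C in \<open>auto simp: emeasure_m\<close>)
 qed
 have "(\<integral>s. indicator C s * (1 + s) \<partial>m x) = (\<integral>s. indicator C s \<partial>m x) + (\<integral>s. indicator C s * s \<partial>m x)" for x
  using Bochner_Integration.integral_add[OF I(2)[of x] I(1)[of x]] by (simp add: distrib_left)
 then have "bS (%s. indicator C s * (1 + s)) u h = bS (indicator C) u h
   + 1/4 * ((\<integral>s. indicator C s * s \<partial>m (u + h)) - (\<integral>s. indicator C s * s \<partial>m (u - h)))"
  by (simp add: bS_def algebra_simps)
 then show ?thesis using 1 unfolding bS_indicator[OF C(1)] by linarith
qed

end

section \<open>The spectral theorem for operators with a positive contractive resolvent\<close>

context pvm
begin

lemma m_uminus: "m (- x) = m x"
 by (rule measure_eqI) (use P_scale[of _ "-1" x] in \<open>auto simp: emeasure_m\<close>)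

lemma bS_commute: "bS \<phi> x y = bS \<phi> y x"
 using m_uminus[of "x - y"] by (simp add: bS_def add.commute)

lemma bS_zero: "bS \<phi> 0 x = 0"
 by (simp add: bS_def m_uminus)

lemma bS_diag: assumes "\<phi> \<in> borel_measurable borel" shows "bS \<phi> x x = (\<integral>s. \<phi> s \<partial>m x)"
proof -
 have "m (x + x) = density (m x) (%_. ennreal 4)"
 proof (rule measure_eqI)
  fix B assume "B \<in> sets (m (x + x))"
  then have B: "B \<in> sets borel" by simp
  have "P B (x + x) \<bullet> (x + x) = 4 * (P B x \<bullet> x)" by (simp add: P_add[OF B] inner_add)
  then show "emeasure (m (x + x)) B = emeasure (density (m x) (%_. ennreal 4)) B"
   using B P_nonneg[OF B, of x] by (simp add: emeasure_density_const emeasure_m ennreal_mult)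
 qed simp
 moreover have "m (x - x) = null_measure borel"
  by (rule measure_eqI) (auto simp: emeasure_m)
 ultimately show ?thesis
  using assms integral_density[of \<phi> "m x" "%_. 4"] by (simp add: bS_def)
qed

lemma bS_tendsto:
 assumes "x \<in> dm (%s. s)" "h \<in> dm (%s. s)"
 shows "(%n. bS (%s. s * indicator {..real n} s) x h) \<longlonglongrightarrow> bS (%s. s) x h"
proof -
 have "(%n. \<integral>s. s * indicator {..real n} s \<partial>m z) \<longlonglongrightarrow> (\<integral>s. s \<partial>m z)" if "z \<in> dm (%s. s)" for z
 proof (rule integral_dominated_convergence[where w = "%s. \<bar>s\<bar>"])
  show "AE s in m z. (%n. s * indicator {..real n} s) \<longlonglongrightarrow> s"
  proof (rule AE_I2)
   fix s :: real
   have "\<forall>\<^sub>F n in sequentially. s * indicator {..real n} s = s"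
    using eventually_ge_at_top[of "nat \<lceil>s\<rceil>"] by eventually_elim (auto simp: indicator_def; linarith)
   then show "(%n. s * indicator {..real n} s) \<longlonglongrightarrow> s" by (rule tendsto_eventually)
  qed
  show "integrable (m z) (%s. \<bar>s\<bar>)" using dm_integrable[OF that] by simp
 qed (auto simp: indicator_def)
 from this[of "x + h"] this[of "x - h"] show ?thesis
  unfolding bS_def using dm_add[OF assms] by (intro tendsto_intros) auto
qed

text \<open>Transported into [0,1] by Y, integrals against polarised spectral measures come under
  the uniqueness result \<open>sfun_eqI\<close>.\<close>

lemma sfun_integral_m:
 assumes Y: "Y \<in> borel_measurable borel" "!!s. Y s \<in> {0..1}"
 shows "sfun (%\<phi>. bS (%s. \<phi> (Y s)) x h)"
proof -
 let ?S = "%\<phi>. 1/4 * (\<integral>y. \<phi> y \<partial>distr (m (x + h)) borel Y) + (-1/4) * (\<integral>y. \<phi> y \<partial>distr (m (x - h)) borel Y)"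
 have fin: "finite_measure (distr (m z) borel Y)" for z
  by (rule finite_measure.finite_measure_distr[OF finite_measure_m]) (use Y in simp)
 have ae: "AE y in distr (m z) borel Y. y \<in> {0..1}" for z
  by (subst AE_distr_iff) (use Y in auto)
 have s: "sfun (%\<phi>. ?S \<phi>)"
  by (intro sfun_combine sfun_integral(1) fin ae) auto
 have eq: "?S \<phi>
   = bS (%s. \<phi> (Y s)) x h" if "bb \<phi>" for \<phi>
 proof -
  have "(\<integral>y. \<phi> y \<partial>distr (m z) borel Y) = (\<integral>s. \<phi> (Y s) \<partial>m z)" for z
   by (rule integral_distr) (use Y that in \<open>auto simp: bb_def\<close>)
  then show ?thesis by (simp add: bS_def)
 qed
 show ?thesis
  unfolding sfun_def
 proof (intro conjI allI impI)
  fix \<phi> \<psi> :: "real => real" assume b: "bb \<phi>" "bb \<psi>"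
  show "bS (%s. \<phi> (Y s) + \<psi> (Y s)) x h = bS (%s. \<phi> (Y s)) x h + bS (%s. \<psi> (Y s)) x h"
   using sfun_add[OF s b] by (simp only: eq b bb_add)
 next
  fix c and \<phi> :: "real => real" assume b: "bb \<phi>"
  show "bS (%s. c * \<phi> (Y s)) x h = c * bS (%s. \<phi> (Y s)) x h"
   using sfun_cmult[OF s b, of c] by (simp only: eq b bb_cmult)
 next
  fix \<phi> :: "nat => real => real" and \<psi> B
  assume b: "ALL n. bb (\<phi> n)" "ALL n. \<forall>x\<in>{0..1}. \<bar>\<phi> n x\<bar> <= B" "\<forall>x\<in>{0..1}. (%n. \<phi> n x) \<longlonglongrightarrow> \<psi> x" "bb \<psi>"
  have b1: "bb (\<phi> n)" for n using b(1) by simp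
  note sfun_lim[OF s, of \<phi> B \<psi>]
  then have "(%n. ?S (\<phi> n)) \<longlonglongrightarrow> ?S \<psi>"
   using b by blast
  then show "(%n. bS (%s. \<phi> n (Y s)) x h) \<longlonglongrightarrow> bS (%s. \<psi> (Y s)) x h"
   by (simp only: eq b1 b(4))
 qed
qed

end

text \<open>As 1 / 0 = 0, the point y = 0 is sent to s = -1; its value enters as an extra summand of
  the bound.\<close>

lemma bb_pull:
 assumes "\<phi> \<in> borel_measurable borel" "!!s. 0 <= s ==> \<bar>\<phi> s\<bar> <= B"
 shows "bb (%y. \<phi> (1 / y - 1))"
proof -
 have "\<bar>\<phi> (1 / y - 1)\<bar> <= \<bar>B\<bar> + \<bar>\<phi> (-1)\<bar>" if "y \<in> {0..1}" for y
 proof (cases "y = 0")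
  case False
  then have "0 <= 1 / y - 1" using that by simp
  from assms(2)[OF this] show ?thesis by simp
 qed simp
 moreover have "(%y. \<phi> (1 / y - 1)) \<in> borel_measurable borel"
  by (rule measurable_compose[OF _ assms(1)]) simp
 ultimately show ?thesis unfolding bb_def by blast
qed

text \<open>Injectivity makes A of the form (1 + L)^-1; the spectral variable of L is then s = 1/y -
  1.\<close>

locale injective_contraction = positive_contraction +
 assumes inj0: "A x = 0 ==> x = 0"
begin

definition Pc :: "real set => 'a => 'a" where "Pc B = fc (%y. indicator B (1 / y - 1))"

lemma bb_pull_indicator: "B \<in> sets borel ==> bb (%y. indicator B (1 / y - 1))"
 by (rule bb_pull[of _ 1]) (auto simp: indicator_def)

text \<open>The indicator of {0} agrees with 0 away from the origin, so \<open>fc_cong\<close> makes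
  its operator vanish.\<close>

lemma AE_\<mu>_pos: "AE y in \<mu> f. 0 < y & y <= 1"
proof -
 have fin: "finite_measure (\<mu> f)" by (rule \<mu>)
 have b: "bb (indicator {0})" by (rule bb_indicator) simp
 have "measure (\<mu> f) {0} = (\<integral>y. indicator {0} y \<partial>\<mu> f)"
  using \<mu>(2)[of f] by (simp add: sets_eq_imp_space_eq)
 also have "\<dots> = fc (indicator {0}) f \<bullet> f" using b by (simp add: fc_inner bform_diag)
 also have "fc (indicator {0}) f = fc (%_. 0 * 0) f"
  by (rule fc_cong[OF inj0 b]) (auto simp: bb_def)
 also have "\<dots> = 0" by (subst fc_fun_scale) auto
 finally have "emeasure (\<mu> f) {0} = 0" using finite_measure.emeasure_eq_measure[OF fin] by simp
 then have "AE y in \<mu> f. y ~= 0" by (intro AE_I[of _ _ "{0}"]) (auto simp: \<mu>(2))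
 with \<mu>(3)[of f] show ?thesis by eventually_elim auto
qed

sublocale Pc: pvm Pc
proof
 fix B :: "real set" and x y assume "B \<in> sets borel"
 then show "Pc B x \<bullet> y = x \<bullet> Pc B y" unfolding Pc_def by (intro fc_sym bb_pull_indicator)
next
 fix B B' :: "real set" and x assume B: "B \<in> sets borel" "B' \<in> sets borel"
 show "Pc (B \<inter> B') x = Pc B (Pc B' x)"
  unfolding Pc_def fc_mult[OF bb_pull_indicator[OF B(1)] bb_pull_indicator[OF B(2)], symmetric]
  by (simp add: indicator_inter_arith)
next
 fix x show "Pc UNIV x = x" by (simp add: Pc_def fc_one)
next
 fix F :: "nat => real set" and x y assume F: "range F \<subseteq> sets borel" "disjoint_family F"
 have Fi: "F i \<in> sets borel" for i using F by auto
 have sum: "(\<Sum>i<n. indicator (F i) s) = (indicator (\<Union>i<n. F i) s :: real)" for n s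
  by (rule indicator_UN_disjoint[symmetric]) (use F(2) in \<open>auto simp: disjoint_family_on_def\<close>)
 have U: "(\<Union>i<n. F i) \<in> sets borel" "(\<Union>i. F i) \<in> sets borel" for n using Fi by auto
 have "(%n. fc (%y. indicator (\<Union>i<n. F i) (1 / y - 1)) x \<bullet> y) \<longlonglongrightarrow> fc (%y. indicator (\<Union>i. F i) (1 / y - 1)) x \<bullet> y"
 proof (rule fc_tendsto[of _ 1])
  show "\<bar>indicator (\<Union>i<n. F i) (1 / y - 1) :: real\<bar> <= 1" for n y by (simp add: indicator_def)
  show "(%n. indicator (\<Union>i<n. F i) (1 / y - 1) :: real) \<longlonglongrightarrow> indicator (\<Union>i. F i) (1 / y - 1)" for y
   by (rule LIMSEQ_indicator_UN)
 qed (intro bb_pull_indicator U)+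
 moreover have "fc (%y. indicator (\<Union>i<n. F i) (1 / y - 1)) x \<bullet> y = (\<Sum>i<n. Pc (F i) x \<bullet> y)" for n
 proof -
  have "bform (%y. \<Sum>i<n. indicator (F i) (1 / y - 1)) x y = (\<Sum>i<n. bform (%y. indicator (F i) (1 / y - 1)) x y)"
   by (rule sfun_sum[OF sfun_bform]) (rule bb_pull_indicator[OF Fi])
  then show ?thesis unfolding Pc_def
   by (subst fc_inner) (auto simp: sum fc_inner bb_pull_indicator Fi U)
 qed
 ultimately show "(%i. Pc (F i) x \<bullet> y) sums (Pc (\<Union>i. F i) x \<bullet> y)"
  unfolding sums_def by (simp add: Pc_def)
qed

lemma emeasure_\<mu>:
 assumes "B \<in> sets borel" shows "emeasure (\<mu> f) B = ennreal (bform (indicator B) f f)"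
 using assms \<mu>(2)[of f] bform_diag[OF bb_indicator[OF assms], of f]
 by (simp add: finite_measure.emeasure_eq_measure[OF \<mu>(1)] sets_eq_imp_space_eq)

lemma measurable_\<mu>: "f \<in> borel_measurable borel ==> f \<in> borel_measurable (\<mu> x)"
 by (subst measurable_cong_sets[OF \<mu>(2) refl])

lemma m_distr: "Pc.m x = distr (\<mu> x) borel (%y. 1 / y - 1)"
proof (rule measure_eqI)
 fix B assume "B \<in> sets (Pc.m x)"
 then have B: "B \<in> sets borel" by simp
 have [measurable]: "B \<in> sets borel" by fact
 have sp: "space (\<mu> x) = UNIV" using sets_eq_imp_space_eq[OF \<mu>(2)] by simp
 have K: "(%y. 1 / y - 1) \<in> borel_measurable (\<mu> x)" by (rule measurable_\<mu>) simp
 have "(%y::real. 1 / y - 1) -` B \<inter> space borel \<in> sets borel" by measurable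
 then have K2: "(%y::real. 1 / y - 1) -` B \<inter> space (\<mu> x) \<in> sets borel" by (simp add: sp)
 have ind: "indicator ((%y. 1 / y - 1) -` B \<inter> space (\<mu> x)) = (%y::real. indicator B (1 / y - 1) :: real)"
  by (auto simp: indicator_def sets_eq_imp_space_eq[OF \<mu>(2)] fun_eq_iff)
 show "emeasure (Pc.m x) B = emeasure (distr (\<mu> x) borel (%y. 1 / y - 1)) B"
  by (simp add: Pc.emeasure_m B emeasure_distr[OF K B] emeasure_\<mu>[OF K2] ind Pc_def fc_inner bb_pull_indicator)
qed simp

lemma bS_bform: assumes "\<phi> \<in> borel_measurable borel" shows "Pc.bS \<phi> x h = bform (%y. \<phi> (1 / y - 1)) x h"
proof -
 have "(\<integral>s. \<phi> s \<partial>Pc.m z) = (\<integral>y. \<phi> (1 / y - 1) \<partial>\<mu> z)" for z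
  unfolding m_distr by (rule integral_distr[OF measurable_\<mu> assms]) simp
 then show ?thesis by (simp add: Pc.bS_def bform_def)
qed

lemma \<mu>_A: "\<mu> (A k) = density (\<mu> k) (%y. ennreal (y\<^sup>2))"
proof (rule measure_eqI)
 show "sets (\<mu> (A k)) = sets (density (\<mu> k) (%y. ennreal (y\<^sup>2)))" by (simp add: \<mu>(2))
 fix B assume "B \<in> sets (\<mu> (A k))"
 then have B: "B \<in> sets borel" by (simp add: \<mu>(2))
 have b: "bb (%y. y * (y * indicator B y))" "bb (%y. y * indicator B y)" using B by (auto intro!: bb_mult bb_id bb_indicator)
 have "emeasure (density (\<mu> k) (%y. ennreal (y\<^sup>2))) B = (\<integral>\<^sup>+y. ennreal (y * (y * indicator B y)) \<partial>\<mu> k)"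
  using B by (subst emeasure_density) (auto simp: \<mu>(2) measurable_\<mu> power2_eq_square indicator_def intro!: nn_integral_cong)
 also have "\<dots> = ennreal (\<integral>y. y * (y * indicator B y) \<partial>\<mu> k)"
  by (rule nn_integral_eq_integral[OF sfun_integral(2)[OF \<mu>(1,2,3) b(1)]]) (auto simp: indicator_def)
 also have "(\<integral>y. y * (y * indicator B y) \<partial>\<mu> k) = bform (indicator B) (A k) (A k)"
  using B b by (simp add: bform_diag[symmetric] bform_A bb_indicator bform_commute[of "%y. y * indicator B y" k "A k"])
 finally show "emeasure (\<mu> (A k)) B = emeasure (density (\<mu> k) (%y. ennreal (y\<^sup>2))) B"
  by (simp add: emeasure_\<mu>[OF B])
qed

text \<open>The measure of A k has the density y^2, and y^2 (1/y - 1)^2 = (1 - y)^2 <= 1.\<close>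

lemma A_dm: "A k \<in> Pc.dm (%s. s)"
proof -
 interpret finite_measure "\<mu> k" by (rule \<mu>)
 have "(\<integral>\<^sup>+s. ennreal (s\<^sup>2) \<partial>Pc.m (A k)) = (\<integral>\<^sup>+y. ennreal (y\<^sup>2) * ennreal ((1 / y - 1)\<^sup>2) \<partial>\<mu> k)"
  unfolding m_distr by (subst nn_integral_distr) (auto simp: \<mu>_A measurable_\<mu> nn_integral_density)
 also have "\<dots> <= (\<integral>\<^sup>+y. 1 \<partial>\<mu> k)"
 proof (rule nn_integral_mono_AE)
  show "AE y in \<mu> k. ennreal (y\<^sup>2) * ennreal ((1 / y - 1)\<^sup>2) <= 1"
   using AE_\<mu>_pos[of k]
  proof eventually_elim
   case (elim y)
   then have "y\<^sup>2 * (1 / y - 1)\<^sup>2 = (1 - y)\<^sup>2" by (simp add: power_mult_distrib[symmetric] right_diff_distrib)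
   also have "\<dots> <= 1" using elim by (simp add: power_le_one)
   finally show ?case by (simp add: ennreal_mult[symmetric])
  qed
 qed
 also have "\<dots> < \<infinity>" by (simp add: emeasure_eq_measure)
 finally show ?thesis by (simp add: Pc.dm_def)
qed

text \<open>The unbounded s is cut off at n. Against A k it gains a factor y, with y (1/y - 1) = 1 -
  y, so bounded convergence removes the cut-off. At y = 0 the product is 0 instead of 1, whence the
  indicator in the limit.\<close>

lemma bS_A:
 assumes h: "h \<in> Pc.dm (%s. s)" shows "Pc.bS (%s. s) (A k) h = (k - A k) \<bullet> h"
proof -
 let ?\<phi> = "%n s. s * indicator {..real n} s"
 let ?\<chi> = "%y::real. (1 - y) * indicator (- {0}) y"
 have b: "bb (%y. ?\<phi> n (1 / y - 1))" for n by (rule bb_pull[of _ "real n"]) (auto simp: indicator_def)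
 have b1: "bb (%y. 1 - y)" by (intro bb_diff bb_id bb_const)
 have b2: "bb ?\<chi>" by (intro bb_mult b1 bb_indicator) auto
 have "(%n. bform (%y. y * ?\<phi> n (1 / y - 1)) k h) \<longlonglongrightarrow> bform ?\<chi> k h"
 proof (rule sfun_lim[OF sfun_bform, of _ 1])
  show "bb (%y. y * ?\<phi> n (1 / y - 1))" for n by (intro bb_mult[OF bb_id] b)
  show "\<bar>y * ?\<phi> n (1 / y - 1)\<bar> <= 1" if "y \<in> {0..1}" for n y
   using that by (cases "y = 0") (auto simp: indicator_def right_diff_distrib)
  show "(%n. y * ?\<phi> n (1 / y - 1)) \<longlonglongrightarrow> ?\<chi> y" if "y \<in> {0..1}" for y
  proof (rule tendsto_eventually)
   show "\<forall>\<^sub>F n in sequentially. y * ?\<phi> n (1 / y - 1) = ?\<chi> y"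
    using eventually_ge_at_top[of "nat \<lceil>1 / y - 1\<rceil>"]
   proof eventually_elim
    case (elim n)
    then have "1 / y - 1 <= real n" by linarith
    then show ?case by (cases "y = 0") (auto simp: indicator_def right_diff_distrib)
   qed
  qed
  show "bb ?\<chi>" by fact
 qed
 moreover have "Pc.bS (?\<phi> n) (A k) h = bform (%y. y * ?\<phi> n (1 / y - 1)) k h" for n
  using bform_A[OF b, of n k h] by (simp add: bS_bform)
 ultimately have "Pc.bS (%s. s) (A k) h = bform ?\<chi> k h"
  using Pc.bS_tendsto[OF A_dm h, of k] LIMSEQ_unique by simp
 also have "\<dots> = fc ?\<chi> k \<bullet> h" using b2 by (simp add: fc_inner)
 also have "fc ?\<chi> k = fc (%y. 1 - y) k" by (rule fc_cong[OF inj0 b2 b1]) (auto simp: indicator_def)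
 also have "\<dots> = fc (%y. 1 + (-1) * y) k" by simp
 also have "\<dots> = fc (%y. 1) k + (-1) *\<^sub>R fc (%y. y) k"
  unfolding fc_fun_scale[OF bb_id, symmetric] by (rule fc_fun_add[OF bb_const bb_cmult[OF bb_id]])
 also have "\<dots> = k - A k" by (simp add: fc_one fc_id)
 finally show ?thesis .
qed

text \<open>The pairs (A k, k - A k) are exactly the graph on the right. Conversely, a pair in the
  graph of the spectral integral is tested with A k, and \<open>bS_A\<close> with the roles
  exchanged gives the resolvent identity against every k.\<close>

theorem SI_Pc: "Pc.SI (%s. s) x g \<longleftrightarrow> x = A (x + g)"
proof
 assume "x = A (x + g)"
 then obtain k where k: "x = A k" "g = k - A k" by (metis add_diff_cancel_left')
 show "Pc.SI (%s. s) x g" unfolding k Pc.SI_def using A_dm bS_A by simp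
next
 assume SI: "Pc.SI (%s. s) x g"
 show "x = A (x + g)"
 proof (rule inner_eqI)
  fix k
  have "g \<bullet> A k = Pc.bS (%s. s) (A k) x" using SI A_dm[of k] by (simp add: Pc.SI_def Pc.bS_commute)
  also have "\<dots> = (k - A k) \<bullet> x" using SI by (intro bS_A) (simp add: Pc.SI_def)
  also have "\<dots> = x \<bullet> k - x \<bullet> A k" by (simp add: inner_diff_right inner_commute[of _ x])
  finally have "g \<bullet> A k = x \<bullet> k - x \<bullet> A k" .
  then show "x \<bullet> k = A (x + g) \<bullet> k" unfolding sym inner_add_left by simp
 qed
qed

end

text \<open>The uniqueness half of the spectral theorem: P is any projection-valued measure for the
  same operator, in particular the one selected by \<open>SOME\<close>. The aim is that its bounded
  functions coincide with \<open>fc\<close>.\<close>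

locale spectral_resolution = positive_contraction A + pvm P
 for A :: "'a::{real_inner,complete_space} => 'a" and P :: "real set => 'a => 'a" +
 assumes SI_iff: "SI (%s. s) x g \<longleftrightarrow> x = A (x + g)"
begin

lemma P_rel:
 assumes "C \<in> sets borel" "C \<subseteq> {-N..N}" shows "P C f \<bullet> h = bS (%s. indicator C s * (1 + s)) (A f) h"
 using resolvent_relation[OF assms, of "A f" f] SI_iff[of "A f" "f - A f"] by simp

text \<open>For f' in the range of the projection and u = A f', the resolvent relation gives f'
  \<bullet> u <= max 0 (1 - eps) * (u \<bullet> u), while A (1 - A) >= 0 gives f' \<bullet> u >= u
  \<bullet> u. So u = 0, and the relation then forces f' = 0.\<close>

lemma P_negative_interval: assumes \<epsilon>: "0 < \<epsilon>" shows "P {-N..-\<epsilon>} f = 0"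
proof -
 let ?C = "{-N..-\<epsilon>}"
 define f' where "f' = P ?C f"
 have C: "?C \<in> sets borel" "?C \<subseteq> {-\<bar>N\<bar>..\<bar>N\<bar>}" using \<epsilon> by auto
 have f': "P ?C f' = f'" by (simp add: f'_def P_idem)
 define u where "u = A f'"
 have "f' \<bullet> u = bS (%s. indicator ?C s * (1 + s)) u u" using P_rel[OF C, of f' u] by (simp add: f' u_def)
 also have "\<dots> = (\<integral>s. indicator ?C s * (1 + s) \<partial>m u)" by (rule bS_diag) simp
 also have "\<dots> <= (\<integral>s. max 0 (1 - \<epsilon>) \<partial>m u)"
 proof (rule integral_mono)
  interpret M: finite_measure "m u" by (rule finite_measure_m)
  show "integrable (m u) (%s. indicator ?C s * (1 + s))"
   by (rule M.integrable_const_bound[of _ "1 + \<bar>N\<bar>"]) (use \<epsilon> in \<open>auto simp: indicator_def\<close>)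
  show "integrable (m u) (%s. max 0 (1 - \<epsilon>))" by (rule M.integrable_const)
 qed (auto simp: indicator_def)
 also have "\<dots> = max 0 (1 - \<epsilon>) * (u \<bullet> u)" using measure_m[of UNIV u] by (simp add: P_UNIV)
 finally have 1: "f' \<bullet> u <= max 0 (1 - \<epsilon>) * (u \<bullet> u)" .
 have "0 <= A (A' f') \<bullet> f'" using pos_pow[of 1 1 f'] by simp
 also have "A (A' f') \<bullet> f' = f' \<bullet> u - u \<bullet> u"
  by (simp add: A'_def linear_diff[OF lin] inner_diff_left inner_diff_right sym u_def inner_commute)
 finally have 2: "(1 - max 0 (1 - \<epsilon>)) * (u \<bullet> u) <= 0" using 1 by (simp add: algebra_simps)
 have "0 < 1 - max 0 (1 - \<epsilon>)" using \<epsilon> by auto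
 with 2 have "u \<bullet> u <= 0" by (simp add: mult_le_0_iff)
 then have u: "u = 0" by (metis inner_eq_zero_iff inner_ge_zero order_antisym)
 have "f' \<bullet> f' = 0" using P_rel[OF C, of f' f'] u by (simp add: f' u_def bS_zero)
 then show ?thesis by (simp add: f'_def)
qed

lemma AE_m_nonneg: "AE s in m f. 0 <= s"
proof -
 have "AE s in m f. \<forall>n::nat. s \<notin> {-real n..-(1 / real (Suc n))}"
  unfolding AE_all_countable
 proof
  fix n :: nat
  have "emeasure (m f) {-real n..-(1 / real (Suc n))} = 0"
   by (subst emeasure_m) (auto simp: P_negative_interval)
  then show "AE s in m f. s \<notin> {-real n..-(1 / real (Suc n))}" by (intro AE_I[of _ _ "{-real n..-(1 / real (Suc n))}"]) auto
 qed
 then show ?thesis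
 proof eventually_elim
  case (elim s)
  show ?case
  proof (rule ccontr)
   assume "\<not> 0 <= s"
   then have s: "s < 0" by simp
   obtain n1 where n1: "- s <= real n1" using real_arch_simple by blast
   obtain n2 where n2: "inverse (real (Suc n2)) < - s" using reals_Archimedean[of "- s"] s by auto
   define n where "n = max n1 n2"
   have "1 / real (Suc n) <= inverse (real (Suc n2))" by (simp add: n_def field_simps)
   moreover have "real n1 <= real n" by (simp add: n_def)
   ultimately have "s \<in> {-real n..-(1 / real (Suc n))}" using n1 n2 by auto
   then show False using elim by blast
  qed
 qed
qed

text \<open>The inverse of y -> 1/y - 1 on s >= 0; elsewhere, where no mass lies, 0 keeps the values
  in [0,1].\<close>

definition Y :: "real => real" where "Y s = (if 0 <= s then 1 / (1 + s) else 0)"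

lemma Y_measurable[measurable]: "Y \<in> borel_measurable borel" unfolding Y_def by measurable

lemma Y_01: "Y s \<in> {0..1}" by (auto simp: Y_def)

lemma Y_pos: "0 <= s ==> 0 < Y s" by (auto simp: Y_def)

lemma bS_cong:
 assumes "!!s. 0 <= s ==> \<phi> s = \<psi> s" "\<phi> \<in> borel_measurable borel" "\<psi> \<in> borel_measurable borel"
 shows "bS \<phi> x h = bS \<psi> x h"
proof -
 have "(\<integral>s. \<phi> s \<partial>m z) = (\<integral>s. \<psi> s \<partial>m z)" for z
  by (rule integral_cong_AE) (use assms AE_m_nonneg[of z] in \<open>auto elim!: eventually_mono\<close>)
 then show ?thesis by (simp add: bS_def)
qed

abbreviation T :: "'a => 'a => (real => real) => real" where "T f h \<phi> \<equiv> bS (%s. \<phi> (Y s)) f h"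

lemma sfun_T: "sfun (T f h)" by (rule sfun_integral_m[OF Y_measurable Y_01])

text \<open>For s >= 0 the condition y >= 1/(n + 1) means s <= n, so the resolvent relation for
  bounded sets applies with 1 + s = 1/y; it extends from indicators to all of
  \<open>bb\<close>.\<close>

lemma T_A_truncated:
 assumes \<psi>: "bb \<psi>"
 shows "T f h (%y. indicator {1 / real (Suc n)..} y * (y * \<psi> y)) = T (A f) h (%y. indicator {1 / real (Suc n)..} y * \<psi> y)"
proof -
 let ?i = "%y::real. indicator {1 / real (Suc n)..} y :: real"
 have bi: "bb ?i" by (rule bb_indicator) simp
 have bw: "bb (%y. ?i y * (1 / y))"
  unfolding bb_def
 proof (intro conjI exI[of _ "real (Suc n)"] ballI)
  fix y :: real assume "y \<in> {0..1}"
  show "\<bar>?i y * (1 / y)\<bar> <= real (Suc n)"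
  proof (cases "1 / real (Suc n) <= y")
   case True
   then have y: "0 < y" by (meson of_nat_0_less_iff zero_less_Suc divide_pos_pos less_le_trans zero_less_one)
   then have "1 / y <= real (Suc n)" using True by (simp add: field_simps)
   then show ?thesis using True y by (simp add: indicator_def)
  qed (simp add: indicator_def)
 qed simp
 have eq: "T f h (%y. ?i y * \<phi> y) = T (A f) h (%y. (?i y * (1 / y)) * \<phi> y)" if b: "bb \<phi>" for \<phi>
 proof -
  let ?D = "%\<phi>. 1 * T f h (%y. ?i y * \<phi> y) + (-1) * T (A f) h (%y. (?i y * (1 / y)) * \<phi> y)"
  have "?D \<phi> = 0"
  proof (rule sfun_eq_zero_indicator[OF _ _ b])
   show "sfun ?D" by (intro sfun_combine sfun_weight sfun_T bi bw)
   fix B :: "real set" assume B: "B \<in> sets borel"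
   define C where "C = {s. Y s \<in> B & 0 <= s & s <= real n}"
   have "{s \<in> space borel. Y s \<in> B & 0 <= s & s <= real n} \<in> sets borel" using B by measurable
   then have C: "C \<in> sets borel" "C \<subseteq> {-real n..real n}" by (auto simp: C_def)
   have eqC: "?i (Y s) * indicator B (Y s) = (indicator C s :: real)" if "0 <= s" for s
   proof -
    have "1 / real (Suc n) <= Y s \<longleftrightarrow> s <= real n" using that by (simp add: Y_def field_simps)
    then show ?thesis using that by (auto simp: indicator_def C_def)
   qed
   have mi: "(indicator B :: real => real) \<in> borel_measurable borel" "(indicator C :: real => real) \<in> borel_measurable borel" using B C by auto
   note [measurable] = B mi
   have "T f h (%y. ?i y * indicator B y) = bS (indicator C) f h"
    by (rule bS_cong) (use eqC in measurable)
   also have "\<dots> = bS (%s. indicator C s * (1 + s)) (A f) h"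
    using P_rel[OF C] by (simp add: bS_indicator[OF C(1)])
   also have "\<dots> = T (A f) h (%y. (?i y * (1 / y)) * indicator B y)"
   proof (rule bS_cong)
    fix s :: real assume s: "0 <= s"
    have "(?i (Y s) * (1 / Y s)) * indicator B (Y s) = (?i (Y s) * indicator B (Y s)) * (1 / Y s)" by (simp only: mult_ac)
    also have "\<dots> = indicator C s * (1 / Y s)" by (simp only: eqC[OF s])
    finally show "indicator C s * (1 + s) = (?i (Y s) * (1 / Y s)) * indicator B (Y s)"
     using s by (simp add: Y_def)
   qed measurable
   finally show "?D (indicator B) = 0" by simp
  qed
  then show ?thesis by simp
 qed
 have "(%s. ?i (Y s) * \<psi> (Y s)) = (%s. (?i (Y s) * (1 / Y s)) * (Y s * \<psi> (Y s)))"
 proof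
  fix s show "?i (Y s) * \<psi> (Y s) = (?i (Y s) * (1 / Y s)) * (Y s * \<psi> (Y s))"
   by (cases "Y s = 0") (auto simp: indicator_def)
 qed
 then show ?thesis using eq[of "%y. y * \<psi> y"] bb_mult[OF bb_id \<psi>] by simp
qed

text \<open>Bounded convergence removes the truncation; the limit leaves out only y = 0, a value
  that Y does not take on s >= 0.\<close>

lemma T_A:
 assumes \<psi>: "bb \<psi>" shows "T f h (%y. y * \<psi> y) = T (A f) h \<psi>"
proof -
 let ?i = "%n y::real. indicator {1 / real (Suc n)..} y :: real"
 have lim: "(%n. T g h (%y. ?i n y * \<phi> y)) \<longlonglongrightarrow> T g h \<phi>" if b: "bb \<phi>" for \<phi> g
 proof -
  obtain B where B: "!!x. x \<in> {0..1} ==> \<bar>\<phi> x\<bar> <= B" using b unfolding bb_def by blast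
  have bi: "bb (?i n)" for n by (rule bb_indicator) simp
  have bp: "bb (indicator {0<..} :: real => real)" by (rule bb_indicator) simp
  have "(%n. T g h (%y. ?i n y * \<phi> y)) \<longlonglongrightarrow> T g h (%y. indicator {0<..} y * \<phi> y)"
  proof (rule sfun_lim[OF sfun_T, of _ B])
   show "\<bar>?i n y * \<phi> y\<bar> <= B" if "y \<in> {0..1}" for n y using B[OF that] by (auto simp: indicator_def)
   show "(%n. ?i n y * \<phi> y) \<longlonglongrightarrow> indicator {0<..} y * \<phi> y" if "y \<in> {0..1}" for y
   proof (rule tendsto_eventually)
    show "\<forall>\<^sub>F n in sequentially. ?i n y * \<phi> y = indicator {0<..} y * \<phi> y"
    proof (cases "y = 0")
     case False
     then have y: "0 < y" using that by simp
     then obtain n0 where n0: "inverse (real (Suc n0)) < y" using reals_Archimedean by blast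
     show ?thesis using eventually_ge_at_top[of n0]
     proof eventually_elim
      case (elim n)
      have "1 / real (Suc n) <= inverse (real (Suc n0))" using elim by (simp add: field_simps)
      then have "1 / real (Suc n) <= y" using n0 by simp
      then show ?case using y by (simp add: indicator_def)
     qed
    qed (simp add: indicator_def)
   qed
  qed (intro bb_mult bi bp b)+
  also have "T g h (%y. indicator {0<..} y * \<phi> y) = T g h \<phi>"
  proof (rule bS_cong)
   have [measurable]: "\<phi> \<in> borel_measurable borel" using b by (simp add: bb_def)
   show "(%s. indicator {0<..} (Y s) * \<phi> (Y s)) \<in> borel_measurable borel" "(%s. \<phi> (Y s)) \<in> borel_measurable borel"
    by measurable
  qed (simp add: Y_pos)
  finally show ?thesis .
 qed
 have "(%n. T f h (%y. ?i n y * (y * \<psi> y))) \<longlonglongrightarrow> T f h (%y. y * \<psi> y)" by (rule lim[OF bb_mult[OF bb_id \<psi>]])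
 then have "(%n. T (A f) h (%y. ?i n y * \<psi> y)) \<longlonglongrightarrow> T f h (%y. y * \<psi> y)" by (simp only: T_A_truncated[OF \<psi>])
 from LIMSEQ_unique[OF this lim[OF \<psi>]] show ?thesis .
qed

lemma T_bform: assumes "bb \<phi>" shows "T f h \<phi> = bform \<phi> f h"
proof (rule sfun_eqI[OF sfun_T sfun_bform _ assms])
 fix n show "T f h (%y. y ^ n) = bform (%y. y ^ n) f h"
 proof (induction n arbitrary: f)
  case 0
  show ?case using bS_indicator[of UNIV f h] bform_power[of 0 f h] by (simp add: P_UNIV indicator_def)
 next
  case (Suc n)
  have b: "bb (%y. y ^ n)" by (intro bb_power bb_id)
  show ?case using T_A[OF b, of f h] bform_A[OF b, of f h] Suc[of "A f"] by simp
 qed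
qed

theorem SI_fc:
 assumes \<phi>: "\<phi> \<in> borel_measurable borel" and b: "bb \<psi>" and eq: "!!s. 0 <= s ==> \<phi> s = \<psi> (1 / (1 + s))"
 shows "x \<in> dm \<phi>" "bS \<phi> x h = fc \<psi> x \<bullet> h" "SI \<phi> x g \<longleftrightarrow> g = fc \<psi> x"
proof -
 have [measurable]: "\<psi> \<in> borel_measurable borel" using b by (simp add: bb_def)
 have bS: "bS \<phi> x h = fc \<psi> x \<bullet> h" for h
 proof -
  have "bS \<phi> x h = T x h \<psi>" by (rule bS_cong) (auto simp: eq Y_def \<phi>)
  then show ?thesis by (simp add: T_bform b fc_inner)
 qed
 then show "bS \<phi> x h = fc \<psi> x \<bullet> h" .
 have dm: "x \<in> dm \<phi>" for x
 proof -
  interpret finite_measure "m x" by (rule finite_measure_m)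
  obtain B where B: "!!y. y \<in> {0..1} ==> \<bar>\<psi> y\<bar> <= B" using b unfolding bb_def by blast
  have "(\<integral>\<^sup>+s. ennreal ((\<phi> s)\<^sup>2) \<partial>m x) <= (\<integral>\<^sup>+s. ennreal (B\<^sup>2) \<partial>m x)"
  proof (rule nn_integral_mono_AE)
   show "AE s in m x. ennreal ((\<phi> s)\<^sup>2) <= ennreal (B\<^sup>2)"
    using AE_m_nonneg
   proof eventually_elim
    case (elim s)
    have "\<bar>\<phi> s\<bar> <= B" unfolding eq[OF elim] using elim by (intro B) auto
    then show ?case by (intro ennreal_leI) (simp add: abs_le_square_iff[symmetric])
   qed
  qed
  also have "\<dots> < \<infinity>" by (simp add: ennreal_mult_less_top emeasure_eq_measure)
  finally show ?thesis by (simp add: dm_def)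
 qed
 then show "x \<in> dm \<phi>" .
 show "SI \<phi> x g \<longleftrightarrow> g = fc \<psi> x"
  unfolding SI_def bS using dm by (auto intro: inner_eqI)
qed

end

section \<open>The semigroup of the Schroedinger operator\<close>

text \<open>Passage from functions to classes. That E respects equality almost everywhere is a
  consequence of symmetry, see \<open>LE_cls\<close>.\<close>

definition LE :: "(real set => (real^'n => complex) => (real^'n => complex)) => real set => 'n::finite ell2 => 'n ell2" where
 "LE E B x = cls (E B (rep x))"

context
 fixes E :: "real set => (real^'n::finite => complex) => (real^'n => complex)"
 assumes E: "projection_valued_measure E"
begin

lemma E_L2: "B \<in> sets borel ==> f \<in> L2 ==> E B f \<in> L2"
 by (rule E[unfolded projection_valued_measure_def, THEN conjunct1, rule_format])

lemma E_sym: "B \<in> sets borel ==> f \<in> L2 ==> g \<in> L2 ==> l2_inner (E B f) g = l2_inner f (E B g)"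
 by (rule E[unfolded projection_valued_measure_def, THEN conjunct2, THEN conjunct1, rule_format])

lemma E_Int: "B \<in> sets borel ==> B' \<in> sets borel ==> f \<in> L2 ==> ae_eq (E (B \<inter> B') f) (E B (E B' f))"
 by (rule E[unfolded projection_valued_measure_def, THEN conjunct2, THEN conjunct2, THEN conjunct1, rule_format])

lemma E_UNIV: "f \<in> L2 ==> ae_eq (E UNIV f) f"
 by (rule E[unfolded projection_valued_measure_def, THEN conjunct2, THEN conjunct2, THEN conjunct2, THEN conjunct1, rule_format])

lemma E_sums: "range F \<subseteq> sets borel ==> disjoint_family F ==> f \<in> L2 ==> g \<in> L2 ==>
  (%i::nat. l2_inner (E (F i) f) g) sums l2_inner (E (\<Union>i. F i) f) g"
 by (rule E[unfolded projection_valued_measure_def, THEN conjunct2, THEN conjunct2, THEN conjunct2, THEN conjunct2, rule_format])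

lemma cls_eqI_inner:
 assumes "f \<in> L2" "g \<in> L2" "!!h. h \<in> L2 ==> l2_inner f h = l2_inner g h" shows "cls f = (cls g :: 'n ell2)"
proof -
 have "cls f \<bullet> x = cls g \<bullet> x" for x :: "'n ell2"
  using assms(3)[of "rep x"] cls_inner[OF assms(1) rep_L2, of x] cls_inner[OF assms(2) rep_L2, of x] by simp
 then show ?thesis using vector_eq_rdot by blast
qed

lemma LE_cls: assumes "B \<in> sets borel" "f \<in> L2" shows "LE E B (cls f) = cls (E B f)"
 unfolding LE_def
proof (rule cls_eqI_inner)
 fix h :: "real^'n => complex" assume h: "h \<in> L2"
 have "l2_inner (E B (rep (cls f))) h = l2_inner (rep (cls f)) (E B h)" using assms h by (simp add: E_sym)
 also have "\<dots> = l2_inner f (E B h)" by (rule l2_inner_cong[OF rep_cls]) (use assms h in \<open>auto simp: E_L2\<close>)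
 also have "\<dots> = l2_inner (E B f) h" using assms h by (simp add: E_sym)
 finally show "l2_inner (E B (rep (cls f))) h = l2_inner (E B f) h" .
qed (use assms in \<open>auto simp: E_L2\<close>)

lemma LE_J: assumes B: "B \<in> sets borel" shows "LE E B (J x) = J (LE E B x)"
proof -
 have i: "(%t. \<i> * rep x t) \<in> L2" by (simp add: L2_cmult)
 have "LE E B (J x) = cls (E B (%t. \<i> * rep x t))" unfolding J_def by (rule LE_cls[OF B i])
 also have "\<dots> = cls (%t. \<i> * E B (rep x) t)"
  by (rule cls_eqI_inner) (use B i in \<open>auto simp: E_L2 L2_cmult E_sym l2_inner_cmult\<close>)
 also have "\<dots> = J (LE E B x)" unfolding LE_def using B by (simp add: J_cls E_L2)
 finally show ?thesis .
qed

lemma pvm_LE: "pvm (LE E)"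
proof
 fix B :: "real set" and x y :: "'n ell2" assume B: "B \<in> sets borel"
 show "LE E B x \<bullet> y = x \<bullet> LE E B y"
  using cls_inner[OF E_L2[OF B rep_L2] rep_L2, of x y] cls_inner[OF rep_L2 E_L2[OF B rep_L2], of x y] E_sym[OF B rep_L2 rep_L2, of x y]
  by (simp add: LE_def)
next
 fix B B' :: "real set" and x :: "'n ell2" assume B: "B \<in> sets borel" "B' \<in> sets borel"
 then have BB: "B \<inter> B' \<in> sets borel" by simp
 have "LE E B (LE E B' x) = cls (E B (E B' (rep x)))" unfolding LE_def[of E B' x] by (rule LE_cls[OF B(1) E_L2[OF B(2) rep_L2]])
 then show "LE E (B \<inter> B') x = LE E B (LE E B' x)"
  unfolding LE_def[of E "B \<inter> B'"] using B BB by (simp add: cls_eq_iff E_L2 E_Int)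
next
 fix x :: "'n ell2"
 have "cls (E UNIV (rep x)) = cls (rep x)" by (subst cls_eq_iff) (auto simp: E_L2 E_UNIV)
 then show "LE E UNIV x = x" by (simp add: LE_def)
next
 fix F :: "nat => real set" and x y :: "'n ell2" assume F: "range F \<subseteq> sets borel" "disjoint_family F"
 have Fi: "F i \<in> sets borel" "(\<Union>i. F i) \<in> sets borel" for i using F(1) by auto
 have "(%i. Re (l2_inner (E (F i) (rep x)) (rep y))) sums Re (l2_inner (E (\<Union>i. F i) (rep x)) (rep y))"
  by (rule sums_Re[OF E_sums[OF F rep_L2 rep_L2]])
 then show "(%i. LE E (F i) x \<bullet> y) sums (LE E (\<Union>i. F i) x \<bullet> y)"
  using cls_inner[OF E_L2[OF Fi(1) rep_L2] rep_L2, of _ x y] cls_inner[OF E_L2[OF Fi(2) rep_L2] rep_L2, of x y] by (simp add: LE_def)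
qed

interpretation LE: pvm "LE E" by (rule pvm_LE)

lemma spectral_measure_LE: assumes f: "f \<in> L2" shows "spectral_measure E f = pvm.m (LE E) (cls f)"
 unfolding spectral_measure_def LE.m_def
proof (rule measure_of_eq)
 fix B assume "B \<in> sigma_sets UNIV (sets (borel :: real measure))"
 then have B: "B \<in> sets borel" using sets.sigma_sets_eq[of "borel :: real measure"] by simp
 show "ennreal (Re (l2_inner (E B f) f)) = ennreal (LE E B (cls f) \<bullet> cls f)"
  by (simp add: LE_cls[OF B f] cls_inner E_L2 B f)
qed simp

lemma m_J: "pvm.m (LE E) (J x) = pvm.m (LE E) x"
 by (rule measure_eqI) (auto simp: LE.emeasure_m LE_J J_inner)

lemma spectral_dom_LE: "f \<in> spectral_dom E \<phi> \<longleftrightarrow> f \<in> L2 & cls f \<in> pvm.dm (LE E) \<phi>"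
 by (auto simp: spectral_dom_def LE.dm_def spectral_measure_LE)

text \<open>In the complex polarisation the terms k = 0, 2 make up the real part and k = 1, 3 the
  imaginary part; each pair is a real polarisation, with h and with i h.\<close>

lemma spectral_sesq_LE:
 assumes f: "f \<in> L2" and h: "h \<in> L2"
 shows "spectral_sesq E \<phi> f h = Complex (pvm.bS (LE E) \<phi> (cls f) (cls h)) (pvm.bS (LE E) \<phi> (cls f) (J (cls h)))"
proof -
 have k: "cls (%x. f x + c * h x) = cls f + cls (%x. c * h x)" for c
  using f h by (simp add: cls_add L2_cmult)
 have s: "spectral_measure E (%x. f x + c * h x) = pvm.m (LE E) (cls f + cls (%x. c * h x))" for c
  unfolding k[symmetric] using f h by (intro spectral_measure_LE) (simp add: L2_add L2_cmult)
 have m1: "cls (%x. - (h x)) = - cls h" using cls_scale[OF h, of "-1"] by simp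
 have m2: "cls (%x. - (\<i> * h x)) = - J (cls h)"
  using cls_scale[of "%x. \<i> * h x" "-1"] J_cls[OF h] h by (simp add: L2_cmult)
 have 3: "\<i> ^ 3 = - \<i>" by (simp add: power3_eq_cube)
 have "{..<4} = {0, 1, 2, 3::nat}" by auto
 then show ?thesis
  using s[of 1] s[of "\<i>"] s[of "-1"] s[of "- \<i>"] m1 m2 J_cls[OF h]
  by (simp add: spectral_sesq_def 3 LE.bS_def complex_eq_iff)
qed

theorem spectral_integral_LE:
 "spectral_integral E \<phi> f g \<longleftrightarrow> f \<in> L2 & g \<in> L2 & pvm.SI (LE E) \<phi> (cls f) (cls g)"
proof -
 have "(\<forall>h\<in>spectral_dom E \<phi>. l2_inner g h = spectral_sesq E \<phi> f h) \<longleftrightarrow>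
   (\<forall>x\<in>LE.dm \<phi>. cls g \<bullet> x = LE.bS \<phi> (cls f) x)" if fg: "f \<in> L2" "g \<in> L2"
 proof
  assume *: "\<forall>h\<in>spectral_dom E \<phi>. l2_inner g h = spectral_sesq E \<phi> f h"
  show "\<forall>x\<in>LE.dm \<phi>. cls g \<bullet> x = LE.bS \<phi> (cls f) x"
  proof
   fix x assume "x \<in> LE.dm \<phi>"
   then have "rep x \<in> spectral_dom E \<phi>" by (simp add: spectral_dom_LE)
   then have "l2_inner g (rep x) = spectral_sesq E \<phi> f (rep x)" using * by blast
   then show "cls g \<bullet> x = LE.bS \<phi> (cls f) x"
    by (simp add: l2_inner_cls[OF fg(2) rep_L2] spectral_sesq_LE[OF fg(1) rep_L2])
  qed
 next
  assume *: "\<forall>x\<in>LE.dm \<phi>. cls g \<bullet> x = LE.bS \<phi> (cls f) x"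
  show "\<forall>h\<in>spectral_dom E \<phi>. l2_inner g h = spectral_sesq E \<phi> f h"
  proof
   fix h assume "h \<in> spectral_dom E \<phi>"
   then have h: "h \<in> L2" "cls h \<in> LE.dm \<phi>" by (auto simp: spectral_dom_LE)
   then have "J (cls h) \<in> LE.dm \<phi>" by (simp add: LE.dm_def m_J)
   then show "l2_inner g h = spectral_sesq E \<phi> f h"
    using * h by (simp add: l2_inner_cls[OF fg(2) h(1)] spectral_sesq_LE[OF fg(1) h(1)])
  qed
 qed
 then show ?thesis unfolding spectral_integral_def LE.SI_def by (auto simp: spectral_dom_LE)
qed

end

text \<open>The point y = 0 corresponds to s = infinity; the value 0 there suits exp(- t s) and 1 /
  (l + s).\<close>

definition pull :: "(real => real) => real => real" where
 "pull \<phi> y = (if 0 < y then \<phi> (1 / y - 1) else 0)"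

lemma pull_bound:
 assumes "!!s. 0 <= s ==> \<bar>\<phi> s\<bar> <= B" "y \<in> {0..1}" "0 <= B" shows "\<bar>pull \<phi> y\<bar> <= B"
 using assms(1)[of "1 / y - 1"] assms(2,3) by (auto simp: pull_def)

lemma bb_pull':
 assumes \<phi>: "\<phi> \<in> borel_measurable borel" and b: "!!s. 0 <= s ==> \<bar>\<phi> s\<bar> <= B"
 shows "bb (pull \<phi>)"
proof -
 note \<phi>[measurable]
 have "0 <= B" using b[of 0] by simp
 moreover have "pull \<phi> \<in> borel_measurable borel" unfolding pull_def by measurable
 moreover have "\<forall>y\<in>{0..1}. \<bar>pull \<phi> y\<bar> <= B" using pull_bound[of \<phi> B] b calculation(1) by simp
 ultimately show ?thesis unfolding bb_def by blast
qed

context schroedinger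
begin

sublocale RC: injective_contraction "R 1"
proof (intro injective_contraction.intro positive_contraction.intro injective_contraction_axioms.intro)
 show "linear (R 1)" by (rule R_linear) simp
 show "R 1 x \<bullet> y = x \<bullet> R 1 y" for x y by (rule R_sym) simp
 fix x :: "'n ell2"
 have p: "R 1 x \<bullet> R 1 x <= R 1 x \<bullet> x" using R_pos[of 1 x] by simp
 then show "0 <= R 1 x \<bullet> x" by (rule order_trans[OF inner_ge_zero])
 have "norm (R 1 x) <= norm x" using R_norm[of 1 x] by simp
 then have "R 1 x \<bullet> x <= norm x * norm x" using norm_cauchy_schwarz[of "R 1 x" x] mult_right_mono[of "norm (R 1 x)" "norm x" "norm x"] norm_ge_zero[of x] by linarith
 then show "R 1 x \<bullet> x <= x \<bullet> x" by (simp add: power2_norm_eq_inner[symmetric] power2_eq_square)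
 show "R 1 x = 0 ==> x = 0" using R_inj[of 1 x] by simp
qed

abbreviation fc where "fc \<equiv> RC.fc"

lemma fc_J: "bb \<phi> ==> fc \<phi> (J f) = J (fc \<phi> f)"
 by (rule RC.fc_commute[OF J_linear J_surj J_inner]) (simp add: R_J)

text \<open>The projections \<open>Pc\<close> commute with \<open>J\<close> by \<open>fc_J\<close>,
  which settles the imaginary parts of the complex inner products.\<close>

lemma resolution_exists: "EX E. is_spectral_resolution E (schrodinger_op V)"
proof
 define E where "E B f = rep (RC.Pc B (cls f))" for B :: "real set" and f :: "real^'n => complex"
 have PJ: "RC.Pc B (J x) = J (RC.Pc B x)" if "B \<in> sets borel" for B x
  unfolding RC.Pc_def by (rule fc_J[OF RC.bb_pull_indicator[OF that]])
 have pv: "projection_valued_measure E"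
  unfolding projection_valued_measure_def
 proof (intro conjI ballI allI impI)
  fix B :: "real set" and f g :: "real^'n => complex" assume B: "B \<in> sets borel" and f: "f \<in> L2" and g: "g \<in> L2"
  show "l2_inner (E B f) g = l2_inner f (E B g)"
   using B f g by (simp add: E_def l2_inner_cls RC.Pc.P_sym PJ[symmetric])
 next
  fix B B' :: "real set" and f :: "real^'n => complex" assume B: "B \<in> sets borel" "B' \<in> sets borel"
  show "ae_eq (E (B \<inter> B') f) (E B (E B' f))" by (simp add: E_def RC.Pc.P_Int[OF B])
 next
  fix f :: "real^'n => complex" assume "f \<in> L2"
  then show "ae_eq (E UNIV f) f" by (simp add: E_def RC.Pc.P_UNIV rep_cls)
 next
  fix F :: "nat => real set" and f g :: "real^'n => complex"
  assume F: "range F \<subseteq> sets borel" "disjoint_family F" and f: "f \<in> L2" and g: "g \<in> L2"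
  show "(%i. l2_inner (E (F i) f) g) sums l2_inner (E (\<Union>i. F i) f) g"
   unfolding sums_complex_iff using g by (simp add: E_def l2_inner_cls RC.Pc.P_sums[OF F])
 qed (simp add: E_def)
 have LE: "LE E = RC.Pc" by (intro ext) (simp add: LE_def E_def)
 have "schrodinger_op V f g \<longleftrightarrow> spectral_integral E (%s. s) f g" for f g
  by (simp add: schrodinger_op_iff spectral_integral_LE[OF pv] LE RC.SI_Pc)
 then show "is_spectral_resolution E (schrodinger_op V)" using pv by (simp add: is_spectral_resolution_def)
qed

lemma resolution: "is_spectral_resolution (schrodinger_resolution V) (schrodinger_op V)"
 unfolding schrodinger_resolution_def by (rule someI_ex[OF resolution_exists])

definition sg :: "real => real => real" where "sg t = pull (%s. exp (- t * s))"

lemma bb_sg: "0 <= t ==> bb (sg t)"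
 unfolding sg_def by (rule bb_pull'[of _ 1]) auto

text \<open>Both \<open>SOME\<close> choices are resolved here: every resolution has the same
  bounded functions by \<open>SI_fc\<close>, and these determine the class of the value.\<close>

theorem semigroup_fc:
 assumes t: "0 < t" and f: "f \<in> L2"
 shows "schrodinger_semigroup V t f \<in> L2" "cls (schrodinger_semigroup V t f) = fc (sg t) (cls f)"
proof -
 let ?E = "schrodinger_resolution V"
 have pv: "projection_valued_measure ?E" using resolution by (simp add: is_spectral_resolution_def)
 interpret LE: pvm "LE ?E" by (rule pvm_LE[OF pv])
 interpret sr: spectral_resolution "R 1" "LE ?E"
 proof
  fix x g :: "'n ell2"
  have "LE.SI (%s. s) x g \<longleftrightarrow> schrodinger_op V (rep x) (rep g)"
   using resolution spectral_integral_LE[OF pv, of "%s. s" "rep x" "rep g"] by (simp add: is_spectral_resolution_def)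
  then show "LE.SI (%s. s) x g \<longleftrightarrow> x = R 1 (x + g)" by (simp add: schrodinger_op_iff)
 qed
 have si: "spectral_integral ?E (%s. exp (- t * s)) f g \<longleftrightarrow> g \<in> L2 & cls g = fc (sg t) (cls f)" for g
 proof -
  have "LE.SI (%s. exp (- t * s)) (cls f) (cls g) \<longleftrightarrow> cls g = fc (sg t) (cls f)"
   by (rule sr.SI_fc(3)[OF _ bb_sg[OF less_imp_le[OF t]]]) (auto simp: sg_def pull_def)
  then show ?thesis unfolding spectral_integral_LE[OF pv] using f by blast
 qed
 have "EX g. spectral_integral ?E (%s. exp (- t * s)) f g"
  by (rule exI[of _ "rep (fc (sg t) (cls f))"]) (simp only: si cls_rep rep_L2 simp_thms)
 from someI_ex[OF this] show "schrodinger_semigroup V t f \<in> L2" "cls (schrodinger_semigroup V t f) = fc (sg t) (cls f)"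
  unfolding schrodinger_semigroup_def si by blast+
qed

end

text \<open>By \<open>fc_norm\<close> the squared norm of the difference is an integral against one
  finite measure, so bounded pointwise convergence gives convergence in norm.\<close>

lemma (in positive_contraction) fc_tendsto_strong:
 assumes \<phi>: "!!n. bb (\<phi> n)" "!!n x. x \<in> {0..1} ==> \<bar>\<phi> n x\<bar> <= B"
  and lim: "!!x. x \<in> {0..1} ==> (%n. \<phi> n x) \<longlonglongrightarrow> \<psi> x" and \<psi>: "bb \<psi>"
 shows "(%n. fc (\<phi> n) f) \<longlonglongrightarrow> fc \<psi> f"
proof -
 obtain B' where B': "!!x. x \<in> {0..1} ==> \<bar>\<psi> x\<bar> <= B'" using \<psi> unfolding bb_def by blast
 have bd: "bb (%x. \<phi> n x - \<psi> x)" for n by (rule bb_diff[OF \<phi>(1) \<psi>])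
 have "(%n. \<integral>x. (\<phi> n x - \<psi> x)\<^sup>2 \<partial>\<mu> f) \<longlonglongrightarrow> (\<integral>x. 0 \<partial>\<mu> f)"
 proof (rule sfun_lim[OF sfun_integral(1)[OF \<mu>(1,2,3)], of _ "(B + B')\<^sup>2"])
  show "bb (%x. (\<phi> n x - \<psi> x)\<^sup>2)" for n by (rule bb_power[OF bd])
  show "\<bar>(\<phi> n x - \<psi> x)\<^sup>2\<bar> <= (B + B')\<^sup>2" if "x \<in> {0..1}" for n x
  proof -
   have "\<bar>\<phi> n x - \<psi> x\<bar> <= B + B'" using \<phi>(2)[OF that, of n] B'[OF that] by linarith
   then have "\<bar>\<phi> n x - \<psi> x\<bar>\<^sup>2 <= (B + B')\<^sup>2" by (rule power_mono) simp
   then show ?thesis by simp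
  qed
  show "(%n. (\<phi> n x - \<psi> x)\<^sup>2) \<longlonglongrightarrow> 0" if "x \<in> {0..1}" for x
   using tendsto_power[OF tendsto_diff[OF lim[OF that] tendsto_const[of "\<psi> x"]], of 2] by simp
 qed simp
 then have "(%n. (norm (fc (%x. \<phi> n x - \<psi> x) f))\<^sup>2) \<longlonglongrightarrow> 0"
  by (simp add: fc_norm[OF bd])
 from tendsto_real_sqrt[OF this] have "(%n. norm (fc (%x. \<phi> n x - \<psi> x) f)) \<longlonglongrightarrow> 0" by simp
 moreover have "fc (%x. \<phi> n x - \<psi> x) f = fc (\<phi> n) f - fc \<psi> f" for n
  using fc_fun_add[OF \<phi>(1)[of n] bb_cmult[OF \<psi>, of "-1"], of f] fc_fun_scale[OF \<psi>, of "-1" f] by simp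
 ultimately have "(%n. norm (fc (\<phi> n) f - fc \<psi> f)) \<longlonglongrightarrow> 0" by simp
 then show ?thesis by (simp add: LIM_zero_iff tendsto_norm_zero_iff)
qed

lemma ell2_borel_rep:
 fixes x :: "'n::finite ell2"
 shows "EX g. g \<in> borel_measurable borel & ae_eq g (rep x)"
proof -
 have "(%t. Re (rep x t)) \<in> borel_measurable (completion lborel)" "(%t. Im (rep x t)) \<in> borel_measurable (completion lborel)"
  using rep_measurable[of x] by simp_all
 from this[THEN completion_ex_borel_measurable_real]
 obtain a b where ab: "a \<in> borel_measurable lborel" "AE t in lborel. Re (rep x t) = a t"
  "b \<in> borel_measurable lborel" "AE t in lborel. Im (rep x t) = b t"
  by blast
 then have m: "a \<in> borel_measurable borel" "b \<in> borel_measurable borel" by simp_all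
 then have "(%t. Complex (a t) (b t)) \<in> borel_measurable borel" unfolding Complex_eq by measurable
 moreover have "AE t in lebesgue. Re (rep x t) = a t" "AE t in lebesgue. Im (rep x t) = b t"
  using ab(2,4) by (auto intro: AE_completion)
 then have "ae_eq (%t. Complex (a t) (b t)) (rep x)"
  unfolding ae_eq_def by eventually_elim (simp add: complex_eq_iff)
 ultimately show ?thesis by blast
qed

text \<open>Joint measurability in \<open>is_semigroup_version\<close> is Borel measurability, hence
  Borel representatives.\<close>

definition brep :: "'n::finite ell2 => real^'n => complex" where
 "brep x = (SOME g. g \<in> borel_measurable borel & ae_eq g (rep x))"

lemma brep: "brep x \<in> borel_measurable borel" "ae_eq (brep x) (rep x)"
 using someI_ex[OF ell2_borel_rep[of x]] unfolding brep_def by blast+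

lemma brep_L2: "brep x \<in> L2" "cls (brep x) = x"
proof -
 have "brep x \<in> borel_measurable lebesgue" using brep(1)[of x] by (intro measurable_completion) simp
 then show L: "brep x \<in> L2" using brep(2)[of x]
  by (intro L2_dominated[OF _ rep_L2[of x], of _ 1]) (auto simp: ae_eq_def elim: eventually_mono)
 have "cls (brep x) = cls (rep x)" using cls_eq_iff[OF L rep_L2, of x] brep(2)[of x] by blast
 then show "cls (brep x) = x" by simp
qed

context schroedinger
begin

text \<open>For y = 1/(1 + s), r = 1/(l + s) satisfies r = y (1 + (1 - l) r). So both sides solve
  the same equation, and their difference d satisfies d = (1 - l) R 1 d, which forces d = 0 because
  0 <= R 1 <= 1 and l > 0.\<close>

lemma R_fc:
 assumes l: "0 < l" shows "R l f = fc (pull (%s. 1 / (l + s))) f"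
proof -
 let ?r = "pull (%s. 1 / (l + s))"
 have b: "bb ?r"
  by (rule bb_pull'[of _ "1 / l"]) (use l in \<open>auto simp: divide_simps\<close>)
 define g where "g = fc ?r f"
 have "g = fc (%y. y * (1 + (1 - l) * ?r y)) f"
  unfolding g_def
 proof (rule RC.fc_cong[OF RC.inj0 b])
  show "bb (%y. y * (1 + (1 - l) * ?r y))" by (intro bb_mult bb_id bb_add bb_const bb_cmult b)
  fix y :: real assume y: "0 < y" "y <= 1"
  have "0 < l * y" using y l by simp
  then have "y < 1 + l * y" using y by linarith
  then show "?r y = y * (1 + (1 - l) * ?r y)" using y by (simp add: pull_def field_simps)
 qed
 also have "\<dots> = R 1 (fc (%y. 1 + (1 - l) * ?r y) f)"
  by (simp add: RC.fc_mult[OF bb_id] RC.fc_id bb_add bb_cmult b)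
 also have "fc (%y. 1 + (1 - l) * ?r y) f = f + (1 - l) *\<^sub>R g"
  by (simp add: RC.fc_fun_add bb_cmult b RC.fc_fun_scale RC.fc_one g_def)
 finally have g: "g = R 1 (f + (1 - l) *\<^sub>R g)" .
 define d where "d = g - R l f"
 have "R l f = R 1 (f + (1 - l) *\<^sub>R R l f)" by (rule R_resolvent[OF l]) simp
 then have "d = R 1 (f + (1 - l) *\<^sub>R g) - R 1 (f + (1 - l) *\<^sub>R R l f)" using g by (simp add: d_def)
 also have "\<dots> = R 1 ((1 - l) *\<^sub>R d)" by (simp add: R_diff[symmetric] d_def algebra_simps)
 finally have d: "d = (1 - l) *\<^sub>R R 1 d" by (simp add: R_scale)
 have "d \<bullet> d = (1 - l) * (R 1 d \<bullet> d)" using arg_cong[OF d, of "%x. x \<bullet> d"] by simp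
 also have "\<dots> <= max 0 (1 - l) * (R 1 d \<bullet> d)" using RC.pos[of d] by (intro mult_right_mono) auto
 also have "\<dots> <= max 0 (1 - l) * (d \<bullet> d)" using RC.le[of d] by (intro mult_left_mono) auto
 finally have "(1 - max 0 (1 - l)) * (d \<bullet> d) <= 0" by (simp add: algebra_simps)
 moreover have "0 < 1 - max 0 (1 - l)" using l by auto
 ultimately have "d \<bullet> d <= 0" by (simp add: mult_le_0_iff)
 then have "d = 0" by (metis inner_eq_zero_iff inner_ge_zero order_antisym)
 then show ?thesis by (simp add: d_def g_def)
qed

text \<open>Exponential formula: with l = (n + 1)/t, the powers (l (l + L)^-1)^(n + 1) tend strongly
  to exp(- t L), and resolvents preserve the closed cone of nonnegative elements.\<close>

lemma semigroup_nonneg: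
 assumes t: "0 < t" and f: "nonneg f" shows "nonneg (fc (sg t) f)"
proof -
 define l where "l n = real (Suc n) / t" for n
 have l: "0 < l n" for n using t by (simp add: l_def)
 define r where "r n = pull (%s. l n / (l n + s))" for n
 have b: "bb (r n)" for n unfolding r_def
  by (rule bb_pull'[of _ 1]) (use l[of n] in \<open>auto simp: divide_simps\<close>)
 have r1: "\<bar>r n y\<bar> <= 1" if "y \<in> {0..1}" for n y unfolding r_def
  by (rule pull_bound[OF _ that]) (use l[of n] in \<open>auto simp: divide_simps\<close>)
 have pw: "fc (%y. r n y ^ k) f = ((%f. l n *\<^sub>R R (l n) f) ^^ k) f" for n k
 proof (induction k)
  case 0 show ?case by (simp add: RC.fc_one)
 next
  case (Suc k)
  have br: "bb (pull (%s. 1 / (l n + s)))"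
   by (rule bb_pull'[of _ "1 / l n"]) (use l[of n] in \<open>auto simp: divide_simps\<close>)
  have "r n = (%y. l n * pull (%s. 1 / (l n + s)) y)" by (auto simp: r_def pull_def fun_eq_iff)
  then have "fc (r n) g = l n *\<^sub>R R (l n) g" for g by (simp add: RC.fc_fun_scale[OF br] R_fc[OF l])
  then show ?case using RC.fc_mult[OF b bb_power[OF b, of n k], of n f] Suc by simp
 qed
 have nn: "nonneg (fc (%y. r n y ^ Suc n) f)" for n
 proof -
  have "nonneg (((%f. l n *\<^sub>R R (l n) f) ^^ k) f)" for k
  proof (induction k)
   case (Suc k)
   have "nonneg (R (l n) (((%f. l n *\<^sub>R R (l n) f) ^^ k) f))" (is "nonneg ?x") by (rule R_nonneg[OF l Suc])
   moreover have "AE t in lebesgue. rep (l n *\<^sub>R ?x) t = complex_of_real (l n) * rep ?x t" by (rule rep_scale)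
   then have "nonneg (l n *\<^sub>R ?x)" unfolding nonneg_def using calculation[unfolded nonneg_def]
    by eventually_elim (use l[of n] in simp)
   then show ?case by simp
  qed (simp add: f)
  then show ?thesis by (simp only: pw)
 qed
 have "(%n. fc (%y. r n y ^ Suc n) f) \<longlonglongrightarrow> fc (sg t) f"
 proof (rule RC.fc_tendsto_strong[of _ 1])
  show "bb (%y. r n y ^ Suc n)" for n by (rule bb_power[OF b])
  show "\<bar>r n y ^ Suc n\<bar> <= 1" if "y \<in> {0..1}" for n y
   using r1[OF that, of n] by (simp add: power_abs power_le_one del: power_Suc)
  show "bb (sg t)" using t by (simp add: bb_sg)
  show "(%n. r n y ^ Suc n) \<longlonglongrightarrow> sg t y" if y: "y \<in> {0..1}" for y
  proof (cases "y = 0")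
   case False
   define s where "s = 1 / y - 1"
   have s: "0 <= s" using y False by (simp add: s_def)
   have "(%n. (1 + (t * s) / real n) ^ n) \<longlonglongrightarrow> exp (t * s)" by (rule tendsto_exp_limit_sequentially)
   from LIMSEQ_Suc[OF this] have "(%n. inverse ((1 + (t * s) / real (Suc n)) ^ Suc n)) \<longlonglongrightarrow> inverse (exp (t * s))"
    by (rule tendsto_inverse) simp
   moreover have "inverse ((1 + (t * s) / real (Suc n)) ^ Suc n) = r n y ^ Suc n" for n
   proof -
    have "r n y = l n / (l n + s)" using y False by (simp add: r_def pull_def s_def)
    also have "\<dots> = inverse (1 + (t * s) / real (Suc n))"
    proof -
     have "l n + s = l n * (1 + (t * s) / real (Suc n))"
      using t by (simp add: l_def distrib_left del: of_nat_Suc)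
     then show ?thesis using l[of n] by (simp add: divide_inverse)
    qed
    finally show ?thesis by (simp only: power_inverse)
   qed
   moreover have "inverse (exp (t * s)) = sg t y" using y False by (simp add: sg_def pull_def s_def exp_minus)
   ultimately show ?thesis by simp
  qed (simp add: r_def sg_def pull_def)
 qed
 then show ?thesis using closed_sequentially[OF closed_nonneg, of "%n. fc (%y. r n y ^ Suc n) f"] nn by (simp del: power_Suc)
qed

text \<open>Write the increment bound as (t s exp(- t s)) |t1 - t2| / t and use x exp(-x) <= 1. The
  constant blows up only as t tends to 0.\<close>

lemma semigroup_Lipschitz:
 assumes t: "0 < t" "t <= t1" "t <= t2"
 shows "norm (fc (sg t1) f - fc (sg t2) f) <= \<bar>t1 - t2\<bar> / t * norm f"
proof -
 have b: "bb (sg t1)" "bb (sg t2)" using t by (simp_all add: bb_sg)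
 have *: "\<bar>exp (- t1 * s) - exp (- t2 * s)\<bar> <= \<bar>t1 - t2\<bar> / t"
  if s: "0 <= s" and t12: "t <= t1" "t1 <= t2" for s t1 t2
 proof -
  have "exp (- t1 * s) - exp (- t2 * s) = exp (- t1 * s) * (1 - exp (- ((t2 - t1) * s)))"
   by (simp add: right_diff_distrib exp_add[symmetric] algebra_simps)
  also have "\<dots> <= exp (- t * s) * ((t2 - t1) * s)"
  proof (rule mult_mono)
   show "exp (- t1 * s) <= exp (- t * s)" using t12 s by (simp add: mult_right_mono)
   show "1 - exp (- ((t2 - t1) * s)) <= (t2 - t1) * s" using exp_ge_add_one_self[of "- ((t2 - t1) * s)"] by linarith
  qed (use t12 s in auto)
  also have "\<dots> = (exp (- (t * s)) * (t * s)) * ((t2 - t1) / t)" using t by simp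
  also have "\<dots> <= 1 * ((t2 - t1) / t)"
  proof (rule mult_right_mono)
   have "t * s <= exp (t * s)" using exp_ge_add_one_self[of "t * s"] by linarith
   then show "exp (- (t * s)) * (t * s) <= 1" by (simp add: exp_minus divide_simps)
  qed (use t t12 in auto)
  finally have "exp (- t1 * s) - exp (- t2 * s) <= (t2 - t1) / t" by simp
  moreover have "exp (- t2 * s) <= exp (- t1 * s)" using t12 s by (simp add: mult_right_mono)
  ultimately show ?thesis using t12 by simp
 qed
 have **: "\<bar>exp (- t1 * s) - exp (- t2 * s)\<bar> <= \<bar>t1 - t2\<bar> / t" if s: "0 <= s" for s
 proof (cases "t1 <= t2")
  case True then show ?thesis using *[OF s t(2)] by blast
 next
  case False
  then show ?thesis using *[OF s t(3), of t1] by (simp add: abs_minus_commute)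
 qed
 have "norm (fc (%y. sg t1 y - sg t2 y) f) <= \<bar>t1 - t2\<bar> / t * norm f"
 proof (rule RC.fc_bound)
  show "bb (%y. sg t1 y - sg t2 y)" by (rule bb_diff[OF b])
  show "\<bar>sg t1 y - sg t2 y\<bar> <= \<bar>t1 - t2\<bar> / t" if "y \<in> {0..1}" for y
   using **[of "1 / y - 1"] that t by (auto simp: sg_def pull_def)
 qed
 moreover have "fc (%y. sg t1 y - sg t2 y) f = fc (sg t1) f - fc (sg t2) f"
  using RC.fc_fun_add[OF b(1) bb_cmult[OF b(2), of "-1"], of f] RC.fc_fun_scale[OF b(2), of "-1" f] by simp
 ultimately show ?thesis by simp
qed

text \<open>Rounding time to the grid 2^-k gives functions piecewise constant in t, hence jointly
  measurable. By the Lipschitz bound their errors are summable, so for each t > 0 they converge at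
  almost every x.\<close>

theorem semigroup_version_exists:
 assumes f: "f \<in> L2" shows "EX u. is_semigroup_version V f u"
proof -
 define c where "c = cls f"
 \<comment> \<open>Rounding up, by floor plus 1, keeps the grid time at or above t, where the
   Lipschitz bound is uniform.\<close>
 define q where "q k j = real_of_int (j + 1) / 2 ^ k" for k :: nat and j :: int
 define U where "U k t = brep (fc (sg (q k \<lfloor>2 ^ k * t\<rfloor>)) c)" for k and t :: real
 define u where "u t x = lim (%k. U k t x)" for t x
 have Um: "(%(t, x). U k t x) \<in> borel_measurable (lborel \<Otimes>\<^sub>M lborel)" for k
 proof -
  have fl: "(%p :: real \<times> (real^'n). \<lfloor>2 ^ k * fst p\<rfloor>) \<in> measurable (lborel \<Otimes>\<^sub>M lborel) (count_space UNIV)"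
   by measurable
  have "(%p :: real \<times> (real^'n). brep (fc (sg (q k j)) c) (snd p)) \<in> borel_measurable (lborel \<Otimes>\<^sub>M lborel)" for j
   by (rule measurable_compose[OF measurable_snd]) (use brep(1) in simp)
  from measurable_compose_countable[OF this fl] show ?thesis by (simp add: U_def case_prod_beta')
 qed
 have "(%(t, x). u t x) \<in> borel_measurable (lborel \<Otimes>\<^sub>M lborel)"
  unfolding u_def case_prod_beta' using Um by (intro borel_measurable_lim_metric) (simp add: case_prod_beta')
 moreover have "ae_eq (u t) (schrodinger_semigroup V t f)" if t: "0 < t" for t
 proof -
  define x where "x k = fc (sg (q k \<lfloor>2 ^ k * t\<rfloor>)) c" for k
  have q: "t <= q k \<lfloor>2 ^ k * t\<rfloor>" "q k \<lfloor>2 ^ k * t\<rfloor> <= t + (1/2) ^ k" for k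
  proof -
   have "2 ^ k * t <= real_of_int (\<lfloor>2 ^ k * t\<rfloor> + 1)" "real_of_int (\<lfloor>2 ^ k * t\<rfloor> + 1) <= 2 ^ k * t + 1" by linarith+
   then show "t <= q k \<lfloor>2 ^ k * t\<rfloor>" "q k \<lfloor>2 ^ k * t\<rfloor> <= t + (1/2) ^ k"
    by (simp_all add: q_def field_simps power_one_over)
  qed
  have lip: "norm (x k - fc (sg t) c) <= (1/2) ^ k / t * norm c" for k
  proof -
   have "norm (x k - fc (sg t) c) <= \<bar>q k \<lfloor>2 ^ k * t\<rfloor> - t\<bar> / t * norm c"
    unfolding x_def by (rule semigroup_Lipschitz[OF t q(1)]) simp
   also have "\<dots> <= (1/2) ^ k / t * norm c"
    using q[of k] t by (intro mult_right_mono divide_right_mono) auto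
   finally show ?thesis .
  qed
  \<comment> \<open>Skipping the first N levels absorbs the constant, so that the increments are at
    most (1/2)^n as \<open>ell2_Cauchy_subseq\<close> demands.\<close>
  obtain N where N: "2 / t * norm c < 2 ^ N" using real_arch_pow[of 2] by auto
  have d: "norm (cls (U (Suc (n + N)) t) - cls (U (n + N) t)) <= (1/2) ^ n" for n
  proof -
   have "norm (x (Suc (n + N)) - x (n + N)) <= norm (x (Suc (n + N)) - fc (sg t) c) + norm (x (n + N) - fc (sg t) c)"
    using norm_triangle_ineq4[of "x (Suc (n + N)) - fc (sg t) c" "x (n + N) - fc (sg t) c"] by simp
   also have "\<dots> <= (1/2) ^ (Suc (n + N)) / t * norm c + (1/2) ^ (n + N) / t * norm c"
    by (intro add_mono lip)
   also have "\<dots> <= (1/2) ^ (n + N) * (2 / t * norm c)" using t by (simp add: field_simps)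
   also have "\<dots> <= (1/2) ^ (n + N) * 2 ^ N" using N by (intro mult_left_mono) auto
   also have "\<dots> = (1/2) ^ n" by (simp add: power_add power_one_over)
   finally show ?thesis by (simp add: U_def brep_L2 x_def)
  qed
  have conv: "AE y in lebesgue. convergent (%n. U (n + N) t y)"
   by (rule ell2_Cauchy_subseq) (use d in \<open>auto simp: U_def brep_L2\<close>)
  have "(%k. (1/2) ^ k / t * norm c) \<longlonglongrightarrow> 0 / t * norm c"
   by (intro tendsto_intros LIMSEQ_power_zero) (use t in auto)
  then have "(%k. x k - fc (sg t) c) \<longlonglongrightarrow> 0"
   by (intro Lim_null_comparison[OF always_eventually[OF allI[OF lip]]]) simp
  then have "x \<longlonglongrightarrow> fc (sg t) c" by (rule LIM_zero_cancel)
  then obtain r where r: "strict_mono r" "AE y in lebesgue. (%n. rep (x (r n)) y) \<longlonglongrightarrow> rep (fc (sg t) c) y"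
   by (rule ell2_AE_subseq)
  have "AE y in lebesgue. ALL k. U k t y = rep (x k) y"
   unfolding AE_all_countable U_def x_def using brep(2) by (auto simp: ae_eq_def)
  moreover have sL: "schrodinger_semigroup V t f \<in> L2" "cls (schrodinger_semigroup V t f) = fc (sg t) c"
   using semigroup_fc[OF t f] by (simp_all add: c_def)
  have "AE y in lebesgue. rep (fc (sg t) c) y = schrodinger_semigroup V t f y"
   using rep_cls[OF sL(1)] by (simp add: sL(2) ae_eq_def)
  ultimately show ?thesis
   using conv r(2) unfolding ae_eq_def
  proof eventually_elim
   case (elim y)
   have "convergent (%k. U k t y)" using elim(3) convergent_ignore_initial_segment[of "%k. U k t y" N] by simp
   then have l: "(%k. U k t y) \<longlonglongrightarrow> u t y" by (simp add: u_def convergent_LIMSEQ_iff)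
   have "(%n. U (r n) t y) \<longlonglongrightarrow> u t y" using LIMSEQ_subseq_LIMSEQ[OF l r(1)] by (simp add: o_def)
   moreover have "(%n. U (r n) t y) \<longlonglongrightarrow> rep (fc (sg t) c) y" using elim(1,4) by simp
   ultimately show ?case using LIMSEQ_unique elim(2) by metis
  qed
 qed
 ultimately show ?thesis unfolding is_semigroup_version_def by blast
qed

lemma semigroup_version:
 assumes f: "f \<in> L2"
 shows "(%(t, x). semigroup_version V f t x) \<in> borel_measurable (lborel \<Otimes>\<^sub>M lborel)"
  and "!!t. 0 < t ==> ae_eq (semigroup_version V f t) (rep (fc (sg t) (cls f)))"
proof -
 have v: "is_semigroup_version V f (semigroup_version V f)"
  unfolding semigroup_version_def by (rule someI_ex[OF semigroup_version_exists[OF f]])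
 then show "(%(t, x). semigroup_version V f t x) \<in> borel_measurable (lborel \<Otimes>\<^sub>M lborel)"
  by (simp add: is_semigroup_version_def)
 fix t :: real assume t: "0 < t"
 have "ae_eq (semigroup_version V f t) (schrodinger_semigroup V t f)" using v t by (simp add: is_semigroup_version_def)
 moreover have "ae_eq (schrodinger_semigroup V t f) (rep (fc (sg t) (cls f)))"
  using rep_cls[OF semigroup_fc(1)[OF t f]] by (simp add: semigroup_fc(2)[OF t f] ae_eq_sym)
 ultimately show "ae_eq (semigroup_version V f t) (rep (fc (sg t) (cls f)))" by (rule ae_eq_trans)
qed

end

section \<open>Weighted time integrals of the semigroup, pointwise and as functions of L\<close>

lemma rep_inner_Re:
 fixes x y :: "'n::finite ell2"
 shows "x \<bullet> y = (\<integral>t. Re (rep x t * cnj (rep y t)) \<partial>lebesgue)"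
 unfolding rep_inner l2_inner_def
 by (rule integral_Re[symmetric]) (rule L2_integrable[OF rep_L2 rep_L2])

text \<open>Take p the positive part of g and h = p - g. Then h is nonnegative on the cone and p
  \<bullet> h = 0, so 0 <= g \<bullet> h = - (h \<bullet> h).\<close>

lemma nonneg_dual:
 fixes g :: "'n::finite ell2"
 assumes g: "!!h. (!!y. nonneg y ==> 0 <= y \<bullet> h) ==> 0 <= g \<bullet> h"
 shows "nonneg g"
proof -
 define p where "p = comp cpos g"
 define h where "h = p - g"
 have h: "AE t in lebesgue. rep h t = cpos (rep g t) - rep g t" "AE t in lebesgue. rep p t = cpos (rep g t)"
  using rep_diff[of p g] rep_comp[OF mc_nc[OF mc_cpos], of g] unfolding h_def p_def
  by (eventually_elim, simp)+
 have "0 <= y \<bullet> h" if y: "nonneg y" for y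
  unfolding rep_inner_Re
 proof (rule integral_nonneg_AE)
  show "AE t in lebesgue. 0 <= Re (rep y t * cnj (rep h t))"
   using y[unfolded nonneg_def] h(1) by eventually_elim (auto simp: cpos_def)
 qed
 then have 1: "0 <= g \<bullet> h" by (rule g)
 have "p \<bullet> h = (\<integral>t. Re (rep p t * cnj (rep h t)) \<partial>lebesgue)" by (rule rep_inner_Re)
 also have "\<dots> = 0"
 proof (rule integral_eq_zero_AE)
  show "AE t in lebesgue. Re (rep p t * cnj (rep h t)) = 0"
   using h by eventually_elim (auto simp: cpos_def max_def)
 qed
 finally have "p \<bullet> h = 0" .
 then have "h \<bullet> h = - (g \<bullet> h)" by (simp add: h_def inner_diff_left)
 with 1 have "h \<bullet> h <= 0" by simp
 then have "h = 0" by (metis inner_eq_zero_iff inner_ge_zero order_antisym)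
 then have "comp cpos g = g" by (simp add: h_def p_def)
 then show ?thesis by (simp add: nonneg_cpos_iff)
qed

lemma AE_eq_if_nn_integrals_eq:
 fixes f g :: "'a::euclidean_space => ennreal"
 assumes [measurable]: "f \<in> borel_measurable borel" "g \<in> borel_measurable borel"
  and eq: "!!B. B \<in> sets borel ==> emeasure lborel B < \<infinity> ==>
   (\<integral>\<^sup>+x. f x * indicator B x \<partial>lborel) = (\<integral>\<^sup>+x. g x * indicator B x \<partial>lborel)"
 shows "AE x in lborel. f x = g x"
proof -
 have [measurable]: "cball (0::'a) (real n) \<in> sets borel" for n by simp
 have "AE x in lborel. f x * indicator (cball 0 (real n)) x = g x * indicator (cball 0 (real n)) x" for n
 proof -
  have km: "(%x. k x * indicator (cball 0 (real n)) x) \<in> borel_measurable lborel" if [measurable]: "k \<in> borel_measurable borel" for k :: "'a => ennreal"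
   by measurable
  have "density lborel (%x. f x * indicator (cball 0 (real n)) x) = density lborel (%x. g x * indicator (cball 0 (real n)) x)"
  proof (rule measure_eqI)
   fix B assume "B \<in> sets (density lborel (%x. f x * indicator (cball 0 (real n)) x))"
   then have B[measurable]: "B \<in> sets borel" by simp
   have "emeasure lborel (cball (0::'a) (real n) \<inter> B) <= emeasure lborel (cball (0::'a) (real n))"
    by (rule emeasure_mono) auto
   also have "\<dots> < \<infinity>" by (rule emeasure_bounded_finite) simp
   finally have fin: "emeasure lborel (cball (0::'a) (real n) \<inter> B) < \<infinity>" .
   have "emeasure (density lborel (%x. k x * indicator (cball 0 (real n)) x)) B
     = (\<integral>\<^sup>+x. k x * indicator (cball 0 (real n) \<inter> B) x \<partial>lborel)" if [measurable]: "k \<in> borel_measurable borel" for k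
    by (subst emeasure_density) (auto intro!: nn_integral_cong simp: indicator_def)
   then show "emeasure (density lborel (%x. f x * indicator (cball 0 (real n)) x)) B = emeasure (density lborel (%x. g x * indicator (cball 0 (real n)) x)) B"
    using eq[OF _ fin] by simp
  qed simp
  then show ?thesis by (rule sigma_finite_measure.density_unique[OF lborel.sigma_finite_measure_axioms km[OF assms(1)] km[OF assms(2)]])
 qed
 then have "AE x in lborel. \<forall>n::nat. f x * indicator (cball 0 (real n)) x = g x * indicator (cball 0 (real n)) x"
  unfolding AE_all_countable by blast
 then show ?thesis
 proof eventually_elim
  case (elim x)
  obtain n where "norm x <= real n" using real_arch_simple by blast
  then show ?case using elim[rule_format, of n] by simp
 qed
qed

context schroedinger
begin

text \<open>Fubini for each of the two measures of the polarisation; the integrable weight times a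
  finite measure dominates.\<close>

lemma laplace_inner:
 assumes W: "integrable lborel W" "!!t. t <= 0 ==> W t = 0" "!!t. 0 <= W t"
  and \<phi>m: "\<phi> \<in> borel_measurable borel" and \<phi>: "!!s. 0 <= s ==> \<phi> s = (\<integral>t. W t * exp (- t * s) \<partial>lborel)"
 shows "fc (pull \<phi>) c \<bullet> h = (\<integral>t. W t * (fc (sg t) c \<bullet> h) \<partial>lborel)"
  and "integrable lborel (%t. W t * (fc (sg t) c \<bullet> h))" and "bb (pull \<phi>)"
proof -
 have [measurable]: "W \<in> borel_measurable borel" using W(1) by auto
 have We: "W t * exp (- t * s) <= W t" if s: "0 <= s" for s t
 proof (cases "t <= 0")
  case False
  then have "exp (- t * s) <= 1" using s by simp
  then show ?thesis using mult_left_mono[OF _ W(3)[of t], of "exp (- t * s)" 1] by simp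
 qed (simp add: W)
 have "\<bar>\<phi> s\<bar> <= (\<integral>t. W t \<partial>lborel)" if s: "0 <= s" for s
 proof -
  have "\<phi> s <= (\<integral>t. W t \<partial>lborel)" unfolding \<phi>[OF s] by (intro integral_mono' W(1) We s) (auto simp: W)
  moreover have "0 <= \<phi> s" unfolding \<phi>[OF s] by (simp add: W)
  ultimately show ?thesis by simp
 qed
 with \<phi>m show b: "bb (pull \<phi>)" by (intro bb_pull') auto
 have *: "(\<integral>y. pull \<phi> y \<partial>RC.\<mu> z) = (\<integral>t. W t * (\<integral>y. sg t y \<partial>RC.\<mu> z) \<partial>lborel)"
  "integrable lborel (%t. W t * (\<integral>y. sg t y \<partial>RC.\<mu> z))" for z
 proof -
  let ?M = "RC.\<mu> z"
  interpret M: finite_measure ?M by (rule RC.\<mu>)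
  interpret P: pair_sigma_finite lborel ?M ..
  have [measurable_cong]: "sets ?M = sets borel" by (rule RC.\<mu>)
  define k where "k t y = W t * (sg t y * indicator {0..1} y)" for t y
  have km[measurable]: "case_prod k \<in> borel_measurable (lborel \<Otimes>\<^sub>M ?M)"
   unfolding k_def sg_def pull_def by measurable
  have k: "0 <= k t y" "k t y <= W t" for t y
   using We[of "1 / y - 1" t] W(3)[of t] by (auto simp: k_def sg_def pull_def indicator_def)
  have "(\<integral>\<^sup>+p. ennreal (norm (case_prod k p)) \<partial>(lborel \<Otimes>\<^sub>M ?M)) = (\<integral>\<^sup>+t. \<integral>\<^sup>+y. ennreal (k t y) \<partial>?M \<partial>lborel)"
   using k by (subst M.nn_integral_fst[symmetric]) auto
  also have "\<dots> <= (\<integral>\<^sup>+t. \<integral>\<^sup>+y. ennreal (W t) \<partial>?M \<partial>lborel)"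
   using k by (intro nn_integral_mono ennreal_leI) auto
  also have "\<dots> = (\<integral>\<^sup>+t. ennreal (W t) \<partial>lborel) * emeasure ?M (space ?M)"
   by (simp add: nn_integral_multc)
  also have "(\<integral>\<^sup>+t. ennreal (W t) \<partial>lborel) = ennreal (\<integral>t. W t \<partial>lborel)"
   by (rule nn_integral_eq_integral[OF W(1)]) (simp add: W)
  also have "ennreal (\<integral>t. W t \<partial>lborel) * emeasure ?M (space ?M) < \<infinity>"
   by (simp add: M.emeasure_eq_measure ennreal_mult_less_top)
  finally have "(\<integral>\<^sup>+p. ennreal (norm (case_prod k p)) \<partial>(lborel \<Otimes>\<^sub>M ?M)) < \<infinity>" .
  then have ki: "integrable (lborel \<Otimes>\<^sub>M ?M) (case_prod k)" by (intro integrableI_bounded) auto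
  have k1: "(\<integral>y. k t y \<partial>?M) = W t * (\<integral>y. sg t y \<partial>?M)" for t
  proof -
   have "(\<integral>y. k t y \<partial>?M) = (\<integral>y. W t * sg t y \<partial>?M)"
   proof (rule integral_cong_AE)
    show "AE y in ?M. k t y = W t * sg t y" using RC.\<mu>(3)[of z] by eventually_elim (simp add: k_def)
    show "(%y. W t * sg t y) \<in> borel_measurable ?M" unfolding sg_def pull_def by measurable
   qed measurable
   then show ?thesis by simp
  qed
  have k2: "(\<integral>t. k t y \<partial>lborel) = pull \<phi> y" if "y \<in> {0..1}" for y
   using that \<phi>[of "1 / y - 1"] by (auto simp: k_def sg_def pull_def)
  show "integrable lborel (%t. W t * (\<integral>y. sg t y \<partial>?M))"
   using P.integrable_fst'[OF ki] by (simp add: k1)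
  have "(\<integral>y. pull \<phi> y \<partial>?M) = (\<integral>y. \<integral>t. k t y \<partial>lborel \<partial>?M)"
  proof (rule integral_cong_AE)
   show "pull \<phi> \<in> borel_measurable ?M" using b unfolding bb_def by (intro RC.measurable_\<mu>) simp
   show "AE y in ?M. pull \<phi> y = (\<integral>t. k t y \<partial>lborel)" using RC.\<mu>(3)[of z] by eventually_elim (simp add: k2)
  qed measurable
  also have "\<dots> = (\<integral>t. W t * (\<integral>y. sg t y \<partial>?M) \<partial>lborel)"
   using P.Fubini_integral[OF ki] by (simp add: k1)
  finally show "(\<integral>y. pull \<phi> y \<partial>?M) = (\<integral>t. W t * (\<integral>y. sg t y \<partial>?M) \<partial>lborel)" .
 qed
 have eq: "W t * (fc (sg t) c \<bullet> h) = 1/4 * (W t * (\<integral>y. sg t y \<partial>RC.\<mu> (c + h))) + (-1/4) * (W t * (\<integral>y. sg t y \<partial>RC.\<mu> (c - h)))" for t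
 proof (cases "t <= 0")
  case False
  then show ?thesis by (simp add: RC.fc_inner bb_sg RC.bform_def algebra_simps)
 qed (simp add: W)
 show "integrable lborel (%t. W t * (fc (sg t) c \<bullet> h))" unfolding eq
  by (intro Bochner_Integration.integrable_add integrable_mult_right *(2))
 have "(\<integral>t. W t * (fc (sg t) c \<bullet> h) \<partial>lborel) = 1/4 * (\<integral>y. pull \<phi> y \<partial>RC.\<mu> (c + h)) + (-1/4) * (\<integral>y. pull \<phi> y \<partial>RC.\<mu> (c - h))"
  unfolding eq *(1)
  by (subst Bochner_Integration.integral_add) (intro integrable_mult_right *(2) | simp)+
 then show "fc (pull \<phi>) c \<bullet> h = (\<integral>t. W t * (fc (sg t) c \<bullet> h) \<partial>lborel)"
  using b by (simp add: RC.fc_inner RC.bform_def)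
qed

text \<open>The time integral at fixed x and the vector from the functional calculus have equal
  integrals over every Borel set of finite measure, by Tonelli and \<open>laplace_inner\<close> with
  the indicator as h. Nonnegativity comes from self-duality of the cone.\<close>

theorem laplace:
 assumes W: "integrable lborel W" "!!t. t <= 0 ==> W t = 0" "!!t. 0 <= W t"
  and \<phi>m: "\<phi> \<in> borel_measurable borel" and \<phi>: "!!s. 0 <= s ==> \<phi> s = (\<integral>t. W t * exp (- t * s) \<partial>lborel)"
  and c: "nonneg c"
  and u: "(%(t, x). u t x) \<in> borel_measurable (lborel \<Otimes>\<^sub>M lborel)" "!!t. 0 < t ==> ae_eq (u t) (rep (fc (sg t) c))"
 shows "nonneg (fc (pull \<phi>) c)"
  and "AE x in lebesgue. (\<integral>\<^sup>+t. ennreal (W t) * ennreal (Re (u t x)) \<partial>lborel) = ennreal (Re (rep (fc (pull \<phi>) c) x))"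
proof -
 have L1: "fc (pull \<phi>) c \<bullet> h = (\<integral>t. W t * (fc (sg t) c \<bullet> h) \<partial>lborel)" for h
  by (rule laplace_inner(1)) (use assms in blast)+
 have L2: "integrable lborel (%t. W t * (fc (sg t) c \<bullet> h))" for h
  by (rule laplace_inner(2)[of W \<phi>]) (use assms in blast)+
 let ?g = "fc (pull \<phi>) c"
 have Wm[measurable]: "W \<in> borel_measurable borel" using W(1) by auto
 note u1[measurable] = u(1)
 show g: "nonneg ?g"
 proof (rule nonneg_dual)
  fix h :: "'n ell2" assume h: "!!y. nonneg y ==> 0 <= y \<bullet> h"
  have "0 <= W t * (fc (sg t) c \<bullet> h)" for t
  proof (cases "t <= 0")
   case False
   then show ?thesis using h[OF semigroup_nonneg[of t, OF _ c]] W(3)[of t] by simp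
  qed (simp add: W)
  then show "0 <= ?g \<bullet> h" unfolding L1 by (intro Bochner_Integration.integral_nonneg)
 qed
 define F where "F x = (\<integral>\<^sup>+t. ennreal (W t) * ennreal (Re (u t x)) \<partial>lborel)" for x
 have um: "(%p. u (fst p) (snd p)) \<in> borel_measurable (lborel \<Otimes>\<^sub>M lborel)" using u1 by (simp add: case_prod_beta')
 have m1: "(%(x, t). ennreal (W t) * ennreal (Re (u t x))) \<in> borel_measurable (lborel \<Otimes>\<^sub>M lborel)"
 proof -
  have "(%(x, t). u t x) \<in> borel_measurable (lborel \<Otimes>\<^sub>M lborel)"
   using measurable_pair_swap[OF u1] by simp
  then show ?thesis by measurable
 qed
 then have [measurable]: "F \<in> borel_measurable borel" unfolding F_def
  using lborel.borel_measurable_nn_integral[of "%x t. ennreal (W t) * ennreal (Re (u t x))" lborel] by simp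
 have [measurable]: "brep ?g \<in> borel_measurable borel" by (rule brep)
 have "AE x in lborel. F x = ennreal (Re (brep ?g x))"
 proof (rule AE_eq_if_nn_integrals_eq)
  fix B :: "(real^'n) set" assume B[measurable]: "B \<in> sets borel" and fin: "emeasure lborel B < \<infinity>"
  have iL: "(%x. indicator B x :: complex) \<in> L2"
  proof -
   have "integrable lebesgue (indicator B :: real^'n => real)"
    using B fin by (intro integrable_real_indicator) auto
   moreover have "(%x. (cmod (indicator B x))\<^sup>2) = (indicator B :: real^'n => real)" by (auto simp: indicator_def)
   ultimately show ?thesis using B by (simp add: L2_def borel_measurable_indicator)
  qed
  define h where "h = cls (%x. indicator B x :: complex)"
  have hr: "AE x in lebesgue. rep h x = indicator B x" using rep_cls[OF iL] by (simp add: h_def ae_eq_def)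
  have hn: "nonneg h" unfolding nonneg_def using hr by eventually_elim (simp add: indicator_def)
  have I: "(\<integral>\<^sup>+x. ennreal (Re (v x)) * indicator B x \<partial>lborel) = ennreal (y \<bullet> h)"
   if y: "nonneg y" and v: "ae_eq v (rep y)" for y v
  proof -
   have "(\<integral>\<^sup>+x. ennreal (Re (v x)) * indicator B x \<partial>lborel) = (\<integral>\<^sup>+x. ennreal (Re (v x)) * indicator B x \<partial>lebesgue)"
    by (simp add: nn_integral_completion)
   also have "\<dots> = (\<integral>\<^sup>+x. ennreal (Re (rep y x)) * ennreal (Re (rep h x)) \<partial>lebesgue)"
    by (rule nn_integral_cong_AE) (use v[unfolded ae_eq_def] hr in eventually_elim, auto simp: indicator_def)
   finally show ?thesis by (simp add: nonneg_inner_integral[OF y hn])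
  qed
  have "(\<integral>\<^sup>+x. F x * indicator B x \<partial>lborel) = (\<integral>\<^sup>+x. \<integral>\<^sup>+t. ennreal (W t) * ennreal (Re (u t x)) * indicator B x \<partial>lborel \<partial>lborel)"
   unfolding F_def using m1 by (intro nn_integral_cong nn_integral_multc[symmetric]) measurable
  also have "\<dots> = (\<integral>\<^sup>+t. \<integral>\<^sup>+x. ennreal (W t) * ennreal (Re (u t x)) * indicator B x \<partial>lborel \<partial>lborel)"
   by (rule lborel_pair.Fubini') measurable
  also have "\<dots> = (\<integral>\<^sup>+t. ennreal (W t) * (\<integral>\<^sup>+x. ennreal (Re (u t x)) * indicator B x \<partial>lborel) \<partial>lborel)"
  proof (rule nn_integral_cong)
   fix t
   have "(%x. u t x) \<in> borel_measurable lborel" using u1 by measurable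
   then show "(\<integral>\<^sup>+x. ennreal (W t) * ennreal (Re (u t x)) * indicator B x \<partial>lborel) = ennreal (W t) * (\<integral>\<^sup>+x. ennreal (Re (u t x)) * indicator B x \<partial>lborel)"
    by (simp add: mult.assoc nn_integral_cmult)
  qed
  also have "\<dots> = (\<integral>\<^sup>+t. ennreal (W t * (fc (sg t) c \<bullet> h)) \<partial>lborel)"
  proof (rule nn_integral_cong)
   fix t
   show "ennreal (W t) * (\<integral>\<^sup>+x. ennreal (Re (u t x)) * indicator B x \<partial>lborel) = ennreal (W t * (fc (sg t) c \<bullet> h))"
   proof (cases "t <= 0")
    case False
    then have t: "0 < t" by simp
    show ?thesis unfolding I[OF semigroup_nonneg[OF t c] u(2)[OF t]]
     by (rule ennreal_mult[symmetric]) (use W nonneg_inner[OF semigroup_nonneg[OF t c] hn] in auto)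
   qed (simp add: W)
  qed
  also have "\<dots> = ennreal (\<integral>t. W t * (fc (sg t) c \<bullet> h) \<partial>lborel)"
  proof (rule nn_integral_eq_integral[OF L2])
   show "AE t in lborel. 0 <= W t * (fc (sg t) c \<bullet> h)"
   proof (rule AE_I2)
    fix t show "0 <= W t * (fc (sg t) c \<bullet> h)"
     using W nonneg_inner[OF semigroup_nonneg[OF _ c] hn, of t] by (cases "t <= 0") auto
   qed
  qed
  also have "\<dots> = (\<integral>\<^sup>+x. ennreal (Re (brep ?g x)) * indicator B x \<partial>lborel)"
   using I[OF g brep(2)] by (simp add: L1)
  finally show "(\<integral>\<^sup>+x. F x * indicator B x \<partial>lborel) = (\<integral>\<^sup>+x. ennreal (Re (brep ?g x)) * indicator B x \<partial>lborel)" .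
 qed measurable
 then have "AE x in lebesgue. F x = ennreal (Re (brep ?g x))" by (rule AE_completion)
 then show "AE x in lebesgue. (\<integral>\<^sup>+t. ennreal (W t) * ennreal (Re (u t x)) \<partial>lborel) = ennreal (Re (rep ?g x))"
  using brep(2)[of ?g, unfolded ae_eq_def] unfolding F_def by eventually_elim simp
qed

end

section \<open>Negative powers of l + L as Gamma integrals, and their bounds weighted by V\<close>

definition gw :: "real => real => real => real" where
 "gw b l t = indicator {0<..} t * t powr (b - 1) * exp (- t * l)"

lemma gw_measurable [measurable]: "gw b l \<in> borel_measurable borel" unfolding gw_def by measurable

lemma gw_nonneg: "0 <= gw b l t" by (simp add: gw_def)

lemma gw_zero: "t <= 0 ==> gw b l t = 0" by (simp add: gw_def)

lemma nn_integral_gw: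
 assumes b: "0 < b" and l: "0 < l"
 shows "(\<integral>\<^sup>+t. ennreal (gw b l t) \<partial>lborel) = ennreal (Gamma b * l powr (- b))"
proof -
 let ?I = "\<integral>\<^sup>+t. ennreal (gw b l t) \<partial>lborel"
 have G: "0 < Gamma b" by (rule Gamma_real_pos[OF b])
 have "ennreal (Gamma b) = (\<integral>\<^sup>+t. ennreal (indicator {0..} t * t powr (b - 1) / exp t) \<partial>lborel)"
  by (rule Gamma_conv_nn_integral_real[OF b])
 also have "\<dots> = ennreal \<bar>l\<bar> * (\<integral>\<^sup>+t. ennreal (indicator {0..} (0 + l * t) * (0 + l * t) powr (b - 1) / exp (0 + l * t)) \<partial>lborel)"
  by (rule nn_integral_real_affine) (use l in auto)
 also have "(\<integral>\<^sup>+t. ennreal (indicator {0..} (0 + l * t) * (0 + l * t) powr (b - 1) / exp (0 + l * t)) \<partial>lborel)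
   = (\<integral>\<^sup>+t. ennreal (l powr (b - 1)) * ennreal (gw b l t) \<partial>lborel)"
 proof (rule nn_integral_cong)
  fix t
  have "indicator {0..} (0 + l * t) * (0 + l * t) powr (b - 1) / exp (0 + l * t) = l powr (b - 1) * gw b l t"
   using l by (cases "0 < t") (auto simp: gw_def indicator_def powr_mult exp_minus field_simps zero_le_mult_iff)
  then show "ennreal (indicator {0..} (0 + l * t) * (0 + l * t) powr (b - 1) / exp (0 + l * t)) = ennreal (l powr (b - 1)) * ennreal (gw b l t)"
   by (simp add: ennreal_mult[symmetric] gw_nonneg)
 qed
 also have "\<dots> = ennreal (l powr (b - 1)) * ?I" by (rule nn_integral_cmult) simp
 finally have "ennreal (Gamma b) = ennreal (l powr b) * ?I"
  using l by (simp add: mult.assoc[symmetric] ennreal_mult[symmetric] powr_mult_base)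
 then have "ennreal (l powr (- b)) * ennreal (Gamma b) = (ennreal (l powr (- b)) * ennreal (l powr b)) * ?I"
  by (simp add: mult.assoc)
 also have "ennreal (l powr (- b)) * ennreal (l powr b) = 1"
  using l by (simp add: ennreal_mult[symmetric] powr_add[symmetric])
 finally show ?thesis using G by (simp add: ennreal_mult[symmetric] mult.commute)
qed

lemma gw_integral:
 assumes b: "0 < b" and l: "0 < l"
 shows "integrable lborel (gw b l)" "(\<integral>t. gw b l t \<partial>lborel) = Gamma b * l powr (- b)"
 using nn_integral_eq_integrable[of "gw b l" lborel "Gamma b * l powr (- b)"] nn_integral_gw[OF b l] Gamma_real_pos[OF b]
 by (auto simp: gw_nonneg)

lemma gw_exp: "gw b l t * exp (- t * s) = gw b (l + s) t"
 by (simp add: gw_def exp_add[symmetric] algebra_simps)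

lemma gw_SUP: "(SUP n. ennreal (gw b (1 / real (Suc n)) t)) = ennreal (gw b 0 t)"
proof -
 have "incseq (%n. ennreal (gw b (1 / real (Suc n)) t))"
 proof (rule incseq_SucI)
  fix n
  show "ennreal (gw b (1 / real (Suc n)) t) <= ennreal (gw b (1 / real (Suc (Suc n))) t)"
  proof (cases "0 < t")
   case True
   have "- t * (1 / real (Suc n)) <= - t * (1 / real (Suc (Suc n)))"
    using True by (intro mult_left_mono_neg) (auto simp: field_simps)
   then show ?thesis unfolding gw_def by (intro ennreal_leI mult_left_mono) auto
  qed (simp add: gw_def)
 qed
 from LIMSEQ_SUP[OF this] have 1: "(%n. ennreal (gw b (1 / real (Suc n)) t)) \<longlonglongrightarrow> (SUP n. ennreal (gw b (1 / real (Suc n)) t))" .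
 have "(%n. gw b (1 / real (Suc n)) t) \<longlonglongrightarrow> indicator {0<..} t * t powr (b - 1) * exp (- t * 0)"
  unfolding gw_def by (intro tendsto_intros LIMSEQ_Suc[OF lim_1_over_n])
 then have "(%n. ennreal (gw b (1 / real (Suc n)) t)) \<longlonglongrightarrow> ennreal (gw b 0 t)"
  by (intro tendsto_ennrealI) (simp add: gw_def)
 from LIMSEQ_unique[OF 1 this] show ?thesis .
qed

text \<open>An initial datum c with an arbitrary jointly measurable version u of its semigroup, tied
  to it only up to a null set for each t.\<close>

locale flow = schroedinger V for V :: "real^'n::finite => real" +
 fixes c :: "'n ell2" and u :: "real => real^'n => complex"
 assumes c: "nonneg c" and u: "(%(t, x). u t x) \<in> borel_measurable (lborel \<Otimes>\<^sub>M lborel)"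
  and u_ae: "!!t. 0 < t ==> ae_eq (u t) (rep (fc (sg t) c))"
begin

text \<open>For l > 0 this is Gamma b times (l + L)^(-b) c, see \<open>G_rep\<close>. For l = 0 it
  is defined pointwise only and may be infinite.\<close>

definition G :: "real => real => real^'n => ennreal" where
 "G b l x = (\<integral>\<^sup>+t. ennreal (gw b l t) * ennreal (Re (u t x)) \<partial>lborel)"

lemma u_swap [measurable]: "(%(x, t). u t x) \<in> borel_measurable (lborel \<Otimes>\<^sub>M lborel)"
 using measurable_pair_swap[OF u] by simp

lemma u_t [measurable]: "(%t. u t x) \<in> borel_measurable borel"
proof -
 have "(%t. (x, t)) \<in> measurable borel (lborel \<Otimes>\<^sub>M lborel)" by simp
 from measurable_compose[OF this u_swap] show ?thesis by simp
qed

lemma G_borel [measurable]: "G b l \<in> borel_measurable borel"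
proof -
 have "(%(x, t). ennreal (gw b l t) * ennreal (Re (u t x))) \<in> borel_measurable (lborel \<Otimes>\<^sub>M lborel)" by measurable
 from lborel.borel_measurable_nn_integral[OF this] show ?thesis unfolding G_def by simp
qed

lemma G_lebesgue [measurable]: "G b l \<in> borel_measurable lebesgue"
 by (rule measurable_completion) simp

abbreviation gp :: "real => real => 'n ell2" where
 "gp b l \<equiv> fc (pull (%s. Gamma b * (l + s) powr (- b))) c"

lemma G_rep:
 assumes b: "0 < b" and l: "0 < l"
 shows "nonneg (gp b l)" "AE x in lebesgue. G b l x = ennreal (Re (rep (gp b l) x))"
  "bb (pull (%s. Gamma b * (l + s) powr (- b)))"
proof -
 have eq: "Gamma b * (l + s) powr (- b) = (\<integral>t. gw b l t * exp (- t * s) \<partial>lborel)" if "0 <= s" for s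
  unfolding gw_exp using gw_integral(2)[OF b, of "l + s"] l that by simp
 have m: "(%s. Gamma b * (l + s) powr (- b)) \<in> borel_measurable borel" by measurable
 note L = laplace[of "gw b l" "%s. Gamma b * (l + s) powr (- b)" c u, OF gw_integral(1)[OF b l] gw_zero gw_nonneg m eq c u u_ae]
 show "nonneg (gp b l)" by (rule L(1)) auto
 show "AE x in lebesgue. G b l x = ennreal (Re (rep (gp b l) x))" unfolding G_def by (rule L(2)) auto
 show "bb (pull (%s. Gamma b * (l + s) powr (- b)))"
  by (rule laplace_inner(3)[of "gw b l"]) (use gw_integral(1)[OF b l] gw_zero gw_nonneg m eq in auto)
qed

lemma G_0_SUP: "G b 0 x = (SUP n. G b (1 / real (Suc n)) x)"
proof -
 have "G b 0 x = (\<integral>\<^sup>+t. (SUP n. ennreal (gw b (1 / real (Suc n)) t) * ennreal (Re (u t x))) \<partial>lborel)"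
  unfolding G_def gw_SUP[symmetric] by (simp add: SUP_mult_right_ennreal)
 also have "\<dots> = (SUP n. G b (1 / real (Suc n)) x)"
  unfolding G_def
 proof (rule nn_integral_monotone_convergence_SUP)
  show "incseq (%n t. ennreal (gw b (1 / real (Suc n)) t) * ennreal (Re (u t x)))"
  proof (rule incseq_SucI, rule le_funI)
   fix n t
   show "ennreal (gw b (1 / real (Suc n)) t) * ennreal (Re (u t x)) <= ennreal (gw b (1 / real (Suc (Suc n))) t) * ennreal (Re (u t x))"
   proof (cases "0 < t")
    case True
    have "- t * (1 / real (Suc n)) <= - t * (1 / real (Suc (Suc n)))"
     using True by (intro mult_left_mono_neg) (auto simp: field_simps)
    then show ?thesis unfolding gw_def by (intro mult_right_mono ennreal_leI mult_left_mono) auto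
   qed (simp add: gw_def)
  qed
 qed measurable
 finally show ?thesis .
qed

lemma gp_1: assumes l: "0 < l" shows "gp 1 l = R l c"
proof -
 have "pull (%s. Gamma 1 * (l + s) powr (- 1)) y = pull (%s. 1 / (l + s)) y" if "y \<in> {0..1}" for y
  using that l by (auto simp: pull_def powr_minus_divide)
 then have "gp 1 l = fc (pull (%s. 1 / (l + s))) c"
  using G_rep(3)[OF zero_less_one l] l by (intro RC.fc_cong01 bb_pull'[of _ "1 / l"]) (auto simp: divide_simps)
 then show ?thesis by (simp add: R_fc[OF l])
qed

lemma G_antimono: "l <= l' ==> G b l' x <= G b l x"
 unfolding G_def
proof (rule nn_integral_mono)
 fix t assume l: "l <= l'"
 show "ennreal (gw b l' t) * ennreal (Re (u t x)) <= ennreal (gw b l t) * ennreal (Re (u t x))"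
  using l by (cases "0 < t") (auto simp: gw_def intro!: mult_right_mono ennreal_leI)
qed

text \<open>Monotone convergence along l = 1/(n + 1). The exponents 1 and 2 serve the two endpoint
  estimates.\<close>

lemma V_G_bound:
 assumes b: "0 < b" and le: "!!l. 0 < l ==> (\<integral>\<^sup>+x. ennreal (V x) * ennreal (Re (rep (gp b l) x)) ^ k \<partial>lebesgue) <= K"
  and k: "k = 1 \<or> k = 2"
 shows "(\<integral>\<^sup>+x. ennreal (V x) * G b 0 x ^ k \<partial>lebesgue) <= K"
proof -
 have mono: "G b (1 / real (Suc n)) x <= G b (1 / real (Suc (Suc n))) x" for n x
  by (rule G_antimono) (simp add: field_simps)
 then have inc: "incseq (%n. G b (1 / real (Suc n)) x)" for x by (rule incseq_SucI)
 have S: "G b 0 x ^ k = (SUP n. G b (1 / real (Suc n)) x ^ k)" for x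
 proof -
  have "(%n. G b (1 / real (Suc n)) x ^ k) \<longlonglongrightarrow> G b 0 x ^ k"
  proof -
   have l: "(%n. G b (1 / real (Suc n)) x) \<longlonglongrightarrow> G b 0 x" unfolding G_0_SUP[of b x] by (rule LIMSEQ_SUP[OF inc])
   then have "(%n. G b (1 / real (Suc n)) x * G b (1 / real (Suc n)) x) \<longlonglongrightarrow> G b 0 x * G b 0 x"
    by (intro tendsto_mult_ennreal) auto
   with l k show ?thesis by (auto simp: power2_eq_square)
  qed
  moreover have "incseq (%n. G b (1 / real (Suc n)) x ^ k)"
   by (intro incseq_SucI power_mono mono) auto
  ultimately show ?thesis using LIMSEQ_SUP LIMSEQ_unique by blast
 qed
 have "(\<integral>\<^sup>+x. ennreal (V x) * G b 0 x ^ k \<partial>lebesgue) = (\<integral>\<^sup>+x. (SUP n. ennreal (V x) * G b (1 / real (Suc n)) x ^ k) \<partial>lebesgue)"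
  unfolding S by (simp add: SUP_mult_left_ennreal)
 also have "\<dots> = (SUP n. \<integral>\<^sup>+x. ennreal (V x) * G b (1 / real (Suc n)) x ^ k \<partial>lebesgue)"
 proof (rule nn_integral_monotone_convergence_SUP)
  show "incseq (%n x. ennreal (V x) * G b (1 / real (Suc n)) x ^ k)"
   by (intro incseq_SucI le_funI mult_left_mono power_mono mono) simp_all
 qed measurable
 also have "\<dots> <= K"
 proof (rule SUP_least)
  fix n
  have "(\<integral>\<^sup>+x. ennreal (V x) * G b (1 / real (Suc n)) x ^ k \<partial>lebesgue)
    = (\<integral>\<^sup>+x. ennreal (V x) * ennreal (Re (rep (gp b (1 / real (Suc n))) x)) ^ k \<partial>lebesgue)"
  proof (rule nn_integral_cong_AE)
   have "0 < 1 / real (Suc n)" by simp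
   from G_rep(2)[OF b this] show "AE x in lebesgue. ennreal (V x) * G b (1 / real (Suc n)) x ^ k
     = ennreal (V x) * ennreal (Re (rep (gp b (1 / real (Suc n))) x)) ^ k"
    by eventually_elim simp
  qed
  then show "(\<integral>\<^sup>+x. ennreal (V x) * G b (1 / real (Suc n)) x ^ k \<partial>lebesgue) <= K" using le[of "1 / real (Suc n)"] by simp
 qed
 finally show ?thesis .
qed

theorem V_G_1: "(\<integral>\<^sup>+x. ennreal (V x) * G 1 0 x \<partial>lebesgue) <= (\<integral>\<^sup>+x. ennreal (Re (rep c x)) \<partial>lebesgue)"
proof -
 have "(\<integral>\<^sup>+x. ennreal (V x) * ennreal (Re (rep (gp 1 l) x)) ^ 1 \<partial>lebesgue) <= (\<integral>\<^sup>+x. ennreal (Re (rep c x)) \<partial>lebesgue)" if "0 < l" for l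
  unfolding gp_1[OF that] power_one_right by (rule V_bound[OF that c])
 from V_G_bound[OF zero_less_one this] show ?thesis by simp
qed

text \<open>Formally g = Gamma(1/2) (l + L)^(-1/2) c has energy pi (L (l + L)^-1 c, c) <= pi |c|^2,
  as Gamma(1/2)^2 = pi. In place of g the vectors X n = k R_k g with k = n + 1 are used, which lie
  in the form domain; their energy has the multiplier pi s r^2 / (l + s) <= pi with r = k/(k + s),
  and Fatou passes to g.\<close>

lemma V_half:
 assumes l: "0 < l"
 shows "(\<integral>\<^sup>+x. ennreal (V x) * ennreal (Re (rep (gp (1/2) l) x)) ^ 2 \<partial>lebesgue) <= ennreal (pi * (norm c)\<^sup>2)"
proof -
 define \<Phi> where "\<Phi> = pull (%s. Gamma (1/2) * (l + s) powr (- (1/2)))"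
 have b\<Phi>: "bb \<Phi>" unfolding \<Phi>_def using G_rep(3)[of "1/2" l] l by simp
 define g where "g = fc \<Phi> c"
 define r where "r n = pull (%s. real (Suc n) / (real (Suc n) + s))" for n
 have br: "bb (r n)" for n unfolding r_def by (rule bb_pull'[of _ 1]) (auto simp: divide_simps)
 have r1: "\<bar>r n y\<bar> <= 1" if "y \<in> {0..1}" for n y
  unfolding r_def by (rule pull_bound[OF _ that]) (auto simp: divide_simps)
 define X where "X n = fc (r n) g" for n
 have X: "X n = real (Suc n) *\<^sub>R R (real (Suc n)) g" for n
 proof -
  have b': "bb (pull (%s. 1 / (real (Suc n) + s)))" by (rule bb_pull'[of _ "1 / real (Suc n)"]) (auto simp: divide_simps)
  have "r n = (%y. real (Suc n) * pull (%s. 1 / (real (Suc n) + s)) y)" by (auto simp: r_def pull_def fun_eq_iff)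
  then show ?thesis unfolding X_def by (simp add: RC.fc_fun_scale[OF b'] R_fc del: of_nat_Suc)
 qed
 have bi: "bb (indicator {0<..} :: real => real)" by (rule bb_indicator) simp
 have "X \<longlonglongrightarrow> fc (indicator {0<..}) g" unfolding X_def
 proof (rule RC.fc_tendsto_strong[OF br r1 _ bi])
  fix y :: real assume y: "y \<in> {0..1}"
  show "(%n. r n y) \<longlonglongrightarrow> indicator {0<..} y"
  proof (cases "y = 0")
   case False
   have "(%n. real n / (real n + (1 / y - 1))) \<longlonglongrightarrow> 1" by real_asymp
   from LIMSEQ_Suc[OF this] show ?thesis using y False by (simp add: r_def pull_def)
  qed (simp add: r_def pull_def)
 qed
 also have "fc (indicator {0<..}) g = fc (%_. 1) g" by (rule RC.fc_cong[OF RC.inj0 bi]) auto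
 also have "\<dots> = g" by (rule RC.fc_one)
 finally have "X \<longlonglongrightarrow> g" .
 then obtain k where k: "strict_mono k" "AE x in lebesgue. (%n. rep (X (k n)) x) \<longlonglongrightarrow> rep g x"
  by (rule ell2_AE_subseq)
 let ?v = "%n x. ennreal (V x) * ennreal ((cmod (rep (X n) x))\<^sup>2)"
 have bd: "(\<integral>\<^sup>+x. ?v n x \<partial>lebesgue) <= ennreal (pi * (norm c)\<^sup>2)" for n
 proof -
  let ?n = "real (Suc n)"
  let ?q = "(%y. \<Phi> y * ((r n y * (1 + (-1) * r n y)) * \<Phi> y))" and ?e = "%y. \<Phi> y * ((real (Suc n) * (1 - r n y) * r n y) * \<Phi> y)"
  obtain w where w: "(R ?n g, w) \<in> D" "!!v z. (v, z) \<in> D ==> ?n * (R ?n g \<bullet> v) + w \<bullet> z = g \<bullet> v"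
   by (rule R_spec[of ?n g]) auto
  have wX: "(X n, ?n *\<^sub>R w) \<in> D" using D_scale[OF w(1), of ?n] by (simp add: X)
  have "(norm (?n *\<^sub>R w))\<^sup>2 = ?n * (?n * (w \<bullet> w))"
   by (simp only: power2_norm_eq_inner inner_scaleR_left inner_scaleR_right)
  also have "?n * (w \<bullet> w) = (g - X n) \<bullet> X n"
  proof -
   have "w \<bullet> w = g \<bullet> R ?n g - ?n * (R ?n g \<bullet> R ?n g)" using w(2)[OF w(1)] by simp
   then show ?thesis by (simp add: X inner_diff_left right_diff_distrib del: of_nat_Suc)
  qed
  also have "?n * ((g - X n) \<bullet> X n) = fc (%y. ?e y) c \<bullet> c"
  proof -
   have b1: "bb (%y. 1 + (-1) * r n y)" by (intro bb_add bb_const bb_cmult br)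
   have "g - X n = fc (%y. 1 + (-1) * r n y) g"
    using RC.fc_fun_add[OF bb_const bb_cmult[OF br, of "-1" n], of 1 g] RC.fc_fun_scale[OF br, of "-1" n g]
    by (simp add: RC.fc_one X_def)
   then have "(g - X n) \<bullet> X n = fc (r n) (fc (%y. 1 + (-1) * r n y) g) \<bullet> g"
    by (simp add: X_def RC.fc_sym[OF br])
   also have "\<dots> = fc \<Phi> (fc (%y. r n y * (1 + (-1) * r n y)) (fc \<Phi> c)) \<bullet> c"
    by (simp only: g_def RC.fc_mult[OF br b1] RC.fc_sym[OF b\<Phi>, of _ c])
   also have "\<dots> = fc ?q c \<bullet> c"
    by (simp only: RC.fc_mult[OF b\<Phi> bb_mult[OF bb_mult[OF br b1] b\<Phi>]] RC.fc_mult[OF bb_mult[OF br b1] b\<Phi>])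
   finally have "?n * ((g - X n) \<bullet> X n) = (?n *\<^sub>R fc ?q c) \<bullet> c"
    by (simp del: of_nat_Suc)
   also have "?n *\<^sub>R fc ?q c = fc (%y. ?n * (\<Phi> y * ((r n y * (1 + (-1) * r n y)) * \<Phi> y))) c"
    by (rule RC.fc_fun_scale[symmetric]) (intro bb_mult b\<Phi> br b1)
   also have "(%y. ?n * (\<Phi> y * ((r n y * (1 + (-1) * r n y)) * \<Phi> y))) = (%y. ?e y)"
    by (rule ext) (simp add: mult_ac del: of_nat_Suc)
   finally show ?thesis .
  qed
  also have "\<dots> <= norm (fc (%y. ?e y) c) * norm c" by (rule norm_cauchy_schwarz)
  also have "\<dots> <= (pi * norm c) * norm c"
  proof (rule mult_right_mono[OF RC.fc_bound])
   show "bb (%y. ?e y)" by (intro bb_mult b\<Phi> br bb_diff bb_const)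
   fix y :: real assume y: "y \<in> {0..1}"
   show "\<bar>?e y\<bar> <= pi"
   proof (cases "y = 0")
    case False
    define s where "s = 1 / y - 1"
    have s: "0 <= s" using y False by (simp add: s_def)
    have ls: "0 < l + s" "0 < ?n + s" using l s by auto
    have r: "r n y = ?n / (?n + s)" "\<Phi> y = sqrt pi * (l + s) powr (- (1/2))"
     using y False by (auto simp: r_def \<Phi>_def pull_def s_def Gamma_one_half_real)
    have P2: "\<Phi> y * \<Phi> y = pi / (l + s)"
    proof -
     have "(l + s) powr (- (1/2)) * (l + s) powr (- (1/2)) = 1 / (l + s)"
      using ls by (simp add: powr_add[symmetric] powr_minus_divide)
     then show ?thesis unfolding r by (simp add: algebra_simps flip: mult.assoc)
    qed
    have 1: "?n * (1 - r n y) * r n y = s * (r n y * r n y)"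
    proof -
     have "1 - r n y = s / (?n + s)" using ls by (simp add: r(1) field_simps del: of_nat_Suc)
     then show ?thesis by (simp add: r(1) del: of_nat_Suc)
    qed
    have r0: "0 <= r n y" using ls by (simp add: r(1) del: of_nat_Suc)
    then have rr: "0 <= r n y" "r n y * r n y <= 1" using r1[OF y, of n] by (auto intro: mult_le_one)
    have "?e y = (\<Phi> y * \<Phi> y) * (s * (r n y * r n y))"
     unfolding 1 by (simp add: mult_ac)
    also have "\<dots> = (pi * (s / (l + s))) * (r n y * r n y)" unfolding P2 by simp
    finally have e: "?e y = (pi * (s / (l + s))) * (r n y * r n y)" .
    have "s / (l + s) <= 1" "0 <= s / (l + s)" using l s by (auto simp: divide_simps)
    then have q: "0 <= pi * (s / (l + s))" "pi * (s / (l + s)) <= pi"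
     using mult_nonneg_nonneg[OF pi_ge_zero, of "s / (l + s)"] mult_left_le[of "s / (l + s)" pi] by simp_all
    have "(pi * (s / (l + s))) * (r n y * r n y) <= pi * 1" by (rule mult_mono) (use q rr in auto)
    moreover have "0 <= (pi * (s / (l + s))) * (r n y * r n y)" by (intro mult_nonneg_nonneg q rr)
    ultimately show ?thesis unfolding e by (simp only: abs_of_nonneg mult_1_right)
   qed (simp add: r_def \<Phi>_def pull_def)
  qed simp
  finally have nw: "(norm (?n *\<^sub>R w))\<^sup>2 <= pi * (norm c)\<^sup>2" by (simp add: power2_eq_square mult.assoc)
  obtain p q where pq: "?n *\<^sub>R w = (p, q)" by (cases "?n *\<^sub>R w")
  have q: "AE x in lebesgue. rep q x = sV x * rep (X n) x" using wX pq D_iff by simp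
  have "(\<integral>\<^sup>+x. ?v n x \<partial>lebesgue) = (\<integral>\<^sup>+x. ennreal ((cmod (rep q x))\<^sup>2) \<partial>lebesgue)"
  proof (rule nn_integral_cong_AE)
   show "AE x in lebesgue. ?v n x = ennreal ((cmod (rep q x))\<^sup>2)"
    using q V_pos by eventually_elim (simp add: sV_def norm_mult power_mult_distrib ennreal_mult[symmetric])
  qed
  also have "\<dots> = ennreal ((norm q)\<^sup>2)" using nn_norm[OF rep_L2, of q] by simp
  also have "\<dots> <= ennreal (pi * (norm c)\<^sup>2)"
  proof (rule ennreal_leI)
   have "(norm q)\<^sup>2 <= (norm (?n *\<^sub>R w))\<^sup>2" unfolding pq by (simp add: norm_Pair)
   from this nw show "(norm q)\<^sup>2 <= pi * (norm c)\<^sup>2" by (rule order_trans)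
  qed
  finally show ?thesis .
 qed
 have "(\<integral>\<^sup>+x. ennreal (V x) * ennreal (Re (rep g x)) ^ 2 \<partial>lebesgue) <= (\<integral>\<^sup>+x. liminf (%n. ?v (k n) x) \<partial>lebesgue)"
 proof (rule nn_integral_mono_AE)
  show "AE x in lebesgue. ennreal (V x) * ennreal (Re (rep g x)) ^ 2 <= liminf (%n. ?v (k n) x)"
   using k(2) V_pos
  proof eventually_elim
   case (elim x)
   have "(%n. ennreal (V x * (cmod (rep (X (k n)) x))\<^sup>2)) \<longlonglongrightarrow> ennreal (V x * (cmod (rep g x))\<^sup>2)"
    by (intro tendsto_intros elim)
   then have "liminf (%n. ennreal (V x * (cmod (rep (X (k n)) x))\<^sup>2)) = ennreal (V x * (cmod (rep g x))\<^sup>2)"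
    by (rule lim_imp_Liminf[OF trivial_limit_sequentially])
   moreover have "ennreal (V x) * ennreal (Re (rep g x)) ^ 2 <= ennreal (V x * (cmod (rep g x))\<^sup>2)"
   proof (cases "0 <= Re (rep g x)")
    case True
    then have "(Re (rep g x))\<^sup>2 <= (cmod (rep g x))\<^sup>2" using abs_Re_le_cmod[of "rep g x"] by (intro power_mono) auto
    then show ?thesis using True elim(2) by (simp add: ennreal_power ennreal_mult[symmetric] ennreal_leI mult_left_mono)
   qed (simp add: ennreal_neg)
   ultimately show ?case using elim(2) by (simp add: ennreal_mult)
  qed
 qed
 also have "\<dots> <= liminf (%n. \<integral>\<^sup>+x. ?v (k n) x \<partial>lebesgue)"
  by (rule nn_integral_liminf) measurable
 also have "\<dots> <= ennreal (pi * (norm c)\<^sup>2)"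
  by (rule Liminf_le[OF sequentially_bot]) (rule always_eventually, rule allI, rule bd)
 finally show ?thesis unfolding g_def \<Phi>_def .
qed

theorem V_G_half: "(\<integral>\<^sup>+x. ennreal (V x) * (G (1/2) 0 x)\<^sup>2 \<partial>lebesgue) <= ennreal (pi * (norm c)\<^sup>2)"
 by (rule V_G_bound[OF _ V_half]) auto

end

section \<open>Interpolation and the maximal function of the resolvents\<close>

lemma nn_integral_powr_below:
 assumes q: "0 < q" and y: "0 <= y"
 shows "(\<integral>\<^sup>+t. ennreal (indicator {0..y} t * t powr (q - 1)) \<partial>lborel) = ennreal (y powr q / q)"
 using nn_integral_has_integral_lebesgue[OF _ has_integral_powr_from_0[of "q - 1" y]] q y by simp

lemma nn_integral_powr_above:
 assumes q: "0 < q" and y: "0 < y"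
 shows "(\<integral>\<^sup>+t. ennreal (indicator {y..} t * t powr (- q - 1)) \<partial>lborel) = ennreal (y powr (- q) / q)"
 using nn_integral_has_integral_lebesgue[OF _ has_integral_powr_to_inf[of "- q - 1" y]] q y by simp

text \<open>Marcinkiewicz interpolation between weak type (1,1), used for the excess of \<open>f\<close> over
  \<open>\<alpha>/2\<close>, and the trivial bound on \<open>L\<^sup>\<infinity>\<close>.\<close>

lemma marcinkiewicz:
 fixes m f :: "'a => real"
 assumes sf: "sigma_finite_measure M" and p: "1 < p"
  and [measurable]: "m \<in> borel_measurable M" "f \<in> borel_measurable M"
  and m0: "AE x in M. 0 <= m x" and f0: "AE x in M. 0 <= f x"
  and weak: "!!\<alpha>. 0 < \<alpha> ==> ennreal \<alpha> * emeasure M {x \<in> space M. \<alpha> < m x} <= 2 * (\<integral>\<^sup>+x. ennreal (f x - \<alpha> / 2) \<partial>M)"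
 shows "(\<integral>\<^sup>+x. ennreal (m x powr p) \<partial>M) <= ennreal (p * 2 powr p / (p - 1)) * (\<integral>\<^sup>+x. ennreal (f x powr p) \<partial>M)"
proof -
 let ?k = "%x \<alpha>. ennreal p * ennreal (indicator {0<..} \<alpha> * \<alpha> powr (p - 1)) * indicator {..<m x} \<alpha>"
 let ?h = "%x \<alpha>. ennreal (2 * p) * ennreal (indicator {0<..} \<alpha> * \<alpha> powr (p - 2)) * ennreal (f x - \<alpha> / 2)"
 interpret M: sigma_finite_measure M by fact
 interpret P: pair_sigma_finite M lborel ..
 have "(\<integral>\<^sup>+x. ennreal (m x powr p) \<partial>M) = (\<integral>\<^sup>+x. \<integral>\<^sup>+\<alpha>. ?k x \<alpha> \<partial>lborel \<partial>M)"
 proof (rule nn_integral_cong_AE)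
  show "AE x in M. ennreal (m x powr p) = (\<integral>\<^sup>+\<alpha>. ?k x \<alpha> \<partial>lborel)"
   using m0
  proof eventually_elim
   case (elim x)
   have "(\<integral>\<^sup>+\<alpha>. ?k x \<alpha> \<partial>lborel)
     = (\<integral>\<^sup>+\<alpha>. ennreal p * ennreal (indicator {0..m x} \<alpha> * \<alpha> powr (p - 1)) \<partial>lborel)"
   proof (rule nn_integral_cong_AE)
    have "AE \<alpha> in lborel. \<alpha> ~= m x" by (rule AE_lborel_singleton)
    then show "AE \<alpha> in lborel. ?k x \<alpha>
      = ennreal p * ennreal (indicator {0..m x} \<alpha> * \<alpha> powr (p - 1))"
    proof eventually_elim
     case (elim \<alpha>)
     then show ?case by (cases "\<alpha> = 0") (auto simp: indicator_def)
    qed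
   qed
   also have "\<dots> = ennreal p * ennreal (m x powr p / p)"
    using p elim by (simp add: nn_integral_cmult nn_integral_powr_below)
   also have "\<dots> = ennreal (m x powr p)" using p by (simp add: ennreal_mult[symmetric])
   finally show ?case by simp
  qed
 qed
 also have "\<dots> = (\<integral>\<^sup>+\<alpha>. \<integral>\<^sup>+x. ?k x \<alpha> \<partial>M \<partial>lborel)"
 proof (rule P.Fubini'[symmetric])
  have "(%(x, \<alpha>). ennreal p * ennreal (indicator {0<..} \<alpha> * \<alpha> powr (p - 1)) * indicator {z. fst z < snd z} (\<alpha>, m x)) \<in> borel_measurable (M \<Otimes>\<^sub>M lborel)"
   by measurable
  then show "(%(x, \<alpha>). ?k x \<alpha>) \<in> borel_measurable (M \<Otimes>\<^sub>M lborel)"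
   by (simp add: indicator_def)
 qed
 also have "\<dots> <= (\<integral>\<^sup>+\<alpha>. \<integral>\<^sup>+x. ?h x \<alpha> \<partial>M \<partial>lborel)"
 proof (rule nn_integral_mono)
  fix \<alpha> :: real
  show "(\<integral>\<^sup>+x. ?k x \<alpha> \<partial>M)
   <= (\<integral>\<^sup>+x. ?h x \<alpha> \<partial>M)"
  proof (cases "0 < \<alpha>")
   case True
   have "(\<integral>\<^sup>+x. ?k x \<alpha> \<partial>M)
     = ennreal p * ennreal (\<alpha> powr (p - 1)) * (\<integral>\<^sup>+x. indicator {x \<in> space M. \<alpha> < m x} x \<partial>M)"
    using True by (subst nn_integral_cmult[symmetric]) (auto intro!: nn_integral_cong simp: indicator_def)
   also have "\<dots> = ennreal p * ennreal (\<alpha> powr (p - 2)) * (ennreal \<alpha> * emeasure M {x \<in> space M. \<alpha> < m x})"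
   proof -
    have "ennreal (\<alpha> powr (p - 1)) = ennreal (\<alpha> powr (p - 2)) * ennreal \<alpha>"
     using True powr_mult_base[of \<alpha> "p - 2"] by (simp add: ennreal_mult[symmetric] mult.commute)
    then show ?thesis by (simp add: mult_ac)
   qed
   also have "\<dots> <= ennreal p * ennreal (\<alpha> powr (p - 2)) * (2 * (\<integral>\<^sup>+x. ennreal (f x - \<alpha> / 2) \<partial>M))"
    by (rule mult_left_mono[OF weak[OF True]]) simp
   also have "\<dots> = (ennreal (2 * p) * ennreal (\<alpha> powr (p - 2))) * (\<integral>\<^sup>+x. ennreal (f x - \<alpha> / 2) \<partial>M)"
    using p by (simp add: ennreal_mult mult_ac)
   also have "\<dots> = (\<integral>\<^sup>+x. ?h x \<alpha> \<partial>M)"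
    using True by (simp add: nn_integral_cmult)
   finally show ?thesis .
  qed simp
 qed
 also have "\<dots> = (\<integral>\<^sup>+x. \<integral>\<^sup>+\<alpha>. ?h x \<alpha> \<partial>lborel \<partial>M)"
  by (rule P.Fubini') measurable
 \<comment> \<open>Origin of the constant: alpha^(p - 2) is integrated from 0 to 2 f, where the
   excess of f over alpha/2 vanishes; convergence at 0 uses p > 1.\<close>
 also have "\<dots> <= (\<integral>\<^sup>+x. ennreal (p * 2 powr p / (p - 1)) * ennreal (f x powr p) \<partial>M)"
 proof (rule nn_integral_mono_AE)
  show "AE x in M. (\<integral>\<^sup>+\<alpha>. ?h x \<alpha> \<partial>lborel)
    <= ennreal (p * 2 powr p / (p - 1)) * ennreal (f x powr p)"
   using f0
  proof eventually_elim
   case (elim x)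
   have "(\<integral>\<^sup>+\<alpha>. ?h x \<alpha> \<partial>lborel)
     <= (\<integral>\<^sup>+\<alpha>. ennreal (2 * p * f x) * ennreal (indicator {0..2 * f x} \<alpha> * \<alpha> powr ((p - 1) - 1)) \<partial>lborel)"
   proof (rule nn_integral_mono)
    fix \<alpha> :: real
    show "?h x \<alpha>
      <= ennreal (2 * p * f x) * ennreal (indicator {0..2 * f x} \<alpha> * \<alpha> powr ((p - 1) - 1))"
    proof (cases "0 < \<alpha> & \<alpha> <= 2 * f x")
     case True
     have "2 * p * \<alpha> powr (p - 2) * (f x - \<alpha> / 2) <= 2 * p * \<alpha> powr (p - 2) * f x"
      using True p by (intro mult_left_mono) auto
     then show ?thesis using True p elim by (simp add: ennreal_mult[symmetric] ennreal_leI mult_ac)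
    qed (auto simp: indicator_def ennreal_neg)
   qed
   also have "\<dots> = ennreal (2 * p * f x) * ennreal ((2 * f x) powr (p - 1) / (p - 1))"
    unfolding nn_integral_powr_below[of "p - 1" "2 * f x", symmetric, OF diff_gt_0_iff_gt[THEN iffD2, OF p] mult_nonneg_nonneg[OF zero_le_numeral elim]]
    by (rule nn_integral_cmult) measurable
   also have "\<dots> = ennreal (p * 2 powr p / (p - 1)) * ennreal (f x powr p)"
   proof -
    have "(2 * f x) * (2 * f x) powr (p - 1) = (2 * f x) powr p" using elim powr_mult_base[of "2 * f x" "p - 1"] by simp
    then have "2 * p * f x * ((2 * f x) powr (p - 1) / (p - 1)) = p * (2 powr p * f x powr p) / (p - 1)"
     using elim by (simp add: powr_mult mult_ac)
    then show ?thesis using p elim by (simp add: ennreal_mult[symmetric] mult_ac)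
   qed
   finally show ?case .
  qed
 qed
 also have "\<dots> = ennreal (p * 2 powr p / (p - 1)) * (\<integral>\<^sup>+x. ennreal (f x powr p) \<partial>M)"
  by (rule nn_integral_cmult) measurable
 finally show ?thesis .
qed

context schroedinger
begin

text \<open>Countable, so that one null set serves all parameters; other l are reached through
  monotonicity of \<open>G\<close> in l.\<close>

definition QP :: "real set" where "QP = {l \<in> \<rat>. 0 < l}"

lemma QP: "countable QP" "l \<in> QP ==> 0 < l" "QP ~= {}"
proof -
 show "countable QP" unfolding QP_def using countable_rat by (rule countable_subset[rotated]) auto
 have "(1::real) \<in> QP" by (simp add: QP_def)
 then show "QP ~= {}" by blast
qed (simp add: QP_def)

lemma maxf_bounded:
 assumes c: "nonneg c" and K: "AE x in lebesgue. Re (rep c x) <= K" "0 < K"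
 shows "AE x in lebesgue. \<forall>l\<in>QP. 0 <= l * Re (rep (R l c) x) & l * Re (rep (R l c) x) <= K"
proof -
 have "AE x in lebesgue. 0 <= l * Re (rep (R l c) x) & l * Re (rep (R l c) x) <= K" if l: "l \<in> QP" for l
 proof -
  have l0: "0 < l" using l by (rule QP)
  let ?c = "(1 / K) *\<^sub>R c"
  have "AE t in lebesgue. Im (rep ?c t) = 0 & 0 <= Re (rep ?c t) & Re (rep ?c t) <= 1"
   using c[unfolded nonneg_def] K(1) rep_scale[of "1 / K" c]
  proof eventually_elim
   case (elim t)
   then show ?case unfolding elim(3) using K(2) by simp
  qed
  then have "AE t in lebesgue. l * Re (rep (R l ?c) t) <= 1" by (rule R_markov[OF l0])
  moreover have "AE t in lebesgue. rep (R l ?c) t = complex_of_real (1 / K) * rep (R l c) t"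
   unfolding R_scale[OF l0] by (rule rep_scale)
  moreover have "AE t in lebesgue. Im (rep (R l c) t) = 0 & 0 <= Re (rep (R l c) t)"
   using R_nonneg[OF l0 c] by (simp add: nonneg_def)
  ultimately show ?thesis
  proof eventually_elim
   case (elim t)
   then have "l * Re (rep (R l c) t) / K <= 1" by simp
   then show ?case using elim(3) l0 K(2) by (simp add: divide_le_eq)
  qed
 qed
 then show ?thesis using QP(1) by (simp add: AE_ball_countable)
qed

text \<open>Splitting f at alpha/2 leaves a bounded part whose maximal function stays below alpha/2
  by the Markov property. \<open>weak_max\<close> is applied to the rest, which is the weak type
  hypothesis of \<open>marcinkiewicz\<close>.\<close>

theorem maximal:
 assumes p: "1 < p" and f: "f \<in> borel_measurable lebesgue" "!!x. 0 <= f x" "!!x. f x <= K" and fL: "(%x. complex_of_real (f x)) \<in> L2"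
 obtains m where "m \<in> borel_measurable lebesgue" "!!x. 0 <= m x"
  "AE x in lebesgue. \<forall>l\<in>QP. l * Re (rep (R l (cls (%x. complex_of_real (f x)))) x) <= m x"
  "(\<integral>\<^sup>+x. ennreal (m x powr p) \<partial>lebesgue) <= ennreal (p * 2 powr p / (p - 1)) * (\<integral>\<^sup>+x. ennreal (f x powr p) \<partial>lebesgue)"
proof -
 define c where "c = cls (%x. complex_of_real (f x))"
 note f(1)[measurable]
 have cr: "AE x in lebesgue. rep c x = complex_of_real (f x)" using rep_cls[OF fL] by (simp add: c_def ae_eq_def)
 have cn: "nonneg c" unfolding nonneg_def using cr by eventually_elim (simp add: f)
 \<comment> \<open>Clamping to [0, K + 1] makes the supremum finite at every point; outside a null
   set it changes nothing, by \<open>maxf_bounded\<close>.\<close>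
 define m where "m x = real_of_ereal (SUP l\<in>QP. ereal (max 0 (min (K + 1) (l * Re (rep (R l c) x)))))" for x
 have K: "0 <= K" using f(2,3) order_trans by blast
 have Sb: "(SUP l\<in>QP. ereal (max 0 (min (K + 1) (g l)))) <= ereal (K + 1)" "0 <= (SUP l\<in>QP. ereal (max 0 (min (K + 1) (g l))))" for g
 proof -
  show "(SUP l\<in>QP. ereal (max 0 (min (K + 1) (g l)))) <= ereal (K + 1)" by (rule SUP_least) (use K in auto)
  obtain l where "l \<in> QP" using QP(3) by blast
  then have "ereal (max 0 (min (K + 1) (g l))) <= (SUP l\<in>QP. ereal (max 0 (min (K + 1) (g l))))" by (rule SUP_upper)
  then show "0 <= (SUP l\<in>QP. ereal (max 0 (min (K + 1) (g l))))"       by (rule order_trans[rotated]) (simp only: zero_ereal_def ereal_less_eq max.cobounded1)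
 qed
 have me: "ereal (m x) = (SUP l\<in>QP. ereal (max 0 (min (K + 1) (l * Re (rep (R l c) x)))))" for x
  unfolding m_def using Sb[of "%l. l * Re (rep (R l c) x)"] by (intro ereal_real') auto
 have mm: "m \<in> borel_measurable lebesgue"
  unfolding m_def using QP(1) by (intro borel_measurable_real_of_ereal borel_measurable_SUP) measurable
 have m0: "0 <= m x" for x using me[of x] Sb(2)[of "%l. l * Re (rep (R l c) x)"] by (metis ereal_less_eq(5))
 have bd: "AE x in lebesgue. \<forall>l\<in>QP. 0 <= l * Re (rep (R l c) x) & l * Re (rep (R l c) x) <= K + 1"
 proof (rule maxf_bounded[OF cn])
  show "AE x in lebesgue. Re (rep c x) <= K + 1" using cr
  proof eventually_elim
   case (elim x)
   then show ?case using f(3)[of x] by simp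
  qed
 qed (use K in simp)
 have ge: "AE x in lebesgue. \<forall>l\<in>QP. l * Re (rep (R l c) x) <= m x"
  using bd
 proof eventually_elim
  case (elim x)
  show ?case
  proof
   fix l assume l: "l \<in> QP"
   have "ereal (max 0 (min (K + 1) (l * Re (rep (R l c) x)))) <= ereal (m x)" unfolding me by (rule SUP_upper[OF l])
   then show "l * Re (rep (R l c) x) <= m x" using elim l by auto
  qed
 qed
 have weak: "ennreal \<alpha> * emeasure lebesgue {x \<in> space lebesgue. \<alpha> < m x} <= 2 * (\<integral>\<^sup>+x. ennreal (f x - \<alpha> / 2) \<partial>lebesgue)" if \<alpha>: "0 < \<alpha>" for \<alpha>
 proof -
  define f1 f2 where "f1 x = complex_of_real (max 0 (f x - \<alpha> / 2))" and "f2 x = complex_of_real (min (f x) (\<alpha> / 2))" for x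
  have L: "f1 \<in> L2" "f2 \<in> L2" unfolding f1_def f2_def
   by (rule L2_dominated[OF _ fL, of _ 1], use f(2) \<alpha> in \<open>auto simp: max_def min_def\<close>)+
  have r: "AE x in lebesgue. rep (cls f1) x = f1 x" "AE x in lebesgue. rep (cls f2) x = f2 x"
   using rep_cls L by (auto simp: ae_eq_def)
  have c12: "c = cls f1 + cls f2" unfolding c_def cls_add[OF L] by (rule arg_cong[of _ _ cls]) (auto simp: f1_def f2_def fun_eq_iff max_def min_def simp flip: of_real_add)
  have n1: "nonneg (cls f1)" "nonneg (cls f2)" unfolding nonneg_def using r(1) apply eventually_elim
   subgoal by (simp add: f1_def)
   using r(2) by eventually_elim (use f(2) \<alpha> in \<open>simp add: f2_def\<close>)
  have b2: "AE x in lebesgue. \<forall>l\<in>QP. 0 <= l * Re (rep (R l (cls f2)) x) & l * Re (rep (R l (cls f2)) x) <= \<alpha> / 2"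
   by (rule maxf_bounded[OF n1(2)]) (use r(2) \<alpha> in \<open>auto elim!: eventually_mono simp: f2_def\<close>)
  have add: "AE x in lebesgue. \<forall>l\<in>QP. rep (R l c) x = rep (R l (cls f1)) x + rep (R l (cls f2)) x"
   using QP(1) by (simp add: AE_ball_countable c12 R_add[OF QP(2)] rep_add)
  let ?S = "{x. \<exists>l\<in>QP. \<alpha> / 2 < l * Re (rep (R l (cls f1)) x)}"
  have Sm: "?S \<in> sets lebesgue"
  proof -
   have "?S = (\<Union>l\<in>QP. {x \<in> space lebesgue. \<alpha> / 2 < l * Re (rep (R l (cls f1)) x)})" by auto
   also have "\<dots> \<in> sets lebesgue" using QP(1) by (rule sets.countable_UN') (rule image_subsetI, measurable)
   finally show ?thesis .
  qed
  have "emeasure lebesgue {x \<in> space lebesgue. \<alpha> < m x} <= emeasure lebesgue ?S"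
  proof (rule emeasure_mono_AE[OF _ Sm])
   show "AE x in lebesgue. x \<in> {x \<in> space lebesgue. \<alpha> < m x} --> x \<in> ?S"
    using add b2
   proof eventually_elim
    case (elim x)
    show ?case
    proof
     assume "x \<in> {x \<in> space lebesgue. \<alpha> < m x}"
     then have "ereal \<alpha> < (SUP l\<in>QP. ereal (max 0 (min (K + 1) (l * Re (rep (R l c) x)))))" using me[of x] by (metis (mono_tags, lifting) less_ereal.simps(1) mem_Collect_eq)
     then obtain l where l: "l \<in> QP" "ereal \<alpha> < ereal (max 0 (min (K + 1) (l * Re (rep (R l c) x))))" by (auto simp: less_SUP_iff)
     then have "\<alpha> < max 0 (min (K + 1) (l * Re (rep (R l c) x)))" by (simp only: less_ereal.simps)
     then have "\<alpha> < l * Re (rep (R l c) x)" using \<alpha> by auto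
     also have "\<dots> = l * Re (rep (R l (cls f1)) x) + l * Re (rep (R l (cls f2)) x)" using elim(1) l(1) by (simp add: distrib_left)
     also have "\<dots> <= l * Re (rep (R l (cls f1)) x) + \<alpha> / 2" using elim(2) l(1) by simp
     finally have "\<alpha> / 2 < l * Re (rep (R l (cls f1)) x)" by linarith
     then show "x \<in> ?S" using l(1) by blast
    qed
   qed
  qed
  then have "ennreal \<alpha> * emeasure lebesgue {x \<in> space lebesgue. \<alpha> < m x} <= ennreal \<alpha> * emeasure lebesgue ?S"
   by (rule mult_left_mono) simp
  also have "\<dots> = 2 * (ennreal (\<alpha> / 2) * emeasure lebesgue ?S)"
   using \<alpha> ennreal_mult[of 2 "\<alpha> / 2"] by (simp add: mult.assoc[symmetric])
  also have "\<dots> <= 2 * (\<integral>\<^sup>+x. ennreal (Re (rep (cls f1) x)) \<partial>lebesgue)"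
   by (rule mult_left_mono[OF weak_max[OF QP(1) QP(2) n1(1)]]) (use \<alpha> in auto)
  also have "(\<integral>\<^sup>+x. ennreal (Re (rep (cls f1) x)) \<partial>lebesgue) = (\<integral>\<^sup>+x. ennreal (f x - \<alpha> / 2) \<partial>lebesgue)"
   by (rule nn_integral_cong_AE) (use r(1) in \<open>eventually_elim, auto simp: f1_def max_def ennreal_neg\<close>)
  finally show ?thesis .
 qed
 have sf: "sigma_finite_measure (lebesgue :: (real^'n) measure)"
 proof -
  from lborel.sigma_finite_countable obtain A :: "(real^'n) set set" where
   A: "countable A & A \<subseteq> sets lborel & \<Union>A = space lborel & (\<forall>a\<in>A. emeasure lborel a ~= \<infinity>)" ..
  have "emeasure lebesgue a ~= \<infinity>" if "a \<in> A" for a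
  proof -
   have "a \<in> sets lborel" "emeasure lborel a ~= \<infinity>" using A that by auto
   then show ?thesis by simp
  qed
  moreover have "A \<subseteq> sets lebesgue" using A by auto
  ultimately show ?thesis using A by (intro sigma_finite_measure.intro exI[of _ A]) simp
 qed
 have "(\<integral>\<^sup>+x. ennreal (m x powr p) \<partial>lebesgue) <= ennreal (p * 2 powr p / (p - 1)) * (\<integral>\<^sup>+x. ennreal (f x powr p) \<partial>lebesgue)"
  by (rule marcinkiewicz[OF sf p mm f(1) _ _ weak]) (use m0 f(2) in auto)
 from that[OF mm m0 ge[unfolded c_def] this] show ?thesis .
qed

end

section \<open>Powers of extended reals, and the two pointwise inequalities\<close>

lemma ennreal_powr_ennreal: "0 <= x ==> ennreal_powr (ennreal x) r = ennreal (x powr r)"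
 by (simp add: ennreal_powr_def)

lemma ennreal_powr_mono:
 assumes "x <= y" "0 <= r" shows "ennreal_powr x r <= ennreal_powr y r"
proof (cases "y = \<infinity>")
 case False
 then obtain v where v: "0 <= v" "y = ennreal v" by (cases y) auto
 then obtain w where w: "0 <= w" "x = ennreal w" using assms(1) by (cases x) (auto simp: top_unique)
 have "w <= v" using assms(1) v w by simp
 then show ?thesis unfolding v w ennreal_powr_ennreal[OF v(1)] ennreal_powr_ennreal[OF w(1)]
  using assms(2) w(1) by (intro ennreal_leI powr_mono2) auto
qed (simp add: ennreal_powr_def)

lemma ennreal_powr_mult:
 assumes k: "0 < k" shows "ennreal_powr (ennreal k * y) r = ennreal (k powr r) * ennreal_powr y r"
proof (cases "y = \<infinity>")
 case True
 then show ?thesis using k by (simp add: ennreal_powr_def ennreal_mult_top)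
next
 case False
 then obtain v where v: "0 <= v" "y = ennreal v" by (cases y) auto
 then show ?thesis using k by (simp add: ennreal_mult[symmetric] ennreal_powr_ennreal powr_mult)
qed

lemma ennreal_powr_add:
 assumes r: "0 <= r"
 shows "ennreal_powr (x + y) r <= ennreal (2 powr r) * (ennreal_powr x r + ennreal_powr y r)"
proof -
 have "ennreal_powr (x + y) r <= ennreal_powr (ennreal 2 * max x y) r"
  by (rule ennreal_powr_mono[OF _ r]) (simp add: mult_2 add_mono)
 also have "\<dots> = ennreal (2 powr r) * ennreal_powr (max x y) r" by (rule ennreal_powr_mult) simp
 also have "\<dots> <= ennreal (2 powr r) * (ennreal_powr x r + ennreal_powr y r)"
  by (intro mult_left_mono) (auto simp: max_def)
 finally show ?thesis .
qed

lemma weighted_le_add: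
 assumes "0 < \<alpha>" "0 < \<beta>" "0 <= s" "s <= 1" shows "\<alpha> powr (1 - s) * \<beta> powr s <= \<alpha> + (\<beta>::real)"
proof -
 have "\<alpha> powr (1 - s) * \<beta> powr s <= (\<alpha> + \<beta>) powr (1 - s) * (\<alpha> + \<beta>) powr s"
  using assms by (intro mult_mono powr_mono2) auto
 also have "\<dots> = \<alpha> + \<beta>" using assms by (simp add: powr_add[symmetric])
 finally show ?thesis .
qed

text \<open>Young's inequality for the factorisation \<open>f = (f\<^sup>p)\<^bsup>1-\<theta>\<^esup> (f\<^bsup>p/2\<^esup>)\<^bsup>\<theta>\<^esup>\<close> with \<open>\<theta> = 2 - 2/p\<close>.\<close>

lemma young_factor:
 fixes f \<kappa> p :: real
 assumes f: "0 <= f" and k: "0 < \<kappa>" and p: "1 < p" "p <= 2" and th: "\<theta> = 2 - 2 / p"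
 shows "f <= (1 - \<theta>) * \<kappa> powr \<theta> * f powr p + \<theta> * \<kappa> powr (\<theta> - 1) * f powr (p / 2)"
proof (cases "f = 0")
 case False
 then have f: "0 < f" using f by simp
 have t: "0 <= \<theta>" "\<theta> <= 1" using p by (auto simp: th field_simps)
 let ?A = "\<kappa> powr \<theta> * f powr p" and ?B = "\<kappa> powr (\<theta> - 1) * f powr (p / 2)"
 have AB: "0 < ?A" "0 < ?B" using f k by simp_all
 have "f = ?A powr (1 - \<theta>) * ?B powr \<theta>"
 proof -
  have 1: "p * (1 - \<theta>) + p / 2 * \<theta> = 1" using p by (simp add: th field_simps)
  have "?A powr (1 - \<theta>) * ?B powr \<theta> = (\<kappa> powr (\<theta> * (1 - \<theta>)) * \<kappa> powr ((\<theta> - 1) * \<theta>)) * (f powr (p * (1 - \<theta>)) * f powr (p / 2 * \<theta>))"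
   using f k by (simp add: powr_mult powr_powr mult_ac)
  also have "\<dots> = \<kappa> powr (\<theta> * (1 - \<theta>) + (\<theta> - 1) * \<theta>) * f powr (p * (1 - \<theta>) + p / 2 * \<theta>)"
   by (simp only: powr_add)
  also have "\<theta> * (1 - \<theta>) + (\<theta> - 1) * \<theta> = 0" by (simp add: algebra_simps)
  finally show ?thesis using f k 1 by simp
 qed
 also have "\<dots> <= (1 - \<theta>) * ?A + \<theta> * ?B" by (rule Youngs_inequality_0) (use t AB in auto)
 finally show ?thesis by (simp add: mult_ac)
qed simp

text \<open>The choice kappa = beta/alpha balances the two terms, and a rational kappa within a
  factor 2 of it gives X <= 2 alpha^(1 - theta) beta^theta. As p (1 - theta) = 2 - p and p theta = 2
  (p - 1), the p-th power is at most 2^p alpha^(2 - p) (beta^2)^(p - 1), with 2^p <= 4. The shift by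
  delta keeps alpha and beta positive.\<close>

lemma powr_bound_from_scaling:
 fixes X \<alpha> \<beta> p :: real
 assumes nn: "0 <= X" "0 <= \<alpha>" "0 <= \<beta>" and p: "1 < p" "p <= 2" and th: "\<theta> = 2 - 2 / p"
  and le: "!!\<kappa>. \<kappa> \<in> \<rat> ==> 0 < \<kappa> ==> X <= (1 - \<theta>) * \<kappa> powr \<theta> * \<alpha> + \<theta> * \<kappa> powr (\<theta> - 1) * \<beta>"
 shows "X powr p <= 4 * (\<alpha> + \<beta>\<^sup>2)"
proof -
 have t: "0 < \<theta>" "\<theta> <= 1" using p by (auto simp: th field_simps)
 have *: "X powr p <= 4 * ((\<alpha> + \<delta>) + (\<beta> + \<delta>)\<^sup>2)" if d: "0 < \<delta>" for \<delta>
 proof -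
  let ?a = "\<alpha> + \<delta>" and ?b = "\<beta> + \<delta>"
  have ab: "0 < ?a" "0 < ?b" using nn d by auto
  define k where "k = ?b / ?a"
  have k: "0 < k" using ab by (simp add: k_def)
  obtain q where q: "q \<in> \<rat>" "k < q" "q < 2 * k" using Rats_dense_in_real[of k "2 * k"] k by auto
  have q0: "0 < q" using q k by simp
  have "q powr \<theta> <= (2 * k) powr \<theta>" using q q0 t by (intro powr_mono2) auto
  also have "\<dots> = 2 powr \<theta> * k powr \<theta>" using k by (simp add: powr_mult)
  also have "\<dots> <= 2 * k powr \<theta>" using powr_mono[of \<theta> 1 2] t by (intro mult_right_mono) auto
  finally have q1: "q powr \<theta> <= 2 * k powr \<theta>" .
  have "q powr (\<theta> - 1) <= k powr (\<theta> - 1)" using q k t by (intro powr_mono2') auto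
  also have "\<dots> <= 2 * k powr (\<theta> - 1)" by simp
  finally have q2: "q powr (\<theta> - 1) <= 2 * k powr (\<theta> - 1)" .
  have "X <= (1 - \<theta>) * q powr \<theta> * \<alpha> + \<theta> * q powr (\<theta> - 1) * \<beta>" by (rule le[OF q(1) q0])
  also have "\<dots> <= (1 - \<theta>) * (2 * k powr \<theta>) * ?a + \<theta> * (2 * k powr (\<theta> - 1)) * ?b"
   by (intro add_mono mult_mono q1 q2) (use t nn d in auto)
  also have "\<dots> = 2 * (?a powr (1 - \<theta>) * ?b powr \<theta>)"
  proof -
   have 1: "k powr \<theta> * ?a = ?a powr (1 - \<theta>) * ?b powr \<theta>"
    using ab by (simp add: k_def powr_divide powr_diff)
   have "k powr (\<theta> - 1) * ?b = k powr (\<theta> - 1) * k * ?a" using ab by (simp add: k_def)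
   also have "k powr (\<theta> - 1) * k = k powr \<theta>" using powr_mult_base[of k "\<theta> - 1"] k by (simp add: mult.commute)
   finally have 2: "k powr (\<theta> - 1) * ?b = ?a powr (1 - \<theta>) * ?b powr \<theta>" using 1 by simp
   have "(1 - \<theta>) * (2 * k powr \<theta>) * ?a + \<theta> * (2 * k powr (\<theta> - 1)) * ?b = 2 * ((1 - \<theta>) * (k powr \<theta> * ?a) + \<theta> * (k powr (\<theta> - 1) * ?b))"
    by (simp only: distrib_left mult_ac)
   also have "\<dots> = 2 * (?a powr (1 - \<theta>) * ?b powr \<theta>)" unfolding 1 2 by (simp add: left_diff_distrib)
   finally show ?thesis .
  qed
  finally have "X powr p <= (2 * (?a powr (1 - \<theta>) * ?b powr \<theta>)) powr p" using nn p by (intro powr_mono2) auto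
  also have "\<dots> = 2 powr p * (?a powr ((1 - \<theta>) * p) * ?b powr (\<theta> * p))" by (simp add: powr_mult powr_powr)
  also have "(1 - \<theta>) * p = 1 - (p - 1)" using p by (simp add: th field_simps)
  also have "?b powr (\<theta> * p) = (?b\<^sup>2) powr (p - 1)"
  proof -
   have "\<theta> * p = 2 * (p - 1)" using p by (simp add: th field_simps)
   then have "?b powr (\<theta> * p) = (?b powr 2) powr (p - 1)" by (simp only: powr_powr)
   also have "?b powr 2 = ?b\<^sup>2" using ab by (simp add: powr_numeral)
   finally show ?thesis .
  qed
  also have "2 powr p * (?a powr (1 - (p - 1)) * ?b\<^sup>2 powr (p - 1)) <= 4 * (?a + ?b\<^sup>2)"
  proof (rule mult_mono)
   show "2 powr p <= (4::real)" using powr_mono[of p 2 2] p by (simp add: powr_numeral)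
   show "?a powr (1 - (p - 1)) * ?b\<^sup>2 powr (p - 1) <= ?a + ?b\<^sup>2" using ab p by (intro weighted_le_add) auto
  qed (use ab in auto)
  finally show ?thesis .
 qed
 have "((%\<delta>. 4 * ((\<alpha> + \<delta>) + (\<beta> + \<delta>)\<^sup>2)) \<longlongrightarrow> 4 * ((\<alpha> + 0) + (\<beta> + 0)\<^sup>2)) (at_right 0)" by (intro tendsto_intros)
 moreover have "eventually (%\<delta>. X powr p <= 4 * ((\<alpha> + \<delta>) + (\<beta> + \<delta>)\<^sup>2)) (at_right (0::real))"
  using eventually_at_right_less[of "0::real"] by eventually_elim (rule *)
 ultimately show ?thesis using tendsto_lowerbound[of _ _ "at_right (0::real)"] by fastforce
qed

lemma finitely_simple_powr:
 assumes "finitely_simple f" "0 < q" shows "finitely_simple (%x. f x powr q)"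
 using assms simple_function_compose1[of lebesgue f "%y. y powr q"] by (auto simp: finitely_simple_def)

lemma finitely_simple_facts:
 fixes f :: "real^'n => real"
 assumes f: "finitely_simple f"
 obtains K where "f \<in> borel_measurable lebesgue" "!!x. f x <= K" "(%x. complex_of_real (f x)) \<in> L2"
proof -
 obtain C where C: "compact C" "!!x. x \<notin> C ==> f x = 0" and sf: "simple_function lebesgue f" using f by (auto simp: finitely_simple_def)
 have fm[measurable]: "f \<in> borel_measurable lebesgue" by (rule borel_measurable_simple_function[OF sf])
 have "finite (range f)" using sf by (simp add: simple_function_def)
 then have "bounded (range f)" by (rule finite_imp_bounded)
 then obtain K where K: "!!x. \<bar>f x\<bar> <= K" unfolding bounded_iff by auto
 have iC: "integrable lebesgue (%x. K\<^sup>2 * indicator C x)"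
  using C(1) fmeasurable_compact[OF C(1)] by (intro integrable_mult_right integrable_real_indicator) (auto simp: fmeasurable_def)
 have "integrable lebesgue (%x. (f x)\<^sup>2)"
 proof (rule Bochner_Integration.integrable_bound[OF iC])
  show "AE x in lebesgue. norm ((f x)\<^sup>2) <= norm (K\<^sup>2 * indicator C x)"
  proof (rule AE_I2)
   fix x
   have "\<bar>f x\<bar>\<^sup>2 <= K\<^sup>2" by (rule power_mono[OF K]) simp
   then show "norm ((f x)\<^sup>2) <= norm (K\<^sup>2 * indicator C x)" using C(2)[of x] by (cases "x \<in> C") auto
  qed
 qed measurable
 then have "(%x. complex_of_real (f x)) \<in> L2" by (simp add: L2_def)
 moreover have "f x <= K" for x using K[of x] by simp
 ultimately show ?thesis using that fm by blast
qed

lemma measurable_gw_times: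
 assumes [measurable]: "(%p. w (fst p) (snd p)) \<in> borel_measurable (lborel \<Otimes>\<^sub>M N)"
 shows "(%p. ennreal (gw d l (fst p)) * ennreal (Re (w (fst p) (snd p)))) \<in> borel_measurable (lborel \<Otimes>\<^sub>M N)"
proof -
 define U where "U p = w (fst p) (snd p)" for p
 have [measurable]: "U \<in> borel_measurable (lborel \<Otimes>\<^sub>M N)" using assms by (simp add: U_def[abs_def])
 have "(%p. ennreal (gw d l (fst p)) * ennreal (Re (U p))) \<in> borel_measurable (lborel \<Otimes>\<^sub>M N)" by measurable
 then show ?thesis by (simp add: U_def)
qed

lemma measurable_le_combination:
 fixes U U1 U2 :: "'a => ennreal"
 assumes [measurable]: "U \<in> borel_measurable M" "U1 \<in> borel_measurable M" "U2 \<in> borel_measurable M"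
 shows "{p \<in> space M. U p <= a * U1 p + b * U2 p} \<in> sets M"
 by measurable

context flow
begin

text \<open>Gamma(1 - d) t^(d - 1) is the integral of l^(-d) exp(- l t), so Gamma(1 - d)
  \<open>G d 0\<close> is the integral of l^(-d) \<open>G 1 l\<close>. Below v, l^(-a) <= v^(b - a)
  l^(-b); above v, \<open>G 1 l\<close> is at most 2 m / l, and the integral of l^(-a - 1) is v^(-a)
  / a.\<close>

lemma G_split:
 assumes a: "0 < a" "a < b" "b < 1" and v: "0 < v" and m: "0 <= m"
  and M: "!!l. l \<in> \<rat> ==> 0 < l ==> ennreal l * G 1 l x <= ennreal m"
 shows "ennreal (v powr a) * G a 0 x <= ennreal (Gamma (1 - b) / Gamma (1 - a)) * (ennreal (v powr b) * G b 0 x)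
  + ennreal (2 / (a * Gamma (1 - a))) * ennreal m"
proof -
 let ?i = "%d l. ennreal (indicator {0<..} l * l powr (- d))"
 let ?w = "%l. ennreal (indicator {v..} l * l powr (- a - 1))"
 have Gp: "0 < Gamma (1 - a)" "0 < Gamma (1 - b)" using a by (auto intro: Gamma_real_pos)
 have rep: "ennreal (Gamma (1 - d)) * G d 0 x = (\<integral>\<^sup>+l. ?i d l * G 1 l x \<partial>lborel)" if d: "0 < d" "d < 1" for d
 proof -
  have gl: "ennreal (Gamma (1 - d)) * ennreal (gw d 0 t) = (\<integral>\<^sup>+l. ?i d l * ennreal (gw 1 l t) \<partial>lborel)" for t
  proof (cases "0 < t")
   case True
   have "(\<integral>\<^sup>+l. ?i d l * ennreal (gw 1 l t) \<partial>lborel) = (\<integral>\<^sup>+l. ennreal (gw (1 - d) t l) \<partial>lborel)"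
    by (rule nn_integral_cong) (use True in \<open>auto simp: gw_def indicator_def ennreal_mult[symmetric] mult.commute\<close>)
   also have "\<dots> = ennreal (Gamma (1 - d) * t powr (- (1 - d)))" by (rule nn_integral_gw) (use d True in auto)
   also have "\<dots> = ennreal (Gamma (1 - d)) * ennreal (gw d 0 t)"
    using True Gamma_real_pos[of "1 - d"] d by (simp add: gw_def ennreal_mult)
   finally show ?thesis by simp
  qed (simp add: gw_def)
  have "ennreal (Gamma (1 - d)) * G d 0 x = (\<integral>\<^sup>+t. (ennreal (Gamma (1 - d)) * ennreal (gw d 0 t)) * ennreal (Re (u t x)) \<partial>lborel)"
   unfolding G_def by (subst nn_integral_cmult[symmetric]) (auto simp: mult.assoc)
  also have "\<dots> = (\<integral>\<^sup>+t. \<integral>\<^sup>+l. ?i d l * ennreal (gw 1 l t) * ennreal (Re (u t x)) \<partial>lborel \<partial>lborel)"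
   unfolding gl by (intro nn_integral_cong nn_integral_multc[symmetric]) (unfold gw_def, measurable)
  also have "\<dots> = (\<integral>\<^sup>+l. \<integral>\<^sup>+t. ?i d l * ennreal (gw 1 l t) * ennreal (Re (u t x)) \<partial>lborel \<partial>lborel)"
   by (rule lborel_pair.Fubini'[symmetric]) (unfold gw_def, measurable)
  also have "\<dots> = (\<integral>\<^sup>+l. ?i d l * G 1 l x \<partial>lborel)"
   unfolding G_def by (intro nn_integral_cong) (simp add: mult.assoc nn_integral_cmult)
  finally show ?thesis .
 qed
 have G1: "(%l. G 1 l x) \<in> borel_measurable borel"
 proof -
  have "(%(l, t). ennreal (gw 1 l t) * ennreal (Re (u t x))) \<in> borel_measurable (lborel \<Otimes>\<^sub>M lborel)"
   unfolding gw_def by measurable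
  from lborel.borel_measurable_nn_integral[OF this] show ?thesis unfolding G_def by simp
 qed
 note [measurable] = G1
 \<comment> \<open>The hypothesis speaks of rational l only; \<open>G\<close> decreases in l, and a
   rational q between l/2 and l costs a factor 2.\<close>
 have Ml: "G 1 l x <= ennreal (2 * m / l)" if l: "0 < l" for l
 proof -
  obtain q where q: "q \<in> \<rat>" "l / 2 < q" "q < l" using Rats_dense_in_real[of "l / 2" l] l by auto
  have q0: "0 < q" using q l by simp
  have "G 1 l x <= G 1 q x" by (rule G_antimono) (use q in simp)
  also have "G 1 q x = ennreal (1 / q) * (ennreal q * G 1 q x)" using q0 by (simp add: mult.assoc[symmetric] ennreal_mult[symmetric])
  also have "\<dots> <= ennreal (1 / q) * ennreal m" by (intro mult_left_mono M q q0) simp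
  also have "\<dots> <= ennreal (2 / l) * ennreal m" using q q0 l by (intro mult_right_mono ennreal_leI) (auto simp: field_simps)
  also have "\<dots> = ennreal (2 * m / l)" using l m by (simp add: ennreal_mult[symmetric])
  finally show ?thesis .
 qed
 have "ennreal (Gamma (1 - a)) * G a 0 x = (\<integral>\<^sup>+l. ?i a l * G 1 l x \<partial>lborel)"
  by (rule rep) (use a in auto)
 also have "\<dots> <= (\<integral>\<^sup>+l. ennreal (v powr (b - a)) * (?i b l * G 1 l x)
   + ennreal (2 * m) * ?w l \<partial>lborel)"
 proof (rule nn_integral_mono)
  fix l :: real
  show "?i a l * G 1 l x <= ennreal (v powr (b - a)) * (?i b l * G 1 l x)
   + ennreal (2 * m) * ?w l"
  proof (cases "0 < l")
   case True
   show ?thesis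
   proof (cases "v <= l")
    case False
    have "l powr (- a) = l powr (b - a) * l powr (- b)" by (simp add: powr_add[symmetric])
    also have "\<dots> <= v powr (b - a) * l powr (- b)" using False True a by (intro mult_right_mono powr_mono2) auto
    finally have "ennreal (l powr (- a)) <= ennreal (v powr (b - a)) * ennreal (l powr (- b))"
     by (simp add: ennreal_mult[symmetric] ennreal_leI)
    then have "ennreal (l powr (- a)) * G 1 l x <= ennreal (v powr (b - a)) * ennreal (l powr (- b)) * G 1 l x"
     by (rule mult_right_mono) simp
    then show ?thesis using True False by (simp add: mult.assoc)
   next
    case vl: True
    have "ennreal (l powr (- a)) * G 1 l x <= ennreal (l powr (- a)) * ennreal (2 * m / l)" by (intro mult_left_mono Ml True) simp
    also have "\<dots> = ennreal (2 * m) * ennreal (l powr (- a - 1))" using True m by (simp add: ennreal_mult[symmetric] powr_diff)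
    finally show ?thesis using True vl by (simp add: add_increasing)
   qed
  qed (use v in simp)
 qed
 also have "\<dots> = ennreal (v powr (b - a)) * (\<integral>\<^sup>+l. ?i b l * G 1 l x \<partial>lborel)
   + ennreal (2 * m) * (\<integral>\<^sup>+l. ?w l \<partial>lborel)"
  by (simp add: nn_integral_add nn_integral_cmult)
 also have "(\<integral>\<^sup>+l. ?i b l * G 1 l x \<partial>lborel) = ennreal (Gamma (1 - b)) * G b 0 x"
  by (rule rep[symmetric]) (use a in auto)
 also have "(\<integral>\<^sup>+l. ?w l \<partial>lborel) = ennreal (v powr (- a) / a)"
  by (rule nn_integral_powr_above[OF a(1) v])
 finally have main: "ennreal (Gamma (1 - a)) * G a 0 x <= ennreal (v powr (b - a)) * (ennreal (Gamma (1 - b)) * G b 0 x) + ennreal (2 * m) * ennreal (v powr (- a) / a)" .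
 have "ennreal (v powr a) * G a 0 x = ennreal (v powr a / Gamma (1 - a)) * (ennreal (Gamma (1 - a)) * G a 0 x)"
  using Gp by (simp add: mult.assoc[symmetric] ennreal_mult[symmetric])
 also have "\<dots> <= ennreal (v powr a / Gamma (1 - a)) * (ennreal (v powr (b - a)) * (ennreal (Gamma (1 - b)) * G b 0 x) + ennreal (2 * m) * ennreal (v powr (- a) / a))"
  by (rule mult_left_mono[OF main]) simp
 also have "\<dots> = ennreal (v powr a / Gamma (1 - a) * (v powr (b - a) * Gamma (1 - b))) * G b 0 x + ennreal (v powr a / Gamma (1 - a) * (2 * m * (v powr (- a) / a)))"
 proof -
  have 1: "ennreal x * (ennreal y * (ennreal z * g)) = ennreal (x * (y * z)) * g" if "0 <= x" "0 <= y" "0 <= z" for x y z g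
   using that by (simp add: ennreal_mult mult.assoc)
  have 2: "ennreal x * (ennreal y * ennreal z) = ennreal (x * (y * z))" if "0 <= x" "0 <= y" "0 <= z" for x y z
   using that by (simp add: ennreal_mult)
  have "0 <= v powr a / Gamma (1 - a)" "0 <= v powr (b - a)" "0 <= Gamma (1 - b)" "0 <= 2 * m" "0 <= v powr (- a) / a"
   using Gp a m by auto
  then show ?thesis unfolding distrib_left by (simp only: 1 2)
 qed
 also have "v powr a / Gamma (1 - a) * (v powr (b - a) * Gamma (1 - b)) = Gamma (1 - b) / Gamma (1 - a) * v powr b"
  using powr_add[of v a "b - a"] by (simp add: mult_ac)
 also have "v powr a / Gamma (1 - a) * (2 * m * (v powr (- a) / a)) = 2 / (a * Gamma (1 - a)) * m"
  using v by (simp add: powr_minus field_simps)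
 also have "ennreal (Gamma (1 - b) / Gamma (1 - a) * v powr b) * G b 0 x = ennreal (Gamma (1 - b) / Gamma (1 - a)) * (ennreal (v powr b) * G b 0 x)"
  by (subst ennreal_mult) (use Gp in \<open>auto simp: mult.assoc\<close>)
 also have "ennreal (2 / (a * Gamma (1 - a)) * m) = ennreal (2 / (a * Gamma (1 - a))) * ennreal m"
  by (rule ennreal_mult) (use Gp a m in auto)
 finally show ?thesis .
qed

end

context schroedinger
begin

lemma flow_semigroup_version:
 assumes f: "(%x. complex_of_real (f x)) \<in> L2" "!!x. 0 <= f x"
 shows "flow V (cls (%x. complex_of_real (f x))) (semigroup_version V (%x. complex_of_real (f x)))"
proof (intro flow.intro flow_axioms.intro schroedinger_axioms)
 have "AE x in lebesgue. rep (cls (%x. complex_of_real (f x))) x = complex_of_real (f x)"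
  using rep_cls[OF f(1)] by (simp add: ae_eq_def)
 then show "nonneg (cls (%x. complex_of_real (f x)))" unfolding nonneg_def by eventually_elim (simp add: f(2))
qed (use semigroup_version[OF f(1)] in auto)

lemma semigroup_mono_combination:
 assumes c: "nonneg (\<alpha> *\<^sub>R c1 + \<beta> *\<^sub>R c2 - c)" and t: "0 < t"
 shows "AE x in lebesgue. Re (rep (fc (sg t) c) x) <= \<alpha> * Re (rep (fc (sg t) c1) x) + \<beta> * Re (rep (fc (sg t) c2) x)"
proof -
 have b: "bb (sg t)" using t by (simp add: bb_sg)
 have "fc (sg t) (\<alpha> *\<^sub>R c1 + \<beta> *\<^sub>R c2 - c) = \<alpha> *\<^sub>R fc (sg t) c1 + \<beta> *\<^sub>R fc (sg t) c2 - fc (sg t) c"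
  using RC.fc_add[OF b, of "\<alpha> *\<^sub>R c1 + \<beta> *\<^sub>R c2" "(-1) *\<^sub>R c"] RC.fc_add[OF b, of "\<alpha> *\<^sub>R c1" "\<beta> *\<^sub>R c2"]
   RC.fc_scale[OF b, of \<alpha> c1] RC.fc_scale[OF b, of \<beta> c2] RC.fc_scale[OF b, of "-1" c] by simp
 then have "nonneg (\<alpha> *\<^sub>R fc (sg t) c1 + \<beta> *\<^sub>R fc (sg t) c2 - fc (sg t) c)" using semigroup_nonneg[OF t c] by simp
 with rep_diff[of "\<alpha> *\<^sub>R fc (sg t) c1 + \<beta> *\<^sub>R fc (sg t) c2" "fc (sg t) c"] rep_add[of "\<alpha> *\<^sub>R fc (sg t) c1" "\<beta> *\<^sub>R fc (sg t) c2"]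
  rep_scale[of \<alpha> "fc (sg t) c1"] rep_scale[of \<beta> "fc (sg t) c2"]
 show ?thesis unfolding nonneg_def by eventually_elim simp
qed

text \<open>At time t the Young parameter is kappa sqrt t. After multiplication by t^(-theta/2) the
  two terms carry the weights 1 and t^(-1/2) of \<open>G 1\<close> and \<open>G (1/2)\<close>, with
  coefficients independent of t.\<close>

lemma G_young:
 assumes fl: "flow V c u" "flow V c1 u1" "flow V c2 u2"
  and c: "!!\<kappa>. 0 < \<kappa> ==> nonneg (((1 - \<theta>) * \<kappa> powr \<theta>) *\<^sub>R c1 + (\<theta> * \<kappa> powr (\<theta> - 1)) *\<^sub>R c2 - c)"
  and t: "0 <= \<theta>" "\<theta> <= 1" and k: "0 < \<kappa>"
 shows "AE x in lebesgue. flow.G u (1 - \<theta> / 2) 0 x <=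
  ennreal ((1 - \<theta>) * \<kappa> powr \<theta>) * flow.G u1 1 0 x + ennreal (\<theta> * \<kappa> powr (\<theta> - 1)) * flow.G u2 (1/2) 0 x"
proof -
 interpret f: flow V c u by fact
 interpret f1: flow V c1 u1 by fact
 interpret f2: flow V c2 u2 by fact
 let ?a = "(1 - \<theta>) * \<kappa> powr \<theta>" and ?b = "\<theta> * \<kappa> powr (\<theta> - 1)"
 have ab: "0 <= ?a" "0 <= ?b" using t by auto
 define Q where "Q t x \<longleftrightarrow> ennreal (gw (1 - \<theta> / 2) 0 t) * ennreal (Re (u t x)) <=
   ennreal ?a * (ennreal (gw 1 0 t) * ennreal (Re (u1 t x))) + ennreal ?b * (ennreal (gw (1/2) 0 t) * ennreal (Re (u2 t x)))" for t x
 have Qt: "AE x in lborel. Q t x" for t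
 proof (cases "0 < t")
  case True
  define k where "k = \<kappa> * sqrt t"
  have k0: "0 < k" using k True by (simp add: k_def)
  have k1: "k powr s = \<kappa> powr s * t powr (s / 2)" for s
   using k True by (simp add: k_def powr_mult powr_half_sqrt[symmetric] powr_powr)
  have "AE x in lebesgue. Q t x"
   using semigroup_mono_combination[OF c[OF k0] True] f.u_ae[OF True, unfolded ae_eq_def] f1.u_ae[OF True, unfolded ae_eq_def] f2.u_ae[OF True, unfolded ae_eq_def]
    semigroup_nonneg[OF True f.c, unfolded nonneg_def] semigroup_nonneg[OF True f1.c, unfolded nonneg_def] semigroup_nonneg[OF True f2.c, unfolded nonneg_def]
  proof eventually_elim
   case (elim x)
   let ?u = "Re (u t x)" and ?u1 = "Re (u1 t x)" and ?u2 = "Re (u2 t x)"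
   have nn: "0 <= ?u" "0 <= ?u1" "0 <= ?u2" using elim by auto
   have "?u <= (1 - \<theta>) * k powr \<theta> * ?u1 + \<theta> * k powr (\<theta> - 1) * ?u2" using elim by simp
   then have "t powr (- \<theta> / 2) * ?u <= t powr (- \<theta> / 2) * ((1 - \<theta>) * k powr \<theta> * ?u1 + \<theta> * k powr (\<theta> - 1) * ?u2)"
    by (rule mult_left_mono) simp
   also have "\<dots> = (1 - \<theta>) * (\<kappa> powr \<theta> * (t powr (- \<theta> / 2) * t powr (\<theta> / 2))) * ?u1 + \<theta> * (\<kappa> powr (\<theta> - 1) * (t powr (- \<theta> / 2) * t powr ((\<theta> - 1) / 2))) * ?u2"
    unfolding k1 by (simp add: distrib_left mult_ac)
   also have "t powr (- \<theta> / 2) * t powr (\<theta> / 2) = 1" using True by (simp add: powr_add[symmetric])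
   also have "t powr (- \<theta> / 2) * t powr ((\<theta> - 1) / 2) = t powr (- (1/2))"
    by (simp add: powr_add[symmetric] diff_divide_distrib)
   finally have le: "t powr (- \<theta> / 2) * ?u <= ?a * ?u1 + ?b * (t powr (- (1/2)) * ?u2)" by (simp add: mult_ac)
   have g: "gw (1 - \<theta> / 2) 0 t = t powr (- \<theta> / 2)" "gw 1 0 t = 1" "gw (1/2) 0 t = t powr (- (1/2))"
    using True by (simp_all add: gw_def)
   have "ennreal (t powr (- \<theta> / 2) * ?u) <= ennreal (?a * ?u1 + ?b * (t powr (- (1/2)) * ?u2))" by (rule ennreal_leI[OF le])
   also have "\<dots> = ennreal ?a * ennreal ?u1 + ennreal ?b * (ennreal (t powr (- (1/2))) * ennreal ?u2)"
    by (subst ennreal_plus) (use ab nn in \<open>auto simp: ennreal_mult simp del: ennreal_plus\<close>)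
   finally show ?case unfolding Q_def g using nn by (simp add: ennreal_mult)
  qed
  then show ?thesis by (simp add: AE_completion_iff)
 qed (simp add: Q_def gw_def)
 \<comment> \<open>The inequality is known at almost every x for each t; measurability of the set
   lets Fubini turn this into almost every t for almost every x.\<close>
 have "{p \<in> space (lborel \<Otimes>\<^sub>M lborel). Q (fst p) (snd p)} \<in> sets (lborel \<Otimes>\<^sub>M (lborel :: (real^'n) measure))"
 proof -
  have "(%p. ennreal (gw d 0 (fst p)) * ennreal (Re (w (fst p) (snd p)))) \<in> borel_measurable (lborel \<Otimes>\<^sub>M (lborel :: (real^'n) measure))"
   if "(%(t, x). w t x) \<in> borel_measurable (lborel \<Otimes>\<^sub>M lborel)" for d and w :: "real => real^'n => complex"
   by (rule measurable_gw_times) (use that in \<open>simp only: case_prod_beta'\<close>)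
  from measurable_le_combination[OF this[OF f.u] this[OF f1.u] this[OF f2.u]]
  show ?thesis unfolding Q_def .
 qed
 from lborel_pair.AE_commute[OF this] have "AE x in lborel. AE t in lborel. Q t x" using Qt by simp
 then have "AE x in lebesgue. AE t in lborel. Q t x" by (rule AE_completion)
 then show ?thesis
 proof eventually_elim
  case (elim x)
  have "f.G (1 - \<theta> / 2) 0 x <= (\<integral>\<^sup>+t. ennreal ?a * (ennreal (gw 1 0 t) * ennreal (Re (u1 t x))) + ennreal ?b * (ennreal (gw (1/2) 0 t) * ennreal (Re (u2 t x))) \<partial>lborel)"
   unfolding f.G_def by (rule nn_integral_mono_AE) (use elim in \<open>simp add: Q_def\<close>)
  also have "\<dots> = ennreal ?a * f1.G 1 0 x + ennreal ?b * f2.G (1/2) 0 x"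
   unfolding f1.G_def f2.G_def using f1.u_t[of x] f2.u_t[of x] by (subst nn_integral_add) (auto simp: nn_integral_cmult)
  finally show ?case .
 qed
qed

lemma riesz_transform_G:
 assumes "a ~= 0" and fl: "flow V c (semigroup_version V (%y. complex_of_real (f y)))"
 shows "riesz_transform V a f x = ennreal (V x powr a) * (ennreal (1 / Gamma a) * flow.G (semigroup_version V (%y. complex_of_real (f y))) a 0 x)"
proof -
 have "(\<integral>\<^sup>+t\<in>{0<..}. ennreal (Re (semigroup_version V (%y. complex_of_real (f y)) t x)) * ennreal (t powr (a - 1)) \<partial>lborel)
   = flow.G (semigroup_version V (%y. complex_of_real (f y))) a 0 x"
  unfolding flow.G_def[OF fl] by (rule nn_integral_cong) (simp add: gw_def indicator_def mult.commute)
 then show ?thesis using assms(1) by (simp add: riesz_transform_def)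
qed

lemma ennreal_powr_bound_from_scaling:
 assumes p: "1 < p" "p <= 2" and th: "\<theta> = 2 - 2 / p"
  and le: "!!\<kappa>. \<kappa> \<in> QP ==> X <= ennreal ((1 - \<theta>) * \<kappa> powr \<theta>) * A + ennreal (\<theta> * \<kappa> powr (\<theta> - 1)) * B"
 shows "ennreal_powr X p <= 4 * (A + B\<^sup>2)"
proof (cases "A = \<infinity> \<or> B = \<infinity>")
 case True
 then have "4 * (A + B\<^sup>2) = \<infinity>" by (auto simp: power2_eq_square ennreal_mult_top ennreal_top_mult)
 then show ?thesis by (simp only: top_greatest infinity_ennreal_def)
next
 case False
 have t: "0 <= \<theta>" "\<theta> <= 1" using p by (auto simp: th field_simps)
 obtain \<alpha> \<beta> where AB: "0 <= \<alpha>" "A = ennreal \<alpha>" "0 <= \<beta>" "B = ennreal \<beta>" using False by (cases A; cases B) auto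
 have le': "X <= ennreal ((1 - \<theta>) * \<kappa> powr \<theta> * \<alpha> + \<theta> * \<kappa> powr (\<theta> - 1) * \<beta>)" if "\<kappa> \<in> QP" for \<kappa>
  using le[OF that] AB t by (simp add: ennreal_mult)
 have "1 \<in> QP" by (simp add: QP_def)
 from le'[OF this] obtain r where r: "0 <= r" "X = ennreal r" by (cases X) (auto simp: top_unique)
 have "r powr p <= 4 * (\<alpha> + \<beta>\<^sup>2)"
 proof (rule powr_bound_from_scaling[OF r(1) AB(1,3) p th])
  fix \<kappa> :: real assume "\<kappa> \<in> \<rat>" "0 < \<kappa>"
  then have "\<kappa> \<in> QP" by (simp add: QP_def)
  from le'[OF this] show "r <= (1 - \<theta>) * \<kappa> powr \<theta> * \<alpha> + \<theta> * \<kappa> powr (\<theta> - 1) * \<beta>"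
   using r AB t by (simp add: ennreal_le_iff del: ennreal_plus)
 qed
 then have "ennreal (r powr p) <= ennreal (4 * (\<alpha> + \<beta>\<^sup>2))" by (rule ennreal_leI)
 also have "\<dots> = 4 * (A + B\<^sup>2)" using AB by (simp add: ennreal_mult ennreal_power)
 finally show ?thesis unfolding r by (simp add: ennreal_powr_ennreal r(1))
qed

text \<open>The p-th power of V^(1/p) is V, so after \<open>G_split\<close> and the Young bound the
  three terms match the two endpoint estimates for f^p and f^(p/2) and the maximal inequality, each
  of which is bounded by a multiple of the integral of f^p.\<close>

theorem riesz_bounded:
 assumes p: "1 < p" "p <= 2" and a: "0 <= a" "a <= 1 / p"
 shows "riesz_bounded_on_Lp V a p"
proof (cases "a = 0")
 case True
 then show ?thesis unfolding riesz_bounded_on_Lp_def riesz_transform_def by (intro exI[of _ 1]) simp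
next
 case False
 then have a0: "0 < a" using a by simp
 define \<theta> where "\<theta> = 2 - 2 / p"
 have t: "0 <= \<theta>" "\<theta> <= 1" using p by (auto simp: \<theta>_def field_simps)
 define b where "b = 1 / p"
 have b: "b = 1 - \<theta> / 2" "b < 1" "0 < b" using p by (simp_all add: \<theta>_def b_def diff_divide_distrib)
 \<comment> \<open>For a = 1/p the weight is already the right one and both constants are 1;
   otherwise they are those of \<open>G_split\<close>.\<close>
 define C1 where "C1 = (if a < b then Gamma (1 - b) / Gamma (1 - a) else 1)"
 define C2 where "C2 = (if a < b then 2 / (a * Gamma (1 - a)) else 1)"
 have C: "0 < C1" "0 < C2" using a0 b by (auto simp: C1_def C2_def intro!: divide_pos_pos mult_pos_pos Gamma_real_pos)
 define g where "g = 1 / Gamma a"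
 have g: "0 < g" using Gamma_real_pos[OF a0] by (simp add: g_def)
 define C3 where "C3 = 4 * C1 powr p + C2 powr p"
 have C3: "0 < C3" "4 * C1 powr p <= C3" "C2 powr p <= C3" using C by (auto simp: C3_def add_pos_pos)
 define L where "L = g powr p * 2 powr p * (C3)"
 \<comment> \<open>The summands 1, pi and p 2^p / (p - 1) are the constants of \<open>V_G_1\<close>,
   \<open>V_G_half\<close> and \<open>maximal\<close>; L collects those of the pointwise
   bound.\<close>
 define T where "T = L * (1 + pi + p * 2 powr p / (p - 1))"
 have L0: "0 < L" using g C3 by (simp add: L_def)
 have T0: "0 < T" using L0 p pi_gt_zero by (simp add: T_def add_pos_pos)
 show ?thesis
  unfolding riesz_bounded_on_Lp_def
 proof (intro exI[of _ "T powr (1 / p)"] conjI allI impI)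
  show "0 < T powr (1 / p)" using T0 by simp
  fix f :: "real^'n => real" assume fs: "finitely_simple f" and f0: "ALL x. 0 <= f x"
  have f0': "0 <= f x" for x using f0 by simp
  obtain K where f: "f \<in> borel_measurable lebesgue" "!!x. f x <= K" "(%x. complex_of_real (f x)) \<in> L2" by (rule finitely_simple_facts[OF fs]) blast
  have fL1: "(%x. complex_of_real (f x powr p)) \<in> L2" using finitely_simple_facts[OF finitely_simple_powr[OF fs, of p]] p by (metis less_trans zero_less_one)
  have fL2: "(%x. complex_of_real (f x powr (p / 2))) \<in> L2" using finitely_simple_facts[OF finitely_simple_powr[OF fs, of "p / 2"]] p by (metis half_gt_zero less_trans zero_less_one)
  note f(1)[measurable]
  define u u1 u2 where "u = semigroup_version V (%x. complex_of_real (f x))"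
   and "u1 = semigroup_version V (%x. complex_of_real (f x powr p))"
   and "u2 = semigroup_version V (%x. complex_of_real (f x powr (p / 2)))"
  define c c1 c2 where "c = cls (%x. complex_of_real (f x))"
   and "c1 = cls (%x. complex_of_real (f x powr p))"
   and "c2 = cls (%x. complex_of_real (f x powr (p / 2)))"
  have fl: "flow V c u" "flow V c1 u1" "flow V c2 u2"
   unfolding c_def u_def c1_def u1_def c2_def u2_def
   by (rule flow_semigroup_version[OF f(3) f0'], rule flow_semigroup_version[OF fL1], simp, rule flow_semigroup_version[OF fL2], simp)
  interpret f: flow V c u by (rule fl)
  interpret f1: flow V c1 u1 by (rule fl)
  interpret f2: flow V c2 u2 by (rule fl)
  have cr: "AE x in lebesgue. rep c x = complex_of_real (f x)" "AE x in lebesgue. rep c1 x = complex_of_real (f x powr p)"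
   "AE x in lebesgue. rep c2 x = complex_of_real (f x powr (p / 2))"
   using rep_cls[OF f(3)] rep_cls[OF fL1] rep_cls[OF fL2] by (simp_all add: c_def c1_def c2_def ae_eq_def)
  have Y: "nonneg (((1 - \<theta>) * \<kappa> powr \<theta>) *\<^sub>R c1 + (\<theta> * \<kappa> powr (\<theta> - 1)) *\<^sub>R c2 - c)" if k: "0 < \<kappa>" for \<kappa>
   unfolding nonneg_def
   using cr rep_diff[of "((1 - \<theta>) * \<kappa> powr \<theta>) *\<^sub>R c1 + (\<theta> * \<kappa> powr (\<theta> - 1)) *\<^sub>R c2" c]
    rep_add[of "((1 - \<theta>) * \<kappa> powr \<theta>) *\<^sub>R c1" "(\<theta> * \<kappa> powr (\<theta> - 1)) *\<^sub>R c2"]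
    rep_scale[of "(1 - \<theta>) * \<kappa> powr \<theta>" c1] rep_scale[of "\<theta> * \<kappa> powr (\<theta> - 1)" c2]
  proof eventually_elim
   case (elim x)
   then show ?case using young_factor[OF f0'[of x] k p \<theta>_def] by simp
  qed
  have H: "AE x in lebesgue. \<forall>\<kappa>\<in>QP. f.G b 0 x <= ennreal ((1 - \<theta>) * \<kappa> powr \<theta>) * f1.G 1 0 x + ennreal (\<theta> * \<kappa> powr (\<theta> - 1)) * f2.G (1/2) 0 x"
   unfolding AE_ball_countable[OF QP(1)] b(1) using G_young[OF fl Y t QP(2)] by blast
  obtain m where m: "m \<in> borel_measurable lebesgue" "!!x. 0 <= m x" "AE x in lebesgue. \<forall>l\<in>QP. l * Re (rep (R l c) x) <= m x"
   "(\<integral>\<^sup>+x. ennreal (m x powr p) \<partial>lebesgue) <= ennreal (p * 2 powr p / (p - 1)) * (\<integral>\<^sup>+x. ennreal (f x powr p) \<partial>lebesgue)"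
   unfolding c_def by (rule maximal[OF p(1) f(1) f0' f(2) f(3)]) blast
  note m(1)[measurable]
  have GR: "AE x in lebesgue. \<forall>l\<in>QP. f.G 1 l x = ennreal (Re (rep (R l c) x))"
   unfolding AE_ball_countable[OF QP(1)] using f.G_rep(2)[OF zero_less_one QP(2)] f.gp_1[OF QP(2)] by simp
  have pt: "AE x in lebesgue. ennreal_powr (riesz_transform V a f x) p <=
   ennreal L * (ennreal (V x) * f1.G 1 0 x + ennreal (V x) * (f2.G (1/2) 0 x)\<^sup>2 + ennreal (m x powr p))"
   using H m(3) GR V_pos
  proof eventually_elim
   case (elim x)
   let ?A = "f1.G 1 0 x" and ?B = "f2.G (1/2) 0 x" and ?v = "V x"
   have rt: "riesz_transform V a f x = ennreal (?v powr a) * (ennreal g * f.G a 0 x)"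
    using riesz_transform_G[OF False fl(1)[unfolded u_def]] by (simp add: u_def g_def)
   show ?case
   proof (cases "?v = 0")
    \<comment> \<open>Where V vanishes the convention 0 * infinity = 0 makes the transform 0, so
      \<open>G_split\<close> is called with v > 0 only.\<close>
    case True
    then have "riesz_transform V a f x = ennreal 0" unfolding rt by simp
    then show ?thesis by (simp add: ennreal_powr_def)
   next
    case vn: False
    then have v: "0 < ?v" using elim(4) by simp
    have M: "ennreal l * f.G 1 l x <= ennreal (m x)" if "l \<in> \<rat>" "0 < l" for l
    proof -
     have l: "l \<in> QP" using that by (simp add: QP_def)
     have "ennreal l * f.G 1 l x = ennreal (l * Re (rep (R l c) x)) \<or> f.G 1 l x = 0"
      using elim(3) l that by (cases "0 <= Re (rep (R l c) x)") (auto simp: ennreal_mult ennreal_neg)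
     moreover have "ennreal (l * Re (rep (R l c) x)) <= ennreal (m x)" using elim(2) l by (intro ennreal_leI) blast
     ultimately show ?thesis by auto
    qed
    have S: "ennreal (?v powr a) * f.G a 0 x <= ennreal C1 * (ennreal (?v powr b) * f.G b 0 x) + ennreal C2 * ennreal (m x)"
    proof (cases "a < b")
     case True
     then show ?thesis unfolding C1_def C2_def using f.G_split[OF a0 True b(2) v m(2) M] by simp
    next
     case False
     then have "a = b" using a by (simp add: b_def)
     then show ?thesis by (simp add: C1_def C2_def)
    qed
    have E: "ennreal_powr (f.G b 0 x) p <= 4 * (?A + ?B\<^sup>2)"
     by (rule ennreal_powr_bound_from_scaling[OF p \<theta>_def]) (use elim(1) in blast)
    have vb: "(?v powr b) powr p = ?v" using v p by (simp add: powr_powr b_def)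
    have "ennreal_powr (riesz_transform V a f x) p = ennreal_powr (ennreal g * (ennreal (?v powr a) * f.G a 0 x)) p"
     unfolding rt by (simp only: mult.left_commute)
    also have "\<dots> = ennreal (g powr p) * ennreal_powr (ennreal (?v powr a) * f.G a 0 x) p" by (rule ennreal_powr_mult[OF g])
    also have "\<dots> <= ennreal (g powr p) * ennreal_powr (ennreal C1 * (ennreal (?v powr b) * f.G b 0 x) + ennreal C2 * ennreal (m x)) p"
     by (intro mult_left_mono ennreal_powr_mono S) (use p in auto)
    also have "\<dots> <= ennreal (g powr p) * (ennreal (2 powr p) * (ennreal_powr (ennreal C1 * (ennreal (?v powr b) * f.G b 0 x)) p + ennreal_powr (ennreal C2 * ennreal (m x)) p))"
     by (intro mult_left_mono ennreal_powr_add) (use p in auto)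
    also have "ennreal_powr (ennreal C1 * (ennreal (?v powr b) * f.G b 0 x)) p = ennreal (C1 powr p) * (ennreal ?v * ennreal_powr (f.G b 0 x) p)"
     using v by (simp add: ennreal_powr_mult C vb)
    also have "ennreal_powr (ennreal C2 * ennreal (m x)) p = ennreal (C2 powr p) * ennreal (m x powr p)"
     by (simp add: ennreal_powr_mult C ennreal_powr_ennreal m(2))
    also have "ennreal (g powr p) * (ennreal (2 powr p) * (ennreal (C1 powr p) * (ennreal ?v * ennreal_powr (f.G b 0 x) p) + ennreal (C2 powr p) * ennreal (m x powr p)))
     <= ennreal (g powr p) * (ennreal (2 powr p) * (ennreal (C3) * (ennreal ?v * (?A + ?B\<^sup>2)) + ennreal (C3) * ennreal (m x powr p)))"
    proof (intro mult_left_mono add_mono)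
     have "ennreal (C1 powr p) * (ennreal ?v * ennreal_powr (f.G b 0 x) p) <= ennreal (C1 powr p) * (ennreal ?v * (4 * (?A + ?B\<^sup>2)))"
      by (intro mult_left_mono E) auto
     also have "\<dots> = ennreal (4 * C1 powr p) * (ennreal ?v * (?A + ?B\<^sup>2))"
      by (simp add: ennreal_mult mult_ac)
     also have "\<dots> <= ennreal (C3) * (ennreal ?v * (?A + ?B\<^sup>2))"
      by (intro mult_right_mono ennreal_leI C3) auto
     finally show "ennreal (C1 powr p) * (ennreal ?v * ennreal_powr (f.G b 0 x) p) <= ennreal (C3) * (ennreal ?v * (?A + ?B\<^sup>2))" .
     show "ennreal (C2 powr p) * ennreal (m x powr p) <= ennreal (C3) * ennreal (m x powr p)"
      by (intro mult_right_mono ennreal_leI C3) auto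
    qed auto
    also have "\<dots> = ennreal L * (ennreal ?v * ?A + ennreal ?v * ?B\<^sup>2 + ennreal (m x powr p))"
    proof -
     have "ennreal L = ennreal (g powr p) * (ennreal (2 powr p) * ennreal (C3))"
      unfolding L_def using C3(1) by (simp add: ennreal_mult mult.assoc)
     then show ?thesis by (simp only: mult.assoc distrib_left)
    qed
    finally show ?thesis .
   qed
  qed
  let ?I = "\<integral>\<^sup>+x. ennreal (f x powr p) \<partial>lebesgue"
  have i1: "(\<integral>\<^sup>+x. ennreal (V x) * f1.G 1 0 x \<partial>lebesgue) <= ?I"
  proof -
   have "(\<integral>\<^sup>+x. ennreal (Re (rep c1 x)) \<partial>lebesgue) = ?I"
    by (rule nn_integral_cong_AE) (use cr(2) in \<open>eventually_elim, simp\<close>)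
   then show ?thesis using f1.V_G_1 by simp
  qed
  have i2: "(\<integral>\<^sup>+x. ennreal (V x) * (f2.G (1/2) 0 x)\<^sup>2 \<partial>lebesgue) <= ennreal pi * ?I"
  proof -
   have "(f x powr (p / 2))\<^sup>2 = f x powr p" for x by (simp add: power2_eq_square powr_add[symmetric])
   then have "ennreal ((norm c2)\<^sup>2) = ?I" using nn_norm[OF fL2] by (simp add: c2_def)
   then have "ennreal (pi * (norm c2)\<^sup>2) = ennreal pi * ?I" by (simp add: ennreal_mult)
   then show ?thesis using f2.V_G_half by simp
  qed
  have "(\<integral>\<^sup>+x. ennreal_powr (riesz_transform V a f x) p \<partial>lebesgue)
   <= (\<integral>\<^sup>+x. ennreal L * (ennreal (V x) * f1.G 1 0 x + ennreal (V x) * (f2.G (1/2) 0 x)\<^sup>2 + ennreal (m x powr p)) \<partial>lebesgue)"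
   by (rule nn_integral_mono_AE[OF pt])
  also have "\<dots> = ennreal L * ((\<integral>\<^sup>+x. ennreal (V x) * f1.G 1 0 x \<partial>lebesgue) + (\<integral>\<^sup>+x. ennreal (V x) * (f2.G (1/2) 0 x)\<^sup>2 \<partial>lebesgue) + (\<integral>\<^sup>+x. ennreal (m x powr p) \<partial>lebesgue))"
   by (simp add: nn_integral_cmult nn_integral_add)
  also have "\<dots> <= ennreal L * (?I + ennreal pi * ?I + ennreal (p * 2 powr p / (p - 1)) * ?I)"
   by (intro mult_left_mono add_mono i1 i2 m(4)) auto
  also have "\<dots> = ennreal T * ?I"
  proof -
   have "ennreal T = ennreal L * (1 + ennreal pi + ennreal (p * 2 powr p / (p - 1)))"
    unfolding T_def using L0 p by (simp add: ennreal_mult)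
   then show ?thesis by (simp add: distrib_left distrib_right mult.assoc)
  qed
  also have "?I = (\<integral>\<^sup>+x. ennreal_powr (ennreal (f x)) p \<partial>lebesgue)" by (simp add: ennreal_powr_ennreal f0')
  finally have "ennreal_powr (\<integral>\<^sup>+x. ennreal_powr (riesz_transform V a f x) p \<partial>lebesgue) (1 / p)
   <= ennreal_powr (ennreal T * (\<integral>\<^sup>+x. ennreal_powr (ennreal (f x)) p \<partial>lebesgue)) (1 / p)"
   by (rule ennreal_powr_mono) (use p in simp)
  then show "Lp_norm p (riesz_transform V a f) <= ennreal (T powr (1 / p)) * Lp_norm p (%x. ennreal (f x))"
   unfolding Lp_norm_def by (simp only: ennreal_powr_mult[OF T0])
 qed
qed

end

theorem theorem1:
  fixes V :: "real^'n \<Rightarrow> real" and p a :: real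
  assumes "locally_integrable V"
    and "AE x in lebesgue. 0 \<le> V x"
    and "1 < p" and "p \<le> 2"
    and "0 \<le> a" and "a \<le> 1 / p"
  shows "riesz_bounded_on_Lp V a p"
proof -
  interpret schroedinger V by (rule schroedinger.intro) fact+
  show ?thesis by (rule riesz_bounded) fact+
qed

end
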